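(* Let $M,\gamma,\eta,\mathsf C,r_0,\mathfrak c^*>0$, $a\in(\frac34,1)$, $\mathfrak c\in(0,\mathfrak c^* )$, and let $A_n(a)=\{(\bar\lambda_{2,n}-\mathfrak c)^2\le b_n^{2a-1},\ r_n\le b_n^a\}$. If $\mathbf P(A_n(a)^c)=o(b_n^p)$ for every $p>1$ and $\mathbf E[\bar\lambda_{2,n}-\mathfrak c]=O(b_n^{2a-1})$, then, with $\mathcal X_n=b_n^{-1/2}(\hat\theta_n-\theta)$, $$\sup_{f\in\mathcal E(M,\gamma)\cap\mathcal E^0(\mathsf C,\eta,r_0,\mathfrak c^* )}\Big|\mathbf E[f(\mathcal X_n)]-\int_{\mathbb R}f(z)\,p_n^*(z)\,dz\Big|=O(b_n^{2a-1}),\qquad(\ast)$$ where $p_n^*(z)=\phi(z;\mathfrak c)\big[1+\frac{b_n^{1/2}}6\mathbf E[\bar\lambda_{3,n}]\,h_3(z;\mathfrak c)\big]$. Moreover, if $\sup_{n}\mathbf E[\bar\lambda_{3,n}]<\infty$, then $(\ast)$ holds with $p_n^*$ replaced by $$p_n^+(z)=\frac{\max(0,p_n^*(z))}{\int_{\mathbb R}\max(0,p_n^*(u))\,du},$$ which is a probability density.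
   Context: Model (no drift). Fix $T>0$. Let $\rho:[0,T]\to[-1,1]$ and $\sigma_1,\sigma_2:[0,T]\to(0,\infty)$ be deterministic measurable functions, $\sigma_1,\sigma_2$ bounded. $B=(B_1,B_2)$ is a centered two-dimensional Gaussian process with independent increments, $\mathbf E[B_{1,t}^2]=\mathbf E[B_{2,t}^2]=t$, $\mathbf E[B_{1,t}B_{2,t}]=\int_0^t\rho_s\,ds$, and $X_{i,t}=X_{i,0}+\int_0^t\sigma_{i,s}\,dB_{i,s}$, $i=1,2$. Sampling. For each $n$, $\Pi_n=(\Pi_n^1,\Pi_n^2)$, where $\Pi^1_n=\{I^i=(S^{i-1},S^i],\,1\le i\le N_1\}$ with $0=S^0<\dots<S^{N_1}=T$ and $\Pi^2_n=\{J^j=(T^{j-1},T^j],\,1\le j\le N_2\}$ with $0=T^0<\dots<T^{N_2}=T$ are (possibly random) partitions, depending on $n$ and independent of $(X_{1,t}-X_{1,0},X_{2,t}-X_{2,0})_{t\in[0,T]}$. $r_n=(\max_i|I^i|)\vee(\max_j|J^j|)$. Estimator. $\theta=\int_0^T\rho_t\sigma_{1,t}\sigma_{2,t}\,dt$ and $\hat\theta_n=\sum_{i,j}(X_{1,S^i}-X_{1,S^{i-1}})(X_{2,T^j}-X_{2,T^{j-1}})\mathbf 1(I^i\cap J^j\ne\emptyset)$. Cumulants. For Borel $S\subset[0,T]$: $v(S)=\int_S\rho_t\sigma_{1,t}\sigma_{2,t}dt$, $v_1(S)=\int_S\sigma_{1,t}^2dt$, $v_2(S)=\int_S\sigma_{2,t}^2dt$.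 Let $K_{IJ}=\mathbf 1(I\cap J\ne\emptyset)$, $\sum_{I,J}=\sum_{I\in\Pi^1_n}\sum_{J\in\Pi^2_n}$, $$\mu_{2,n}=\tfrac12\Big\{\sum_{I,J}v_1(I)v_2(J)K_{IJ}+\sum_{I}v(I)^2+\sum_{J}v(J)^2-\sum_{I,J}v(I\cap J)^2\Big\},$$ $$\mu_{3,n}=\tfrac14\Big\{\sum_Iv(I)^3+\sum_Jv(J)^3+2\sum_{I,J}v(I\cap J)^3+3\sum_{I,J}v_1(I)v_2(J)v(I\cup J)K_{IJ}-3\sum_{I,J}\big[v(I\cap J)^2(v(I)+v(J))-v(I\cap J)v(I)v(J)\big]\Big\}.$$ $(b_n)$ is a deterministic positive sequence tending to $0$; $\bar\lambda_{2,n}=2b_n^{-1}\mu_{2,n}$, $\bar\lambda_{3,n}=8b_n^{-2}\mu_{3,n}$. $\phi(z;\Sigma)$ is the centered normal density with variance $\Sigma$; $h_3(z;\Sigma)=(z^3-3\Sigma z)/\Sigma^3$. Function classes. $\mathcal E(M,\gamma)$: measurable $f:\mathbb R\to\mathbb R$ with $|f(x)|\le M(1+|x|^\gamma)$ for all $x$. $\mathcal E^0(\mathsf C,\eta,r_0,\mathfrak c^* )$: functions $f$ with $\int_{\mathbb R}\sup_{|x|\le r}|f(z+x)-f(z)|\,\phi(z;\mathfrak c^* )\,dz\le\mathsf C r^\eta$ for all $r\le r_0$. *)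

theory Defs
  imports "HOL-Probability.Probability" "HOL-Library.Landau_Symbols"
begin

(* Degenerate laws count as Gaussian. *)
definition centered_gaussian :: "'a measure \<Rightarrow> ('a \<Rightarrow> real) \<Rightarrow> bool" where
  "centered_gaussian P Y \<longleftrightarrow> Y \<in> borel_measurable P \<and>
     ((AE \<omega> in P. Y \<omega> = 0) \<or> (\<exists>s>0. distributed P lborel Y (normal_density 0 s)))"

definition centered_gaussian_process ::
  "'a measure \<Rightarrow> real \<Rightarrow> (real \<Rightarrow> 'a \<Rightarrow> real) \<Rightarrow> (real \<Rightarrow> 'a \<Rightarrow> real) \<Rightarrow> bool" where
  "centered_gaussian_process P T B1 B2 \<longleftrightarrow>
     (\<forall>F u w. finite F \<and> F \<subseteq> {0..T} \<longrightarrow>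
        centered_gaussian P (\<lambda>\<omega>. \<Sum>t\<in>F. u t * B1 t \<omega> + w t * B2 t \<omega>))"

definition independent_increments ::
  "'a measure \<Rightarrow> real \<Rightarrow> (real \<Rightarrow> 'a \<Rightarrow> real) \<Rightarrow> (real \<Rightarrow> 'a \<Rightarrow> real) \<Rightarrow> bool" where
  "independent_increments P T B1 B2 \<longleftrightarrow>
     (\<forall>(k::nat) t. strict_mono_on {..k} t \<and> t ` {..k} \<subseteq> {0..T} \<longrightarrow>
        prob_space.indep_vars P (\<lambda>_. borel \<Otimes>\<^sub>M borel)
          (\<lambda>i \<omega>. (B1 (t (Suc i)) \<omega> - B1 (t i) \<omega>, B2 (t (Suc i)) \<omega> - B2 (t i) \<omega>)) {..<k})"

definition step_fun :: "nat \<Rightarrow> (nat \<Rightarrow> real) \<Rightarrow> (nat \<Rightarrow> real) \<Rightarrow> real \<Rightarrow> real" where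
  "step_fun k p c s = (\<Sum>i<k. c i * indicator {p i<..p (Suc i)} s)"

definition step_integral ::
  "(real \<Rightarrow> 'a \<Rightarrow> real) \<Rightarrow> nat \<Rightarrow> (nat \<Rightarrow> real) \<Rightarrow> (nat \<Rightarrow> real) \<Rightarrow> 'a \<Rightarrow> real" where
  "step_integral B k p c \<omega> = (\<Sum>i<k. c i * (B (p (Suc i)) \<omega> - B (p i) \<omega>))"

(* Y is a version of the Wiener integral of f against B over [0,t], i.e. a mean-square limit of
   the integrals of step functions converging to f in L2[0,t].  By the isometry
   the limit does not depend on the approximating sequence, up to null sets. *)
definition is_wiener_integral ::
  "'a measure \<Rightarrow> (real \<Rightarrow> 'a \<Rightarrow> real) \<Rightarrow> real \<Rightarrow> (real \<Rightarrow> real) \<Rightarrow> ('a \<Rightarrow> real) \<Rightarrow> bool" where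
  "is_wiener_integral P B t f Y \<longleftrightarrow> Y \<in> borel_measurable P \<and>
     (\<exists>(k :: nat \<Rightarrow> nat) p c.
        (\<forall>m. mono_on {..k m} (p m) \<and> p m ` {..k m} \<subseteq> {0..t}) \<and>
        (\<lambda>m. \<integral>\<^sup>+s\<in>{0..t}. ennreal ((f s - step_fun (k m) (p m) (c m) s)\<^sup>2) \<partial>lborel) \<longlonglongrightarrow> 0 \<and>
        (\<lambda>m. \<integral>\<^sup>+\<omega>. ennreal ((Y \<omega> - step_integral B (k m) (p m) (c m) \<omega>)\<^sup>2) \<partial>P) \<longlonglongrightarrow> 0)"

(* (N, s) encodes the partition of (0,T] into the cells (s (i-1), s i], 1 <= i <= N;
   the values s i with i > N carry no meaning. *)
type_synonym grid = "nat \<times> (nat \<Rightarrow> real)"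

definition is_grid :: "real \<Rightarrow> grid \<Rightarrow> bool" where
  "is_grid T g \<longleftrightarrow>
     snd g 0 = 0 \<and> snd g (fst g) = T \<and> strict_mono_on {..fst g} (snd g)"

definition cell :: "grid \<Rightarrow> nat \<Rightarrow> real set" where
  "cell g i = {snd g (i - 1)<..snd g i}"

definition cells :: "grid \<Rightarrow> real set set" where
  "cells g = cell g ` {1..fst g}"

definition mesh :: "grid \<Rightarrow> grid \<Rightarrow> real" where
  "mesh g h = max (Max (measure lborel ` cells g)) (Max (measure lborel ` cells h))"

definition grid_space :: "grid measure" where
  "grid_space = count_space UNIV \<Otimes>\<^sub>M (\<Pi>\<^sub>M i\<in>UNIV. borel)"

(* Freezing the sequence after index N makes the encoding of a partition unique, so that
   measurability and independence of a random grid do not involve its meaningless tail. *)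
definition canonical_grid :: "grid \<Rightarrow> grid" where
  "canonical_grid g = (fst g, \<lambda>i. snd g (min i (fst g)))"

(* Independence of the generated sigma-algebras.  Membership of both in the events, i.e.
   measurability of the random grids, is part of the library's indep_set. *)
definition sampling_independent ::
  "'a measure \<Rightarrow> real \<Rightarrow> (real \<Rightarrow> 'a \<Rightarrow> real) \<Rightarrow> (real \<Rightarrow> 'a \<Rightarrow> real)
     \<Rightarrow> ('a \<Rightarrow> grid) \<Rightarrow> ('a \<Rightarrow> grid) \<Rightarrow> bool" where
  "sampling_independent P T X1 X2 G H \<longleftrightarrow>
     prob_space.indep_set P
       (sets (vimage_algebra (space P)
          (\<lambda>\<omega>. (canonical_grid (G \<omega>), canonical_grid (H \<omega>))) (grid_space \<Otimes>\<^sub>M grid_space)))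
       (sets (vimage_algebra (space P)
          (\<lambda>\<omega>. \<lambda>t\<in>{0..T}. (X1 t \<omega> - X1 0 \<omega>, X2 t \<omega> - X2 0 \<omega>))
          (\<Pi>\<^sub>M t\<in>{0..T}. borel \<Otimes>\<^sub>M borel)))"

definition overlap :: "real set \<Rightarrow> real set \<Rightarrow> real" where
  "overlap I J = of_bool (I \<inter> J \<noteq> {})"

(* x1 and x2 are sample paths. *)
definition theta_hat :: "(real \<Rightarrow> real) \<Rightarrow> (real \<Rightarrow> real) \<Rightarrow> grid \<Rightarrow> grid \<Rightarrow> real" where
  "theta_hat x1 x2 g h =
     (\<Sum>i=1..fst g. \<Sum>j=1..fst h.
        (x1 (snd g i) - x1 (snd g (i - 1))) * (x2 (snd h j) - x2 (snd h (j - 1)))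
          * overlap (cell g i) (cell h j))"

definition cov_on ::
  "(real \<Rightarrow> real) \<Rightarrow> (real \<Rightarrow> real) \<Rightarrow> (real \<Rightarrow> real) \<Rightarrow> real set \<Rightarrow> real" where
  "cov_on \<rho> \<sigma>1 \<sigma>2 S = (LINT t:S|lborel. \<rho> t * \<sigma>1 t * \<sigma>2 t)"

definition var_on :: "(real \<Rightarrow> real) \<Rightarrow> real set \<Rightarrow> real" where
  "var_on \<sigma> S = (LINT t:S|lborel. (\<sigma> t)\<^sup>2)"

definition theta :: "real \<Rightarrow> (real \<Rightarrow> real) \<Rightarrow> (real \<Rightarrow> real) \<Rightarrow> (real \<Rightarrow> real) \<Rightarrow> real" where
  "theta T \<rho> \<sigma>1 \<sigma>2 = cov_on \<rho> \<sigma>1 \<sigma>2 {0..T}"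

definition mu2 ::
  "(real \<Rightarrow> real) \<Rightarrow> (real \<Rightarrow> real) \<Rightarrow> (real \<Rightarrow> real) \<Rightarrow> grid \<Rightarrow> grid \<Rightarrow> real" where
  "mu2 \<rho> \<sigma>1 \<sigma>2 g h =
     (let v = cov_on \<rho> \<sigma>1 \<sigma>2; v1 = var_on \<sigma>1; v2 = var_on \<sigma>2 in
      1 / 2 * ((\<Sum>I\<in>cells g. \<Sum>J\<in>cells h. v1 I * v2 J * overlap I J)
        + (\<Sum>I\<in>cells g. (v I)\<^sup>2) + (\<Sum>J\<in>cells h. (v J)\<^sup>2)
        - (\<Sum>I\<in>cells g. \<Sum>J\<in>cells h. (v (I \<inter> J))\<^sup>2)))"

definition mu3 ::
  "(real \<Rightarrow> real) \<Rightarrow> (real \<Rightarrow> real) \<Rightarrow> (real \<Rightarrow> real) \<Rightarrow> grid \<Rightarrow> grid \<Rightarrow> real" where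
  "mu3 \<rho> \<sigma>1 \<sigma>2 g h =
     (let v = cov_on \<rho> \<sigma>1 \<sigma>2; v1 = var_on \<sigma>1; v2 = var_on \<sigma>2 in
      1 / 4 * ((\<Sum>I\<in>cells g. (v I) ^ 3) + (\<Sum>J\<in>cells h. (v J) ^ 3)
        + 2 * (\<Sum>I\<in>cells g. \<Sum>J\<in>cells h. (v (I \<inter> J)) ^ 3)
        + 3 * (\<Sum>I\<in>cells g. \<Sum>J\<in>cells h. v1 I * v2 J * v (I \<union> J) * overlap I J)
        - 3 * (\<Sum>I\<in>cells g. \<Sum>J\<in>cells h.
                 (v (I \<inter> J))\<^sup>2 * (v I + v J) - v (I \<inter> J) * v I * v J)))"

definition lambda2 ::
  "(real \<Rightarrow> real) \<Rightarrow> (real \<Rightarrow> real) \<Rightarrow> (real \<Rightarrow> real) \<Rightarrow> real \<Rightarrow> grid \<Rightarrow> grid \<Rightarrow> real" where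
  "lambda2 \<rho> \<sigma>1 \<sigma>2 \<beta> g h = 2 * inverse \<beta> * mu2 \<rho> \<sigma>1 \<sigma>2 g h"

definition lambda3 ::
  "(real \<Rightarrow> real) \<Rightarrow> (real \<Rightarrow> real) \<Rightarrow> (real \<Rightarrow> real) \<Rightarrow> real \<Rightarrow> grid \<Rightarrow> grid \<Rightarrow> real" where
  "lambda3 \<rho> \<sigma>1 \<sigma>2 \<beta> g h = 8 * inverse (\<beta>\<^sup>2) * mu3 \<rho> \<sigma>1 \<sigma>2 g h"

(* The second argument is the variance, whereas the library's density takes the
   standard deviation. *)
definition gauss_density :: "real \<Rightarrow> real \<Rightarrow> real" where
  "gauss_density z \<Sigma> = normal_density 0 (sqrt \<Sigma>) z"

definition h3 :: "real \<Rightarrow> real \<Rightarrow> real" where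
  "h3 z \<Sigma> = (z ^ 3 - 3 * \<Sigma> * z) / \<Sigma> ^ 3"

definition p_star :: "real \<Rightarrow> real \<Rightarrow> real \<Rightarrow> real \<Rightarrow> real" where
  "p_star c \<beta> l z = gauss_density z c * (1 + \<beta> powr (1 / 2) / 6 * l * h3 z c)"

definition p_plus :: "real \<Rightarrow> real \<Rightarrow> real \<Rightarrow> real \<Rightarrow> real" where
  "p_plus c \<beta> l z = max 0 (p_star c \<beta> l z) / (LINT u|lborel. max 0 (p_star c \<beta> l u))"

definition is_probability_density :: "(real \<Rightarrow> real) \<Rightarrow> bool" where
  "is_probability_density p \<longleftrightarrow>
     p \<in> borel_measurable borel \<and> (\<forall>z. 0 \<le> p z) \<and> (\<integral>\<^sup>+z. ennreal (p z) \<partial>lborel) = 1"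

definition growth_class :: "real \<Rightarrow> real \<Rightarrow> (real \<Rightarrow> real) set" where
  "growth_class M \<gamma> = {f \<in> borel_measurable borel. \<forall>x. \<bar>f x\<bar> \<le> M * (1 + \<bar>x\<bar> powr \<gamma>)}"

(* For Borel f the supremum over the uncountable set [-r,r] is Lebesgue but in general not Borel
   measurable in z, hence the integral with respect to the completed measure. *)
definition smoothness_class :: "real \<Rightarrow> real \<Rightarrow> real \<Rightarrow> real \<Rightarrow> (real \<Rightarrow> real) set" where
  "smoothness_class C \<eta> r0 cs =
     {f. \<forall>r. 0 < r \<and> r \<le> r0 \<longrightarrow>
        (\<integral>\<^sup>+z. (SUP x\<in>{-r..r}. ennreal \<bar>f (z + x) - f z\<bar>) * ennreal (gauss_density z cs) \<partial>lebesgue)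
          \<le> ennreal (C * r powr \<eta>)}"

(* The supremum is taken in the extended reals, so its finiteness is part of the claim
   sup_f |E f(Z_n) - int f p_n| = O(rate_n). *)
definition uniform_expansion ::
  "'a measure \<Rightarrow> (real \<Rightarrow> real) set \<Rightarrow> (nat \<Rightarrow> 'a \<Rightarrow> real) \<Rightarrow> (nat \<Rightarrow> real \<Rightarrow> real)
     \<Rightarrow> (nat \<Rightarrow> real) \<Rightarrow> bool" where
  "uniform_expansion P \<F> Z p rate \<longleftrightarrow>
     (\<exists>K. \<forall>\<^sub>F n in sequentially.
        (SUP f\<in>\<F>. ereal \<bar>(LINT \<omega>|P. f (Z n \<omega>)) - (LINT z|lborel. f z * p n z)\<bar>)
          \<le> ereal (K * rate n))"

end

theory Submission
  imports Defs "HOL-Real_Asymp.Real_Asymp"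
begin

text \<open>
Conditionally on the sampling times, the estimation error is a quadratic form in Gaussian
increments. Diagonalising it writes the error as \<open>\<Sum>j. a j * ((\<eta> j)\<^sup>2 - 1)\<close> with i.i.d. standard
normal \<open>\<eta> j\<close>, and because the overlap graph of two interval partitions has no cycles the traces
\<open>\<Sum>j. (a j)\<^sup>2\<close> and \<open>\<Sum>j. (a j) ^ 3\<close> are exactly the cumulant expressions \<open>mu2\<close> and \<open>mu3\<close>, while every
\<open>a j\<close> is at most a multiple of the mesh. The moment generating function is therefore an
explicit product, which is expanded on the strip \<open>\<bar>Re w\<bar> \<le> 1\<close> with an error of order
\<open>1 / (1 + (Im w)\<^sup>2)\<close>. After averaging over the sampling times, Fourier inversion on the two lines
\<open>Re w = 1\<close> and \<open>Re w = -1\<close> bounds the difference of the densities by a multiple of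
\<open>b n powr (2 * a - 1) * exp (- \<bar>x\<bar>)\<close>, which integrates every function of polynomial growth.
\<close>

text \<open>On the event \<open>good\<close> every rescaled coefficient is
  O(\<open>b n powr (a - 1 / 2)\<close>). Its square and the squared deviation of
  \<open>lambda2\<close> from \<open>c\<close> produce the rate \<open>b n powr (2 * a - 1)\<close>.
  For a fixed sampling scheme the term linear in \<open>lambda2 - c\<close> may exceed that rate,
  and only its mean is small. It has to be carried along until the sampling times are averaged out,
  so the inversion can only follow the averaging. Inversion needs an integrable transform, which
  comes from the spread of the coefficients: the sum of their squares is bounded below while each is
  small.

  Off \<open>good\<close> the rescaled error is out of control and the unscaled error is used
  instead. No mesh exceeds \<open>T\<close>, hence it has exponential moments at the fixed scale
  \<open>s0\<close> for all schemes at once. Undoing the scaling costs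
  \<open>b n powr (- \<gamma> / 2)\<close>, and replacing the restricted mean of
  \<open>lambda3\<close> by the full one costs \<open>b n powr (-2)\<close>. The exponent
  \<open>\<gamma> / 2 + 3\<close> for the complement pays for either and leaves at least a factor
  \<open>b n\<close>.\<close>

lemmas integrable_dominated = Bochner_Integration.integrable_bound
lemmas lintegral_cong = Bochner_Integration.integral_cong
lemmas lintegral_diff = Bochner_Integration.integral_diff


section \<open>Complex Gaussian integrals\<close>

text \<open>Takes the place of integration by parts: the Gaussian identities below come from
  exhibiting a suitable primitive \<open>F\<close>.\<close>

lemma integral_derivative_eq_0:
 fixes F f :: "real => complex"
 assumes F: "!!x. (F has_vector_derivative f x) (at x)"
 and f: "continuous_on UNIV f" "integrable lborel f"
 and lim: "(F \<longlongrightarrow> 0) at_top" "(F \<longlongrightarrow> 0) at_bot"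
 shows "(LINT x|lborel. f x) = 0"
proof -
 have "(LBINT x=-\<infinity>..\<infinity>. f x) = 0 - 0"
 proof (rule interval_integral_FTC_integrable[where F=F])
 show "set_integrable lborel (einterval (- \<infinity>) \<infinity>) f"
 using f(2) by (simp add: set_integrable_def)
 show "((F \<circ> real_of_ereal) \<longlongrightarrow> 0) (at_right (- \<infinity>))"
 using lim(2) by (simp add: ereal_tendsto_simps)
 show "((F \<circ> real_of_ereal) \<longlongrightarrow> 0) (at_left \<infinity>)"
 using lim(1) by (simp add: ereal_tendsto_simps)
 show "isCont f x" for x
 using f(1) by (simp add: continuous_on_eq_continuous_at)
 qed (use F in auto)
 then show ?thesis
 by (simp add: interval_lebesgue_integral_def set_lebesgue_integral_def)
qed

lemma has_vector_derivative_iff_quotient: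
 fixes f :: "real => complex"
 shows "(f has_vector_derivative D) (at t0) \<longleftrightarrow> ((%t. (f t - f t0) / of_real (t - t0)) \<longlongrightarrow> D) (at t0)"
proof -
 have eq: "(%t. norm ((f t - f t0) / of_real (t - t0) - D)) t = norm ((f t - f t0 - (t - t0) *\<^sub>R D) /\<^sub>R norm (t - t0))"
 if "t ~= t0" for t
 proof -
 have "(f t - f t0) / of_real (t - t0) - D = (f t - f t0 - (t - t0) *\<^sub>R D) / of_real (t - t0)"
 using that by (simp add: diff_divide_distrib scaleR_conv_of_real)
 then have "norm ((f t - f t0) / of_real (t - t0) - D) = norm (f t - f t0 - (t - t0) *\<^sub>R D) / \<bar>t - t0\<bar>"
 by (simp only: norm_divide norm_of_real)
 then show ?thesis by (simp add: divide_inverse mult.commute)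
 qed
 have "((%t. (f t - f t0) / of_real (t - t0)) \<longlongrightarrow> D) (at t0) \<longleftrightarrow>
 ((%t. norm ((f t - f t0) / of_real (t - t0) - D)) \<longlongrightarrow> 0) (at t0)"
 by (simp add: tendsto_norm_zero_iff LIM_zero_iff)
 also have "... \<longleftrightarrow> ((%t. norm ((f t - f t0 - (t - t0) *\<^sub>R D) /\<^sub>R norm (t - t0))) \<longlongrightarrow> 0) (at t0)"
 by (rule filterlim_cong) (use eq in \<open>auto simp: eventually_at_filter\<close>)
 also have "... \<longleftrightarrow> (f has_vector_derivative D) (at t0)"
 by (simp only: tendsto_norm_zero_iff has_vector_derivative_def has_derivative_at_within bounded_linear_scaleR_left simp_thms)
 finally show ?thesis by simp
qed

text \<open>The mean value inequality bounds every difference quotient by \<open>w\<close>, so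
  dominated convergence applies along each sequence tending to \<open>t0\<close>.\<close>

lemma has_vector_derivative_lebesgue_integral:
 fixes f f' :: "real => 'a => complex"
 assumes der: "!!t x. x : space M ==> ((%t. f t x) has_vector_derivative f' t x) (at t)"
 and int: "!!t. integrable M (f t)"
 and meas: "f' t0 : borel_measurable M"
 and bound: "!!t x. x : space M ==> norm (f' t x) <= w x" and w: "integrable M w"
 shows "((%t. \<integral>x. f t x \<partial>M) has_vector_derivative (LINT x|M. f' t0 x)) (at t0)"
proof -
 have lip: "norm (f t x - f t0 x) <= w x * \<bar>t - t0\<bar>" if x: "x : space M" for t x
 proof -
 have on: "onorm (%h. h *\<^sub>R f' s x) <= w x" for s
 using bound[OF x, of s] onorm_scaleR_left_lemma[of "%h::real. h" "f' s x"] by (simp add: onorm_id)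
 have "norm (f t x - f t0 x) <= w x * norm (t - t0)"
 by (rule differentiable_bound[where S=UNIV and f' = "%s h. h *\<^sub>R f' s x"])
 (use der[OF x] on in \<open>auto simp: has_vector_derivative_def\<close>)
 then show ?thesis by simp
 qed
 have "(%i. ((LINT x|M. f (X i) x) - (LINT x|M. f t0 x)) / of_real (X i - t0)) \<longlonglongrightarrow> (LINT x|M. f' t0 x)"
 if X: "!!i. X i ~= t0" "X \<longlonglongrightarrow> t0" for X :: "nat => real"
 proof -
 have eq: "((LINT x|M. f (X i) x) - (LINT x|M. f t0 x)) / of_real (X i - t0)
 = (LINT x|M. (f (X i) x - f t0 x) / of_real (X i - t0))" for i
 using int X(1)[of i] by (subst integral_divide_zero) auto
 show ?thesis
 unfolding eq
 proof (rule integral_dominated_convergence[where w=w])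
 show "(%x. (f (X i) x - f t0 x) / of_real (X i - t0)) : borel_measurable M" for i
 using int by auto
 show "AE x in M. (%i. (f (X i) x - f t0 x) / of_real (X i - t0)) \<longlonglongrightarrow> f' t0 x"
 proof (rule AE_I2)
 fix x assume "x : space M"
 from der[OF this, of t0] show "(%i. (f (X i) x - f t0 x) / of_real (X i - t0)) \<longlonglongrightarrow> f' t0 x"
 using X unfolding has_vector_derivative_iff_quotient tendsto_at_iff_sequentially comp_def by auto
 qed
 show "AE x in M. norm ((f (X i) x - f t0 x) / of_real (X i - t0)) <= w x" for i
 proof (rule AE_I2)
 fix x assume x: "x : space M"
 have "0 < \<bar>X i - t0\<bar>" using X(1)[of i] by simp
 then show "norm ((f (X i) x - f t0 x) / of_real (X i - t0)) <= w x"
 using lip[OF x, of "X i"] by (simp only: norm_divide norm_of_real divide_le_eq) simp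
 qed
 qed (use meas w in auto)
 qed
 then show ?thesis
 unfolding has_vector_derivative_iff_quotient tendsto_at_iff_sequentially comp_def by auto
qed

lemma gaussian_moment_integrable:
 assumes "0 < p" shows "integrable lborel (%x::real. \<bar>x\<bar> ^ k * exp (- p * x^2 / 2))"
proof -
 have "integrable lborel (%x. sqrt (2 * pi / p) * (normal_density 0 (1 / sqrt p) x * \<bar>x - 0\<bar> ^ k))"
 using assms by (intro integrable_mult_right integrable_normal_moment_abs) auto
 moreover have "sqrt (2 * pi / p) * (normal_density 0 (1 / sqrt p) x * \<bar>x - 0\<bar> ^ k) = abs x ^ k * exp (- p * x^2 / 2)" for x
 using assms by (simp add: normal_density_def power_divide field_simps)
 ultimately show ?thesis by (simp only:)
qed

lemma cexp_quadratic_integrable: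
 fixes al :: complex
 assumes "0 < Re al" shows "integrable lborel (%x::real. of_real (x ^ k) * exp (- al * of_real (x^2) / 2))"
 by (rule integrable_dominated[OF gaussian_moment_integrable[OF assms, of k]])
 (auto simp: norm_mult norm_power)

lemma gaussian_tail_tendsto:
 assumes "0 < p"
 shows "((%x::real. \<bar>x\<bar> ^ k * exp (- p * x^2 / 2)) \<longlongrightarrow> 0) at_top"
 "((%x::real. \<bar>x\<bar> ^ k * exp (- p * x^2 / 2)) \<longlongrightarrow> 0) at_bot"
proof -
 have *: "((%x::real. x ^ k * exp (- p * x^2 / 2)) \<longlongrightarrow> 0) at_top"
 using assms by real_asymp
 show "((%x::real. \<bar>x\<bar> ^ k * exp (- p * x^2 / 2)) \<longlongrightarrow> 0) at_top"
 by (rule Lim_transform_eventually[OF *]) (auto intro!: eventually_mono[OF eventually_ge_at_top[of 0]])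
 then show "((%x::real. \<bar>x\<bar> ^ k * exp (- p * x^2 / 2)) \<longlongrightarrow> 0) at_bot"
 by (subst at_bot_mirror, subst filterlim_filtermap) simp
qed

lemma cexp_quadratic_by_parts:
 fixes al :: complex
 assumes "0 < Re al"
 shows "al * (LINT x|lborel. of_real (x^2) * exp (- al * of_real (x^2) / 2)) = (LINT x|lborel. exp (- al * of_real (x^2) / 2))"
proof -
 note int = cexp_quadratic_integrable[OF assms, of 0] cexp_quadratic_integrable[OF assms, of 2]
 have "(LINT x|lborel. exp (- al * of_real (x^2) / 2) - al * (of_real (x^2) * exp (- al * of_real (x^2) / 2))) = 0"
 proof (rule integral_derivative_eq_0[where F="%x. of_real x * exp (- al * of_real (x^2) / 2)"])
 show "((%x. of_real x * exp (- al * of_real (x^2) / 2)) has_vector_derivative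
 exp (- al * of_real (x^2) / 2) - al * (of_real (x^2) * exp (- al * of_real (x^2) / 2))) (at x)" for x
 unfolding of_real_power
 by (rule has_vector_derivative_real_field[where f="%z. z * exp (- al * z^2 / 2)"])
 (auto intro!: derivative_eq_intros simp: algebra_simps power2_eq_square)
 show "continuous_on UNIV (%x. exp (- al * of_real (x^2) / 2) - al * (of_real (x^2) * exp (- al * of_real (x^2) / 2)))"
 by (intro continuous_intros) auto
 show "integrable lborel (%x. exp (- al * of_real (x^2) / 2) - al * (of_real (x^2) * exp (- al * of_real (x^2) / 2)))"
 using int by (intro Bochner_Integration.integrable_diff integrable_mult_right) auto
 have n: "norm (of_real x * exp (- al * of_real (x^2) / 2)) = abs x ^ 1 * exp (- Re al * x^2 / 2)" for x :: real
 by (simp add: norm_mult)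
 show "((%x. of_real x * exp (- al * of_real (x^2) / 2)) \<longlongrightarrow> 0) at_top"
 by (rule tendsto_norm_zero_cancel, unfold n, rule gaussian_tail_tendsto[OF assms])
 show "((%x. of_real x * exp (- al * of_real (x^2) / 2)) \<longlongrightarrow> 0) at_bot"
 by (rule tendsto_norm_zero_cancel, unfold n, rule gaussian_tail_tendsto[OF assms])
 qed
 then show ?thesis
 using int by simp
qed

text \<open>No contour is rotated. With the real part fixed, the product is constant along the
  vertical line through \<open>al\<close>, because its derivative vanishes by
  \<open>cexp_quadratic_by_parts\<close>; on the real axis it is the normalisation of a normal
  density. The positive real part keeps \<open>csqrt\<close> off its cut.\<close>

lemma csqrt_times_gaussian_integral:
 fixes al :: complex
 assumes "0 < Re al"
 shows "csqrt al * (LINT x|lborel. exp (- al * of_real (x^2) / 2)) = of_real (sqrt (2 * pi))"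
proof -
 define p where "p = Re al"
 define bt where "bt t = Complex p t" for t
 define g where "g t = (LINT x|lborel. exp (- bt t * of_real (x^2) / 2))" for t
 have p: "0 < p" using assms by (simp add: p_def)
 have Re: "Re (bt t) = p" for t by (simp add: bt_def)
 have dg: "(g has_vector_derivative (LINT x|lborel. - (\<i> / 2) * (of_real (x^2) * exp (- bt t * of_real (x^2) / 2)))) (at t)" for t
 unfolding g_def
 proof (rule has_vector_derivative_lebesgue_integral[where w="%x. \<bar>x\<bar> ^ 2 * exp (- p * x^2 / 2)"])
 show "((%t. exp (- bt t * of_real (x^2) / 2)) has_vector_derivative
 - (\<i> / 2) * (of_real (x^2) * exp (- bt t * of_real (x^2) / 2))) (at t)" for t x
 proof -
 have "bt t = of_real p + \<i> * of_real t" for t by (simp add: bt_def complex_eq_iff)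
 then show ?thesis
 by (simp only:, intro has_vector_derivative_real_field[where f="%z. exp (- (of_real p + \<i> * z) * of_real (x^2) / 2)"])
 (auto intro!: derivative_eq_intros simp: algebra_simps)
 qed
 show "integrable lborel (%x. exp (- bt t * of_real (x^2) / 2))" for t
 using cexp_quadratic_integrable[of "bt t" 0] p Re by simp
 show "norm (- (\<i> / 2) * (of_real (x^2) * exp (- bt t * of_real (x^2) / 2))) <= abs x ^ 2 * exp (- p * x^2 / 2)" for t x
 by (simp add: norm_mult norm_power Re)
 qed (use gaussian_moment_integrable[OF p, of 2] in auto)
 have nz: "bt t ~= 0" "bt t \<notin> \<real>\<^sub>\<le>\<^sub>0" for t
 using p Re[of t] by (auto simp: complex_nonpos_Reals_iff)
 have "((%t. csqrt (bt t) * g t) has_vector_derivative 0) (at t)" for t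
 proof -
 have "(csqrt has_field_derivative inverse (2 * csqrt (bt t))) (at (bt t))"
 by (rule has_field_derivative_csqrt) (rule nz)
 moreover have "(bt has_vector_derivative \<i>) (at t)"
 proof -
 have "bt = (%t. of_real p + \<i> * of_real t)" by (auto simp: bt_def complex_eq_iff)
 then show ?thesis
 unfolding has_vector_derivative_def
 by (auto intro!: derivative_eq_intros simp: scaleR_conv_of_real)
 qed
 ultimately have "((csqrt \<circ> bt) has_vector_derivative (\<i> * inverse (2 * csqrt (bt t)))) (at t)"
 by (intro field_vector_diff_chain_at)
 from has_vector_derivative_mult[OF this dg[of t]]
 have "((%t. csqrt (bt t) * g t) has_vector_derivative
 (csqrt (bt t) * (LINT x|lborel. - (\<i> / 2) * (of_real (x^2) * exp (- bt t * of_real (x^2) / 2)))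
 + \<i> * inverse (2 * csqrt (bt t)) * g t)) (at t)" by (simp add: o_def)
 moreover have "(csqrt (bt t) * (LINT x|lborel. - (\<i> / 2) * (of_real (x^2) * exp (- bt t * of_real (x^2) / 2)))
 + \<i> * inverse (2 * csqrt (bt t)) * g t) = 0"
 proof -
 have g: "g t = bt t * (LINT x|lborel. of_real (x^2) * exp (- bt t * of_real (x^2) / 2))"
 unfolding g_def by (rule cexp_quadratic_by_parts[symmetric]) (simp add: Re p)
 have "bt t = csqrt (bt t) * csqrt (bt t)" using power2_csqrt[of "bt t"] by (simp add: power2_eq_square)
 then have "inverse (csqrt (bt t)) * bt t = csqrt (bt t)"
 using nz(1)[of t] by (metis csqrt_eq_0 left_inverse mult.assoc mult_1)
 then have "csqrt (bt t) * (- (\<i> / 2) * I) + \<i> * inverse (2 * csqrt (bt t)) * (bt t * I) = 0" for I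
 by (metis (no_types, opaque_lifting) ab_left_minus inverse_eq_divide inverse_mult_distrib mult.assoc mult.commute mult_minus_left times_divide_eq_right mult_1_right)
 then show ?thesis unfolding g integral_mult_right_zero .
 qed
 ultimately show ?thesis by (simp only:)
 qed
 then obtain K where K: "csqrt (bt t) * g t = K" for t
 using has_vector_derivative_zero_constant[of UNIV "%t. csqrt (bt t) * g t"] by auto
 have "g 0 = of_real (LINT x|lborel. exp (- p * x^2 / 2))"
 proof -
 have "exp (- bt 0 * of_real (x^2) / 2) = complex_of_real (exp (- p * x^2 / 2))" for x
 by (simp add: bt_def complex_of_real_def[symmetric] flip: exp_of_real)
 then show ?thesis unfolding g_def by (simp only: integral_complex_of_real)
 qed
 also have "(LINT x|lborel. exp (- p * x^2 / 2)) = sqrt (2 * pi / p)"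
 proof -
 have "exp (- p * x^2 / 2) = sqrt (2 * pi / p) * normal_density 0 (1 / sqrt p) x" for x
 using p by (simp add: normal_density_def power_divide field_simps)
 then show ?thesis using p by simp
 qed
 finally have "csqrt (bt 0) * g 0 = of_real (sqrt p * sqrt (2 * pi / p))"
 using p by (simp add: bt_def complex_of_real_def[symmetric] csqrt_of_real)
 also have "... = of_real (sqrt (2 * pi))" using p by (simp flip: real_sqrt_mult)
 finally show ?thesis using K[of 0] K[of "Im al"] by (simp add: g_def bt_def p_def complex_surj)
qed

text \<open>The moment generating function of a chi-square variable with one degree of freedom, in
  the complex half-plane where it converges.\<close>

lemma std_normal_exp_square:
 fixes bt :: complex
 assumes "Re bt < 1 / 2"
 shows "integrable std_normal_distribution (%x. exp (bt * of_real (x^2)))"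
 "(LINT x|std_normal_distribution. exp (bt * of_real (x^2))) = 1 / csqrt (1 - 2 * bt)"
proof -
 define al where "al = 1 - 2 * bt"
 have al: "0 < Re al" using assms by (simp add: al_def)
 have eq: "std_normal_density x *\<^sub>R exp (bt * of_real (x^2)) = of_real (1 / sqrt (2 * pi)) * exp (- al * of_real (x^2) / 2)" for x
 proof -
 have "complex_of_real (exp (- x\<^sup>2 / 2)) * exp (bt * of_real (x^2)) = exp (of_real (- x\<^sup>2 / 2) + bt * of_real (x^2))"
 unfolding exp_add exp_of_real ..
 also have "of_real (- x\<^sup>2 / 2) + bt * of_real (x^2) = - al * of_real (x^2) / 2"
 by (simp add: al_def field_simps)
 finally show ?thesis
 by (simp add: std_normal_density_def scaleR_conv_of_real)
 qed
 show "integrable std_normal_distribution (%x. exp (bt * of_real (x^2)))"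
 by (subst integrable_density, simp, simp, simp, unfold eq)
 (use cexp_quadratic_integrable[OF al, of 0] in \<open>intro integrable_mult_right, simp\<close>)
 have "(LINT x|std_normal_distribution. exp (bt * of_real (x^2)))
 = of_real (1 / sqrt (2 * pi)) * (LINT x|lborel. exp (- al * of_real (x^2) / 2))"
 by (subst integral_density, simp, simp, simp, unfold eq, simp)
 also have "... = 1 / csqrt al"
 proof -
 have "csqrt al ~= 0" using al by auto
 then show ?thesis using csqrt_times_gaussian_integral[OF al] by (simp add: divide_simps mult_ac)
 qed
 finally show "(LINT x|std_normal_distribution. exp (bt * of_real (x^2))) = 1 / csqrt (1 - 2 * bt)"
 by (simp add: al_def)
qed

section \<open>Moment generating functions in the second Wiener chaos\<close>

text \<open>The moment generating function of the sum of \<open>a k * ((\<eta> k)^2 - 1)\<close> for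
  independent standard normal \<eta>, see \<open>chaos_mgf_integral\<close>. It is a product of
  principal roots and not the root of a product, whose argument could cross the cut.\<close>

definition chaos_mgf :: "'i set => ('i => real) => complex => complex" where
 "chaos_mgf J a w = (PROD k:J. exp (- w * a k) / csqrt (1 - 2 * w * a k))"

text \<open>Concavity of the logarithm. It lets many small coefficients be weighed against one
  common logarithm in \<open>chaos_mgf_decay\<close>.\<close>

lemma scaled_ln_1p_le:
 fixes \<theta> x :: real
 assumes "0 <= \<theta>" "\<theta> <= 1" "0 <= x"
 shows "\<theta> * ln (1 + x) <= ln (1 + \<theta> * x)"
proof -
 have "(1 - \<theta>) * ln 1 + \<theta> * ln (1 + x) <= ln ((1 - \<theta>) *\<^sub>R 1 + \<theta> *\<^sub>R (1 + x))"
 using assms by (intro concave_onD[OF ln_concave]) auto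
 then show ?thesis by (simp add: algebra_simps)
qed

lemma ln_1m_lower:
 fixes x :: real
 assumes "abs x <= 1 / 4"
 shows "- 2 * x - 8 * x^2 <= ln (1 - 2 * x)"
proof (cases "0 <= x")
 case True
 then show ?thesis
 using ln_one_minus_pos_lower_bound[of "2 * x"] assms by (simp add: power2_eq_square)
next
 case False
 show ?thesis
 proof -
 have "- 2 * x - (- 2 * x)\<^sup>2 <= ln (1 + - 2 * x)"
 using False assms by (intro ln_one_plus_pos_lower_bound) auto
 then have "- 2 * x - 4 * x^2 <= ln (1 - 2 * x)" by (simp add: power_mult_distrib)
 then show ?thesis using zero_le_power2[of x] by linarith
 qed
qed

lemma Re_chaos_factor:
 fixes w :: complex
 assumes "\<bar>Re w\<bar> <= 1" "abs a <= 1 / 4"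
 shows "1 / 2 <= Re (1 - 2 * w * of_real a)"
proof -
 have "\<bar>Re w * a\<bar> <= 1 * (1 / 4)"
 unfolding abs_mult using assms by (intro mult_mono) auto
 then show ?thesis by auto
qed

text \<open>The drift \<open>exp (- w * a)\<close> cancels the first order of the logarithm of
  \<open>1 - 2 * x\<close>, so the real part of \<open>w\<close> costs only
  \<open>exp (4 * a^2)\<close>. The imaginary part gives the decay: since
  \<open>(1 - 2 * x)^2 <= 4\<close>, the squared modulus splits off the factor
  \<open>1 + (Im w)^2 * a^2\<close>.\<close>

lemma norm_chaos_factor_le:
 fixes w :: complex
 assumes w: "\<bar>Re w\<bar> <= 1" and a: "abs a <= 1 / 4"
 shows "norm (exp (- w * a) / csqrt (1 - 2 * w * a)) <= exp (4 * a^2 - ln (1 + (Im w)\<^sup>2 * a^2) / 4)"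
proof -
 define x where "x = Re w * a"
 define N where "N = norm (1 - 2 * w * a)"
 have x: "abs x <= 1 / 4" "x^2 <= a^2"
 proof -
 have *: "abs x <= 1 * abs a"
 unfolding x_def abs_mult using w by (intro mult_mono) auto
 then show "abs x <= 1 / 4" using a by simp
 show "x^2 <= a^2" using * by (simp add: abs_le_square_iff)
 qed
 have N2: "N^2 = (1 - 2 * x)\<^sup>2 + 4 * ((Im w)\<^sup>2 * a^2)"
 unfolding N_def cmod_power2 by (simp add: x_def power_mult_distrib mult.assoc)
 have "(1 - 2 * x)\<^sup>2 <= 2\<^sup>2" using x by (intro power_mono) auto
 then have "(1 - 2 * x)\<^sup>2 * ((Im w)\<^sup>2 * a^2) <= 4 * ((Im w)\<^sup>2 * a^2)"
 by (intro mult_right_mono) auto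
 then have N2_ge: "(1 - 2 * x)\<^sup>2 * (1 + (Im w)\<^sup>2 * a^2) <= N^2"
 unfolding N2 by (simp add: algebra_simps)
 have pos: "0 < 1 + (Im w)\<^sup>2 * a^2" "0 < 1 - 2 * x" using x by (auto intro: add_pos_nonneg)
 have "0 < (1 - 2 * x)\<^sup>2 * (1 + (Im w)\<^sup>2 * a^2)" using pos by simp
 then have Npos: "0 < N" using N2_ge by (cases "N = 0") (auto simp: N_def)
 have "ln ((1 - 2 * x)\<^sup>2 * (1 + (Im w)\<^sup>2 * a^2)) <= ln (N^2)"
 using N2_ge pos Npos by (intro ln_mono) auto
 then have lnN: "2 * ln (1 - 2 * x) + ln (1 + (Im w)\<^sup>2 * a^2) <= 2 * ln N"
 using pos Npos by (simp add: ln_mult ln_realpow)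
 have "norm (exp (- w * a) / csqrt (1 - 2 * w * a)) = exp (- x) / sqrt N"
 by (simp add: norm_divide x_def N_def norm_exp_eq_Re)
 also have "... = exp (- x - ln N / 2)"
 using Npos by (simp add: exp_diff ln_sqrt[symmetric])
 also have "... <= exp (4 * a^2 - ln (1 + (Im w)\<^sup>2 * a^2) / 4)"
 using lnN ln_1m_lower[OF x(1)] x(2) by simp
 finally show ?thesis .
qed

lemma norm_chaos_mgf_le:
 fixes w :: complex
 assumes "finite J" "\<bar>Re w\<bar> <= 1" "!!k. k : J ==> \<bar>a k\<bar> <= 1 / 4"
 shows "norm (chaos_mgf J a w) <= exp (4 * (SUM k:J. (a k)\<^sup>2) - (SUM k:J. ln (1 + (Im w)\<^sup>2 * (a k)\<^sup>2)) / 4)"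
proof -
 have "norm (chaos_mgf J a w) <= (PROD k:J. exp (4 * (a k)\<^sup>2 - ln (1 + (Im w)\<^sup>2 * (a k)\<^sup>2) / 4))"
 unfolding chaos_mgf_def prod_norm[symmetric] by (intro prod_mono conjI norm_ge_zero norm_chaos_factor_le assms)
 also have "... = exp (4 * (SUM k:J. (a k)\<^sup>2) - (SUM k:J. ln (1 + (Im w)\<^sup>2 * (a k)\<^sup>2)) / 4)"
 by (simp add: exp_sum[OF assms(1), symmetric] sum_subtractf sum_distrib_left sum_divide_distrib)
 finally show ?thesis .
qed

text \<open>Each squared coefficient is at most \<open>c / 64\<close> while their sum is at least
  \<open>c / 4\<close>, which amounts to sixteen coefficients of maximal size. By concavity the
  logarithms add up to at least \<open>16 * L\<close>, and the fourth root in each factor leaves the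
  power 4. This power beats the degree of the polynomial remainder in
  \<open>chaos_mgf_expansion\<close>.\<close>

lemma chaos_mgf_decay:
 fixes w :: complex
 assumes J: "finite J" and w: "\<bar>Re w\<bar> <= 1" and c: "0 < c"
 and a: "!!k. k : J ==> \<bar>a k\<bar> <= ep" and ep: "ep <= 1 / 4" "64 * ep^2 <= c"
 and S: "c / 4 <= (SUM k:J. (a k)\<^sup>2)"
 shows "norm (chaos_mgf J a w) <= exp (4 * (SUM k:J. (a k)\<^sup>2)) / (1 + c / 64 * (Im w)\<^sup>2) ^ 4"
proof -
 define L where "L = ln (1 + c / 64 * (Im w)\<^sup>2)"
 have one: "64 / c * (a k)\<^sup>2 * L <= ln (1 + (Im w)\<^sup>2 * (a k)\<^sup>2)" if "k : J" for k
 proof -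
 have "(a k)\<^sup>2 <= ep^2" using power_mono[OF a[OF that], of 2] by simp
 then have "64 / c * (a k)\<^sup>2 <= 1" using ep c by (simp add: field_simps)
 from scaled_ln_1p_le[OF _ this, of "c / 64 * (Im w)\<^sup>2"]
 show ?thesis using c by (simp add: L_def mult.commute)
 qed
 have L: "0 <= L" using c by (simp add: L_def)
 have "16 * L <= 64 / c * (SUM k:J. (a k)\<^sup>2) * L"
 using S c L by (intro mult_right_mono) (auto simp: field_simps)
 also have "... <= (SUM k:J. ln (1 + (Im w)\<^sup>2 * (a k)\<^sup>2))"
 using sum_mono[OF one] by (simp add: sum_distrib_left sum_distrib_right)
 finally have 16: "16 * L <= (SUM k:J. ln (1 + (Im w)\<^sup>2 * (a k)\<^sup>2))" .
 have "norm (chaos_mgf J a w) <= exp (4 * (SUM k:J. (a k)\<^sup>2) - (SUM k:J. ln (1 + (Im w)\<^sup>2 * (a k)\<^sup>2)) / 4)"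
 by (rule norm_chaos_mgf_le[OF J w]) (use a ep in force)
 also have "... <= exp (4 * (SUM k:J. (a k)\<^sup>2) - 4 * L)"
 using 16 by simp
 also have "exp (4 * L) = (1 + c / 64 * (Im w)\<^sup>2) ^ 4"
 proof -
 have "0 < 1 + c / 64 * (Im w)\<^sup>2" using c by (auto intro: add_pos_nonneg)
 then show ?thesis using exp_of_nat_mult[of 4 L] by (simp add: L_def)
 qed
 then have "exp (4 * (SUM k:J. (a k)\<^sup>2) - 4 * L) = exp (4 * (SUM k:J. (a k)\<^sup>2)) / (1 + c / 64 * (Im w)\<^sup>2) ^ 4"
 by (simp only: exp_diff)
 finally show ?thesis .
qed

text \<open>The interpolation between the chaos at \<open>t = 1\<close> and a Gaussian at
  \<open>t = 0\<close>: the variance lost by shrinking the chaos by \<open>t\<close> is returned as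
  a Gaussian factor. The two decays combine to the full one uniformly in \<open>t\<close>, because
  \<open>(1 + Y) * (1 + v)\<close> is at least \<open>1 + (Y + v)\<close>.\<close>

lemma interpolation_bound:
 fixes w :: complex
 assumes J: "finite J" and w: "\<bar>Re w\<bar> <= 1" and c: "0 < c"
 and a: "!!k. k : J ==> \<bar>a k\<bar> <= ep" and ep: "ep <= 1 / 4" "64 * ep^2 <= c"
 and S: "c / 4 <= (SUM k:J. (a k)\<^sup>2)" and t: "0 <= t" "t <= 1"
 shows "norm (chaos_mgf J a (w * of_real t) * exp (of_real ((1 - t\<^sup>2) * c / 2) * w^2))
 <= exp (4 * (SUM k:J. (a k)\<^sup>2) + c / 2) / (1 + c / 64 * (Im w)\<^sup>2) ^ 4"
proof -
 define u where "u = Im w"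
 define S2 where "S2 = (SUM k:J. (a k)\<^sup>2)"
 define v where "v = (1 - t\<^sup>2) * (c / 64 * u^2)"
 have t2: "0 <= 1 - t\<^sup>2" "t^2 <= 1" using t by (auto simp: power_le_one)
 have v: "0 <= v" using t2 c by (simp add: v_def)
 have "\<bar>Re w\<bar> * abs t <= 1 * 1" using w t by (intro mult_mono) auto
 then have 1: "norm (chaos_mgf J a (w * of_real t)) <= exp (4 * S2) / (1 + c / 64 * (u * t)\<^sup>2) ^ 4"
 using chaos_mgf_decay[OF J _ c a ep S, of "w * of_real t"] by (simp add: abs_mult S2_def u_def)
 have "(Re w)\<^sup>2 <= 1" using w by (simp add: abs_square_le_1)
 then have "(1 - t\<^sup>2) * c / 2 * ((Re w)\<^sup>2 - u\<^sup>2) <= (1 - t\<^sup>2) * c / 2 * (1 - u\<^sup>2)"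
 using t2 c by (intro mult_left_mono) auto
 \<comment> \<open>The Gaussian factor supplies \<open>32 * v\<close>; only \<open>4 * v\<close> is
   kept, to match the fourth power on the chaos side.\<close>
 also have "... = (1 - t\<^sup>2) * (c / 2) - 32 * v" by (simp add: v_def field_simps)
 also have "... <= 1 * (c / 2) - 4 * v"
 proof -
 have "(1 - t\<^sup>2) * (c / 2) <= 1 * (c / 2)" using c by (intro mult_right_mono) auto
 then show ?thesis using v by linarith
 qed
 finally have "(1 - t\<^sup>2) * c / 2 * ((Re w)\<^sup>2 - u\<^sup>2) <= c / 2 - 4 * v" by simp
 moreover have "Re (of_real ((1 - t\<^sup>2) * c / 2) * w^2) = (1 - t\<^sup>2) * c / 2 * ((Re w)\<^sup>2 - u\<^sup>2)"
 by (simp add: u_def Re_power2 del: of_real_mult of_real_divide of_real_diff)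
 ultimately have "norm (exp (of_real ((1 - t\<^sup>2) * c / 2) * w^2)) <= exp (c / 2 - 4 * v)"
 by (simp only: exp_le_cancel_iff norm_exp_eq_Re)
 also have "... = exp (c / 2) / exp v ^ 4"
 using exp_of_nat_mult[of 4 v] by (simp add: exp_diff)
 also have "... <= exp (c / 2) / (1 + v) ^ 4"
 using v by (intro divide_left_mono power_mono) (auto simp: exp_ge_add_one_self)
 finally have 2: "norm (exp (of_real ((1 - t\<^sup>2) * c / 2) * w^2)) <= exp (c / 2) / (1 + v) ^ 4" .
 have y: "0 <= c / 64 * (u * t)\<^sup>2" using c by simp
 have "1 + c / 64 * u^2 <= (1 + c / 64 * (u * t)\<^sup>2) * (1 + v)"
 proof -
 have "c / 64 * (u * t)\<^sup>2 + v = c / 64 * u^2" by (simp add: v_def field_simps power_mult_distrib)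
 moreover have "(1 + Y) * (1 + v) = 1 + (Y + v) + Y * v" for Y by (simp add: algebra_simps)
 ultimately show ?thesis using mult_nonneg_nonneg[OF y v] by simp
 qed
 then have 3: "(1 + c / 64 * u^2) ^ 4 <= (1 + c / 64 * (u * t)\<^sup>2) ^ 4 * (1 + v) ^ 4"
 unfolding power_mult_distrib[symmetric] using c by (intro power_mono) auto
 have "norm (chaos_mgf J a (w * of_real t) * exp (of_real ((1 - t\<^sup>2) * c / 2) * w^2))
 <= exp (4 * S2) / (1 + c / 64 * (u * t)\<^sup>2) ^ 4 * (exp (c / 2) / (1 + v) ^ 4)"
 unfolding norm_mult using 1 2 by (intro mult_mono) auto
 also have "... = exp (4 * S2 + c / 2) / ((1 + c / 64 * (u * t)\<^sup>2) ^ 4 * (1 + v) ^ 4)"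
 by (simp add: exp_add)
 also have "... <= exp (4 * S2 + c / 2) / (1 + c / 64 * u^2) ^ 4"
 using 3 c v by (intro divide_left_mono) (auto intro!: mult_pos_pos zero_less_power add_pos_nonneg)
 finally show ?thesis by (simp add: S2_def u_def)
qed

lemma norm_diff_le_derivative_bound:
 fixes f :: "real => complex"
 assumes "!!t. 0 <= t ==> t <= 1 ==> (f has_vector_derivative f' t) (at t)"
 and "!!t. 0 <= t ==> t <= 1 ==> norm (f' t) <= B" and "0 <= t" "t <= 1"
 shows "norm (f t - f 0) <= B"
proof -
 have on: "onorm (%h. h *\<^sub>R f' s) <= B" if "s : {0..1}" for s
 using assms(2)[of s] that onorm_scaleR_left_lemma[of "%h::real. h" "f' s"] by (simp add: onorm_id)
 have "norm (f t - f 0) <= B * norm (t - 0)"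
 by (rule differentiable_bound[where S="{0..1}" and f' = "%s h. h *\<^sub>R f' s"])
 (use assms(1,3,4) on in \<open>auto simp: has_vector_derivative_def intro: has_derivative_at_withinI\<close>)
 also have "... <= B"
 proof -
 have "0 <= B" using assms(2)[of 0] norm_ge_zero[of "f' 0"] by linarith
 then show ?thesis using assms(3,4) mult_left_mono[of t 1 B] by simp
 qed
 finally show ?thesis .
qed

text \<open>Along the interpolation \<open>F' = F * g\<close>, where \<open>g\<close> is explicit
  because each factor has a rational logarithmic derivative. The main part of \<open>g\<close> is
  \<open>g0\<close>, and the error derivative \<open>(F - F0) * g + F0 * (g - g0)\<close> is of
  second order: \<open>F - F0\<close> is itself bounded through \<open>g\<close>, and
  \<open>g - g0\<close> is quartic in the coefficients. The constants \<open>1 / 2\<close> and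
  \<open>4 / 3\<close> are the integrals of \<open>t\<close> and \<open>4 * t^2\<close> over the
  unit interval.\<close>

lemma chaos_mgf_expansion_aux:
 fixes w :: complex
 assumes J: "finite J" and w: "\<bar>Re w\<bar> <= 1"
 and a: "!!k. k : J ==> \<bar>a k\<bar> <= ep" and ep: "ep <= 1 / 4" "0 <= ep"
 and m: "!!t. 0 <= t ==> t <= 1 ==>
 norm (chaos_mgf J a (w * of_real t) * exp (of_real ((1 - t\<^sup>2) * c / 2) * w^2)) <= m"
 defines "S2 \<equiv> (SUM k:J. (a k)\<^sup>2)" and "S3 \<equiv> (SUM k:J. (a k) ^ 3)"
 shows "norm (chaos_mgf J a w - exp (of_real (c / 2) * w^2) * (1 + of_real ((2 * S2 - c) / 2) * w^2 + of_real (4 / 3 * S3) * w ^ 3))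
 <= m * (((norm w)\<^sup>2 * \<bar>2 * S2 - c\<bar> + 8 * norm w ^ 3 * ep * S2)\<^sup>2 + 16 * norm w ^ 4 * ep^2 * S2)"
proof -
 define F where "F t = chaos_mgf J a (w * of_real t) * exp (of_real ((1 - t\<^sup>2) * c / 2) * w^2)" for t
 define q where "q t k = 1 - 2 * (w * of_real t) * of_real (a k)" for t k
 define g where "g t = (SUM k:J. 2 * w^2 * of_real ((a k)\<^sup>2) * of_real t / q t k) - of_real (t * c) * w^2" for t
 define g0 where "g0 t = of_real (t * (2 * S2 - c)) * w^2 + of_real (4 * t^2 * S3) * w ^ 3" for t
 define F0 where "F0 = exp (of_real (c / 2) * w^2)"
 define Bg where "Bg = (norm w)\<^sup>2 * \<bar>2 * S2 - c\<bar> + 8 * norm w ^ 3 * ep * S2"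
 have S2: "0 <= S2" by (auto simp: S2_def intro: sum_nonneg)
 have Re_q: "1 / 2 <= Re (q t k)" if "k : J" "0 <= t" "t <= 1" for t k
 proof -
 have "\<bar>Re w\<bar> * abs t <= 1 * 1" using w that by (intro mult_mono) auto
 then show ?thesis
 unfolding q_def using a[OF that(1)] ep by (intro Re_chaos_factor) (auto simp: abs_mult)
 qed
 have q0: "q t k ~= 0" "q t k \<notin> \<real>\<^sub>\<le>\<^sub>0" "norm (1 / q t k) <= 2" if "k : J" "0 <= t" "t <= 1" for t k
 proof -
 have *: "1 / 2 <= Re (q t k)" by (rule Re_q[OF that])
 then show "q t k ~= 0" "q t k \<notin> \<real>\<^sub>\<le>\<^sub>0" by (auto simp: complex_nonpos_Reals_iff)
 have "1 / 2 <= norm (q t k)" using * complex_Re_le_cmod[of "q t k"] by linarith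
 then have "1 / norm (q t k) <= 1 / (1 / 2)" by (intro divide_left_mono) auto
 then show "norm (1 / q t k) <= 2" by (simp add: norm_divide)
 qed
 have dfac: "((%t. exp (- (w * of_real t) * of_real (a k)) / csqrt (q t k)) has_vector_derivative
 exp (- (w * of_real t) * of_real (a k)) / csqrt (q t k) * (2 * w^2 * of_real ((a k)\<^sup>2) * of_real t / q t k)) (at t)"
 if k: "k : J" and t: "0 <= t" "t <= 1" for t k
 proof -
 note q = q0[OF k t]
 have sq: "q t k = csqrt (q t k) * csqrt (q t k)" using power2_csqrt[of "q t k"] by (simp add: power2_eq_square)
 have cs0: "csqrt (q t k) ~= 0" using q by simp
 let ?E = "%z. exp (- (w * z) * of_real (a k))" and ?Q = "%z. 1 - 2 * (w * z) * of_real (a k)"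
 have Qt: "?Q (of_real t) = q t k" by (simp add: q_def)
 have "((%z. ?E z / csqrt (?Q z)) has_field_derivative
 ((?E (of_real t) * (- w * of_real (a k))) * csqrt (q t k) - ?E (of_real t) * (inverse (2 * csqrt (q t k)) * (- 2 * w * of_real (a k))))
 / (csqrt (q t k) * csqrt (q t k))) (at (of_real t))"
 proof (rule DERIV_divide[where g="%z. csqrt (?Q z)" and x="of_real t", unfolded Qt])
 show "(?E has_field_derivative ?E (of_real t) * (- w * of_real (a k))) (at (of_real t))"
 by (auto intro!: derivative_eq_intros)
 have "(?Q has_field_derivative - 2 * w * of_real (a k)) (at (of_real t))"
 by (auto intro!: derivative_eq_intros)
 moreover have "(csqrt has_field_derivative inverse (2 * csqrt (q t k))) (at (?Q (of_real t)))"
 unfolding Qt by (rule has_field_derivative_csqrt) (rule q)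
 ultimately show "((%z. csqrt (?Q z)) has_field_derivative (inverse (2 * csqrt (q t k)) * (- 2 * w * of_real (a k)))) (at (of_real t))"
 by (rule DERIV_chain2[rotated])
 show "csqrt (q t k) ~= 0" by (rule cs0)
 qed
 moreover have "((?E (of_real t) * (- w * of_real (a k))) * csqrt (q t k) - ?E (of_real t) * (inverse (2 * csqrt (q t k)) * (- 2 * w * of_real (a k))))
 / (csqrt (q t k) * csqrt (q t k)) = ?E (of_real t) / csqrt (q t k) * (2 * w^2 * of_real ((a k)\<^sup>2) * of_real t / q t k)"
 proof -
 have key: "2 * w^2 * of_real ((a k)\<^sup>2) * of_real t = w * of_real (a k) * (1 - q t k)"
 by (simp add: q_def power2_eq_square algebra_simps)
 have "(e * (- W) * s - e * (inverse (2 * s) * (- 2 * W))) / (s * s) = e / s * (W * (1 - s * s) / (s * s))"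
 if "s ~= 0" for e s W :: complex using that by (simp add: field_simps)
 from this[OF cs0, of "?E (of_real t)" "w * of_real (a k)"] show ?thesis
 unfolding key sq[symmetric] by (simp add: mult.assoc)
 qed
 ultimately have "((%z. ?E z / csqrt (?Q z)) has_field_derivative
 (?E (of_real t) / csqrt (q t k) * (2 * w^2 * of_real ((a k)\<^sup>2) * of_real t / q t k))) (at (of_real t))"
 by (simp only:)
 from has_vector_derivative_real_field[OF this] show ?thesis unfolding q_def .
 qed
 have dprod: "((%t. chaos_mgf I a (w * of_real t)) has_vector_derivative
 chaos_mgf I a (w * of_real t) * (SUM k:I. 2 * w^2 * of_real ((a k)\<^sup>2) * of_real t / q t k)) (at t)"
 if t: "0 <= t" "t <= 1" and I: "I \<subseteq> J" "finite I" for t I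
 using I(2,1)
 proof (induction I)
 case empty then show ?case by (simp add: chaos_mgf_def)
 next
 case (insert k I)
 have d1: "((%t. exp (- (w * of_real t) * of_real (a k)) / csqrt (q t k) * chaos_mgf I a (w * of_real t)) has_vector_derivative
 (exp (- (w * of_real t) * of_real (a k)) / csqrt (q t k) * (chaos_mgf I a (w * of_real t) * (SUM k:I. 2 * w^2 * of_real ((a k)\<^sup>2) * of_real t / q t k))
 + exp (- (w * of_real t) * of_real (a k)) / csqrt (q t k) * (2 * w^2 * of_real ((a k)\<^sup>2) * of_real t / q t k) * chaos_mgf I a (w * of_real t))) (at t)"
 using insert by (intro has_vector_derivative_mult dfac t) auto
 have ins: "chaos_mgf (insert k I) a (w * of_real t)
 = exp (- (w * of_real t) * of_real (a k)) / csqrt (q t k) * chaos_mgf I a (w * of_real t)" for t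
 using insert by (simp add: chaos_mgf_def q_def)
 have ring: "A * (M * S) + A * T * M = A * M * (T + S)" for A M S T :: complex
 by (simp add: algebra_simps)
 show ?case unfolding ins sum.insert[OF insert.hyps(1,2)] ring[symmetric] by (rule d1)
 qed
 have dF: "(F has_vector_derivative F t * g t) (at t)" if t: "0 <= t" "t <= 1" for t
 proof -
 have "((%t. exp (of_real ((1 - t\<^sup>2) * c / 2) * w^2)) has_vector_derivative
 exp (of_real ((1 - t\<^sup>2) * c / 2) * w^2) * (- of_real (t * c) * w^2)) (at t)"
 proof -
 have "((%z. exp ((1 - z\<^sup>2) * of_real c / 2 * w^2)) has_field_derivative
 exp ((1 - (of_real t)\<^sup>2) * of_real c / 2 * w^2) * (- (of_real t * of_real c) * w^2)) (at (of_real t))"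
 by (auto intro!: derivative_eq_intros)
 from has_vector_derivative_real_field[OF this] show ?thesis by simp
 qed
 from has_vector_derivative_mult[OF dprod[OF t subset_refl J] this]
 show ?thesis unfolding F_def g_def by (simp add: algebra_simps)
 qed
 have F_0: "F 0 = F0" by (simp add: F_def F0_def chaos_mgf_def)
 have F_1: "F 1 = chaos_mgf J a w" by (simp add: F_def)
 \<comment> \<open>One step of the geometric expansion of \<open>1 / q t k\<close> with exact
   remainder. Applied once it isolates the squares of the coefficients, applied twice also the
   cubes.\<close>
 have split_div: "X / z = Y + Z / z" if "z ~= 0" "X = Y * z + Z" for X Y Z z :: complex
 using that by (simp add: field_simps)
 have g_split: "g t = of_real (t * (2 * S2 - c)) * w^2 + (SUM k:J. 4 * w ^ 3 * of_real ((a k) ^ 3) * of_real (t^2) / q t k)"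
 if t: "0 <= t" "t <= 1" for t
 proof -
 have "2 * w^2 * of_real ((a k)\<^sup>2) * of_real t / q t k
 = of_real (t * (2 * (a k)\<^sup>2)) * w^2 + 4 * w ^ 3 * of_real ((a k) ^ 3) * of_real (t^2) / q t k" if "k : J" for k
 by (rule split_div[OF q0(1)[OF that t]]) (simp add: q_def algebra_simps power2_eq_square power3_eq_cube)
 then have "(SUM k:J. 2 * w^2 * of_real ((a k)\<^sup>2) * of_real t / q t k)
 = (SUM k:J. of_real (t * (2 * (a k)\<^sup>2)) * w^2 + 4 * w ^ 3 * of_real ((a k) ^ 3) * of_real (t^2) / q t k)"
 by (intro sum.cong) auto
 then show ?thesis
 by (simp add: g_def sum.distrib S2_def sum_distrib_left sum_distrib_right algebra_simps)
 qed
 have g_split2: "g t - g0 t = (SUM k:J. 8 * w ^ 4 * of_real ((a k) ^ 4) * of_real (t ^ 3) / q t k)"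
 if t: "0 <= t" "t <= 1" for t
 proof -
 have "4 * w ^ 3 * of_real ((a k) ^ 3) * of_real (t^2) / q t k
 = of_real (4 * t^2 * (a k) ^ 3) * w ^ 3 + 8 * w ^ 4 * of_real ((a k) ^ 4) * of_real (t ^ 3) / q t k" if "k : J" for k
 by (rule split_div[OF q0(1)[OF that t]]) (simp add: q_def algebra_simps power2_eq_square power3_eq_cube power4_eq_xxxx)
 then have "(SUM k:J. 4 * w ^ 3 * of_real ((a k) ^ 3) * of_real (t^2) / q t k)
 = (SUM k:J. of_real (4 * t^2 * (a k) ^ 3) * w ^ 3 + 8 * w ^ 4 * of_real ((a k) ^ 4) * of_real (t ^ 3) / q t k)"
 by (intro sum.cong) auto
 then show ?thesis
 unfolding g_split[OF t] g0_def by (simp add: sum.distrib S3_def sum_distrib_left sum_distrib_right algebra_simps)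
 qed
 have g_le: "norm (g t) <= Bg" if t: "0 <= t" "t <= 1" for t
 proof -
 have t2: "t^2 <= 1" using t by (simp add: power_le_one)
 have "norm (4 * w ^ 3 * of_real ((a k) ^ 3) * of_real (t^2) / q t k) <= 8 * norm w ^ 3 * ep * (a k)\<^sup>2" if k: "k : J" for k
 proof -
 have "norm (4 * w ^ 3 * of_real ((a k) ^ 3) * of_real (t^2) / q t k)
 = 4 * norm w ^ 3 * (\<bar>a k\<bar> * (a k)\<^sup>2) * t^2 * norm (1 / q t k)"
 by (simp add: norm_mult norm_divide norm_power power3_eq_cube power2_eq_square)
 also have "... <= 4 * norm w ^ 3 * (ep * (a k)\<^sup>2) * 1 * 2"
 using t2 a[OF k] ep q0(3)[OF k t] by (intro mult_mono) auto
 finally show ?thesis by (simp add: mult_ac)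
 qed
 then have "norm (SUM k:J. 4 * w ^ 3 * of_real ((a k) ^ 3) * of_real (t^2) / q t k) <= (SUM k:J. 8 * norm w ^ 3 * ep * (a k)\<^sup>2)"
 by (rule sum_norm_le)
 moreover have "norm (of_real (t * (2 * S2 - c)) * w^2) <= 1 * ((norm w)\<^sup>2 * \<bar>2 * S2 - c\<bar>)"
 proof -
 have "norm (of_real (t * (2 * S2 - c)) * w^2) = abs t * ((norm w)\<^sup>2 * \<bar>2 * S2 - c\<bar>)"
 by (simp only: norm_mult norm_of_real norm_power abs_mult) (simp add: mult_ac)
 also have "... <= 1 * ((norm w)\<^sup>2 * \<bar>2 * S2 - c\<bar>)" using t by (intro mult_right_mono) auto
 finally show ?thesis .
 qed
 ultimately show ?thesis
 unfolding g_split[OF t] Bg_def S2_def sum_distrib_left by (intro norm_triangle_le) simp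
 qed
 have r_le: "norm (g t - g0 t) <= 16 * norm w ^ 4 * ep^2 * S2" if t: "0 <= t" "t <= 1" for t
 proof -
 have t3: "t ^ 3 <= 1" using t by (simp add: power_le_one)
 have "norm (8 * w ^ 4 * of_real ((a k) ^ 4) * of_real (t ^ 3) / q t k) <= 16 * norm w ^ 4 * ep^2 * (a k)\<^sup>2" if k: "k : J" for k
 proof -
 have a2: "(a k)\<^sup>2 <= ep^2" using power_mono[OF a[OF k], of 2] by simp
 have "norm (8 * w ^ 4 * of_real ((a k) ^ 4) * of_real (t ^ 3) / q t k)
 = 8 * norm w ^ 4 * ((a k)\<^sup>2 * (a k)\<^sup>2) * t ^ 3 * norm (1 / q t k)"
 using t by (simp add: norm_mult norm_divide norm_power power4_eq_xxxx power2_eq_square)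
 also have "... <= 8 * norm w ^ 4 * (ep^2 * (a k)\<^sup>2) * 1 * 2"
 using t3 t a2 q0(3)[OF k t] by (intro mult_mono) auto
 finally show ?thesis by (simp add: mult_ac)
 qed
 then show ?thesis
 unfolding g_split2[OF t] S2_def sum_distrib_left by (rule sum_norm_le)
 qed
 have m0: "0 <= m" by (rule order_trans[OF norm_ge_zero m[of 0]]) auto
 have Bg0: "0 <= Bg" using S2 ep by (simp add: Bg_def)
 have F_le: "norm (F t) <= m" if t: "0 <= t" "t <= 1" for t using m[OF t] by (simp add: F_def)
 have FF0: "norm (F t - F0) <= m * Bg" if t: "0 <= t" "t <= 1" for t
 unfolding F_0[symmetric]
 by (rule norm_diff_le_derivative_bound[OF dF _ t], assumption+, unfold norm_mult)
 (rule mult_mono[OF F_le g_le m0 norm_ge_zero])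
 \<comment> \<open>The subtracted polynomial in \<open>t\<close> is the primitive of
   \<open>F0 * g0\<close> with value \<open>F0\<close> at 0. Hence \<open>R 0 = 0\<close>, and
   \<open>R 1\<close> is the difference to be estimated.\<close>
 define R where "R t = F t - F0 * (1 + of_real (t^2 * (2 * S2 - c) / 2) * w^2 + of_real (4 / 3 * t ^ 3 * S3) * w ^ 3)" for t
 have dR: "(R has_vector_derivative (F t - F0) * g t + F0 * (g t - g0 t)) (at t)" if t: "0 <= t" "t <= 1" for t
 proof -
 have "((%z. F0 * (1 + z^2 * D / 2 * w^2 + 4 / 3 * z ^ 3 * E * w ^ 3)) has_field_derivative
 F0 * (of_real t * D * w^2 + 4 * (of_real t)\<^sup>2 * E * w ^ 3)) (at (of_real t))" for D E :: complex
 by (auto intro!: derivative_eq_intros simp: field_simps)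
 from has_vector_derivative_real_field[OF this[of "of_real (2 * S2 - c)" "of_real S3"]]
 have "((%t. F0 * (1 + of_real (t^2 * (2 * S2 - c) / 2) * w^2 + of_real (4 / 3 * t ^ 3 * S3) * w ^ 3)) has_vector_derivative F0 * g0 t) (at t)"
 by (simp add: g0_def)
 from has_vector_derivative_diff[OF dF[OF t] this] show ?thesis
 unfolding R_def by (simp add: algebra_simps)
 qed
 have "norm (R 1 - R 0) <= m * Bg * Bg + m * (16 * norm w ^ 4 * ep^2 * S2)"
 proof (rule norm_diff_le_derivative_bound[OF dR])
 fix t :: real assume t: "0 <= t" "t <= 1"
 have "norm ((F t - F0) * g t) <= m * Bg * Bg"
 unfolding norm_mult by (rule mult_mono[OF FF0[OF t] g_le[OF t] mult_nonneg_nonneg[OF m0 Bg0] norm_ge_zero])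
 moreover have "norm (F0 * (g t - g0 t)) <= m * (16 * norm w ^ 4 * ep^2 * S2)"
 unfolding norm_mult F_0[symmetric] by (rule mult_mono[OF F_le r_le[OF t] m0 norm_ge_zero]) auto
 ultimately show "norm ((F t - F0) * g t + F0 * (g t - g0 t)) <= m * Bg * Bg + m * (16 * norm w ^ 4 * ep^2 * S2)"
 by (rule norm_triangle_mono)
 qed auto
 moreover have "R 0 = 0" by (simp add: R_def F_0)
 moreover have "R 1 = chaos_mgf J a w - F0 * (1 + of_real ((2 * S2 - c) / 2) * w^2 + of_real (4 / 3 * S3) * w ^ 3)"
 unfolding R_def F_1 by simp
 moreover have "m * Bg * Bg + m * (16 * norm w ^ 4 * ep^2 * S2) = m * (Bg^2 + 16 * norm w ^ 4 * ep^2 * S2)"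
 by (simp add: distrib_left power2_eq_square)
 ultimately show ?thesis
 unfolding F0_def[symmetric] Bg_def[symmetric] by simp
qed

text \<open>The constant depends on \<open>c\<close> alone, not on the number of coefficients. The
  remainder grows like the third power of \<open>U\<close>, the decay supplies the fourth power, and
  one factor \<open>1 / U\<close> is left to be integrated in the inversion.\<close>

lemma chaos_mgf_expansion:
 fixes c :: real
 assumes c: "0 < c"
 obtains K where "0 <= K" and "!!(J :: 'i set) a ep (w :: complex). finite J ==> \<bar>Re w\<bar> <= 1 ==>
 (!!k. k : J ==> \<bar>a k\<bar> <= ep) ==> 0 <= ep ==> ep <= 1 / 4 ==> 64 * ep^2 <= c ==>
 \<bar>2 * (SUM k:J. (a k)\<^sup>2) - c\<bar> <= c / 2 ==>
 norm (chaos_mgf J a w - exp (of_real (c / 2) * w^2) *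
 (1 + of_real ((2 * (SUM k:J. (a k)\<^sup>2) - c) / 2) * w^2 + of_real (4 / 3 * (SUM k:J. (a k) ^ 3)) * w ^ 3))
 <= K * (ep^2 + (2 * (SUM k:J. (a k)\<^sup>2) - c)\<^sup>2) / (1 + (Im w)\<^sup>2)"
proof
 \<comment> \<open>Converts decay in \<open>V\<close>, which carries the factor
   \<open>c / 64\<close>, into decay in \<open>U\<close>.\<close>
 define K1 where "K1 = max 1 (64 / c)"
 define K where "K = exp (4 * c) * K1 ^ 4 * (2 + 128 * c^2 + 16 * c)"
 show "0 <= K" using c by (simp add: K_def K1_def)
 fix J :: "'i set" and a ep and w :: complex
 assume J: "finite J" and w: "\<bar>Re w\<bar> <= 1" and a: "!!k. k : J ==> \<bar>a k\<bar> <= ep"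
 and ep: "0 <= ep" "ep <= 1 / 4" "64 * ep^2 <= c" and d: "\<bar>2 * (SUM k:J. (a k)\<^sup>2) - c\<bar> <= c / 2"
 define S2 where "S2 = (SUM k:J. (a k)\<^sup>2)"
 define dl where "dl = \<bar>2 * S2 - c\<bar>"
 define U where "U = 1 + (Im w)\<^sup>2"
 define V where "V = 1 + c / 64 * (Im w)\<^sup>2"
 define m where "m = exp (4 * S2 + c / 2) / V ^ 4"
 have S2: "c / 4 <= S2" "S2 <= c" "0 <= S2" using d c unfolding S2_def[symmetric] by linarith+
 have U: "1 <= U" and V: "1 <= V" using c by (auto simp: U_def V_def)
 have m0: "0 <= m" using V by (simp add: m_def)
 have UV: "U <= K1 * V"
 proof -
 have "1 * (Im w)\<^sup>2 <= (K1 * (c / 64)) * (Im w)\<^sup>2"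
 proof (rule mult_right_mono)
 have "64 / c * (c / 64) <= K1 * (c / 64)" using c by (intro mult_right_mono) (auto simp: K1_def)
 then show "1 <= K1 * (c / 64)" using c by simp
 qed auto
 moreover have "1 <= K1" by (simp add: K1_def)
 ultimately show ?thesis by (simp add: U_def V_def algebra_simps)
 qed
 have nw: "(norm w)\<^sup>2 <= U"
 proof -
 have "(Re w)\<^sup>2 <= 1" using w by (simp add: abs_square_le_1)
 then show ?thesis by (simp add: cmod_power2 U_def)
 qed
 have "norm w ^ 4 <= U ^ 2" using power_mono[OF nw, of 2] by simp
 have n4: "norm w ^ 4 <= U ^ 3"
 proof -
 have "U ^ 2 <= U ^ 3" using U by (intro power_increasing) auto
 then show ?thesis using \<open>norm w ^ 4 <= U ^ 2\<close> by linarith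
 qed
 have n6: "norm w ^ 6 <= U ^ 3" using power_mono[OF nw, of 3] by simp
 have "(((norm w)\<^sup>2 * dl + 8 * norm w ^ 3 * ep * S2)\<^sup>2 + 16 * norm w ^ 4 * ep^2 * S2)
 <= 2 * ((norm w)\<^sup>2 * dl)\<^sup>2 + 2 * (8 * norm w ^ 3 * ep * S2)\<^sup>2 + 16 * norm w ^ 4 * ep^2 * S2"
 using sum_squares_bound[of "(norm w)\<^sup>2 * dl" "8 * norm w ^ 3 * ep * S2"] by (simp add: power2_sum)
 also have "... = 2 * (norm w ^ 4 * dl^2) + 128 * (norm w ^ 6 * (ep^2 * S2^2)) + 16 * (norm w ^ 4 * (ep^2 * S2))"
 by (simp add: power_mult_distrib flip: power_mult)
 also have "... <= 2 * (U ^ 3 * (ep^2 + dl^2)) + 128 * (U ^ 3 * ((ep^2 + dl^2) * c^2)) + 16 * (U ^ 3 * ((ep^2 + dl^2) * c))"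
 using n4 n6 S2 U by (intro add_mono mult_mono power_mono) auto
 also have "... = U ^ 3 * (ep^2 + dl^2) * (2 + 128 * c^2 + 16 * c)"
 by (simp add: algebra_simps)
 finally have poly: "(((norm w)\<^sup>2 * dl + 8 * norm w ^ 3 * ep * S2)\<^sup>2 + 16 * norm w ^ 4 * ep^2 * S2)
 <= U ^ 3 * (ep^2 + dl^2) * (2 + 128 * c^2 + 16 * c)" .
 have mU: "m * U ^ 3 <= exp (4 * c) * K1 ^ 4 / U"
 proof -
 have "U ^ 4 <= K1 ^ 4 * V ^ 4" unfolding power_mult_distrib[symmetric] using UV U by (intro power_mono) auto
 moreover have "exp (4 * S2 + c / 2) <= exp (4 * c)"
 using abs_le_D1[OF d] c unfolding S2_def[symmetric] exp_le_cancel_iff by linarith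
 ultimately have "exp (4 * S2 + c / 2) * U ^ 4 <= exp (4 * c) * (K1 ^ 4 * V ^ 4)"
 using U by (intro mult_mono) auto
 moreover have "m * U ^ 3 = exp (4 * S2 + c / 2) * U ^ 4 / (V ^ 4 * U)"
 using U V by (simp add: m_def power_numeral_reduce)
 moreover have "exp (4 * S2 + c / 2) * U ^ 4 / (V ^ 4 * U) <= exp (4 * c) * (K1 ^ 4 * V ^ 4) / (V ^ 4 * U)"
 using U V calculation(1) by (intro divide_right_mono) auto
 moreover have "exp (4 * c) * (K1 ^ 4 * V ^ 4) / (V ^ 4 * U) = exp (4 * c) * K1 ^ 4 / U"
 using V by simp
 ultimately show ?thesis by simp
 qed
 have "norm (chaos_mgf J a w - exp (of_real (c / 2) * w^2) *
 (1 + of_real ((2 * S2 - c) / 2) * w^2 + of_real (4 / 3 * (SUM k:J. (a k) ^ 3)) * w ^ 3))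
 <= m * (((norm w)\<^sup>2 * dl + 8 * norm w ^ 3 * ep * S2)\<^sup>2 + 16 * norm w ^ 4 * ep^2 * S2)"
 unfolding S2_def dl_def
 by (rule chaos_mgf_expansion_aux[OF J w a ep(2,1)])
 (use interpolation_bound[OF J w c a ep(2,3)] S2 in \<open>auto simp: m_def S2_def V_def\<close>)
 also have "... <= m * (U ^ 3 * (ep^2 + dl^2) * (2 + 128 * c^2 + 16 * c))"
 by (rule mult_left_mono[OF poly m0])
 also have "... = (m * U ^ 3) * ((ep^2 + dl^2) * (2 + 128 * c^2 + 16 * c))" by simp
 also have "... <= (exp (4 * c) * K1 ^ 4 / U) * ((ep^2 + dl^2) * (2 + 128 * c^2 + 16 * c))"
 using c by (intro mult_right_mono mU) auto
 also have "... = K * (ep^2 + (2 * S2 - c)\<^sup>2) / U" by (simp add: K_def dl_def)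
 finally show "norm (chaos_mgf J a w - exp (of_real (c / 2) * w^2) *
 (1 + of_real ((2 * (SUM k:J. (a k)\<^sup>2) - c) / 2) * w^2 + of_real (4 / 3 * (SUM k:J. (a k) ^ 3)) * w ^ 3))
 <= K * (ep^2 + (2 * (SUM k:J. (a k)\<^sup>2) - c)\<^sup>2) / (1 + (Im w)\<^sup>2)"
 by (simp add: S2_def U_def)
qed

section \<open>Gaussian integrals along vertical lines\<close>

lemma gaussian_poly_integrable:
 fixes p :: real
 assumes "0 < p"
 shows "integrable lborel (%u. (1 + abs u) ^ k * exp (- p * u^2 / 2))"
proof (rule integrable_dominated)
 show "integrable lborel (%u. 2 ^ k * (abs u ^ 0 * exp (- p * u^2 / 2) + abs u ^ k * exp (- p * u^2 / 2)))"
 using assms by (intro integrable_mult_right Bochner_Integration.integrable_add gaussian_moment_integrable)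
 have "(1 + y) ^ k <= 2 ^ k * (1 + y ^ k)" if "0 <= y" for y :: real
 proof -
 have "(1 + y) ^ k <= (2 * max 1 y) ^ k" using that by (intro power_mono) auto
 also have "... = 2 ^ k * (max 1 y) ^ k" by (simp add: power_mult_distrib)
 also have "... <= 2 ^ k * (1 + y ^ k)" using that by (intro mult_left_mono) (auto simp: max_def)
 finally show ?thesis .
 qed
 then have "(1 + abs u) ^ k * exp (- p * u^2 / 2) <= (2 ^ k * (1 + abs u ^ k)) * exp (- p * u^2 / 2)" for u
 by (intro mult_right_mono) auto
 then show "AE u in lborel. norm ((1 + abs u) ^ k * exp (- p * u^2 / 2))
 <= norm (2 ^ k * (abs u ^ 0 * exp (- p * u^2 / 2) + abs u ^ k * exp (- p * u^2 / 2)))"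
 by (intro AE_I2) (simp add: algebra_simps abs_mult)
qed auto

lemma gaussian_poly_tendsto:
 fixes p :: real
 assumes "0 < p"
 shows "((%u. (1 + abs u) ^ k * exp (- p * u^2 / 2)) \<longlongrightarrow> 0) at_top"
 "((%u. (1 + abs u) ^ k * exp (- p * u^2 / 2)) \<longlongrightarrow> 0) at_bot"
proof -
 have *: "((%u::real. (1 + u) ^ k * exp (- p * u^2 / 2)) \<longlongrightarrow> 0) at_top"
 using assms by real_asymp
 show "((%u. (1 + abs u) ^ k * exp (- p * u^2 / 2)) \<longlongrightarrow> 0) at_top"
 by (rule Lim_transform_eventually[OF *]) (auto intro!: eventually_mono[OF eventually_ge_at_top[of 0]])
 then show "((%u. (1 + abs u) ^ k * exp (- p * u^2 / 2)) \<longlongrightarrow> 0) at_bot"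
 by (subst at_bot_mirror, subst filterlim_filtermap) simp
qed

lemma norm_Complex_le:
 assumes "abs s <= 1" shows "norm (Complex s u) <= 1 + abs u"
 using cmod_le[of "Complex s u"] assms by simp

lemma norm_exp_half_square:
 "norm (exp (of_real (c / 2) * (Complex s u)\<^sup>2)) = exp (c * s^2 / 2) * exp (- c * u^2 / 2)"
 by (simp add: norm_exp_eq_Re Re_power2 exp_add[symmetric] algebra_simps diff_divide_distrib)

lemma gaussian_line_integrable:
 fixes c s x :: real
 assumes "0 < c" "abs s <= 1"
 shows "integrable lborel (%u. (Complex s u) ^ k * exp (of_real (c / 2) * (Complex s u)\<^sup>2 - of_real x * Complex s u))"
proof (rule integrable_dominated)
 show "integrable lborel (%u. exp (c * s^2 / 2 - x * s) * ((1 + abs u) ^ k * exp (- c * u^2 / 2)))"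
 using assms by (intro integrable_mult_right gaussian_poly_integrable)
 have "continuous_on UNIV (%u. (Complex s u) ^ k * exp (of_real (c / 2) * (Complex s u)\<^sup>2 - of_real x * Complex s u))"
 unfolding Complex_eq by (intro continuous_intros)
 then show "(%u. (Complex s u) ^ k * exp (of_real (c / 2) * (Complex s u)\<^sup>2 - of_real x * Complex s u)) : borel_measurable lborel"
 using borel_measurable_continuous_onI by simp
 show "AE u in lborel. norm ((Complex s u) ^ k * exp (of_real (c / 2) * (Complex s u)\<^sup>2 - of_real x * Complex s u))
 <= norm (exp (c * s^2 / 2 - x * s) * ((1 + abs u) ^ k * exp (- c * u^2 / 2)))"
 proof (rule AE_I2)
 fix u
 have "norm (exp (of_real (c / 2) * (Complex s u)\<^sup>2 - of_real x * Complex s u)) = exp (c * s^2 / 2 - x * s) * exp (- c * u^2 / 2)"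
 unfolding exp_diff norm_divide norm_exp_half_square by (simp add: norm_exp_eq_Re)
 moreover have "norm (Complex s u ^ k) <= (1 + abs u) ^ k"
 unfolding norm_power using norm_Complex_le[OF assms(2)] by (intro power_mono) auto
 ultimately show "norm ((Complex s u) ^ k * exp (of_real (c / 2) * (Complex s u)\<^sup>2 - of_real x * Complex s u))
 <= norm (exp (c * s^2 / 2 - x * s) * ((1 + abs u) ^ k * exp (- c * u^2 / 2)))"
 by (simp add: norm_mult abs_mult mult_right_mono)
 qed
qed

lemma gaussian_line_tendsto:
 fixes c s x :: real
 assumes "0 < c" "abs s <= 1" "F = at_top \<or> F = at_bot"
 shows "((%u. (Complex s u) ^ k * exp (of_real (c / 2) * (Complex s u)\<^sup>2 - of_real x * Complex s u)) \<longlongrightarrow> 0) F"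
proof (rule Lim_null_comparison)
 show "eventually (%u. norm ((Complex s u) ^ k * exp (of_real (c / 2) * (Complex s u)\<^sup>2 - of_real x * Complex s u))
 <= exp (c * s^2 / 2 - x * s) * ((1 + abs u) ^ k * exp (- c * u^2 / 2))) F"
 proof (rule always_eventually, rule allI)
 fix u
 have "norm (exp (of_real (c / 2) * (Complex s u)\<^sup>2 - of_real x * Complex s u)) = exp (c * s^2 / 2 - x * s) * exp (- c * u^2 / 2)"
 unfolding exp_diff norm_divide norm_exp_half_square by (simp add: norm_exp_eq_Re)
 moreover have "norm (Complex s u ^ k) <= (1 + abs u) ^ k"
 unfolding norm_power using norm_Complex_le[OF assms(2)] by (intro power_mono) auto
 ultimately show "norm ((Complex s u) ^ k * exp (of_real (c / 2) * (Complex s u)\<^sup>2 - of_real x * Complex s u))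
 <= exp (c * s^2 / 2 - x * s) * ((1 + abs u) ^ k * exp (- c * u^2 / 2))"
 by (simp add: norm_mult abs_mult mult_right_mono)
 qed
 show "((%u. exp (c * s^2 / 2 - x * s) * ((1 + abs u) ^ k * exp (- c * u^2 / 2))) \<longlongrightarrow> 0) F"
 using gaussian_poly_tendsto[OF assms(1), of k] assms(3) by (auto intro: tendsto_mult_right_zero)
qed

text \<open>Completing the square on the line reduces the integral to the standard normal
  characteristic function at \<open>r\<close>. The dependence on \<open>s\<close> cancels, as a
  shift of the contour would predict.\<close>

lemma gaussian_line_integral_0:
 fixes c s x :: real
 assumes c: "0 < c"
 shows "(LINT u|lborel. exp (of_real (c / 2) * (Complex s u)\<^sup>2 - of_real x * Complex s u))
 = of_real (2 * pi * gauss_density x c)"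
proof -
 define r where "r = (c * s - x) / sqrt c"
 have eq: "exp (of_real (c / 2) * (Complex s u)\<^sup>2 - of_real x * Complex s u)
 = of_real (exp (c * s^2 / 2 - s * x) * sqrt (2 * pi)) * (std_normal_density (0 + sqrt c * u) *\<^sub>R iexp (r * (0 + sqrt c * u)))" for u
 proof -
 have "of_real (c / 2) * (Complex s u)\<^sup>2 - of_real x * Complex s u
 = of_real (c * s^2 / 2 - s * x) + of_real (- (sqrt c * u)\<^sup>2 / 2) + \<i> * of_real (r * (sqrt c * u))"
 using c by (simp add: complex_eq_iff r_def Re_power2 Im_power2 power_mult_distrib algebra_simps diff_divide_distrib)
 then show ?thesis
 by (simp only: exp_add exp_of_real) (simp add: std_normal_density_def scaleR_conv_of_real)
 qed
 have char: "(LINT y|lborel. std_normal_density y *\<^sub>R iexp (r * y)) = of_real (exp (- r\<^sup>2 / 2))"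
 using fun_cong[OF char_std_normal_distribution, of r] unfolding char_def
 by (subst (asm) integral_density) auto
 have "(LINT u|lborel. std_normal_density (0 + sqrt c * u) *\<^sub>R iexp (r * (0 + sqrt c * u))) = of_real (exp (- r\<^sup>2 / 2) / sqrt c)"
 using lborel_integral_real_affine[of "sqrt c" "%y. std_normal_density y *\<^sub>R iexp (r * y)" 0] c
 unfolding char by (simp add: scaleR_conv_of_real field_simps)
 then have "(LINT u|lborel. exp (of_real (c / 2) * (Complex s u)\<^sup>2 - of_real x * Complex s u))
 = of_real (exp (c * s^2 / 2 - s * x) * sqrt (2 * pi) * (exp (- r\<^sup>2 / 2) / sqrt c))"
 unfolding eq integral_mult_right_zero by simp
 also have "exp (c * s^2 / 2 - s * x) * sqrt (2 * pi) * (exp (- r\<^sup>2 / 2) / sqrt c) = 2 * pi * gauss_density x c"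
 proof -
 have "c * s^2 / 2 - s * x + (- r\<^sup>2 / 2) = - x\<^sup>2 / (2 * c)"
 using c by (simp add: r_def power_divide field_simps power2_eq_square)
 then have "exp (c * s^2 / 2 - s * x) * exp (- r\<^sup>2 / 2) = exp (- x\<^sup>2 / (2 * c))"
 by (simp flip: exp_add)
 moreover have "sqrt (2 * pi) * sqrt (2 * pi) = 2 * pi" by simp
 ultimately show ?thesis
 using c by (simp add: gauss_density_def normal_density_def real_sqrt_mult field_simps)
 qed
 finally show ?thesis .
qed

lemma gaussian_line_integral_3:
 fixes c s x :: real
 assumes c: "0 < c" and s: "abs s <= 1"
 shows "(LINT u|lborel. (Complex s u) ^ 3 * exp (of_real (c / 2) * (Complex s u)\<^sup>2 - of_real x * Complex s u))
 = of_real (2 * pi * (gauss_density x c * h3 x c))"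
proof -
 let ?e = "%u. exp (of_real (c / 2) * (Complex s u)\<^sup>2 - of_real x * Complex s u)"
 let ?I = "of_real (inverse c) :: complex" and ?X = "of_real x :: complex"
 \<comment> \<open>Chosen so that differentiating \<open>?q w * exp (c / 2 * w^2 - x * w)\<close> in
   \<open>w\<close> gives \<open>w ^ 3 - h3 x c\<close> times the exponential: division of
   \<open>w ^ 3\<close> by the derivative \<open>c * w - x\<close> of the exponent, with the Hermite
   polynomial as remainder. The factor \<open>- \<i>\<close> in the primitive accounts for the
   direction of the line.\<close>
 let ?q = "%w. ?I * w^2 + ?X * ?I\<^sup>2 * w + (?X\<^sup>2 * ?I ^ 3 - 2 * ?I\<^sup>2)"
 let ?h = "of_real (h3 x c) :: complex"
 note int = gaussian_line_integrable[OF c s, of _ x]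
 have "h3 x c = - (x * inverse c ^ 2 - x * (x^2 * inverse c ^ 3 - 2 * inverse c ^ 2))"
 using c by (simp add: h3_def field_simps power2_eq_square power3_eq_cube)
 then have h: "?h = - (?X * ?I\<^sup>2 - ?X * (?X\<^sup>2 * ?I ^ 3 - 2 * ?I\<^sup>2))" by simp
 have "(LINT u|lborel. (Complex s u) ^ 3 * ?e u - ?h * ?e u) = 0"
 proof (rule integral_derivative_eq_0[where F="%u. - \<i> * (?q (Complex s u) * ?e u)"])
 show "((%u. - \<i> * (?q (Complex s u) * ?e u)) has_vector_derivative (Complex s u) ^ 3 * ?e u - ?h * ?e u) (at u)" for u
 proof -
 have gen: "I * (2 * w) + y * I^2 + (I * w^2 + y * I^2 * w + (y^2 * I ^ 3 - 2 * I^2)) * (d * w - y)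
 = w ^ 3 - - (y * I^2 - y * (y^2 * I ^ 3 - 2 * I^2))" if "d * I = 1" for d I w y :: complex
 proof -
 have "I * (2 * w) + y * I^2 + (I * w^2 + y * I^2 * w + (y^2 * I ^ 3 - 2 * I^2)) * (d * w - y)
 = (d * I) * (w ^ 3 + y * I * w^2 + y^2 * I^2 * w - 2 * I * w)
 + (2 * I * w + y * I^2 - I * w^2 * y - y\<^sup>2 * I^2 * w - (y^2 * I ^ 3 - 2 * I^2) * y)"
 by (simp add: algebra_simps power2_eq_square power3_eq_cube)
 then show ?thesis unfolding that by (simp add: algebra_simps power2_eq_square power3_eq_cube)
 qed
 let ?w = "of_real s + \<i> * of_real u"
 have "((%z. - \<i> * (?q (of_real s + \<i> * z) * exp (of_real (c / 2) * (of_real s + \<i> * z)\<^sup>2 - ?X * (of_real s + \<i> * z))))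
 has_field_derivative - \<i> * (\<i> * (?I * (2 * ?w) + ?X * ?I\<^sup>2) * exp (of_real (c / 2) * ?w\<^sup>2 - ?X * ?w)
 + exp (of_real (c / 2) * ?w\<^sup>2 - ?X * ?w) * (\<i> * (of_real c * ?w - ?X)) * ?q ?w)) (at (of_real u))"
 proof (intro DERIV_cmult DERIV_mult DERIV_fun_exp)
 show "((%z. ?q (of_real s + \<i> * z)) has_field_derivative \<i> * (?I * (2 * ?w) + ?X * ?I\<^sup>2)) (at (of_real u))"
 by (auto intro!: derivative_eq_intros simp: algebra_simps)
 show "((%z. of_real (c / 2) * (of_real s + \<i> * z)\<^sup>2 - ?X * (of_real s + \<i> * z)) has_field_derivative
 \<i> * (of_real c * ?w - ?X)) (at (of_real u))"
 by (auto intro!: derivative_eq_intros simp: field_simps)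
 qed
 also have "- \<i> * (\<i> * (?I * (2 * ?w) + ?X * ?I\<^sup>2) * E + E * (\<i> * (of_real c * ?w - ?X)) * ?q ?w)
 = (?I * (2 * ?w) + ?X * ?I\<^sup>2 + ?q ?w * (of_real c * ?w - ?X)) * E" for E
 proof -
 have "- \<i> * (\<i> * P * E + E * (\<i> * Q) * R) = (P + R * Q) * E" for P Q R :: complex
 by (simp add: algebra_simps)
 then show ?thesis .
 qed
 also have "(?I * (2 * ?w) + ?X * ?I\<^sup>2 + ?q ?w * (of_real c * ?w - ?X)) = ?w ^ 3 - ?h"
 unfolding h using c by (intro gen) (simp flip: of_real_mult)
 finally show ?thesis
 unfolding Complex_eq left_diff_distrib[symmetric] by (rule has_vector_derivative_real_field)
 qed
 show "continuous_on UNIV (%u. (Complex s u) ^ 3 * ?e u - ?h * ?e u)"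
 unfolding Complex_eq by (intro continuous_intros)
 show "integrable lborel (%u. (Complex s u) ^ 3 * ?e u - ?h * ?e u)"
 using int[of 3] int[of 0] by simp
 have *: "((%u. - \<i> * (?q (Complex s u) * ?e u)) \<longlongrightarrow> 0) F" if "F = at_top \<or> F = at_bot" for F
 proof -
 note t = gaussian_line_tendsto[OF c s that, of _ x]
 have "((%u. - \<i> * (?I * (Complex s u ^ 2 * ?e u) + ?X * ?I\<^sup>2 * (Complex s u ^ 1 * ?e u)
 + (?X\<^sup>2 * ?I ^ 3 - 2 * ?I\<^sup>2) * (Complex s u ^ 0 * ?e u))) \<longlongrightarrow> - \<i> * (?I * 0 + ?X * ?I\<^sup>2 * 0
 + (?X\<^sup>2 * ?I ^ 3 - 2 * ?I\<^sup>2) * 0)) F"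
 by (intro tendsto_intros t)
 then show ?thesis by (simp only: distrib_right mult.assoc power_one_right power_0 mult_1 mult_zero_right add_0)
 qed
 show "((%u. - \<i> * (?q (Complex s u) * ?e u)) \<longlongrightarrow> 0) at_top" by (rule *) simp
 show "((%u. - \<i> * (?q (Complex s u) * ?e u)) \<longlongrightarrow> 0) at_bot" by (rule *) simp
 qed
 then show ?thesis
 using int[of 3] int[of 0] gaussian_line_integral_0[OF c, of s x] by (simp add: mult_ac)
qed

text \<open>The two-sided Laplace transform that \<open>edgeworth_inversion\<close> turns into the
  Edgeworth density; \<open>ka\<close> stands in the place of the third cumulant.\<close>

definition edgeworth_mgf :: "real => real => complex => complex" where
 "edgeworth_mgf c ka w = exp (of_real (c / 2) * w^2) * (1 + of_real (ka / 6) * w ^ 3)"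

lemma edgeworth_inversion:
 fixes c s x ka :: real
 assumes c: "0 < c" and s: "abs s <= 1"
 shows "integrable lborel (%u. exp (- of_real x * Complex s u) * edgeworth_mgf c ka (Complex s u))"
 "(LINT u|lborel. exp (- of_real x * Complex s u) * edgeworth_mgf c ka (Complex s u))
 = of_real (2 * pi * (gauss_density x c * (1 + ka / 6 * h3 x c)))"
proof -
 have eq: "exp (- of_real x * Complex s u) * edgeworth_mgf c ka (Complex s u)
 = (Complex s u) ^ 0 * exp (of_real (c / 2) * (Complex s u)\<^sup>2 - of_real x * Complex s u)
 + of_real (ka / 6) * ((Complex s u) ^ 3 * exp (of_real (c / 2) * (Complex s u)\<^sup>2 - of_real x * Complex s u))" for u
 proof -
 have "exp (of_real (c / 2) * w^2 - of_real x * w) = exp (- of_real x * w) * exp (of_real (c / 2) * w^2)" for w :: complex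
 by (simp flip: exp_add)
 moreover have "X * (E * (1 + k * W)) = 1 * (X * E) + k * (W * (X * E))" for X E k W :: complex
 by (simp add: algebra_simps)
 ultimately show ?thesis unfolding edgeworth_mgf_def power_0 by (simp only:)
 qed
 note int = gaussian_line_integrable[OF c s, of _ x]
 show "integrable lborel (%u. exp (- of_real x * Complex s u) * edgeworth_mgf c ka (Complex s u))"
 unfolding eq by (intro Bochner_Integration.integrable_add integrable_mult_right int)
 show "(LINT u|lborel. exp (- of_real x * Complex s u) * edgeworth_mgf c ka (Complex s u))
 = of_real (2 * pi * (gauss_density x c * (1 + ka / 6 * h3 x c)))"
 proof -
 have "(LINT u|lborel. exp (- of_real x * Complex s u) * edgeworth_mgf c ka (Complex s u))
 = of_real (2 * pi * gauss_density x c) + of_real (ka / 6) * of_real (2 * pi * (gauss_density x c * h3 x c))"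
 unfolding eq Bochner_Integration.integral_add[OF int integrable_mult_right[OF int]] integral_mult_right_zero
 gaussian_line_integral_3[OF c s] unfolding power_0 mult_1 gaussian_line_integral_0[OF c] ..
 then show ?thesis by (simp add: algebra_simps)
 qed
qed

section \<open>Densities from integrable characteristic functions\<close>

lemma integrable_indicator_Icc: "integrable lborel (indicator {a..b} :: real => real)"
 by (rule integrable_real_indicator) (auto simp: emeasure_lborel_Icc_eq)

lemma iexp_interval_integral:
 assumes "a <= b" "t ~= 0"
 shows "(LINT x|lborel. indicator {a..b} x *\<^sub>R iexp (- (t * x))) = (iexp (- (t * a)) - iexp (- (t * b))) / (\<i> * t)"
proof -
 have "(LINT x|lborel. indicator {a..b} x *\<^sub>R iexp (- (t * x))) = \<i> / t * iexp (- (t * b)) - \<i> / t * iexp (- (t * a))"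
 proof (rule integral_FTC_atLeastAtMost[OF assms(1)])
 show "((%x. \<i> / t * iexp (- (t * x))) has_vector_derivative iexp (- (t * x))) (at x within {a..b})" for x
 proof -
 have "((%z. \<i> / t * exp (\<i> * - (t * z))) has_field_derivative exp (\<i> * - (t * of_real x))) (at (of_real x))"
 using assms(2) by (auto intro!: derivative_eq_intros)
 from has_vector_derivative_real_field[OF this] show ?thesis
 by (simp add: has_vector_derivative_at_within)
 qed
 show "continuous_on {a..b} (%x. iexp (- (t * x)))" by (intro continuous_intros)
 qed
 also have "... = (iexp (- (t * a)) - iexp (- (t * b))) / (\<i> * t)"
 using assms(2) by (simp add: field_simps)
 finally show ?thesis .
qed

text \<open>Levy's inversion gives a limit of truncated integrals. Integrability of the
  characteristic function turns it into an absolutely convergent integral; writing the kernel as an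
  integral over \<open>{a..b}\<close> and exchanging the order produces the density.\<close>

lemma (in real_distribution) interval_measure_eq:
 assumes int: "integrable lborel (char M)" and ab: "a <= b" and atoms: "measure M {a} = 0" "measure M {b} = 0"
 shows "complex_of_real (measure M {a<..b}) = (LINT x|lborel. indicator {a..b} x *\<^sub>R (1 / (2 * pi) * (LINT t|lborel. iexp (- (t * x)) * char M t)))"
proof -
 \<comment> \<open>At \<open>t = 0\<close> the quotient is 0 by convention instead of
   \<open>b - a\<close>; a single point does not matter to the integral.\<close>
 define K where "K t = (iexp (- (t * a)) - iexp (- (t * b))) / (\<i> * of_real t)" for t :: real
 have K_le: "norm (K t) <= b - a" for t
 proof (cases "t = 0")
 case False
 then show ?thesis
 using Levy_Inversion_aux2[of "- b" "- a" t] ab by (simp add: K_def)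
 qed (use ab in \<open>simp add: K_def\<close>)
 have [measurable]: "K : borel_measurable borel" unfolding K_def by measurable
 have intK: "integrable lborel (%t. K t * char M t)"
 by (rule integrable_dominated[OF integrable_scaleR_right[OF int, of "b - a"]])
 (use K_le ab in \<open>auto simp: norm_mult intro!: mult_right_mono\<close>)
 have "(%T::nat. CLBINT t=- real T..real T. K t * char M t) \<longlonglongrightarrow> (LINT t|lborel. K t * char M t)"
 proof -
 have "(%T::nat. \<integral>t. indicator {- real T<..<real T} t *\<^sub>R (K t * char M t) \<partial>lborel) \<longlonglongrightarrow> (LINT t|lborel. K t * char M t)"
 proof (rule integral_dominated_convergence[where w="%t. norm (K t * char M t)"])
 show "AE t in lborel. (%T::nat. indicator {- real T<..<real T} t *\<^sub>R (K t * char M t)) \<longlonglongrightarrow> K t * char M t"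
 proof (rule AE_I2)
 fix t :: real
 obtain N :: nat where N: "abs t < N" using reals_Archimedean2 by blast
 have "eventually (%T::nat. indicator {- real T<..<real T} t *\<^sub>R (K t * char M t) = K t * char M t) sequentially"
 using eventually_ge_at_top[of N] by eventually_elim (use N in \<open>auto simp: indicator_def abs_less_iff\<close>)
 then show "(%T::nat. indicator {- real T<..<real T} t *\<^sub>R (K t * char M t)) \<longlonglongrightarrow> K t * char M t"
 by (rule tendsto_eventually)
 qed
 qed (use intK in \<open>auto simp: indicator_def\<close>)
 then show ?thesis
 by (simp add: interval_lebesgue_integral_def set_lebesgue_integral_def)
 qed
 then have "(%T::nat. 1 / (2 * pi) * (CLBINT t=- real T..real T. K t * char M t)) \<longlonglongrightarrow> 1 / (2 * pi) * (LINT t|lborel. K t * char M t)"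
 by (intro tendsto_mult tendsto_const)
 moreover have "(%T::nat. 1 / (2 * pi) * (CLBINT t=- real T..real T. K t * char M t)) \<longlonglongrightarrow> measure M {a<..b}"
 unfolding K_def using Levy_Inversion[OF ab atoms] by simp
 ultimately have 1: "complex_of_real (measure M {a<..b}) = 1 / (2 * pi) * (LINT t|lborel. K t * char M t)"
 by (rule LIMSEQ_unique[rotated])
 have "(LINT t|lborel. K t * char M t) = (LINT t|lborel. (LINT x|lborel. indicator {a..b} x *\<^sub>R (iexp (- (t * x)) * char M t)))"
 proof (rule integral_cong_AE)
 show "AE t in lborel. K t * char M t = (LINT x|lborel. indicator {a..b} x *\<^sub>R (iexp (- (t * x)) * char M t))"
 using AE_lborel_singleton[of "0::real"]
 proof eventually_elim
 case (elim t)
 show ?case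
 unfolding K_def iexp_interval_integral[OF ab elim, symmetric] by (simp flip: integral_mult_left_zero)
 qed
 qed (use intK in auto)
 also have "... = (LINT x|lborel. (LINT t|lborel. indicator {a..b} x *\<^sub>R (iexp (- (t * x)) * char M t)))"
 proof (rule lborel_pair.Fubini_integral[symmetric])
 have "integrable (lborel \<Otimes>\<^sub>M lborel) (%(t, x). norm (char M t) * indicator {a..b} x :: real)"
 by (rule lborel_pair.Fubini_integrable) (use int in \<open>auto simp: abs_mult intro!: integrable_mult_right integrable_mult_left integrable_indicator_Icc\<close>)
 then show "integrable (lborel \<Otimes>\<^sub>M lborel) (%(t, x). indicator {a..b} x *\<^sub>R (iexp (- (t * x)) * char M t))"
 by (rule integrable_dominated) (auto simp: norm_mult mult.commute)
 qed
 finally have F: "(LINT t|lborel. K t * char M t) = (LINT x|lborel. indicator {a..b} x *\<^sub>R (LINT t|lborel. iexp (- (t * x)) * char M t))"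
 by (simp only: integral_scaleR_right)
 show ?thesis unfolding 1 F
 by (simp only: mult_scaleR_right[symmetric] integral_mult_right_zero)
qed

text \<open>The interval formula holds only for endpoints without mass. Atoms are countable, so such
  endpoints surround every point closely, and boundedness of \<open>q\<close> then excludes atoms
  altogether. A negative value of \<open>q\<close> would by continuity make some interval have
  negative mass.\<close>

lemma (in real_distribution) density_of_integrable_char:
 assumes int: "integrable lborel (char M)"
 defines "q \<equiv> %x. Re (1 / (2 * pi) * (LINT t|lborel. iexp (- (t * x)) * char M t))"
 shows "!!x. 0 <= q x" "q : borel_measurable borel" "M = density lborel (%x. ennreal (q x))"
proof -
 have intx: "integrable lborel (%t. iexp (- (t * x)) * char M t)" for x
 by (rule integrable_dominated[OF int]) (auto simp: norm_mult)
 define Q where "Q = 1 / (2 * pi) * (LINT t|lborel. norm (char M t)) + 1"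
 have Q: "0 < Q" by (auto simp: Q_def intro!: add_nonneg_pos)
 have q_le: "\<bar>q x\<bar> <= Q" for x
 proof -
 have "\<bar>q x\<bar> <= norm (1 / (2 * pi) * (LINT t|lborel. iexp (- (t * x)) * char M t))"
 unfolding q_def by (rule abs_Re_le_cmod)
 also have "... <= 1 / (2 * pi) * (LINT t|lborel. norm (iexp (- (t * x)) * char M t))"
 unfolding norm_mult[of "complex_of_real (1 / (2 * pi))"] by (intro mult_mono integral_norm_bound) (auto simp: norm_divide)
 finally show ?thesis by (simp add: norm_mult Q_def)
 qed
 have cont: "continuous_on UNIV q"
 proof -
 have "continuous_on UNIV (%x. \<integral>t. iexp (- (t * x)) * char M t \<partial>lborel)"
 proof (rule continuous_on_sequentiallyI)
 fix X and x :: real assume X: "X \<longlonglongrightarrow> x"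
 show "(%n. \<integral>t. iexp (- (t * X n)) * char M t \<partial>lborel) \<longlonglongrightarrow> (LINT t|lborel. iexp (- (t * x)) * char M t)"
 proof (rule integral_dominated_convergence[where w="%t. norm (char M t)"])
 show "AE t in lborel. (%n. iexp (- (t * X n)) * char M t) \<longlonglongrightarrow> iexp (- (t * x)) * char M t"
 by (intro AE_I2 tendsto_intros X)
 qed (use int in \<open>auto simp: norm_mult\<close>)
 qed
 then show ?thesis unfolding q_def by (intro continuous_intros)
 qed
 then show q_meas[measurable]: "q : borel_measurable borel" by (rule borel_measurable_continuous_onI)
 have meas: "measure M {a<..b} = (LINT x|lborel. indicator {a..b} x * q x)"
 if "a <= b" "measure M {a} = 0" "measure M {b} = 0" for a b
 proof -
 have *: "continuous_on {a..b} (%x. 1 / (2 * pi) * (LINT t|lborel. iexp (- (t * x)) * char M t))"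
 proof (intro continuous_intros continuous_on_sequentiallyI)
 fix X and x :: real assume X: "X \<longlonglongrightarrow> x"
 show "(%n. \<integral>t. iexp (- (t * X n)) * char M t \<partial>lborel) \<longlonglongrightarrow> (LINT t|lborel. iexp (- (t * x)) * char M t)"
 proof (rule integral_dominated_convergence[where w="%t. norm (char M t)"])
 show "AE t in lborel. (%n. iexp (- (t * X n)) * char M t) \<longlonglongrightarrow> iexp (- (t * x)) * char M t"
 by (intro AE_I2 tendsto_intros X)
 qed (use int in \<open>auto simp: norm_mult\<close>)
 qed
 have "integrable lborel (%x. indicator {a..b} x *\<^sub>R (1 / (2 * pi) * (LINT t|lborel. iexp (- (t * x)) * char M t)))"
 using borel_integrable_atLeastAtMost'[OF *] by (simp add: set_integrable_def)
 note I = this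
 have "measure M {a<..b} = Re (complex_of_real (measure M {a<..b}))" by simp
 also have "... = (LINT x|lborel. Re (indicator {a..b} x *\<^sub>R (1 / (2 * pi) * (LINT t|lborel. iexp (- (t * x)) * char M t))))"
 unfolding interval_measure_eq[OF int that] by (rule integral_Re[OF I, symmetric])
 also have "... = (LINT x|lborel. indicator {a..b} x * q x)"
 unfolding q_def scaleR_complex.simps ..
 finally show ?thesis .
 qed
 have intq: "integrable lborel (%x. indicator {a..b} x * q x)" for a b
 using borel_integrable_atLeastAtMost'[OF continuous_on_subset[OF cont, of "{a..b}"]] by (simp add: set_integrable_def)
 have meas_le: "measure M {a<..b} <= Q * (b - a)" if "a <= b" "measure M {a} = 0" "measure M {b} = 0" for a b
 proof -
 have "(LINT x|lborel. indicator {a..b} x * q x) <= (LINT x|lborel. Q * indicator {a..b} x)"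
 proof (rule integral_mono[OF intq])
 show "indicator {a..b} x * q x <= Q * indicator {a..b} x" for x
 using q_le[of x] by (auto simp: indicator_def)
 qed (auto intro!: integrable_mult_right integrable_indicator_Icc)
 then show ?thesis using meas[OF that] that(1) by simp
 qed
 have co: "countable {x. measure M {x} ~= 0}" by (rule countable_support)
 have ex: "\<exists>y. a < y & y < b & measure M {y} = 0" if "a < b" for a b
 using real_interval_avoid_countable_set[OF that co] by auto
 have no_atom: "measure M {x} = 0" for x
 proof (rule ccontr)
 assume "measure M {x} ~= 0"
 then have pos: "0 < measure M {x}" using measure_nonneg[of M "{x}"] by linarith
 \<comment> \<open>With this radius the intervals around \<open>x\<close> have at most half of the
   supposed mass of the atom.\<close>
 define e where "e = measure M {x} / (4 * Q)"
 have e: "0 < e" using pos Q by (simp add: e_def)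
 obtain a b where ab: "x - e < a" "a < x" "measure M {a} = 0" "x < b" "b < x + e" "measure M {b} = 0"
 using ex[of "x - e" x] ex[of x "x + e"] e by auto
 have "measure M {x} <= measure M {a<..b}" using ab by (intro finite_measure_mono) auto
 also have "... <= Q * (b - a)" using ab by (intro meas_le) auto
 also have "... <= Q * (2 * e)" using ab Q by (intro mult_left_mono) auto
 also have "... < measure M {x}" using Q pos by (simp add: e_def field_simps)
 finally show False by simp
 qed
 show nonneg: "0 <= q x" for x
 proof (rule ccontr)
 assume neg: "\<not> 0 <= q x"
 have "isCont q x" using cont by (simp add: continuous_on_eq_continuous_at)
 then have "eventually (%y. q y < q x / 2) (nhds x)"
 using neg by (intro order_tendstoD(2)[of q "q x"]) (auto simp: continuous_within tendsto_at_iff_tendsto_nhds)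
 then obtain d where d: "d > 0" "!!y. dist y x < d ==> q y < q x / 2"
 unfolding eventually_nhds_metric by auto
 have "0 <= measure M {x<..x + d / 2}" by simp
 also have "... = (LINT y|lborel. indicator {x..x + d / 2} y * q y)"
 using d by (intro meas no_atom) auto
 also have "... <= (LINT y|lborel. q x / 2 * indicator {x..x + d / 2} y)"
 proof (rule integral_mono[OF intq])
 show "indicator {x..x + d / 2} y * q y <= q x / 2 * indicator {x..x + d / 2} y" for y
 using d(1) d(2)[of y] by (auto simp: indicator_def dist_real_def)
 qed (auto intro!: integrable_mult_right integrable_indicator_Icc)
 also have "... = q x / 2 * (d / 2)" using d by simp
 also have "... < 0" using neg d by (simp add: mult_neg_pos)
 finally show False by simp
 qed
 show "M = density lborel (%x. ennreal (q x))"
 proof (rule measure_eqI_lessThan)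
 show "emeasure M {x<..} = emeasure (density lborel (%x. ennreal (q x))) {x<..}" for x
 proof -
 have U: "(\<Union>n::nat. {x<..x + real n}) = {x<..}"
 proof safe
 fix y assume "x < y"
 obtain n :: nat where "y - x < n" using reals_Archimedean2 by blast
 then show "y : (\<Union>n::nat. {x<..x + real n})" using \<open>x < y\<close> by (auto intro!: exI[of _ n])
 qed auto
 have inc: "incseq (%n::nat. {x<..x + real n})" by (auto simp: incseq_def)
 have eq: "emeasure M {x<..x + real n} = emeasure (density lborel (%x. ennreal (q x))) {x<..x + real n}" for n
 proof -
 have "emeasure (density lborel (%x. ennreal (q x))) {x<..x + real n} = (\<integral>\<^sup>+y. ennreal (q y) * indicator {x<..x + real n} y \<partial>lborel)"
 by (intro emeasure_density) auto
 also have "... = (\<integral>\<^sup>+y. ennreal (indicator {x..x + real n} y * q y) \<partial>lborel)"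
 by (intro nn_integral_cong_AE eventually_mono[OF AE_lborel_singleton[of x]]) (auto simp: indicator_def)
 also have "... = ennreal (LINT y|lborel. indicator {x..x + real n} y * q y)"
 by (intro nn_integral_eq_integral intq AE_I2) (auto simp: nonneg)
 also have "... = emeasure M {x<..x + real n}"
 by (subst meas[symmetric]) (auto simp: no_atom emeasure_eq_measure)
 finally show ?thesis by simp
 qed
 have "(%n::nat. emeasure M {x<..x + real n}) \<longlonglongrightarrow> emeasure M {x<..}"
 unfolding U[symmetric] by (rule Lim_emeasure_incseq[OF _ inc]) auto
 moreover have "(%n::nat. emeasure M {x<..x + real n}) \<longlonglongrightarrow> emeasure (density lborel (%x. ennreal (q x))) {x<..}"
 unfolding eq U[symmetric] by (rule Lim_emeasure_incseq[OF _ inc]) auto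
 ultimately show ?thesis by (rule LIMSEQ_unique)
 qed
 qed (auto simp: emeasure_eq_measure)
qed

text \<open>The measures to be inverted are exponential tilts of restrictions to an event and have
  arbitrary total mass. Normalising reduces them to distributions, and total mass zero is treated
  separately.\<close>

lemma density_of_integrable_transform:
 fixes \<nu> :: "real measure"
 assumes fin: "finite_measure \<nu>" and sets: "sets \<nu> = sets borel"
 and int: "integrable lborel (%t. \<integral>x. iexp (t * x) \<partial>\<nu>)"
 defines "q \<equiv> %x. Re (1 / (2 * pi) * (LINT t|lborel. iexp (- (t * x)) * (LINT y|\<nu>. iexp (t * y))))"
 shows "!!x. 0 <= q x" "q : borel_measurable borel" "\<nu> = density lborel (%x. ennreal (q x))"
proof -
 interpret finite_measure \<nu> by (rule fin)
 have space: "space \<nu> = UNIV" using sets_eq_imp_space_eq[OF sets] by simp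
 have "(\<forall>x. 0 <= q x) & q : borel_measurable borel & \<nu> = density lborel (%x. ennreal (q x))"
 proof (cases "measure \<nu> UNIV = 0")
 case True
 then have "emeasure \<nu> (space \<nu>) = 0" by (simp add: space emeasure_eq_measure)
 then have null: "\<nu> = null_measure borel" using sets
 by (intro measure_eqI) (auto simp: emeasure_eq_measure space intro: antisym[OF order_trans[OF finite_measure_mono]])
 have "q = (%_. 0)" unfolding q_def null by (simp add: integral_null_measure)
 moreover have "density lborel (%x::real. ennreal 0) = null_measure borel"
 by (intro measure_eqI) (auto simp: emeasure_density)
 ultimately show ?thesis using null by auto
 next
 case False
 define m where "m = measure \<nu> UNIV"
 have m: "0 < m" using False measure_nonneg[of \<nu> UNIV] unfolding m_def by linarith
 define N where "N = density \<nu> (%_. ennreal (1 / m))"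
 have "emeasure N (space N) = 1"
 using m by (simp add: N_def emeasure_density space emeasure_eq_measure m_def[symmetric] sets ennreal_mult'[symmetric] space_density nn_integral_cmult)
 then interpret N: real_distribution N
 by (intro real_distribution.intro real_distribution_axioms.intro prob_spaceI) (auto simp: N_def sets space)
 have char: "char N t = of_real (1 / m) * (LINT x|\<nu>. iexp (t * x))" for t
 unfolding char_def N_def using m
 by (subst integral_density) (auto simp: scaleR_conv_of_real cong: measurable_cong_sets[OF sets refl])
 have "char N = (%t. of_real (1 / m) * (LINT x|\<nu>. iexp (t * x)))" by (rule ext) (rule char)
 then have "integrable lborel (char N)" using int by (simp del: of_real_divide)
 note dens = N.density_of_integrable_char[OF this]
 define q' where "q' x = Re (1 / (2 * pi) * (LINT t|lborel. iexp (- (t * x)) * char N t))" for x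
 note dens = dens[folded q'_def]
 have q: "q x = m * q' x" for x
 proof -
 have "(LINT t|lborel. iexp (- (t * x)) * char N t) = of_real (1 / m) * (LINT t|lborel. iexp (- (t * x)) * (LINT y|\<nu>. iexp (t * y)))"
 unfolding char integral_mult_right_zero[symmetric] by (simp add: mult_ac)
 then have "q' x = Re (of_real (1 / m) * (1 / (2 * pi) * (LINT t|lborel. iexp (- (t * x)) * (LINT y|\<nu>. iexp (t * y)))))"
 unfolding q'_def by (simp only: mult_ac)
 also have "... = 1 / m * q x" unfolding q_def Re_complex_of_real[symmetric] by (simp del: of_real_divide)
 finally show ?thesis using m by simp
 qed
 have "\<nu> = density N (%_. ennreal m)"
 unfolding N_def using m by (subst density_density_eq) (auto simp: ennreal_mult'[symmetric] density_1)
 also have "... = density lborel (%x. ennreal (q' x) * ennreal m)"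
 using dens(2) by (subst dens(3), subst density_density_eq) auto
 also have "... = density lborel (%x. ennreal (q x))"
 using m dens(1) by (simp add: q ennreal_mult'[symmetric] mult.commute)
 finally have "\<nu> = density lborel (%x. ennreal (q x))" .
 moreover have "q = (%x. m * q' x)" by (rule ext) (rule q)
 ultimately show ?thesis using dens(1,2) m by auto
 qed
 then show "!!x. 0 <= q x" "q : borel_measurable borel" "\<nu> = density lborel (%x. ennreal (q x))" by auto
qed

section \<open>Exponential tilting and pointwise comparison of densities\<close>

lemma integrable_inverse_1_plus_square: "integrable lborel (%u::real. 1 / (1 + u^2))"
proof -
 have "set_integrable lborel (einterval (-\<infinity>) \<infinity>) (%u::real. 1 / (1 + u^2))"
 proof (rule interval_integral_FTC_nonneg(1)[where F=arctan and A="- pi / 2" and B="pi / 2"])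
 show "DERIV arctan x :> 1 / (1 + x^2)" for x
 using DERIV_arctan[of x] by (simp add: inverse_eq_divide)
 show "isCont (%u::real. 1 / (1 + u^2)) x" for x
 by (intro continuous_intros) (auto simp: add_nonneg_eq_0_iff)
 show "((arctan \<circ> real_of_ereal) \<longlongrightarrow> - pi / 2) (at_right (- \<infinity>))"
 using tendsto_arctan_at_bot by (simp add: ereal_tendsto_simps)
 show "((arctan \<circ> real_of_ereal) \<longlongrightarrow> pi / 2) (at_left \<infinity>)"
 using tendsto_arctan_at_top by (simp add: ereal_tendsto_simps)
 qed auto
 then show ?thesis by (simp add: set_integrable_def)
qed

text \<open>\<open>p_star\<close> is this function at \<open>ka = \<beta> powr (1 / 2) * l\<close>,
  see \<open>p_star_edgeworth\<close>.\<close>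

definition ew_density :: "real => real => real => real" where
 "ew_density c ka x = gauss_density x c * (1 + ka / 6 * h3 x c)"

text \<open>Tilting by \<open>exp (s * z)\<close> moves the Laplace transform on the line with real
  part \<open>s\<close> to the characteristic function of the tilted measure. The hypothesis
  \<open>D\<close> makes that function integrable and bounds the difference after inversion; undoing
  the tilt yields the factor \<open>exp (- s * x)\<close>.\<close>

lemma tilted_density:
 fixes \<nu> :: "real measure"
 assumes fin: "finite_measure \<nu>" and sets: "sets \<nu> = sets borel" and c: "0 < c"
 and s: "abs s <= 1" and int: "integrable \<nu> (%z. exp (s * z))"
 and D: "!!u. norm ((LINT z|\<nu>. exp (Complex s u * of_real z)) - edgeworth_mgf c ka (Complex s u)) <= dl / (1 + u^2)"
 obtains r where "r : borel_measurable borel" "!!x. 0 <= r x" "\<nu> = density lborel (%x. ennreal (r x))"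
 "!!x. \<bar>r x - ew_density c ka x\<bar> <= dl * (LINT u|lborel. 1 / (1 + u^2)) / (2 * pi) * exp (- s * x)"
proof -
 interpret finite_measure \<nu> by (rule fin)
 have space: "space \<nu> = UNIV" using sets_eq_imp_space_eq[OF sets] by simp
 have [measurable_cong]: "sets \<nu> = sets borel" by (rule sets)
 define \<nu>s where "\<nu>s = density \<nu> (%z. ennreal (exp (s * z)))"
 have fin_s: "finite_measure \<nu>s"
 proof (rule finite_measureI)
 have "emeasure \<nu>s (space \<nu>s) = (\<integral>\<^sup>+z. ennreal (exp (s * z)) \<partial>\<nu>)"
 by (simp add: \<nu>s_def emeasure_density)
 also have "... = ennreal (LINT z|\<nu>. exp (s * z))" using int by (intro nn_integral_eq_integral) auto
 finally show "emeasure \<nu>s (space \<nu>s) ~= \<infinity>" by simp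
 qed
 have sets_s[measurable_cong]: "sets \<nu>s = sets borel" by (simp add: \<nu>s_def sets)
 interpret s: finite_measure \<nu>s by (rule fin_s)
 have tr: "(LINT z|\<nu>s. iexp (u * z)) = (LINT z|\<nu>. exp (Complex s u * of_real z))" for u
 proof -
 have "(LINT z|\<nu>s. iexp (u * z)) = (LINT z|\<nu>. exp (s * z) *\<^sub>R iexp (u * z))"
 unfolding \<nu>s_def by (subst integral_density) auto
 also have "(%z. exp (s * z) *\<^sub>R iexp (u * z)) = (%z. exp (Complex s u * of_real z))"
 unfolding Complex_eq by (rule ext) (simp add: scaleR_conv_of_real distrib_right exp_add mult.assoc flip: exp_of_real)
 finally show ?thesis .
 qed
 let ?h = "%u. \<integral>z. iexp (u * z) \<partial>\<nu>s"
 have cont: "continuous_on UNIV ?h"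
 proof (rule continuous_on_sequentiallyI)
 fix X and x :: real assume X: "X \<longlonglongrightarrow> x"
 show "(%n. ?h (X n)) \<longlonglongrightarrow> ?h x"
 proof (rule integral_dominated_convergence[where w="%z. 1"])
 show "AE z in \<nu>s. (%n. iexp (X n * z)) \<longlonglongrightarrow> iexp (x * z)"
 by (intro AE_I2 tendsto_intros X)
 qed auto
 qed
 have [measurable]: "?h : borel_measurable borel" by (rule borel_measurable_continuous_onI[OF cont])
 note line = edgeworth_inversion[OF c s, of _ ka]
 have int_e: "integrable lborel (%u. edgeworth_mgf c ka (Complex s u))"
 using line(1)[of 0] by simp
 have dl: "0 <= dl" using order_trans[OF norm_ge_zero D[of 0]] by simp
 have int_D: "integrable lborel (%u. ?h u - edgeworth_mgf c ka (Complex s u))"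
 proof (rule integrable_dominated[OF integrable_mult_right[OF integrable_inverse_1_plus_square, of dl]])
 show "AE u in lborel. norm (?h u - edgeworth_mgf c ka (Complex s u)) <= norm (dl * (1 / (1 + u^2)))"
 using D dl unfolding tr by (intro AE_I2) simp
 qed (use borel_measurable_integrable[OF int_e] in auto)
 have int_h: "integrable lborel ?h"
 using Bochner_Integration.integrable_add[OF int_D int_e] by simp
 define q where "q x = Re (1 / (2 * pi) * (LINT t|lborel. iexp (- (t * x)) * ?h t))" for x
 note dens = density_of_integrable_transform[OF fin_s sets_s int_h, folded q_def]
 note [measurable] = dens(2)
 define r where "r x = exp (- s * x) * q x" for x
 have diff: "\<bar>q x - exp (s * x) * ew_density c ka x\<bar> <= dl * (LINT u|lborel. 1 / (1 + u^2)) / (2 * pi)" for x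
 proof -
 have i1: "integrable lborel (%t. iexp (- (t * x)) * ?h t)"
 by (rule integrable_dominated[OF int_h]) (auto simp: norm_mult)
 have i2: "integrable lborel (%t. iexp (- (t * x)) * edgeworth_mgf c ka (Complex s t))"
 by (rule integrable_dominated[OF int_e]) (use borel_measurable_integrable[OF int_e] in \<open>auto simp: norm_mult\<close>)
 have "(%t. iexp (- (t * x)) * edgeworth_mgf c ka (Complex s t))
 = (%t. of_real (exp (s * x)) * (exp (- of_real x * Complex s t) * edgeworth_mgf c ka (Complex s t)))"
 unfolding Complex_eq mult.assoc[symmetric] exp_of_real[symmetric] exp_add[symmetric] by (simp add: algebra_simps)
 then have "(LINT t|lborel. iexp (- (t * x)) * edgeworth_mgf c ka (Complex s t))
 = of_real (exp (s * x)) * of_real (2 * pi * (gauss_density x c * (1 + ka / 6 * h3 x c)))"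
 unfolding line(2)[symmetric] by simp
 then have e: "of_real (exp (s * x) * ew_density c ka x) = 1 / (2 * pi) * (LINT t|lborel. iexp (- (t * x)) * edgeworth_mgf c ka (Complex s t))"
 by (simp add: ew_density_def)
 have "q x - exp (s * x) * ew_density c ka x
 = Re (1 / (2 * pi) * (LINT t|lborel. iexp (- (t * x)) * ?h t) - of_real (exp (s * x) * ew_density c ka x))"
 by (simp add: q_def)
 also have "1 / (2 * pi) * (LINT t|lborel. iexp (- (t * x)) * ?h t) - of_real (exp (s * x) * ew_density c ka x)
 = 1 / (2 * pi) * (LINT t|lborel. iexp (- (t * x)) * (?h t - edgeworth_mgf c ka (Complex s t)))"
 unfolding e right_diff_distrib[symmetric] lintegral_diff[OF i1 i2, symmetric] ..
 finally have "\<bar>q x - exp (s * x) * ew_density c ka x\<bar>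
 <= norm (1 / (2 * pi) * (LINT t|lborel. iexp (- (t * x)) * (?h t - edgeworth_mgf c ka (Complex s t))))"
 by (simp only: abs_Re_le_cmod)
 also have "... = 1 / (2 * pi) * norm (LINT t|lborel. iexp (- (t * x)) * (?h t - edgeworth_mgf c ka (Complex s t)))"
 unfolding norm_mult[of "complex_of_real (1 / (2 * pi))"] norm_of_real by simp
 also have "... <= 1 / (2 * pi) * (LINT t|lborel. dl * (1 / (1 + t^2)))"
 proof (intro mult_left_mono Bochner_Integration.integral_norm_bound_integral)
 show "integrable lborel (%t. iexp (- (t * x)) * (?h t - edgeworth_mgf c ka (Complex s t)))"
 using Bochner_Integration.integrable_diff[OF i1 i2] by (simp add: right_diff_distrib)
 show "integrable lborel (%t. dl * (1 / (1 + t^2)))"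
 by (intro integrable_mult_right integrable_inverse_1_plus_square)
 show "norm (iexp (- (t * x)) * (?h t - edgeworth_mgf c ka (Complex s t))) <= dl * (1 / (1 + t^2))" for t
 using D[of t] unfolding norm_mult tr by simp
 qed auto
 also have "... = dl * (LINT u|lborel. 1 / (1 + u^2)) / (2 * pi)"
 unfolding integral_mult_right_zero by simp
 finally show ?thesis .
 qed
 show thesis
 proof
 show "r : borel_measurable borel" unfolding r_def by measurable
 show "0 <= r x" for x using dens(1) by (simp add: r_def)
 have "\<nu> = density \<nu>s (%z. ennreal (exp (- s * z)))"
 unfolding \<nu>s_def by (subst density_density_eq) (auto simp: ennreal_mult'[symmetric] density_1 simp flip: exp_add)
 also have "... = density lborel (%x. ennreal (q x) * ennreal (exp (- s * x)))"
 by (subst dens(3), subst density_density_eq) auto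
 also have "... = density lborel (%x. ennreal (r x))"
 by (simp add: r_def ennreal_mult'[symmetric] dens(1) mult.commute)
 finally show "\<nu> = density lborel (%x. ennreal (r x))" .
 show "\<bar>r x - ew_density c ka x\<bar> <= dl * (LINT u|lborel. 1 / (1 + u^2)) / (2 * pi) * exp (- s * x)" for x
 proof -
 have "r x - ew_density c ka x = exp (- s * x) * (q x - exp (s * x) * ew_density c ka x)"
 by (simp add: r_def right_diff_distrib exp_minus)
 then have "\<bar>r x - ew_density c ka x\<bar> = exp (- s * x) * \<bar>q x - exp (s * x) * ew_density c ka x\<bar>"
 by (simp only: abs_mult abs_exp_cancel)
 then show ?thesis
 using mult_left_mono[OF diff[of x], of "exp (- s * x)"] by (simp add: mult.commute)
 qed
 qed
qed

text \<open>The densities found from the tilts 1 and -1 agree almost everywhere, so at almost every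
  point the better of the bounds \<open>exp (- x)\<close> and \<open>exp x\<close> is
  available.\<close>

lemma edgeworth_comparison:
 fixes \<nu> :: "real measure" and f :: "real => real"
 assumes fin: "finite_measure \<nu>" and sets: "sets \<nu> = sets borel" and c: "0 < c"
 and int: "!!s. \<bar>s\<bar> <= 1 ==> integrable \<nu> (%z. exp (s * z))"
 and D: "!!s u. \<bar>s\<bar> <= 1 ==> norm ((LINT z|\<nu>. exp (Complex s u * of_real z)) - edgeworth_mgf c ka (Complex s u)) <= dl / (1 + u^2)"
 and f: "f : borel_measurable borel" "integrable lborel (%x. \<bar>f x\<bar> * exp (- abs x))"
 and fp: "integrable lborel (%x. f x * ew_density c ka x)"
 shows "\<bar>(LINT x|\<nu>. f x) - (LINT x|lborel. f x * ew_density c ka x)\<bar>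
 <= dl * (LINT u|lborel. 1 / (1 + u^2)) / (2 * pi) * (LINT x|lborel. \<bar>f x\<bar> * exp (- abs x))"
proof -
 define B where "B = dl * (LINT u|lborel. 1 / (1 + u^2)) / (2 * pi)"
 let ?p = "ew_density c ka"
 obtain r where r: "r : borel_measurable borel" "!!x. 0 <= r x" "\<nu> = density lborel (%x. ennreal (r x))"
 "!!x. \<bar>r x - ?p x\<bar> <= B * exp (- 1 * x)"
 using tilted_density[OF fin sets c _ int D, of 1] unfolding B_def by auto
 obtain r' where r': "r' : borel_measurable borel" "!!x. 0 <= r' x" "\<nu> = density lborel (%x. ennreal (r' x))"
 "!!x. \<bar>r' x - ?p x\<bar> <= B * exp (- (-1) * x)"
 using tilted_density[OF fin sets c _ int D, of "-1"] unfolding B_def by auto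
 have "AE x in lborel. ennreal (r x) = ennreal (r' x)"
 by (rule sigma_finite_measure.density_unique[OF sigma_finite_lborel])
 (use r r' in \<open>auto simp flip: r(3)\<close>)
 then have bound: "AE x in lborel. \<bar>r x - ?p x\<bar> <= B * exp (- abs x)"
 proof eventually_elim
 case (elim x)
 then have "r x = r' x" using r(2) r'(2) by (simp add: ennreal_inj)
 then show ?case using r(4)[of x] r'(4)[of x] by (cases "0 <= x") auto
 qed
 then have bound': "AE x in lborel. norm (f x * (r x - ?p x)) <= B * (\<bar>f x\<bar> * exp (- abs x))"
 proof eventually_elim
 case (elim x)
 then show ?case using mult_left_mono[OF elim, of "\<bar>f x\<bar>"] by (simp add: abs_mult mult_ac)
 qed
 note [measurable] = f(1) r(1)
 have [measurable]: "?p : borel_measurable borel"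
 unfolding ew_density_def gauss_density_def h3_def by measurable
 have i: "integrable lborel (%x. f x * (r x - ?p x))"
 by (rule integrable_dominated[OF integrable_mult_right[OF f(2), of B]])
 (use bound' in \<open>auto elim!: eventually_mono\<close>)
 have "(LINT x|\<nu>. f x) = (LINT x|lborel. r x * f x)"
 unfolding r(3) by (subst integral_density) (auto simp: r(2))
 also have "... = (LINT x|lborel. f x * (r x - ?p x) + f x * ?p x)"
 by (simp add: algebra_simps)
 also have "... = (LINT x|lborel. f x * (r x - ?p x)) + (LINT x|lborel. f x * ?p x)"
 by (rule Bochner_Integration.integral_add[OF i fp])
 finally have "\<bar>(LINT x|\<nu>. f x) - (LINT x|lborel. f x * ?p x)\<bar> = norm (LINT x|lborel. f x * (r x - ?p x))" by simp
 also have "... <= (LINT x|lborel. norm (f x * (r x - ?p x)))" by (rule integral_norm_bound)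
 also have "... <= (LINT x|lborel. B * (\<bar>f x\<bar> * exp (- abs x)))"
 by (rule integral_mono_AE[OF _ _ bound']) (intro integrable_norm i integrable_mult_right f(2))+
 finally show ?thesis unfolding integral_mult_right_zero B_def .
qed

section \<open>Spectral theorem and diagonalisation of quadratic forms\<close>

text \<open>Vectors and matrices are plain functions read on a finite index set: the dimension
  varies with the sampling scheme and so cannot be a type.\<close>

definition ip :: "'i set => ('i => real) => ('i => real) => real" where
 "ip I x y = (SUM i:I. x i * y i)"

definition mv :: "'i set => ('i => 'i => real) => ('i => real) => 'i => real" where
 "mv I A x i = (SUM l:I. A i l * x l)"

lemma ip_commute: "ip I x y = ip I y x"
 by (simp add: ip_def mult.commute)

lemma ip_add_left: "ip I (%i. x i + y i) z = ip I x z + ip I y z"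
 by (simp add: ip_def distrib_right sum.distrib)

lemma ip_diff_left: "ip I (%i. x i - y i) z = ip I x z - ip I y z"
 by (simp add: ip_def left_diff_distrib sum_subtractf)

lemma ip_scale_left: "ip I (%i. t * x i) z = t * ip I x z"
 by (simp add: ip_def sum_distrib_left mult.assoc)

lemma ip_scale_right: "ip I z (%i. t * x i) = t * ip I z x"
 by (simp add: ip_def sum_distrib_left mult_ac)

lemma ip_add_right: "ip I z (%i. x i + y i) = ip I z x + ip I z y"
 by (simp add: ip_def distrib_left sum.distrib)

lemma ip_diff_right: "ip I z (%i. x i - y i) = ip I z x - ip I z y"
 by (simp add: ip_def right_diff_distrib sum_subtractf)

lemma ip_sum_left: "ip I (%i. SUM k:K. x k i) z = (SUM k:K. ip I (x k) z)"
 unfolding ip_def sum_distrib_right by (rule sum.swap)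

lemma ip_sum_right: "ip I z (%i. SUM k:K. x k i) = (SUM k:K. ip I z (x k))"
 unfolding ip_def sum_distrib_left by (rule sum.swap)

lemma ip_cong: "(!!i. i : I ==> x i = x' i) ==> (!!i. i : I ==> y i = y' i) ==> ip I x y = ip I x' y'"
 by (simp add: ip_def)

lemma ip_self_nonneg: "0 <= ip I x x"
 by (simp add: ip_def sum_nonneg)

lemma ip_self_eq_0: "finite I ==> ip I x x = 0 \<longleftrightarrow> (\<forall>i\<in>I. x i = 0)"
 by (simp add: ip_def sum_nonneg_eq_0_iff)

lemma mv_add: "mv I A (%i. x i + y i) = (%i. mv I A x i + mv I A y i)"
 by (rule ext) (simp add: mv_def distrib_left sum.distrib)

lemma mv_scale: "mv I A (%i. t * x i) = (%i. t * mv I A x i)"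
 by (rule ext) (simp add: mv_def sum_distrib_left mult_ac)

lemma mv_sum: "mv I A (%i. SUM k:K. x k i) = (%i. SUM k:K. mv I A (x k) i)"
 unfolding mv_def sum_distrib_left by (rule ext) (rule sum.swap)

lemma mv_cong: "(!!i. i : I ==> x i = x' i) ==> mv I A x = mv I A x'"
 by (rule ext) (simp add: mv_def)

lemma ip_mv_sym:
 assumes "!!i l. i : I ==> l : I ==> A i l = A l i"
 shows "ip I (mv I A x) y = ip I x (mv I A y)"
proof -
 have "ip I (mv I A x) y = (SUM i:I. SUM l:I. A i l * x l * y i)"
 by (simp add: ip_def mv_def sum_distrib_right)
 also have "... = (SUM l:I. SUM i:I. A i l * x l * y i)" by (rule sum.swap)
 also have "... = ip I x (mv I A y)"
 unfolding ip_def mv_def sum_distrib_left by (intro sum.cong refl) (simp add: assms mult_ac)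
 finally show ?thesis .
qed

text \<open>The unit vectors orthogonal to the given ones form a closed subset of a compact cube in
  the product topology over \<open>I\<close>. The form attains its maximum there, and homogeneity
  extends the inequality to all vectors.\<close>

lemma rayleigh_maximizer:
 fixes u :: "nat => 'i => real"
 assumes I: "finite I" and ex: "ip I v v = 1" "!!j. j < k ==> ip I v (u j) = 0"
 shows "\<exists>x. ip I x x = 1 & (\<forall>j<k. ip I x (u j) = 0) &
 (\<forall>y. (\<forall>j<k. ip I y (u j) = 0) --> ip I y (mv I A y) <= ip I x (mv I A x) * ip I y y)"
proof -
 define X where "X = product_topology (%_::'i. euclideanreal) I"
 define S where "S = {x : PiE I (%_. {-1..1}). ip I x x = 1 & (\<forall>j<k. ip I x (u j) = 0)}"
 have topX: "topspace X = PiE I (%_. UNIV)" by (simp add: X_def)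
 have proj: "continuous_map X euclideanreal (%x. x i)" if "i : I" for i
 unfolding X_def using that by (rule continuous_map_product_projection)
 have cont_ip: "continuous_map X euclideanreal (%x. ip I x v)" for v
 unfolding ip_def by (intro continuous_map_sum continuous_map_real_mult continuous_map_canonical_const I proj)
 have cont_q: "continuous_map X euclideanreal (%x. ip I x (mv I A x))"
 unfolding ip_def mv_def by (intro continuous_map_sum continuous_map_real_mult continuous_map_canonical_const I proj)
 have cont_n: "continuous_map X euclideanreal (%x. ip I x x)"
 unfolding ip_def by (intro continuous_map_sum continuous_map_real_mult continuous_map_canonical_const I proj)
 have "closedin X {x : topspace X. ip I x x : {1} }"
 by (rule closedin_continuous_map_preimage[OF cont_n]) simp
 moreover have "closedin X (\<Inter>j\<in>{..<k}. {x : topspace X. ip I x (u j) : {0} })" if "0 < k"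
 using that by (intro closedin_INT closedin_continuous_map_preimage[OF cont_ip]) auto
 \<comment> \<open>For \<open>k = 0\<close> the intersection over an empty family is replaced by the
   whole space.\<close>
 ultimately have "closedin X ({x : topspace X. ip I x x : {1} } \<inter> (if 0 < k then (\<Inter>j\<in>{..<k}. {x : topspace X. ip I x (u j) : {0} }) else topspace X))"
 by (intro closedin_Int) auto
 moreover have "compactin X (PiE I (%_. {-1..1}))"
 unfolding X_def by (simp add: compactin_PiE)
 ultimately have "compactin X (PiE I (%_. {-1..1}) \<inter> ({x : topspace X. ip I x x : {1} } \<inter> (if 0 < k then (\<Inter>j\<in>{..<k}. {x : topspace X. ip I x (u j) : {0} }) else topspace X)))"
 by (intro compact_Int_closedin)
 also have "PiE I (%_. {-1..1}) \<inter> ({x : topspace X. ip I x x : {1} } \<inter> (if 0 < k then (\<Inter>j\<in>{..<k}. {x : topspace X. ip I x (u j) : {0} }) else topspace X)) = S"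
 unfolding S_def topX by (auto simp: PiE_iff extensional_def)
 finally have "compactin X S" .
 from image_compactin[OF this cont_q] have comp: "compact ((%x. ip I x (mv I A x)) ` S)" by simp
 have restr: "restrict y I : S" "ip I (restrict y I) (mv I A (restrict y I)) = ip I y (mv I A y)"
 if y: "ip I y y = 1" "!!j. j < k ==> ip I y (u j) = 0" for y
 proof -
 have eq: "ip I (restrict y I) v = ip I y v" for v by (rule ip_cong) auto
 have eq2: "mv I A (restrict y I) = mv I A y" by (rule mv_cong) auto
 have "\<bar>y i\<bar> <= 1" if "i : I" for i
 proof -
 have "(y i)\<^sup>2 <= ip I y y"
 unfolding ip_def power2_eq_square using I that by (intro member_le_sum[of i I "%i. y i * y i"]) auto
 then show ?thesis by (simp add: y abs_square_le_1)
 qed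
 then have "restrict y I : PiE I (%_. {-1..1})" by (auto simp: abs_le_iff)
 moreover have "ip I (restrict y I) (restrict y I) = 1"
 unfolding y(1)[symmetric] by (rule ip_cong) auto
 ultimately show "restrict y I : S" using y(2) by (simp add: S_def eq)
 show "ip I (restrict y I) (mv I A (restrict y I)) = ip I y (mv I A y)" unfolding eq eq2 ..
 qed
 have "(%x. ip I x (mv I A x)) ` S ~= {}" using restr(1)[OF ex] by auto
 from compact_attains_sup[OF comp this] obtain x where x: "x : S"
 "!!y. y : S ==> ip I y (mv I A y) <= ip I x (mv I A x)" by auto
 show ?thesis
 proof (intro exI conjI allI impI)
 show "ip I x x = 1" "!!j. j < k ==> ip I x (u j) = 0" using x(1) by (auto simp: S_def)
 fix y assume "\<forall>j<k. ip I y (u j) = 0"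
 then have y: "!!j. j < k ==> ip I y (u j) = 0" by simp
 show "ip I y (mv I A y) <= ip I x (mv I A x) * ip I y y"
 proof (cases "ip I y y = 0")
 case True
 then have "\<forall>i\<in>I. y i = 0" by (simp add: ip_self_eq_0 I)
 then have "ip I y (mv I A y) = 0" by (simp add: ip_def)
 then show ?thesis using True by simp
 next
 case False
 then have pos: "0 < ip I y y" using ip_self_nonneg[of I y] by linarith
 define t where "t = 1 / sqrt (ip I y y)"
 have t2: "t * t * ip I y y = 1" using pos by (simp add: t_def)
 have n1: "ip I (%i. t * y i) (%i. t * y i) = 1"
 using t2 by (simp add: ip_scale_left ip_scale_right)
 have n2: "ip I (%i. t * y i) (u j) = 0" if "j < k" for j
 using y[OF that] by (simp add: ip_scale_left)
 have "ip I (%i. t * y i) (mv I A (%i. t * y i)) <= ip I x (mv I A x)"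
 using x(2)[OF restr(1)[OF n1 n2]] restr(2)[OF n1 n2] by (simp only:)
 then have "t * t * ip I y (mv I A y) <= ip I x (mv I A x)"
 by (simp add: mv_scale ip_scale_left ip_scale_right)
 then have "ip I y y * (t * t * ip I y (mv I A y)) <= ip I y y * ip I x (mv I A x)"
 using pos by (intro mult_left_mono) auto
 moreover have "ip I y y * (t * t * Q) = (t * t * ip I y y) * Q" for Q by (simp only: mult_ac)
 ultimately show ?thesis unfolding t2 by (simp add: mult.commute)
 qed
 qed
qed

lemma quadratic_perturbation_zero:
 fixes b C :: real
 assumes "!!t. 2 * t * b <= t^2 * C"
 shows "b = 0"
proof (rule ccontr)
 assume b: "b ~= 0"
 define K where "K = abs C + 1"
 have K: "0 < K" "C < K" by (auto simp: K_def)
 \<comment> \<open>At \<open>t = b / K\<close> the linear term is twice the bound on the quadratic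
   one.\<close>
 have "2 * (b / K) * b <= (b / K)\<^sup>2 * C" by (rule assms)
 also have "... <= (b / K)\<^sup>2 * K" using K by (intro mult_left_mono) auto
 also have "... = (b / K) * b" using K by (simp add: power2_eq_square)
 finally have "(b / K) * b <= 0" by simp
 moreover have "0 < (b / K) * b" using b K by (simp add: zero_less_divide_iff flip: power2_eq_square)
 ultimately show False by simp
qed

text \<open>The first variation at the maximizer says that \<open>z = mv I A x - r * x\<close> is
  orthogonal to the complement of the vectors \<open>u j\<close>. By symmetry of \<open>A\<close>
  the vector \<open>z\<close> also lies in that complement, so it vanishes.\<close>

lemma rayleigh_eigenvector:
 fixes u :: "nat => 'i => real"
 assumes I: "finite I" and sym: "!!i l. i : I ==> l : I ==> A i l = A l i"
 and eig: "!!j i. j < k ==> i : I ==> mv I A (u j) i = a j * u j i"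
 and ex: "ip I v v = 1" "!!j. j < k ==> ip I v (u j) = 0"
 shows "\<exists>x r. ip I x x = 1 & (\<forall>j<k. ip I x (u j) = 0) & (\<forall>i\<in>I. mv I A x i = r * x i)"
proof -
 obtain x where x0: "ip I x x = 1 & (\<forall>j<k. ip I x (u j) = 0) &
 (\<forall>y. (\<forall>j<k. ip I y (u j) = 0) --> ip I y (mv I A y) <= ip I x (mv I A x) * ip I y y)"
 using rayleigh_maximizer[where A=A, OF I ex] by (rule exE)
 have x: "ip I x x = 1" "!!j. j < k ==> ip I x (u j) = 0"
 "!!y. \<forall>j<k. ip I y (u j) = 0 ==> ip I y (mv I A y) <= ip I x (mv I A x) * ip I y y"
 using x0 by (simp, simp, blast)
 define r where "r = ip I x (mv I A x)"
 have crit: "ip I (mv I A x) y = r * ip I x y" if y: "!!j. j < k ==> ip I y (u j) = 0" for y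
 proof -
 have "2 * t * (ip I (mv I A x) y - r * ip I x y) <= t^2 * (r * ip I y y - ip I y (mv I A y))" for t
 proof -
 have "\<forall>j<k. ip I (%i. x i + t * y i) (u j) = 0"
 using x(2) y by (simp add: ip_add_left ip_scale_left)
 from x(3)[OF this]
 have le: "ip I (%i. x i + t * y i) (mv I A (%i. x i + t * y i)) <= r * ip I (%i. x i + t * y i) (%i. x i + t * y i)"
 by (simp only: r_def)
 have e1: "ip I (%i. x i + t * y i) (mv I A (%i. x i + t * y i))
 = r + t * ip I x (mv I A y) + (t * ip I y (mv I A x) + t * (t * ip I y (mv I A y)))"
 unfolding mv_add mv_scale ip_add_left ip_add_right ip_scale_left ip_scale_right r_def by (simp only: distrib_left add_ac)
 have e2: "ip I (%i. x i + t * y i) (%i. x i + t * y i) = 1 + t * ip I x y + (t * ip I y x + t * (t * ip I y y))"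
 unfolding ip_add_left ip_add_right ip_scale_left ip_scale_right x(1) by (simp only: distrib_left add_ac)
 have "ip I (mv I A x) y = ip I x (mv I A y)" by (rule ip_mv_sym) (rule sym)
 then have e3: "ip I x (mv I A y) = ip I (mv I A x) y" "ip I y (mv I A x) = ip I (mv I A x) y" "ip I y x = ip I x y"
 by (simp, intro ip_commute, intro ip_commute)
 show ?thesis
 using le unfolding e1 e2 e3 by (simp add: power2_eq_square algebra_simps)
 qed
 from quadratic_perturbation_zero[OF this] show ?thesis by simp
 qed
 define z where "z i = mv I A x i - r * x i" for i
 have zu: "ip I z (u j) = 0" if "j < k" for j
 proof -
 have "ip I (mv I A x) (u j) = ip I x (mv I A (u j))" by (rule ip_mv_sym) (rule sym)
 also have "... = ip I x (%i. a j * u j i)" using eig[OF that] by (intro ip_cong) auto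
 also have "... = 0" using x(2)[OF that] by (simp add: ip_scale_right)
 finally show ?thesis using x(2)[OF that] unfolding z_def by (simp add: ip_diff_left ip_scale_left)
 qed
 have "ip I z z = 0"
 using crit[OF zu] unfolding z_def by (simp add: ip_diff_left ip_scale_left)
 then have "mv I A x i = r * x i" if "i : I" for i
 using that by (simp add: ip_self_eq_0 I z_def)
 then show ?thesis using x by blast
qed

text \<open>\<open>r i\<close> is what remains of the i-th unit vector after projection. The sum of
  the squared lengths is the trace of the complementary projection: while it is positive there is a
  further direction, and once it is zero the system is complete.\<close>

lemma orthonormal_residual:
 fixes u :: "nat => 'i => real"
 assumes I: "finite I" and on: "!!j l. j < k ==> l < k ==> ip I (u j) (u l) = of_bool (j = l)"
 defines "r \<equiv> %i l. of_bool (i = l) - (\<Sum>j<k. u j i * u j l)"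
 shows "!!i j. i : I ==> j < k ==> ip I (r i) (u j) = 0"
 and "(SUM i:I. ip I (r i) (r i)) = real (card I) - real k"
proof -
 have eu: "ip I (%l. of_bool (i = l)) v = v i" if "i : I" for i v
 using I that by (simp add: ip_def of_bool_def if_distrib[of "%x. x * _"] cong: if_cong)
 have ru: "ip I (r i) v = v i - (\<Sum>j<k. u j i * ip I (u j) v)" if "i : I" for i v
 unfolding r_def by (simp add: ip_diff_left eu[OF that] ip_sum_left ip_scale_left)
 show orth: "ip I (r i) (u j) = 0" if "i : I" "j < k" for i j
 proof -
 have "(\<Sum>l<k. u l i * ip I (u l) (u j)) = (\<Sum>l<k. if l = j then u l i else 0)"
 using that by (intro sum.cong) (auto simp: on)
 then show ?thesis using that by (simp add: ru)
 qed
 have "ip I (r i) (r i) = 1 - (\<Sum>j<k. u j i * u j i)" if "i : I" for i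
 proof -
 have "(\<Sum>j<k. u j i * ip I (u j) (r i)) = 0"
 proof (intro sum.neutral ballI)
 fix j assume "j : {..<k}"
 then show "u j i * ip I (u j) (r i) = 0"
 using orth[OF that, of j] ip_commute[of I "u j" "r i"] by simp
 qed
 then show ?thesis using ru[OF that, of "r i"] by (simp add: r_def)
 qed
 then have "(SUM i:I. ip I (r i) (r i)) = (SUM i:I. 1 - (\<Sum>j<k. u j i * u j i))" by simp
 also have "... = real (card I) - (\<Sum>j<k. ip I (u j) (u j))"
 unfolding ip_def by (simp add: sum_subtractf) (rule sum.swap)
 also have "... = real (card I) - real k" by (simp add: on)
 finally show "(SUM i:I. ip I (r i) (r i)) = real (card I) - real k" .
qed

theorem spectral_theorem_symmetric:
 fixes A :: "'i => 'i => real"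
 assumes I: "finite I" and sym: "!!i l. i : I ==> l : I ==> A i l = A l i"
 shows "\<exists>(u :: nat => 'i => real) (a :: nat => real).
 (\<forall>j<card I. \<forall>l<card I. ip I (u j) (u l) = of_bool (j = l)) &
 (\<forall>j<card I. \<forall>i\<in>I. mv I A (u j) i = a j * u j i) &
 (\<forall>i\<in>I. \<forall>l\<in>I. (\<Sum>j<card I. u j i * u j l) = of_bool (i = l))"
proof -
 have "\<exists>u a. (\<forall>j<k. \<forall>l<k. ip I (u j) (u l) = of_bool (j = l)) & (\<forall>j<k. \<forall>i\<in>I. mv I A (u j) i = a j * u j i)"
 if "k <= card I" for k
 using that
 proof (induction k)
 case (Suc k)
 then obtain u a where H: "(\<forall>j<k. \<forall>l<k. ip I (u j) (u l) = of_bool (j = l)) & (\<forall>j<k. \<forall>i\<in>I. mv I A (u j) i = a j * u j i)"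
 by (meson Suc_leD)
 have on: "!!j l. j < k ==> l < k ==> ip I (u j) (u l) = of_bool (j = l)"
 and eig: "!!j i. j < k ==> i : I ==> mv I A (u j) i = a j * u j i" using H by auto
 define r where "r i l = of_bool (i = l) - (\<Sum>j<k. u j i * u j l)" for i l
 have r: "r i = (%l. of_bool (i = l) - (\<Sum>j<k. u j i * u j l))" for i by (rule ext) (rule r_def)
 have res: "ip I (r i) (u j) = 0" if "i : I" "j < k" for i j
 unfolding r by (rule orthonormal_residual(1)[OF I]) (use on that in auto)
 have res2: "(SUM i:I. ip I (r i) (r i)) = real (card I) - real k"
 unfolding r by (rule orthonormal_residual(2)[OF I]) (use on in auto)
 have "\<exists>i\<in>I. 0 < ip I (r i) (r i)"
 proof (rule ccontr)
 assume "\<not> ?thesis"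
 then have "(SUM i:I. ip I (r i) (r i)) <= 0" by (intro sum_nonpos) (auto simp: not_less)
 then show False using res2 Suc.prems by simp
 qed
 then obtain i where i: "i : I" "0 < ip I (r i) (r i)" by blast
 define t where "t = 1 / sqrt (ip I (r i) (r i))"
 have x1: "ip I (%l. t * r i l) (%l. t * r i l) = 1"
 unfolding ip_scale_left ip_scale_right using i(2) by (simp add: t_def)
 have x2: "ip I (%l. t * r i l) (u j) = 0" if "j < k" for j
 using res[OF i(1) that] by (simp add: ip_scale_left)
 have "\<exists>x r. ip I x x = 1 & (\<forall>j<k. ip I x (u j) = 0) & (\<forall>i\<in>I. mv I A x i = r * x i)"
 by (rule rayleigh_eigenvector[where v="%l. t * r i l" and a=a, OF I]) (rule sym eig x1 x2; assumption)+
 then obtain x rr where x: "ip I x x = 1" "!!j. j < k ==> ip I x (u j) = 0" "!!i. i : I ==> mv I A x i = rr * x i"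
 by auto
 have "(\<forall>j<Suc k. \<forall>l<Suc k. ip I ((u(k := x)) j) ((u(k := x)) l) = of_bool (j = l))"
 proof -
 have "ip I (u j) x = 0" if "j < k" for j using x(2)[OF that] ip_commute[of I x "u j"] by simp
 then show ?thesis using on x(1,2) by (auto simp: less_Suc_eq)
 qed
 moreover have "(\<forall>j<Suc k. \<forall>i\<in>I. mv I A ((u(k := x)) j) i = (a(k := rr)) j * (u(k := x)) j i)"
 using eig x(3) by (auto simp: less_Suc_eq)
 ultimately show ?case by (intro exI conjI)
 qed auto
 from this[OF order_refl] obtain u a where
 H: "(\<forall>j<card I. \<forall>l<card I. ip I (u j) (u l) = of_bool (j = l)) & (\<forall>j<card I. \<forall>i\<in>I. mv I A (u j) i = a j * u j i)"
 by (elim exE)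
 have on: "!!j l. j < card I ==> l < card I ==> ip I (u j) (u l) = of_bool (j = l)"
 and eig: "!!j i. j < card I ==> i : I ==> mv I A (u j) i = a j * u j i" using H by auto
 have "(\<Sum>j<card I. u j i * u j l) = of_bool (i = l)" if "i : I" "l : I" for i l
 proof -
 define r where "r i l = of_bool (i = l) - (\<Sum>j<card I. u j i * u j l)" for i l
 have r: "r i = (%l. of_bool (i = l) - (\<Sum>j<card I. u j i * u j l))" for i by (rule ext) (rule r_def)
 have "(SUM i:I. ip I (r i) (r i)) = real (card I) - real (card I)"
 unfolding r by (rule orthonormal_residual(2)[OF I]) (use on in auto)
 then have "(SUM i:I. ip I (r i) (r i)) = 0" by simp
 then have "ip I (r i) (r i) = 0"
 using I that by (subst (asm) sum_nonneg_eq_0_iff) (auto simp: ip_self_nonneg)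
 then have "r i l = 0" using I that by (simp add: ip_self_eq_0)
 then show ?thesis by (simp add: r_def)
 qed
 then show ?thesis using on eig by (intro exI[of _ u] exI[of _ a]) simp
qed

definition mm :: "'i set => ('j => 'i => real) => ('i => 'k => real) => 'j => 'k => real" where
 "mm I X Y i l = (SUM m:I. X i m * Y m l)"

definition tr :: "'i set => ('i => 'i => real) => real" where
 "tr I X = (SUM i:I. X i i)"

lemma mm_assoc: "mm K (mm I X Y) Z = mm I X (mm K Y Z)"
proof (intro ext)
 fix i l
 have "mm K (mm I X Y) Z i l = (SUM k:K. SUM m:I. X i m * Y m k * Z k l)"
 by (simp add: mm_def sum_distrib_right)
 also have "... = (SUM m:I. SUM k:K. X i m * Y m k * Z k l)" by (rule sum.swap)
 also have "... = mm I X (mm K Y Z) i l" by (simp add: mm_def sum_distrib_left mult.assoc)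
 finally show "mm K (mm I X Y) Z i l = mm I X (mm K Y Z) i l" .
qed

lemma tr_commute: "tr I (mm K X Y) = tr K (mm I Y X)"
 unfolding tr_def mm_def by (subst sum.swap) (simp add: mult.commute)

lemma mv_mm: "mv I (mm I X Y) v = mv I X (mv I Y v)"
proof (rule ext)
 fix i
 have "mv I (mm I X Y) v i = (SUM k:I. SUM m:I. X i m * Y m k * v k)"
 by (simp add: mm_def mv_def sum_distrib_right)
 also have "... = (SUM m:I. SUM k:I. X i m * Y m k * v k)" by (rule sum.swap)
 also have "... = mv I X (mv I Y v) i" by (simp add: mv_def sum_distrib_left mult.assoc)
 finally show "mv I (mm I X Y) v i = mv I X (mv I Y v) i" .
qed

lemma tr_orthonormal_basis:
 assumes I: "finite I" and compl: "!!i l. i : I ==> l : I ==> (\<Sum>j<n. u j i * u j l) = of_bool (i = l)"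
 shows "tr I X = (\<Sum>j<n. ip I (u j) (mv I X (u j)))"
proof -
 have "tr I X = (SUM i:I. SUM l:I. X i l * of_bool (i = l))"
 using I by (simp add: tr_def of_bool_def if_distrib[of "%x. _ * x"] cong: if_cong)
 also have "... = (SUM i:I. SUM l:I. \<Sum>j<n. X i l * (u j i * u j l))"
 by (intro sum.cong refl) (simp add: compl flip: sum_distrib_left)
 also have "... = (SUM i:I. \<Sum>j<n. SUM l:I. X i l * (u j i * u j l))"
 by (intro sum.cong refl sum.swap)
 also have "... = (\<Sum>j<n. SUM i:I. SUM l:I. X i l * (u j i * u j l))" by (rule sum.swap)
 also have "... = (\<Sum>j<n. ip I (u j) (mv I X (u j)))"
 by (simp add: ip_def mv_def sum_distrib_left mult_ac)
 finally show ?thesis .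
qed

lemma orthonormal_expansion:
 assumes I: "finite I" and compl: "!!i l. i : I ==> l : I ==> (\<Sum>j<n. u j i * u j l) = of_bool (i = l)"
 and i: "i : I"
 shows "(\<Sum>j<n. ip I (u j) x * u j i) = x i"
proof -
 have "(\<Sum>j<n. ip I (u j) x * u j i) = (\<Sum>j<n. SUM l:I. x l * (u j i * u j l))"
 unfolding ip_def sum_distrib_right by (intro sum.cong refl) (simp add: mult_ac)
 also have "... = (SUM l:I. \<Sum>j<n. x l * (u j i * u j l))" by (rule sum.swap)
 also have "... = (SUM l:I. x l * of_bool (i = l))"
 by (intro sum.cong refl) (simp add: compl i flip: sum_distrib_left)
 also have "... = x i" using I i by (simp add: of_bool_def if_distrib[of "%x. _ * x"] cong: if_cong)
 finally show ?thesis .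
qed

text \<open>\<open>Sg\<close> is a covariance and \<open>M\<close> a form. The linear functionals
  \<open>e j\<close> become uncorrelated coordinates of unit variance, and the \<open>q k\<close>
  are directions of zero variance, so the identity for the form is demanded only where they
  vanish.\<close>

definition diagonalizes ::
 "'i set => ('i => 'i => real) => ('i => 'i => real) => nat set => nat set => (nat => 'i => real) => (nat => 'i => real) => (nat => real) => bool" where
 "diagonalizes I Sg M J K e q a \<longleftrightarrow> finite J & finite K
 & (\<forall>j\<in>J. \<forall>l\<in>J. ip I (e j) (mv I Sg (e l)) = of_bool (j = l))
 & (\<forall>k\<in>K. ip I (q k) (mv I Sg (q k)) = 0)
 & (\<forall>z. (\<forall>k\<in>K. ip I (q k) z = 0) --> ip I z (mv I M z) = (SUM j:J. a j * (ip I (e j) z)\<^sup>2))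
 & (\<forall>j\<in>J. a j = ip I (mv I Sg (e j)) (mv I M (mv I Sg (e j))))
 & (SUM j:J. (a j)\<^sup>2) = tr I (mm I (mm I M Sg) (mm I M Sg))
 & (SUM j:J. (a j) ^ 3) = tr I (mm I (mm I M Sg) (mm I (mm I M Sg) (mm I M Sg)))"

text \<open>\<open>Sg\<close> may be singular. It is factored through the vectors
  \<open>p k\<close>, its eigenvectors scaled by the roots of the eigenvalues, and the compressed
  form \<open>A\<close> is diagonalised. The functionals \<open>e j\<close> pull back by the
  pseudo-inverse \<open>v\<close>, set to 0 on the kernel. The power traces follow because traces
  are cyclic.\<close>

theorem quadratic_form_diagonalization:
 fixes Sg M :: "'i => 'i => real"
 assumes I: "finite I" and symS: "!!i l. i : I ==> l : I ==> Sg i l = Sg l i"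
 and symM: "!!i l. i : I ==> l : I ==> M i l = M l i"
 and psd: "!!x. 0 <= ip I x (mv I Sg x)"
 shows "\<exists>J K e q a. diagonalizes I Sg M J K e q a"
proof -
 define n where "n = card I"
 have "\<exists>u a. (\<forall>j<n. \<forall>l<n. ip I (u j) (u l) = of_bool (j = l)) & (\<forall>j<n. \<forall>i\<in>I. mv I Sg (u j) i = a j * u j i) &
 (\<forall>i\<in>I. \<forall>l\<in>I. (\<Sum>j<n. u j i * u j l) = of_bool (i = l))"
 unfolding n_def by (rule spectral_theorem_symmetric[OF I]) (rule symS)
 then obtain q s where Hq: "(\<forall>j<n. \<forall>l<n. ip I (q j) (q l) = of_bool (j = l)) & (\<forall>j<n. \<forall>i\<in>I. mv I Sg (q j) i = s j * q j i) &
 (\<forall>i\<in>I. \<forall>l\<in>I. (\<Sum>j<n. q j i * q j l) = of_bool (i = l))" by (elim exE)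
 have on_q: "!!j l. j < n ==> l < n ==> ip I (q j) (q l) = of_bool (j = l)"
 and eig_q: "!!j i. j < n ==> i : I ==> mv I Sg (q j) i = s j * q j i"
 and compl_q: "!!i l. i : I ==> l : I ==> (\<Sum>j<n. q j i * q j l) = of_bool (i = l)"
 using Hq by auto
 have ip_S: "ip I (q k) (mv I Sg (q k)) = s k" if "k < n" for k
 proof -
 have "ip I (q k) (mv I Sg (q k)) = ip I (q k) (%i. s k * q k i)" using eig_q[OF that] by (intro ip_cong) auto
 then show ?thesis using on_q[OF that that] by (simp add: ip_scale_right)
 qed
 have s: "0 <= s k" if "k < n" for k using psd[of "q k"] ip_S[OF that] by simp
 define w where "w k = sqrt (s k)" for k
 define v where "v k = (if s k = 0 then 0 else 1 / w k)" for k
 have vw: "v k * w k = of_bool (s k ~= 0)" "v k * s k = w k" "w k * w k = s k" if "k < n" for k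
 using s[OF that] by (auto simp: v_def w_def real_div_sqrt)
 define p where "p k i = w k * q k i" for k i
 define A where "A k l = ip I (p k) (mv I M (p l))" for k l
 have symA: "A k l = A l k" for k l
 proof -
 have "ip I (mv I M (p k)) (p l) = ip I (p k) (mv I M (p l))" by (rule ip_mv_sym) (rule symM)
 then show ?thesis using ip_commute[of I "mv I M (p k)" "p l"] by (simp add: A_def)
 qed
 have "\<exists>u a. (\<forall>j<card {..<n}. \<forall>l<card {..<n}. ip {..<n} (u j) (u l) = of_bool (j = l)) &
 (\<forall>j<card {..<n}. \<forall>i\<in>{..<n}. mv {..<n} A (u j) i = a j * u j i) &
 (\<forall>i\<in>{..<n}. \<forall>l\<in>{..<n}. (\<Sum>j<card {..<n}. u j i * u j l) = of_bool (i = l))"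
 by (rule spectral_theorem_symmetric[OF finite_lessThan]) (rule symA)
 then obtain u a where Hu: "(\<forall>j<card {..<n}. \<forall>l<card {..<n}. ip {..<n} (u j) (u l) = of_bool (j = l)) &
 (\<forall>j<card {..<n}. \<forall>i\<in>{..<n}. mv {..<n} A (u j) i = a j * u j i) &
 (\<forall>i\<in>{..<n}. \<forall>l\<in>{..<n}. (\<Sum>j<card {..<n}. u j i * u j l) = of_bool (i = l))" by (elim exE)
 have on_u: "!!j l. j < n ==> l < n ==> ip {..<n} (u j) (u l) = of_bool (j = l)"
 and eig_u: "!!j i. j < n ==> i < n ==> mv {..<n} A (u j) i = a j * u j i"
 and compl_u: "!!i l. i < n ==> l < n ==> (\<Sum>j<n. u j i * u j l) = of_bool (i = l)"
 using Hu by auto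
 define e where "e j i = (\<Sum>k<n. u j k * v k * q k i)" for j i
 \<comment> \<open>An eigenvector of \<open>A\<close> for a non-zero eigenvalue has no component in
   the kernel of \<open>Sg\<close>, which makes the \<open>e j\<close> orthonormal for
   \<open>Sg\<close>. For eigenvalue 0 this can fail; dropping those indices changes none of the
   sums.\<close>
 define J where "J = {j. j < n & a j ~= 0}"
 define K where "K = {k. k < n & s k = 0}"
 have fin: "finite J" "finite K" by (auto simp: J_def K_def)
 have u0: "u j k = 0" if "j : J" "k < n" "s k = 0" for j k
 proof -
 have "p k = (%i. 0)" using that by (auto simp: p_def w_def)
 then have "A k l = 0" for l unfolding A_def by (simp add: ip_def)
 then have "mv {..<n} A (u j) k = 0" by (simp add: mv_def)
 then show ?thesis using eig_u[of j k] that by (simp add: J_def)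
 qed
 have Se: "mv I Sg (e l) i = (\<Sum>k<n. u l k * p k i)" if "i : I" for l i
 proof -
 have "mv I Sg (e l) i = (\<Sum>k<n. u l k * v k * mv I Sg (q k) i)"
 unfolding e_def mv_sum mv_scale ..
 also have "... = (\<Sum>k<n. u l k * p k i)"
 using that vw(2) by (intro sum.cong refl) (simp add: eig_q p_def mult_ac)
 finally show ?thesis .
 qed
 have orth: "ip I (e j) (mv I Sg (e l)) = of_bool (j = l)" if "j : J" "l : J" for j l
 proof -
 have "ip I (e j) (mv I Sg (e l)) = ip I (e j) (%i. \<Sum>k<n. u l k * p k i)"
 using Se by (intro ip_cong) auto
 also have "... = (\<Sum>k<n. u l k * (w k * ip I (e j) (q k)))"
 unfolding ip_sum_right ip_scale_right p_def ..
 also have "... = (\<Sum>k<n. u j k * u l k)"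
 proof (intro sum.cong refl)
 fix k assume "k : {..<n}"
 then have k: "k < n" by simp
 have "ip I (e j) (q k) = (\<Sum>m<n. u j m * v m * ip I (q m) (q k))"
 unfolding e_def ip_sum_left ip_scale_left ..
 also have "... = (\<Sum>m<n. if m = k then u j m * v m else 0)"
 using k by (intro sum.cong refl) (auto simp: on_q)
 also have "... = u j k * v k" using k by simp
 finally have "u l k * (w k * ip I (e j) (q k)) = u l k * u j k * (v k * w k)" by simp
 also have "... = u j k * u l k"
 unfolding vw(1)[OF k] using u0[OF that(1) k] by (cases "s k = 0") auto
 finally show "u l k * (w k * ip I (e j) (q k)) = u j k * u l k" .
 qed
 also have "... = of_bool (j = l)"
 using on_u[of j l] that by (simp add: ip_def J_def)
 finally show ?thesis .
 qed
 have quad: "ip {..<n} x (mv {..<n} A x) = (\<Sum>j<n. a j * (ip {..<n} (u j) x)\<^sup>2)" for x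
 proof -
 have "ip {..<n} x (mv {..<n} A x) = ip {..<n} x (mv {..<n} A (%i. \<Sum>j<n. ip {..<n} (u j) x * u j i))"
 by (intro arg_cong2[where f="ip {..<n}"] refl mv_cong orthonormal_expansion[symmetric]) (auto simp: compl_u)
 also have "... = (\<Sum>j<n. ip {..<n} (u j) x * ip {..<n} x (mv {..<n} A (u j)))"
 unfolding mv_sum mv_scale ip_sum_right ip_scale_right ..
 also have "... = (\<Sum>j<n. a j * (ip {..<n} (u j) x)\<^sup>2)"
 proof (intro sum.cong refl)
 fix j assume "j : {..<n}"
 then have "ip {..<n} x (mv {..<n} A (u j)) = ip {..<n} x (%i. a j * u j i)"
 by (intro ip_cong) (auto simp: eig_u)
 then show "ip {..<n} (u j) x * ip {..<n} x (mv {..<n} A (u j)) = a j * (ip {..<n} (u j) x)\<^sup>2"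
 by (simp add: ip_scale_right ip_commute[of _ x "u j"] power2_eq_square)
 qed
 finally show ?thesis .
 qed
 have diag: "ip I z (mv I M z) = (SUM j:J. a j * (ip I (e j) z)\<^sup>2)" if z: "\<forall>k\<in>K. ip I (q k) z = 0" for z
 proof -
 define x where "x k = v k * ip I (q k) z" for k
 have zx: "z i = (\<Sum>k<n. x k * p k i)" if "i : I" for i
 proof -
 have "(\<Sum>k<n. x k * p k i) = (\<Sum>k<n. ip I (q k) z * q k i)"
 proof (intro sum.cong refl)
 fix k assume "k : {..<n}"
 then have k: "k < n" by simp
 have "x k * p k i = (v k * w k) * (ip I (q k) z * q k i)" by (simp add: x_def p_def)
 also have "... = ip I (q k) z * q k i"
 unfolding vw(1)[OF k] using z k by (cases "s k = 0") (auto simp: K_def)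
 finally show "x k * p k i = ip I (q k) z * q k i" .
 qed
 also have "... = z i" by (rule orthonormal_expansion[OF I compl_q that])
 finally show ?thesis by simp
 qed
 have "ip I z (mv I M z) = ip I (%i. \<Sum>k<n. x k * p k i) (mv I M (%i. \<Sum>k<n. x k * p k i))"
 proof -
 have "mv I M z = mv I M (%i. \<Sum>k<n. x k * p k i)" using zx by (intro mv_cong) auto
 then show ?thesis using zx by (intro ip_cong) auto
 qed
 also have "... = ip {..<n} x (mv {..<n} A x)"
 unfolding mv_sum mv_scale ip_sum_left ip_scale_left ip_sum_right ip_scale_right
 by (simp add: ip_def[of "{..<n}"] mv_def[of "{..<n}"] A_def mult.commute)
 also have "... = (\<Sum>j<n. a j * (ip {..<n} (u j) x)\<^sup>2)" by (rule quad)
 also have "... = (\<Sum>j<n. a j * (ip I (e j) z)\<^sup>2)"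
 proof (intro sum.cong refl)
 fix j
 have "ip I (e j) z = ip {..<n} (u j) x"
 unfolding e_def ip_sum_left ip_scale_left by (simp add: ip_def[of "{..<n}"] x_def mult.assoc)
 then show "a j * (ip {..<n} (u j) x)\<^sup>2 = a j * (ip I (e j) z)\<^sup>2" by simp
 qed
 also have "... = (SUM j:J. a j * (ip I (e j) z)\<^sup>2)"
 by (rule sum.mono_neutral_right) (auto simp: J_def)
 finally show ?thesis .
 qed
 have aj: "a j = ip I (mv I Sg (e j)) (mv I M (mv I Sg (e j)))" if "j : J" for j
 proof -
 have j: "j < n" using that by (simp add: J_def)
 have "ip I (mv I Sg (e j)) (mv I M (mv I Sg (e j))) = ip I (%i. \<Sum>k<n. u j k * p k i) (mv I M (%i. \<Sum>k<n. u j k * p k i))"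
 proof -
 have "mv I M (mv I Sg (e j)) = mv I M (%i. \<Sum>k<n. u j k * p k i)" using Se by (intro mv_cong) auto
 then show ?thesis using Se by (intro ip_cong) auto
 qed
 also have "... = ip {..<n} (u j) (mv {..<n} A (u j))"
 unfolding mv_sum mv_scale ip_sum_left ip_scale_left ip_sum_right ip_scale_right
 by (simp add: ip_def[of "{..<n}"] mv_def[of "{..<n}"] A_def mult.commute)
 also have "... = ip {..<n} (u j) (%i. a j * u j i)"
 using j by (intro ip_cong) (auto simp: eig_u)
 also have "... = a j" using on_u[OF j j] by (simp add: ip_scale_right)
 finally show ?thesis by simp
 qed
 let ?N = "{..<n}"
 have S_p: "Sg i l = (\<Sum>k<n. p k i * p k l)" if "i : I" "l : I" for i l
 proof -
 have "Sg i l = (\<Sum>k<n. ip I (q k) (%m. Sg i m) * q k l)"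
 using orthonormal_expansion[OF I compl_q that(2), of "%m. Sg i m"] by simp
 also have "... = (\<Sum>k<n. mv I Sg (q k) i * q k l)" by (simp add: ip_def mv_def mult.commute)
 also have "... = (\<Sum>k<n. p k i * p k l)"
 proof (intro sum.cong refl)
 fix k assume "k : {..<n}"
 then have k: "k < n" by simp
 have "mv I Sg (q k) i * q k l = (w k * w k) * q k i * q k l"
 unfolding eig_q[OF k that(1)] vw(3)[OF k] ..
 then show "mv I Sg (q k) i * q k l = p k i * p k l" by (simp add: p_def mult_ac)
 qed
 finally show ?thesis .
 qed
 define Pt where "Pt = (%i k. p k i)"
 have A_mm: "A = mm I p (mm I M Pt)"
 by (intro ext) (simp add: A_def ip_def mv_def mm_def Pt_def)
 \<comment> \<open>The two left factors agree only for column indices in \<open>I\<close>, so one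
   replaces the other inside a product. Cyclic shifts of the trace bring each factor into that
   position.\<close>
 have B: "mm I (mm ?N (mm I M Pt) p) X i l = mm I (mm I M Sg) X i l" for X :: "'i => 'i => real" and i l
 proof -
 have "mm I M (mm ?N Pt p) i m = mm I M Sg i m" if "m : I" for i m
 using that by (simp add: mm_def S_p Pt_def)
 then show ?thesis unfolding mm_assoc[of ?N I M] by (simp add: mm_def[of I "mm I M _"])
 qed
 have trA: "tr ?N X = (\<Sum>j<n. ip ?N (u j) (mv ?N X (u j)))" for X
 by (rule tr_orthonormal_basis) (auto simp: compl_u)
 have mvA: "mv ?N X (mv ?N A (u j)) = (%i. a j * mv ?N X (u j) i)" if "j < n" for X j
 proof -
 have "mv ?N X (mv ?N A (u j)) = mv ?N X (%i. a j * u j i)" using that by (intro mv_cong) (auto simp: eig_u)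
 then show ?thesis by (simp add: mv_scale)
 qed
 have ipA: "ip ?N (u j) (mv ?N A (u j)) = a j" if "j < n" for j
 proof -
 have "ip ?N (u j) (mv ?N A (u j)) = ip ?N (u j) (%i. a j * u j i)"
 using that by (intro ip_cong) (auto simp: eig_u)
 then show ?thesis using on_u[OF that that] by (simp add: ip_scale_right)
 qed
 have t2: "(SUM j:J. (a j)\<^sup>2) = tr I (mm I (mm I M Sg) (mm I M Sg))"
 proof -
 have "(SUM j:J. (a j)\<^sup>2) = (\<Sum>j<n. (a j)\<^sup>2)"
 by (rule sum.mono_neutral_left) (auto simp: J_def)
 also have "... = tr ?N (mm ?N A A)"
 unfolding trA by (intro sum.cong refl) (simp add: mv_mm mvA ipA ip_scale_right power2_eq_square)
 also have "... = tr I (mm I (mm ?N (mm I M Pt) p) (mm ?N (mm I M Pt) p))"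
 unfolding A_mm mm_assoc[of ?N I p] by (subst tr_commute) (simp only: mm_assoc)
 also have "... = tr I (mm I (mm I M Sg) (mm ?N (mm I M Pt) p))"
 by (simp add: tr_def B)
 also have "... = tr I (mm I (mm ?N (mm I M Pt) p) (mm I M Sg))" by (rule tr_commute)
 also have "... = tr I (mm I (mm I M Sg) (mm I M Sg))" by (simp add: tr_def B)
 finally show ?thesis .
 qed
 have t3: "(SUM j:J. (a j) ^ 3) = tr I (mm I (mm I M Sg) (mm I (mm I M Sg) (mm I M Sg)))"
 proof -
 let ?Q = "mm ?N (mm I M Pt) p" and ?R = "mm I M Sg"
 have "(SUM j:J. (a j) ^ 3) = (\<Sum>j<n. (a j) ^ 3)"
 by (rule sum.mono_neutral_left) (auto simp: J_def)
 also have "... = tr ?N (mm ?N A (mm ?N A A))"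
 unfolding trA by (intro sum.cong refl) (simp add: mv_mm mvA mv_scale ipA ip_scale_right power3_eq_cube)
 also have "... = tr I (mm I ?Q (mm I ?Q ?Q))"
 unfolding A_mm mm_assoc[of ?N I p] by (subst tr_commute) (simp only: mm_assoc)
 also have "... = tr I (mm I ?R (mm I ?Q ?Q))" by (simp add: tr_def B)
 also have "... = tr I (mm I (mm I ?Q ?Q) ?R)" by (rule tr_commute)
 also have "... = tr I (mm I ?Q (mm I ?Q ?R))" unfolding mm_assoc ..
 also have "... = tr I (mm I ?R (mm I ?Q ?R))" by (simp add: tr_def B)
 also have "mm I ?Q ?R = mm I ?R ?R" by (intro ext) (rule B)
 finally show ?thesis .
 qed
 show ?thesis unfolding diagonalizes_def
 proof (rule exI[of _ J], rule exI[of _ K], rule exI[of _ e], rule exI[of _ q], rule exI[of _ a], intro conjI ballI allI impI)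
 show "ip I (q k) (mv I Sg (q k)) = 0" if "k : K" for k using that ip_S by (simp add: K_def)
 qed (fact fin t2 t3 | rule orth diag aj; assumption)+
qed

section \<open>Independence from joint characteristic functions\<close>

text \<open>The weight may change sign, but \<open>2 + w\<close> is positive and becomes a
  probability density after division by \<open>2 + W\<close>. The factorisation says that
  \<open>Y\<close> has the same characteristic function under the new measure, hence the same
  law.\<close>

lemma (in prob_space) char_weight_real:
 fixes Y :: "'a => real" and w :: "'a => real"
 assumes Y[measurable]: "Y : borel_measurable M" and w[measurable]: "w : borel_measurable M"
 and w01: "!!x. x : space M ==> \<bar>w x\<bar> <= 1"
 and char: "!!t. (LINT x|M. w x *\<^sub>R iexp (t * Y x)) = (LINT x|M. w x) *\<^sub>R (LINT x|M. iexp (t * Y x))"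
 and B[measurable]: "B : sets borel"
 shows "(LINT x|M. w x * indicator B (Y x)) = (LINT x|M. w x) * prob (Y -` B \<inter> space M)"
proof -
 have intw: "integrable M w"
 by (rule integrable_const_bound[where B=1]) (use w01 in auto)
 have inte: "integrable M (%x. iexp (t * Y x))" for t
 by (rule integrable_const_bound[where B=1]) auto
 have intwe: "integrable M (%x. w x *\<^sub>R iexp (t * Y x))" for t
 by (rule integrable_const_bound[where B=1]) (use w01 in auto)
 have intwi: "integrable M (%x. w x * indicator B (Y x))"
 by (rule integrable_const_bound[where B=1]) (use w01 in \<open>auto simp: indicator_def\<close>)
 have inti: "integrable M (%x. indicator B (Y x) :: real)"
 by (rule integrable_const_bound[where B=1]) (auto simp: indicator_def)
 define W where "W = (LINT x|M. w x)"
 have W: "abs W <= 1"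
 proof -
 have "abs W <= (LINT x|M. \<bar>w x\<bar>)" unfolding W_def by (rule integral_abs_bound)
 also have "... <= (LINT x|M. 1)" using w01 intw by (intro integral_mono) auto
 finally show ?thesis by (simp add: prob_space)
 qed
 define d where "d x = (2 + w x) / (2 + W)" for x
 have [measurable]: "d : borel_measurable M" unfolding d_def by measurable
 have d0: "0 <= d x" if "x : space M" for x using w01[OF that] W by (auto simp: d_def abs_le_iff)
 have pos: "0 < 2 + W" using W by (auto simp: abs_le_iff)
 define N where "N = density M (%x. ennreal (d x))"
 have intd: "integrable M d" unfolding d_def using intw by auto
 have "emeasure N (space N) = 1"
 proof -
 have "emeasure N (space N) = (\<integral>\<^sup>+x. ennreal (d x) \<partial>M)"
 unfolding N_def by (subst emeasure_density) (auto intro!: nn_integral_cong)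
 also have "... = ennreal (LINT x|M. d x)" by (intro nn_integral_eq_integral intd AE_I2 d0)
 also have "(LINT x|M. d x) = 1" unfolding d_def using intw pos by (simp add: W_def[symmetric] prob_space)
 finally show ?thesis by simp
 qed
 then interpret N: prob_space N by (rule prob_spaceI)
 have [measurable]: "Y : borel_measurable N" by (simp add: N_def)
 have sc: "2 * z + v *\<^sub>R z = (2 + v) *\<^sub>R z" for z :: complex and v
 by (simp add: scaleR_conv_of_real distrib_right)
 have dE: "(LINT x|N. f (Y x)) = (2 * (LINT x|M. f (Y x)) + (LINT x|M. w x *\<^sub>R f (Y x))) /\<^sub>R (2 + W)"
 if "integrable M (%x. f (Y x))" "integrable M (%x. w x *\<^sub>R f (Y x))" "f : borel_measurable borel"
 for f :: "real => complex"
 proof -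
 have [measurable]: "f : borel_measurable borel" by (rule that)
 have "(LINT x|N. f (Y x)) = (LINT x|M. d x *\<^sub>R f (Y x))"
 unfolding N_def using d0 by (intro integral_density) auto
 also have "... = (LINT x|M. (2 * f (Y x) + w x *\<^sub>R f (Y x)) /\<^sub>R (2 + W))"
 by (intro lintegral_cong refl) (simp add: d_def sc divide_inverse mult.commute)
 also have "... = (2 * (LINT x|M. f (Y x)) + (LINT x|M. w x *\<^sub>R f (Y x))) /\<^sub>R (2 + W)"
 using that by simp
 finally show ?thesis .
 qed
 have "char (distr N borel Y) = char (distr M borel Y)"
 proof (rule ext)
 fix t
 have "char (distr N borel Y) t = (LINT x|N. iexp (t * Y x))"
 unfolding char_def by (subst integral_distr) auto
 also have "... = (2 * (LINT x|M. iexp (t * Y x)) + (LINT x|M. w x *\<^sub>R iexp (t * Y x))) /\<^sub>R (2 + W)"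
 by (rule dE) (use inte intwe in auto)
 also have "... = (LINT x|M. iexp (t * Y x))"
 unfolding char W_def[symmetric] sc using pos by simp
 also have "... = char (distr M borel Y) t"
 unfolding char_def by (subst integral_distr) auto
 finally show "char (distr N borel Y) t = char (distr M borel Y) t" .
 qed
 then have eq: "distr N borel Y = distr M borel Y"
 by (intro Levy_uniqueness real_distribution_distr N.real_distribution_distr) auto
 define p where "p = prob (Y -` B \<inter> space M)"
 have p: "(LINT x|M. indicator B (Y x)) = p"
 proof -
 have "(LINT x|M. indicator B (Y x)) = (\<integral>x. indicator (Y -` B \<inter> space M) x \<partial>M :: real)"
 by (intro lintegral_cong refl) (auto simp: indicator_def)
 then show ?thesis by (simp add: p_def)
 qed
 have "(LINT x|N. indicator B (Y x)) = (\<integral>y. indicator B y \<partial>distr N borel Y :: real)"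
 by (subst integral_distr) auto
 also have "... = (LINT x|M. indicator B (Y x))"
 unfolding eq by (subst integral_distr) auto
 finally have "(LINT x|N. indicator B (Y x)) = p" unfolding p .
 moreover have "(LINT x|N. indicator B (Y x)) = (\<integral>x. d x *\<^sub>R indicator B (Y x) \<partial>M :: real)"
 unfolding N_def using d0 by (intro integral_density) auto
 moreover have "(LINT x|M. d x *\<^sub>R indicator B (Y x)) = (LINT x|M. (2 * indicator B (Y x) + w x * indicator B (Y x)) / (2 + W))"
 by (intro lintegral_cong refl) (simp add: d_def field_simps)
 moreover have "... = (2 * p + (LINT x|M. w x * indicator B (Y x))) / (2 + W)"
 using inti intwi by (simp add: p)
 ultimately have "(2 * p + (LINT x|M. w x * indicator B (Y x))) / (2 + W) = p" by (simp only:)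
 then have "2 * p + (LINT x|M. w x * indicator B (Y x)) = p * (2 + W)" using pos by (simp add: field_simps)
 then show ?thesis by (simp add: W_def[symmetric] p_def[symmetric] algebra_simps)
qed

text \<open>The characteristic function of a family is turned into a product of probabilities one
 coordinate at a time, each time by one-dimensional uniqueness under a reweighted measure.\<close>

lemma (in prob_space) char_weight_complex:
 fixes Y :: "'a => real" and Ph :: "'a => complex"
 assumes Y[measurable]: "Y : borel_measurable M" and Ph[measurable]: "Ph : borel_measurable M"
 and bound: "!!x. x : space M ==> norm (Ph x) <= 1"
 and char: "!!t. (LINT x|M. Ph x * iexp (t * Y x)) = (LINT x|M. Ph x) * (LINT x|M. iexp (t * Y x))"
 and B[measurable]: "B : sets borel"
 shows "(LINT x|M. Ph x * indicator B (Y x)) = (LINT x|M. Ph x) * prob (Y -` B \<inter> space M)"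
proof -
 have intPh: "integrable M Ph" by (rule integrable_const_bound[where B=1]) (use bound in auto)
 have intE: "integrable M (%x. Ph x * iexp (t * Y x))" for t
 by (rule integrable_const_bound[where B=1]) (use bound in \<open>auto simp: norm_mult\<close>)
 have intI: "integrable M (%x. Ph x * indicator B (Y x))"
 by (rule integrable_const_bound[where B=1]) (use bound in \<open>auto simp: norm_mult indicator_def\<close>)
 have cnj_char: "(LINT x|M. cnj (Ph x) * iexp (t * Y x)) = cnj (LINT x|M. Ph x) * (LINT x|M. iexp (t * Y x))" for t
 proof -
 have "(%x. cnj (Ph x) * iexp (t * Y x)) = (%x. cnj (Ph x * iexp ((- t) * Y x)))"
 by (rule ext) (simp add: exp_cnj)
 then have "(LINT x|M. cnj (Ph x) * iexp (t * Y x)) = cnj (LINT x|M. Ph x * iexp ((- t) * Y x))"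
 by (simp only: Bochner_Integration.integral_cnj)
 also have "... = cnj ((LINT x|M. Ph x) * (LINT x|M. iexp ((- t) * Y x)))"
 unfolding char ..
 also have "(LINT x|M. iexp ((- t) * Y x)) = cnj (LINT x|M. iexp (t * Y x))"
 unfolding Bochner_Integration.integral_cnj[symmetric] by (intro lintegral_cong refl) (simp add: exp_cnj)
 finally show ?thesis by (simp only: complex_cnj_mult complex_cnj_cnj)
 qed
 have [measurable]: "(%x. cnj (Ph x)) : borel_measurable M"
 by (rule borel_measurable_continuous_on[OF _ Ph]) (intro continuous_intros)
 have intc: "integrable M (%x. cnj (Ph x) * iexp (t * Y x))" for t
 by (rule integrable_const_bound[where B=1]) (use bound in \<open>auto simp: norm_mult\<close>)
 have Re_char: "(LINT x|M. Re (Ph x) *\<^sub>R iexp (t * Y x)) = (LINT x|M. Re (Ph x)) *\<^sub>R (LINT x|M. iexp (t * Y x))" for t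
 proof -
 have "(%x. Re (Ph x) *\<^sub>R iexp (t * Y x)) = (%x. (Ph x * iexp (t * Y x) + cnj (Ph x) * iexp (t * Y x)) / 2)"
 by (rule ext) (simp add: scaleR_conv_of_real complex_add_cnj flip: distrib_right)
 then have "(LINT x|M. Re (Ph x) *\<^sub>R iexp (t * Y x)) = ((LINT x|M. Ph x) + cnj (LINT x|M. Ph x)) * (LINT x|M. iexp (t * Y x)) / 2"
 by (simp only: integral_divide_zero Bochner_Integration.integral_add[OF intE intc] char cnj_char distrib_right)
 also have "... = (LINT x|M. Re (Ph x)) *\<^sub>R (LINT x|M. iexp (t * Y x))"
 using intPh by (simp add: complex_add_cnj scaleR_conv_of_real)
 finally show ?thesis .
 qed
 have imi: "(z - cnj z) * E / (2 * \<i>) = Im z *\<^sub>R E" for z E :: complex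
 unfolding complex_diff_cnj by (rule iffD2[OF nonzero_divide_eq_eq]) (simp_all add: scaleR_conv_of_real)
 have Im_char: "(LINT x|M. Im (Ph x) *\<^sub>R iexp (t * Y x)) = (LINT x|M. Im (Ph x)) *\<^sub>R (LINT x|M. iexp (t * Y x))" for t
 proof -
 have "(LINT x|M. Im (Ph x) *\<^sub>R iexp (t * Y x)) = ((LINT x|M. Ph x) - cnj (LINT x|M. Ph x)) * (LINT x|M. iexp (t * Y x)) / (2 * \<i>)"
 unfolding imi[symmetric] unfolding left_diff_distrib
 by (simp only: integral_divide_zero lintegral_diff[OF intE intc] char cnj_char)
 also have "... = (LINT x|M. Im (Ph x)) *\<^sub>R (LINT x|M. iexp (t * Y x))"
 unfolding imi using intPh by simp
 finally show ?thesis .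
 qed
 have "Re (LINT x|M. Ph x * indicator B (Y x)) = (LINT x|M. Re (Ph x) * indicator B (Y x))"
 by (subst integral_Re[OF intI, symmetric]) (auto intro!: lintegral_cong simp: indicator_def)
 also have "... = (LINT x|M. Re (Ph x)) * prob (Y -` B \<inter> space M)"
 proof (rule char_weight_real[OF Y _ _ Re_char B])
 show "\<bar>Re (Ph x)\<bar> <= 1" if "x : space M" for x
 using order_trans[OF abs_Re_le_cmod bound[OF that]] .
 qed simp
 finally have R: "Re (LINT x|M. Ph x * indicator B (Y x)) = Re (LINT x|M. Ph x) * prob (Y -` B \<inter> space M)"
 using intPh by simp
 have "Im (LINT x|M. Ph x * indicator B (Y x)) = (LINT x|M. Im (Ph x) * indicator B (Y x))"
 by (subst integral_Im[OF intI, symmetric]) (auto intro!: lintegral_cong simp: indicator_def)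
 also have "... = (LINT x|M. Im (Ph x)) * prob (Y -` B \<inter> space M)"
 proof (rule char_weight_real[OF Y _ _ Im_char B])
 show "\<bar>Im (Ph x)\<bar> <= 1" if "x : space M" for x
 using order_trans[OF abs_Im_le_cmod bound[OF that]] .
 qed simp
 finally have I: "Im (LINT x|M. Ph x * indicator B (Y x)) = Im (LINT x|M. Ph x) * prob (Y -` B \<inter> space M)"
 using intPh by simp
 show ?thesis using R I by (simp add: complex_eq_iff)
qed

lemma (in prob_space) indep_vars_of_joint_char:
 fixes Y :: "'i => 'a => real"
 assumes J: "finite J" and Y: "!!j. j : J ==> Y j : borel_measurable M"
 and char: "!!t. (LINT x|M. (PROD j:J. iexp (t j * Y j x))) = (PROD j:J. \<integral>x. iexp (t j * Y j x) \<partial>M)"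
 shows "indep_vars (%_. borel) Y J"
proof (cases "J = {}")
 case True
 then show ?thesis by (simp add: indep_vars_def indep_sets_def)
next
 case False
 \<comment> \<open>On \<open>L\<close> the exponentials have already been replaced by indicators.
   The frequencies \<open>t\<close> stay arbitrary in the induction, because the step lets the
   frequency of the coordinate \<open>k\<close> vary.\<close>
 have mix: "(LINT x|M. (PROD j:L. indicator (B j) (Y j x)) * (PROD j:J - L. iexp (t j * Y j x)))
 = (PROD j:L. of_real (prob (Y j -` B j \<inter> space M))) * (PROD j:J - L. \<integral>x. iexp (t j * Y j x) \<partial>M)"
 if "L \<subseteq> J" "finite L" and B: "!!j. B j : sets borel" for L t B
 using that(2,1)
 proof (induction L arbitrary: t)
 case empty
 show ?case unfolding prod.empty mult_1 Diff_empty by (rule char)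
 next
 case (insert k L)
 have k: "k : J" "k \<notin> L" "finite (J - insert k L)" using insert J by auto
 have JL: "J - L = insert k (J - insert k L)" using insert by auto
 define Ph where "Ph x = (PROD j:L. indicator (B j) (Y j x)) * (PROD j:J - insert k L. iexp (t j * Y j x))" for x
 have mi: "(%x. indicator (B j) (Y j x) :: complex) : borel_measurable M" if "j : J" for j
 using measurable_compose[OF Y[OF that] borel_measurable_indicator[OF B]] .
 have me: "(%x. iexp (s * Y j x)) : borel_measurable M" if "j : J" for j s
 by (rule measurable_compose[OF Y[OF that]]) measurable
 have Ph_meas: "Ph : borel_measurable M"
 unfolding Ph_def by (intro borel_measurable_times borel_measurable_prod mi me) (use insert.prems in auto)
 have IH: "(LINT x|M. Ph x * iexp (s * Y k x)) = (PROD j:L. of_real (prob (Y j -` B j \<inter> space M))) *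
 ((LINT x|M. iexp (s * Y k x)) * (PROD j:J - insert k L. \<integral>x. iexp (t j * Y j x) \<partial>M))" for s
 proof -
 have e1: "(PROD j:J - L. iexp ((t(k := s)) j * Y j x)) = iexp (s * Y k x) * (PROD j:J - insert k L. iexp (t j * Y j x))" for x
 unfolding JL using k by (subst prod.insert) (auto intro!: prod.cong)
 have e2: "(PROD j:J - L. \<integral>x. iexp ((t(k := s)) j * Y j x) \<partial>M) = (LINT x|M. iexp (s * Y k x)) * (PROD j:J - insert k L. \<integral>x. iexp (t j * Y j x) \<partial>M)"
 unfolding JL using k by (subst prod.insert) (auto intro!: prod.cong)
 have I: "(LINT x|M. (PROD j:L. indicator (B j) (Y j x)) * (PROD j:J - L. iexp ((t(k := s)) j * Y j x)))
 = (PROD j:L. of_real (prob (Y j -` B j \<inter> space M))) * (PROD j:J - L. \<integral>x. iexp ((t(k := s)) j * Y j x) \<partial>M)"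
 by (rule insert.IH) (use insert.prems in auto)
 have e3: "(%x. Ph x * iexp (s * Y k x)) = (%x. (PROD j:L. indicator (B j) (Y j x)) * (iexp (s * Y k x) * (PROD j:J - insert k L. iexp (t j * Y j x))))"
 by (rule ext) (simp only: Ph_def mult_ac)
 show ?thesis unfolding e3 by (rule I[unfolded e1 e2])
 qed
 have IH0: "(LINT x|M. Ph x) = (PROD j:L. of_real (prob (Y j -` B j \<inter> space M))) * (PROD j:J - insert k L. \<integral>x. iexp (t j * Y j x) \<partial>M)"
 using IH[of 0] by (simp add: prob_space)
 have "(LINT x|M. Ph x * indicator (B k) (Y k x)) = (LINT x|M. Ph x) * prob (Y k -` B k \<inter> space M)"
 proof (rule char_weight_complex[OF Y[OF k(1)] Ph_meas])
 have "norm (PROD j:L. indicator (B j) (Y j x) :: complex) <= 1" for x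
 unfolding prod_norm[symmetric] by (intro prod_le_1) (auto simp: indicator_def)
 moreover have "norm (PROD j:J - insert k L. iexp (t j * Y j x)) = 1" for x
 unfolding prod_norm[symmetric] by simp
 ultimately show "norm (Ph x) <= 1" for x by (simp add: Ph_def norm_mult)
 show "(LINT x|M. Ph x * iexp (s * Y k x)) = (LINT x|M. Ph x) * (LINT x|M. iexp (s * Y k x))" for s
 unfolding IH IH0 by (simp only: mult_ac)
 qed (rule B)
 note fin = this
 have e: "(PROD j:insert k L. indicator (B j) (Y j x)) * (PROD j:J - insert k L. iexp (t j * Y j x))
 = Ph x * indicator (B k) (Y k x)" for x
 unfolding prod.insert[OF insert.hyps] Ph_def by (simp only: mult_ac)
 show ?case unfolding e unfolding fin IH0 prod.insert[OF insert.hyps] by (simp only: mult_ac)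
 qed
 have prob_eq: "prob (\<Inter>j\<in>J. Y j -` B j \<inter> space M) = (PROD j:J. prob (Y j -` B j \<inter> space M))"
 if B: "!!j. B j : sets borel" for B
 proof -
 have "complex_of_real (prob (\<Inter>j\<in>J. Y j -` B j \<inter> space M)) = (LINT x|M. indicator (\<Inter>j\<in>J. Y j -` B j \<inter> space M) x)"
 proof -
 have "(\<Inter>j\<in>J. Y j -` B j \<inter> space M) : sets M"
 by (intro sets.finite_INT[OF J False] measurable_sets[OF Y B])
 moreover have "(LINT x|M. indicator D x) = complex_of_real (LINT x|M. indicator D x)" for D
 by (simp only: integral_complex_of_real[symmetric] of_real_indicator)
 ultimately show ?thesis by (simp add: Int_absorb2 sets.sets_into_space)
 qed
 also have "... = (LINT x|M. (PROD j:J. indicator (B j) (Y j x)))"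
 proof (intro lintegral_cong refl)
 fix x assume "x : space M"
 then show "indicator (\<Inter>j\<in>J. Y j -` B j \<inter> space M) x = (PROD j:J. indicator (B j) (Y j x) :: complex)"
 proof (cases "\<forall>j\<in>J. Y j x : B j")
 case True
 then have "(PROD j:J. indicator (B j) (Y j x) :: complex) = 1" by (intro prod.neutral) auto
 then show ?thesis using True \<open>x : space M\<close> by simp
 next
 case False
 then obtain j where j: "j : J" "Y j x \<notin> B j" by blast
 then have "(PROD j:J. indicator (B j) (Y j x) :: complex) = 0" using J by (intro prod_zero bexI[of _ j]) auto
 moreover have "x \<notin> (\<Inter>j\<in>J. Y j -` B j \<inter> space M)" using j by blast
 ultimately show ?thesis by simp
 qed
 qed
 also have "... = (PROD j:J. of_real (prob (Y j -` B j \<inter> space M)))"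
 using mix[of J B "%_. 0", OF subset_refl J B] by simp
 finally show ?thesis by (simp flip: of_real_prod)
 qed
 show ?thesis
 proof (subst indep_vars_finite[where E="%_. sets borel"])
 show "\<forall>A\<in>J \<rightarrow> sets borel. prob (\<Inter>j\<in>J. Y j -` A j \<inter> space M) = (PROD j:J. prob (Y j -` A j \<inter> space M))"
 proof
 fix A assume A: "A : J \<rightarrow> sets (borel :: real measure)"
 define B where "B j = (if j : J then A j else UNIV)" for j
 have "prob (\<Inter>j\<in>J. Y j -` B j \<inter> space M) = (PROD j:J. prob (Y j -` B j \<inter> space M))"
 by (rule prob_eq) (use A in \<open>auto simp: B_def\<close>)
 then show "prob (\<Inter>j\<in>J. Y j -` A j \<inter> space M) = (PROD j:J. prob (Y j -` A j \<inter> space M))"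
 proof -
 have "(\<Inter>j\<in>J. Y j -` B j \<inter> space M) = (\<Inter>j\<in>J. Y j -` A j \<inter> space M)"
 by (intro INF_cong refl) (simp add: B_def)
 moreover have "(PROD j:J. prob (Y j -` B j \<inter> space M)) = (PROD j:J. prob (Y j -` A j \<inter> space M))"
 by (intro prod.cong refl) (simp add: B_def)
 moreover assume "prob (\<Inter>j\<in>J. Y j -` B j \<inter> space M) = (PROD j:J. prob (Y j -` B j \<inter> space M))"
 ultimately show ?thesis by simp
 qed
 qed
 show "sets borel = sigma_sets (space borel) (sets (borel :: real measure))"
 using sets.sigma_sets_eq[of "borel :: real measure"] by simp
 show "Int_stable (sets (borel :: real measure))" by (auto simp: Int_stable_def)
 qed (use False J Y in auto)
qed

section \<open>Mean-square limits and Gaussian variables\<close>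

lemma ennreal_square_tendsto_0:
 fixes x :: "nat => ennreal"
 assumes "(%m. (x m)\<^sup>2) \<longlonglongrightarrow> 0" shows "x \<longlonglongrightarrow> 0"
proof (rule order_tendstoI)
 fix a :: ennreal assume "0 < a"
 then have "0 < a^2" by (simp add: power2_eq_square ennreal_zero_less_mult_iff)
 from order_tendstoD(2)[OF assms this] show "eventually (%m. x m < a) sequentially"
 proof eventually_elim
 case (elim m)
 then show ?case using power_mono[of a "x m" 2] by (meson not_le zero_le)
 qed
qed auto

text \<open>Extended non-negative, so that convergence to 0 can be stated before square
  integrability is known.\<close>

definition sq_dist :: "'a measure => ('a => real) => ('a => real) => ennreal" where
 "sq_dist M f g = (\<integral>\<^sup>+x. ennreal ((f x - g x)\<^sup>2) \<partial>M)"

lemma nn_integral_abs_mult_square_le: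
 assumes [measurable]: "f : borel_measurable M" "g : borel_measurable M"
 shows "(\<integral>\<^sup>+x. ennreal \<bar>f x * g x\<bar> \<partial>M)\<^sup>2 <= (\<integral>\<^sup>+x. ennreal ((f x)\<^sup>2) \<partial>M) * (\<integral>\<^sup>+x. ennreal ((g x)\<^sup>2) \<partial>M)"
 using Cauchy_Schwarz_nn_integral[of "%x. ennreal \<bar>f x\<bar>" M "%x. ennreal \<bar>g x\<bar>"]
 by (simp add: abs_mult ennreal_mult' ennreal_power)

text \<open>One approximant at finite distance is enough, by
  \<open>(f x)^2 <= 2 * (f x - fs m x)^2 + 2 * (fs m x)^2\<close>.\<close>

lemma square_integrable_limit:
 assumes [measurable]: "f : borel_measurable M" "!!m. fs m : borel_measurable M"
 and int: "!!m. integrable M (%x. (fs m x)\<^sup>2)" and lim: "(%m. sq_dist M f (fs m)) \<longlonglongrightarrow> 0"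
 shows "integrable M (%x. (f x)\<^sup>2)"
proof -
 have "eventually (%m. sq_dist M f (fs m) < 1) sequentially"
 using order_tendstoD(2)[OF lim, of 1] by simp
 then obtain m where m: "sq_dist M f (fs m) < 1" by (auto simp: eventually_sequentially)
 have "(f x)\<^sup>2 <= 2 * (f x - fs m x)\<^sup>2 + 2 * (fs m x)\<^sup>2" for x
 using zero_le_power2[of "f x - 2 * fs m x"] by (simp add: power2_eq_square algebra_simps)
 then have "(\<integral>\<^sup>+x. ennreal ((f x)\<^sup>2) \<partial>M) <= (\<integral>\<^sup>+x. 2 * ennreal ((f x - fs m x)\<^sup>2) + 2 * ennreal ((fs m x)\<^sup>2) \<partial>M)"
 by (intro nn_integral_mono) (simp add: ennreal_mult'[symmetric] ennreal_plus[symmetric] del: ennreal_plus flip: ennreal_numeral)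
 also have "... = 2 * sq_dist M f (fs m) + 2 * (\<integral>\<^sup>+x. ennreal ((fs m x)\<^sup>2) \<partial>M)"
 by (subst nn_integral_add) (auto simp: nn_integral_cmult sq_dist_def)
 also have "... < \<infinity>"
 proof -
 have "(\<integral>\<^sup>+x. ennreal ((fs m x)\<^sup>2) \<partial>M) < \<infinity>"
 using int[of m] by (simp add: integrable_iff_bounded)
 then show ?thesis using m by (auto simp: ennreal_mult_less_top less_top[symmetric] top_unique ennreal_mult_eq_top_iff)
 qed
 finally show ?thesis by (simp add: integrable_iff_bounded)
qed

lemma integrable_product_of_squares:
 fixes f g :: "'a => real"
 assumes [measurable]: "f : borel_measurable M" "g : borel_measurable M"
 and "integrable M (%x. (f x)\<^sup>2)" "integrable M (%x. (g x)\<^sup>2)"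
 shows "integrable M (%x. f x * g x)"
proof (rule integrable_dominated)
 show "integrable M (%x. (f x)\<^sup>2 + (g x)\<^sup>2)" using assms by simp
 have "\<bar>a * b\<bar> <= a^2 + b^2" for a b :: real
 proof -
 have "2 * (abs a * abs b) <= a^2 + b^2" using sum_squares_bound[of "abs a" "abs b"] by simp
 moreover have "0 <= abs a * abs b" by simp
 ultimately show ?thesis unfolding abs_mult by linarith
 qed
 then show "AE x in M. norm (f x * g x) <= norm ((f x)\<^sup>2 + (g x)\<^sup>2)" by auto
qed auto

text \<open>The bounded weight \<open>h\<close> covers both uses: \<open>h = 1\<close> for moments
  under the probability, and \<open>h = corr e e'\<close> for integrals over time. The difference of
  the products splits into three terms, each handled by Cauchy-Schwarz.\<close>

lemma inner_product_limit:
 fixes f g h :: "'a => real"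
 assumes [measurable]: "f : borel_measurable M" "!!m. fs m : borel_measurable M"
 "g : borel_measurable M" "!!m. gs m : borel_measurable M" "h : borel_measurable M"
 and int: "!!m. integrable M (%x. (fs m x)\<^sup>2)" "!!m. integrable M (%x. (gs m x)\<^sup>2)"
 and lim: "(%m. sq_dist M f (fs m)) \<longlonglongrightarrow> 0" "(%m. sq_dist M g (gs m)) \<longlonglongrightarrow> 0"
 and h: "!!x. x : space M ==> \<bar>h x\<bar> <= 1"
 shows "(%m. \<integral>x. h x * (fs m x * gs m x) \<partial>M) \<longlonglongrightarrow> (LINT x|M. h x * (f x * g x))"
proof -
 have f2: "integrable M (%x. (f x)\<^sup>2)" and g2: "integrable M (%x. (g x)\<^sup>2)"
 using square_integrable_limit[OF _ _ int(1) lim(1)] square_integrable_limit[OF _ _ int(2) lim(2)] by auto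
 have hint: "integrable M (%x. h x * F x)" if "integrable M F" for F :: "'a => real"
 by (rule integrable_dominated[OF that])
 (use that h in \<open>auto simp: abs_mult intro!: AE_I2 mult_left_le_one_le\<close>)
 have pf: "integrable M (%x. h x * (f x * g x))"
 by (intro hint integrable_product_of_squares f2 g2) auto
 have pm: "integrable M (%x. h x * (fs m x * gs m x))" for m
 by (intro hint integrable_product_of_squares int) auto
 define F2 where "F2 = (\<integral>\<^sup>+x. ennreal ((f x)\<^sup>2) \<partial>M)"
 define G2 where "G2 = (\<integral>\<^sup>+x. ennreal ((g x)\<^sup>2) \<partial>M)"
 have fin: "F2 ~= \<infinity>" "G2 ~= \<infinity>" using f2 g2 by (auto simp: F2_def G2_def integrable_iff_bounded)
 define t1 where "t1 m = (\<integral>\<^sup>+x. ennreal \<bar>(f x - fs m x) * g x\<bar> \<partial>M)" for m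
 define t2 where "t2 m = (\<integral>\<^sup>+x. ennreal \<bar>f x * (g x - gs m x)\<bar> \<partial>M)" for m
 define t3 where "t3 m = (\<integral>\<^sup>+x. ennreal \<bar>(f x - fs m x) * (g x - gs m x)\<bar> \<partial>M)" for m
 have t1: "t1 \<longlonglongrightarrow> 0"
 proof (rule ennreal_square_tendsto_0)
 have "(%m. sq_dist M f (fs m) * G2) \<longlonglongrightarrow> 0 * G2"
 using fin lim by (intro tendsto_mult_ennreal tendsto_const) auto
 then have "(%m. sq_dist M f (fs m) * G2) \<longlonglongrightarrow> 0" by simp
 then show "(%m. (t1 m)\<^sup>2) \<longlonglongrightarrow> 0"
 by (rule tendsto_sandwich[OF _ _ tendsto_const, rotated -1])
 (auto intro!: always_eventually simp: t1_def sq_dist_def G2_def nn_integral_abs_mult_square_le)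
 qed
 have t2: "t2 \<longlonglongrightarrow> 0"
 proof (rule ennreal_square_tendsto_0)
 have "(%m. F2 * sq_dist M g (gs m)) \<longlonglongrightarrow> F2 * 0"
 using fin lim by (intro tendsto_mult_ennreal tendsto_const) auto
 then have "(%m. F2 * sq_dist M g (gs m)) \<longlonglongrightarrow> 0" by simp
 then show "(%m. (t2 m)\<^sup>2) \<longlonglongrightarrow> 0"
 by (rule tendsto_sandwich[OF _ _ tendsto_const, rotated -1])
 (auto intro!: always_eventually simp: t2_def sq_dist_def F2_def nn_integral_abs_mult_square_le)
 qed
 have t3: "t3 \<longlonglongrightarrow> 0"
 proof (rule ennreal_square_tendsto_0)
 have "(%m. sq_dist M f (fs m) * sq_dist M g (gs m)) \<longlonglongrightarrow> 0 * 0"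
 using lim by (intro tendsto_mult_ennreal) auto
 then have "(%m. sq_dist M f (fs m) * sq_dist M g (gs m)) \<longlonglongrightarrow> 0" by simp
 then show "(%m. (t3 m)\<^sup>2) \<longlonglongrightarrow> 0"
 by (rule tendsto_sandwich[OF _ _ tendsto_const, rotated -1])
 (auto intro!: always_eventually simp: t3_def sq_dist_def nn_integral_abs_mult_square_le)
 qed
 have tri: "\<bar>p - q - r\<bar> <= abs q + abs r + abs p" for p q r :: real by linarith
 have le: "ennreal \<bar>(LINT x|M. h x * (fs m x * gs m x)) - (LINT x|M. h x * (f x * g x))\<bar> <= t1 m + t2 m + t3 m" for m
 proof -
 have "ennreal \<bar>(LINT x|M. h x * (fs m x * gs m x)) - (LINT x|M. h x * (f x * g x))\<bar>
 = ennreal (norm (LINT x|M. h x * (fs m x * gs m x) - h x * (f x * g x)))"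
 using pf pm by simp
 also have "... <= (\<integral>\<^sup>+x. ennreal (norm (h x * (fs m x * gs m x) - h x * (f x * g x))) \<partial>M)"
 using pf pm by (intro integral_norm_bound_ennreal) auto
 also have "... <= (\<integral>\<^sup>+x. ennreal \<bar>(f x - fs m x) * g x\<bar> + ennreal \<bar>f x * (g x - gs m x)\<bar> + ennreal \<bar>(f x - fs m x) * (g x - gs m x)\<bar> \<partial>M)"
 proof (rule nn_integral_mono)
 fix x assume "x : space M"
 have "norm (h x * (fs m x * gs m x) - h x * (f x * g x)) = \<bar>h x\<bar> * \<bar>fs m x * gs m x - f x * g x\<bar>"
 by (simp add: abs_mult flip: right_diff_distrib)
 also have "... <= 1 * \<bar>fs m x * gs m x - f x * g x\<bar>" by (intro mult_right_mono h \<open>x : space M\<close>) auto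
 also have "fs m x * gs m x - f x * g x = (f x - fs m x) * (g x - gs m x) - (f x - fs m x) * g x - f x * (g x - gs m x)"
 by (simp add: algebra_simps)
 also have "1 * \<bar>...\<bar> <= \<bar>(f x - fs m x) * g x\<bar> + \<bar>f x * (g x - gs m x)\<bar> + \<bar>(f x - fs m x) * (g x - gs m x)\<bar>"
 unfolding mult_1 by (rule tri)
 finally show "ennreal (norm (h x * (fs m x * gs m x) - h x * (f x * g x)))
 <= ennreal \<bar>(f x - fs m x) * g x\<bar> + ennreal \<bar>f x * (g x - gs m x)\<bar> + ennreal \<bar>(f x - fs m x) * (g x - gs m x)\<bar>"
 by (simp add: ennreal_leI flip: ennreal_plus)
 qed
 also have "... = t1 m + t2 m + t3 m"
 by (subst nn_integral_add, simp, simp, subst nn_integral_add) (auto simp: t1_def t2_def t3_def)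
 finally show ?thesis .
 qed
 have "(%m. t1 m + t2 m + t3 m) \<longlonglongrightarrow> 0 + 0 + 0" by (intro tendsto_add t1 t2 t3)
 then have "(%m. t1 m + t2 m + t3 m) \<longlonglongrightarrow> 0" by simp
 then have "(%m. ennreal \<bar>(LINT x|M. h x * (fs m x * gs m x)) - (LINT x|M. h x * (f x * g x))\<bar>) \<longlonglongrightarrow> 0"
 by (rule tendsto_sandwich[OF _ _ tendsto_const, rotated -1]) (auto intro!: always_eventually le)
 then have "(%m. \<bar>(LINT x|M. h x * (fs m x * gs m x)) - (LINT x|M. h x * (f x * g x))\<bar>) \<longlonglongrightarrow> 0"
 by (intro tendsto_ennrealD[of _ 0]) auto
 then show ?thesis by (simp add: LIM_zero_iff tendsto_rabs_zero_iff)
qed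

text \<open>A form of Gaussianity that passes to mean-square limits, degenerate ones included.
  Frequency 1 suffices because the property is used for all linear combinations at once.\<close>

definition gaussian_char :: "'a measure => ('a => real) => bool" where
 "gaussian_char P Y \<longleftrightarrow> Y : borel_measurable P & integrable P (%om. (Y om)\<^sup>2) & (LINT om|P. Y om) = 0
 & (LINT om|P. iexp (Y om)) = of_real (exp (- (LINT om|P. (Y om)\<^sup>2) / 2))"

lemma (in prob_space) centered_gaussian_char:
 assumes "centered_gaussian M Y" shows "gaussian_char M Y"
proof -
 have [measurable]: "Y : borel_measurable M" using assms by (simp add: centered_gaussian_def)
 consider "AE om in M. Y om = 0" | s where "0 < s" "distributed M lborel Y (normal_density 0 s)"
 using assms by (auto simp: centered_gaussian_def)
 then show ?thesis
 proof cases
 case 1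
 have "(LINT om|M. (Y om)\<^sup>2) = (LINT om|M. 0)" by (rule integral_cong_AE) (use 1 in auto)
 moreover have "(LINT om|M. Y om) = (LINT om|M. 0)" by (rule integral_cong_AE) (use 1 in auto)
 moreover have "(LINT om|M. iexp (Y om)) = (LINT om|M. 1)" by (rule integral_cong_AE) (use 1 in auto)
 moreover have "integrable M (%om. (Y om)\<^sup>2) \<longleftrightarrow> integrable M (%om. 0::real)"
 by (rule integrable_cong_AE) (use 1 in auto)
 ultimately show ?thesis by (simp add: gaussian_char_def prob_space)
 next
 case (2 s)
 have m: "(LINT om|M. Y om) = 0" using normal_distributed_expectation[OF 2] .
 have v: "variance Y = s^2" using normal_distributed_variance[OF 2] .
 have i: "integrable M (%om. (Y om)\<^sup>2)"
 proof -
 have "integrable lborel (%x. normal_density 0 s x * (x - 0) ^ 2)"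
 using 2 by (intro integrable_normal_moment) auto
 then show ?thesis using distributed_integrable[OF 2(2), of "%x. x\<^sup>2"] by simp
 qed
 have "(LINT om|M. iexp (Y om)) = (LINT om|M. iexp (s * (Y om / s)))" using 2 by simp
 also have "... = char (distr M borel (%om. Y om / s)) s"
 unfolding char_def by (subst integral_distr) auto
 also have "distr M borel (%om. Y om / s) = std_normal_distribution"
 proof -
 have "distributed M lborel (%om. (Y om - 0) / s) std_normal_density"
 using normal_standard_normal_convert[of s Y 0] 2 by simp
 then have "distr M lborel (%om. Y om / s) = std_normal_distribution"
 by (simp add: distributed_def)
 then show ?thesis by (metis distr_cong sets_lborel)
 qed
 finally have "(LINT om|M. iexp (Y om)) = of_real (exp (- s\<^sup>2 / 2))" by (simp add: char_std_normal_distribution)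
 then show ?thesis using m v i by (simp add: gaussian_char_def)
 qed
qed

text \<open>Mean-square convergence implies convergence in mean, and \<open>iexp\<close> is
  Lipschitz, so characteristic functions and second moments converge together.\<close>

lemma (in prob_space) gaussian_char_limit:
 assumes [measurable]: "Y : borel_measurable M" and G: "!!m. gaussian_char M (Ys m)"
 and lim: "(%m. sq_dist M Y (Ys m)) \<longlonglongrightarrow> 0"
 shows "gaussian_char M Y"
proof -
 have [measurable]: "Ys m : borel_measurable M" for m using G[of m] by (simp add: gaussian_char_def)
 have int: "integrable M (%om. (Ys m om)\<^sup>2)" for m using G[of m] by (simp add: gaussian_char_def)
 have Y2: "integrable M (%om. (Y om)\<^sup>2)" by (rule square_integrable_limit[OF _ _ int lim]) auto
 have iY: "integrable M Y" and iYs: "integrable M (Ys m)" for m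
 using square_integrable_imp_integrable[OF _ Y2] square_integrable_imp_integrable[OF _ int[of m]] by auto
 have "(%m. \<integral>om. 1 * (Ys m om * Ys m om) \<partial>M) \<longlonglongrightarrow> (LINT om|M. 1 * (Y om * Y om))"
 by (rule inner_product_limit) (use int lim in auto)
 then have lim2: "(%m. \<integral>om. (Ys m om)\<^sup>2 \<partial>M) \<longlonglongrightarrow> (LINT om|M. (Y om)\<^sup>2)" by (simp add: power2_eq_square)
 have "(%m. \<integral>om. 1 * (Ys m om * 1) \<partial>M) \<longlonglongrightarrow> (LINT om|M. 1 * (Y om * 1))"
 by (rule inner_product_limit) (use int lim in \<open>auto simp: sq_dist_def\<close>)
 then have "(%m. \<integral>om. Ys m om \<partial>M) \<longlonglongrightarrow> (LINT om|M. Y om)" by simp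
 moreover have "(%m. \<integral>om. Ys m om \<partial>M) = (%m. 0)" using G by (simp add: gaussian_char_def)
 ultimately have EY: "(LINT om|M. Y om) = 0"
 using LIMSEQ_unique[OF _ tendsto_const] by simp
 have "(%m. \<integral>\<^sup>+om. ennreal \<bar>(Y om - Ys m om) * 1\<bar> \<partial>M) \<longlonglongrightarrow> 0"
 proof (rule ennreal_square_tendsto_0)
 show "(%m. (\<integral>\<^sup>+om. ennreal \<bar>(Y om - Ys m om) * 1\<bar> \<partial>M)\<^sup>2) \<longlonglongrightarrow> 0"
 proof (rule tendsto_sandwich[OF _ _ tendsto_const lim])
 have "(\<integral>\<^sup>+om. ennreal \<bar>(Y om - Ys m om) * 1\<bar> \<partial>M)\<^sup>2 <= sq_dist M Y (Ys m)" for m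
 using nn_integral_abs_mult_square_le[of "%om. Y om - Ys m om" M "%_. 1"]
 by (simp add: sq_dist_def emeasure_space_1)
 then show "eventually (%m. (\<integral>\<^sup>+om. ennreal \<bar>(Y om - Ys m om) * 1\<bar> \<partial>M)\<^sup>2 <= sq_dist M Y (Ys m)) sequentially" by simp
 qed simp
 qed
 then have L1: "(%m. \<integral>\<^sup>+om. ennreal \<bar>Y om - Ys m om\<bar> \<partial>M) \<longlonglongrightarrow> 0" by simp
 have "(%m. ennreal (norm ((LINT om|M. iexp (Ys m om)) - (LINT om|M. iexp (Y om))))) \<longlonglongrightarrow> 0"
 proof (rule tendsto_sandwich[OF _ _ tendsto_const L1])
 have "ennreal (norm ((LINT om|M. iexp (Ys m om)) - (LINT om|M. iexp (Y om)))) <= (\<integral>\<^sup>+om. ennreal \<bar>Y om - Ys m om\<bar> \<partial>M)" for m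
 proof -
 have ii: "integrable M (%om. iexp (Z om))" if [measurable]: "Z : borel_measurable M" for Z
 by (rule integrable_const_bound[where B=1]) auto
 have "ennreal (norm ((LINT om|M. iexp (Ys m om)) - (LINT om|M. iexp (Y om)))) = ennreal (norm (LINT om|M. iexp (Ys m om) - iexp (Y om)))"
 by (subst lintegral_diff[OF ii ii]) auto
 also have "... <= (\<integral>\<^sup>+om. ennreal (norm (iexp (Ys m om) - iexp (Y om))) \<partial>M)"
 by (intro integral_norm_bound_ennreal Bochner_Integration.integrable_diff ii) auto
 also have "... <= (\<integral>\<^sup>+om. ennreal \<bar>Y om - Ys m om\<bar> \<partial>M)"
 proof (intro nn_integral_mono ennreal_leI)
 fix om
 have "iexp (Ys m om) - iexp (Y om) = iexp (Y om) * (iexp (Ys m om - Y om) - 1)"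
 by (simp add: algebra_simps exp_diff of_real_diff)
 then have "norm (iexp (Ys m om) - iexp (Y om)) = norm (iexp (Ys m om - Y om) - 1)" by (simp add: norm_mult)
 also have "... <= \<bar>Ys m om - Y om\<bar>" using iexp_approx1[of "Ys m om - Y om" 0] by simp
 finally show "norm (iexp (Ys m om) - iexp (Y om)) <= \<bar>Y om - Ys m om\<bar>" by (simp add: abs_minus_commute)
 qed
 finally show ?thesis .
 qed
 then show "eventually (%m. ennreal (norm ((LINT om|M. iexp (Ys m om)) - (LINT om|M. iexp (Y om)))) <= (\<integral>\<^sup>+om. ennreal \<bar>Y om - Ys m om\<bar> \<partial>M)) sequentially" by simp
 qed simp
 then have "(%m. norm ((LINT om|M. iexp (Ys m om)) - (LINT om|M. iexp (Y om)))) \<longlonglongrightarrow> 0"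
 by (intro tendsto_ennrealD[of _ 0]) auto
 then have l1: "(%m. \<integral>om. iexp (Ys m om) \<partial>M) \<longlonglongrightarrow> (LINT om|M. iexp (Y om))"
 by (simp add: tendsto_norm_zero_iff LIM_zero_iff)
 have "(%m. complex_of_real (exp (- (LINT om|M. (Ys m om)\<^sup>2) / 2))) \<longlonglongrightarrow> of_real (exp (- (LINT om|M. (Y om)\<^sup>2) / 2))"
 by (intro tendsto_intros lim2) auto
 moreover have "(%m. \<integral>om. iexp (Ys m om) \<partial>M) = (%m. complex_of_real (exp (- (LINT om|M. (Ys m om)\<^sup>2) / 2)))"
 using G by (simp add: gaussian_char_def)
 ultimately have "(LINT om|M. iexp (Y om)) = of_real (exp (- (LINT om|M. (Y om)\<^sup>2) / 2))"
 using LIMSEQ_unique[OF l1] by simp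
 then show ?thesis using Y2 EY by (simp add: gaussian_char_def)
qed

section \<open>Covariances and Gaussianity of the Wiener integrals\<close>

lemma image_atMost_mem: "p ` {..k} \<subseteq> S ==> i <= k ==> p i : S" for k :: nat
 by auto

text \<open>The model without sampling. Continuity of paths enters only in
  \<open>sampled_model\<close>, where paths are evaluated at random times.\<close>

locale wiener_model = prob_space P for P :: "'a measure" +
 fixes T :: real and rh sg1 sg2 :: "real => real" and B1 B2 X1 X2 :: "real => 'a => real"
 assumes T: "0 < T"
 and rho_meas: "rh : borel_measurable (restrict_space borel {0..T})"
 and sigma1_meas: "sg1 : borel_measurable (restrict_space borel {0..T})"
 and sigma2_meas: "sg2 : borel_measurable (restrict_space borel {0..T})"
 and rho_bound: "\<forall>t\<in>{0..T}. rh t : {-1..1}"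
 and sigma1_pos: "\<forall>t\<in>{0..T}. 0 < sg1 t" and sigma2_pos: "\<forall>t\<in>{0..T}. 0 < sg2 t"
 and sigma1_bdd: "bounded (sg1 ` {0..T})" and sigma2_bdd: "bounded (sg2 ` {0..T})"
 and gauss: "centered_gaussian_process P T B1 B2"
 and incr: "independent_increments P T B1 B2"
 and var1: "\<forall>t\<in>{0..T}. (LINT om|P. (B1 t om)\<^sup>2) = t"
 and var2: "\<forall>t\<in>{0..T}. (LINT om|P. (B2 t om)\<^sup>2) = t"
 and cov12: "\<forall>t\<in>{0..T}. (LINT om|P. B1 t om * B2 t om) = (LINT s:{0..t}|lborel. rh s)"
 and X1_meas: "\<forall>t\<in>{0..T}. X1 t : borel_measurable P"
 and X2_meas: "\<forall>t\<in>{0..T}. X2 t : borel_measurable P"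
 and X1_wiener: "\<forall>t\<in>{0..T}. is_wiener_integral P B1 t sg1 (%om. X1 t om - X1 0 om)"
 and X2_wiener: "\<forall>t\<in>{0..T}. is_wiener_integral P B2 t sg2 (%om. X2 t om - X2 0 om)"
begin

text \<open>A Boolean selects the component, so that variances and covariances become instances of
  one statement.\<close>

definition B :: "bool => real => 'a => real" where "B e = (if e then B1 else B2)"

definition Y :: "bool => real => 'a => real" where
 "Y e t om = (if e then X1 t om - X1 0 om else X2 t om - X2 0 om)"

text \<open>Cut off outside \<open>{0..T}\<close>, where the coefficients are unconstrained; the
  cut-off functions are Borel on the whole line.\<close>

definition vol :: "bool => real => real" where
 "vol e t = indicator {0..T} t * (if e then sg1 t else sg2 t)"

definition corr :: "bool => bool => real => real" where
 "corr e e' t = indicator {0..T} t * (if e = e' then 1 else rh t)"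

definition lin_span :: "('a => real) set" where
 "lin_span = {G. \<exists>F u w. finite F & F \<subseteq> {0..T} & G = (%om. SUM t:F. u t * B1 t om + w t * B2 t om)}"

lemma lin_span_gaussian:
 assumes "G : lin_span" shows "gaussian_char P G"
proof -
 obtain F u w where *: "finite F" "F \<subseteq> {0..T}" "G = (%om. SUM t:F. u t * B1 t om + w t * B2 t om)"
 using assms unfolding lin_span_def mem_Collect_eq by (elim exE conjE)
 show ?thesis unfolding *(3)
 by (rule centered_gaussian_char, rule gauss[unfolded centered_gaussian_process_def, rule_format]) (use * in simp)
qed

lemma lin_spanI: "finite F ==> F \<subseteq> {0..T} ==> (%om. SUM t:F. u t * B1 t om + w t * B2 t om) : lin_span"
 unfolding lin_span_def mem_Collect_eq by (rule exI[of _ F], rule exI[of _ u], rule exI[of _ w]) simp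

lemma lin_spanE:
 assumes "G : lin_span"
 obtains F u w where "finite F" "F \<subseteq> {0..T}" "G = (%om. SUM t:F. u t * B1 t om + w t * B2 t om)"
 using assms unfolding lin_span_def mem_Collect_eq by (elim exE conjE) (rule that)

lemma lin_span_B:
 assumes "t : {0..T}" shows "B e t : lin_span"
proof -
 have "(%om. SUM s:{t}. of_bool e * B1 s om + of_bool (\<not> e) * B2 s om) : lin_span"
 using assms by (intro lin_spanI) auto
 moreover have "(%om. SUM s:{t}. of_bool e * B1 s om + of_bool (\<not> e) * B2 s om) = B e t"
 by (rule ext) (simp add: B_def)
 ultimately show ?thesis by (simp only:)
qed

lemma lin_span_scale: "G : lin_span ==> (%om. a * G om) : lin_span"
proof -
 assume "G : lin_span"
 then obtain F u w where *: "finite F" "F \<subseteq> {0..T}" "G = (%om. SUM t:F. u t * B1 t om + w t * B2 t om)"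
 by (rule lin_spanE)
 have "(%om. a * G om) = (%om. SUM t:F. (a * u t) * B1 t om + (a * w t) * B2 t om)"
 unfolding *(3) by (simp add: sum_distrib_left algebra_simps)
 then show ?thesis using lin_spanI[OF *(1,2)] by (simp only:)
qed

lemma lin_span_add: "G : lin_span ==> H : lin_span ==> (%om. G om + H om) : lin_span"
proof -
 assume G: "G : lin_span" and H: "H : lin_span"
 obtain F u w where *: "finite F" "F \<subseteq> {0..T}" "G = (%om. SUM t:F. u t * B1 t om + w t * B2 t om)"
 using G by (rule lin_spanE)
 obtain F' u' w' where **: "finite F'" "F' \<subseteq> {0..T}" "H = (%om. SUM t:F'. u' t * B1 t om + w' t * B2 t om)"
 using H by (rule lin_spanE)
 define U where "U t = (if t : F then u t else 0) + (if t : F' then u' t else 0)" for t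
 define W where "W t = (if t : F then w t else 0) + (if t : F' then w' t else 0)" for t
 have "(SUM t:F. u t * B1 t om + w t * B2 t om) + (SUM t:F'. u' t * B1 t om + w' t * B2 t om)
 = (SUM t:F \<union> F'. U t * B1 t om + W t * B2 t om)" for om
 proof -
 have "(SUM t:F. u t * B1 t om + w t * B2 t om) = (SUM t:F \<union> F'. if t : F then u t * B1 t om + w t * B2 t om else 0)"
 using *(1) **(1) by (intro sum.mono_neutral_cong_left) auto
 moreover have "(SUM t:F'. u' t * B1 t om + w' t * B2 t om) = (SUM t:F \<union> F'. if t : F' then u' t * B1 t om + w' t * B2 t om else 0)"
 using *(1) **(1) by (intro sum.mono_neutral_cong_left) auto
 moreover have "(if t : F then u t * B1 t om + w t * B2 t om else 0) + (if t : F' then u' t * B1 t om + w' t * B2 t om else 0)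
 = U t * B1 t om + W t * B2 t om" for t
 unfolding U_def W_def by (simp add: algebra_simps)
 ultimately show ?thesis by (simp only: sum.distrib[symmetric])
 qed
 then have "(%om. G om + H om) = (%om. SUM t:F \<union> F'. U t * B1 t om + W t * B2 t om)" unfolding *(3) **(3) by (intro ext)
 then show ?thesis using lin_spanI[of "F \<union> F'" U W] *(1,2) **(1,2) by (simp only: finite_Un Un_least)
qed

lemma lin_span_diff: "G : lin_span ==> H : lin_span ==> (%om. G om - H om) : lin_span"
 using lin_span_add[of G "%om. -1 * H om"] lin_span_scale[of H "-1"] by simp

lemma lin_span_zero: "(%om. 0) : lin_span"
 using lin_spanI[of "{}"] by simp

lemma lin_span_sum: "(!!i. i : K ==> G i : lin_span) ==> (%om. SUM i:K. G i om) : lin_span"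
 by (induction K rule: infinite_finite_induct) (auto intro: lin_span_zero lin_span_add)

lemma lin_span_facts:
 assumes "G : lin_span"
 shows "G : borel_measurable P" "integrable P (%om. (G om)\<^sup>2)" "(LINT om|P. G om) = 0" "integrable P G"
proof -
 show 1: "G : borel_measurable P" "integrable P (%om. (G om)\<^sup>2)" "(LINT om|P. G om) = 0"
 using lin_span_gaussian[OF assms] by (auto simp: gaussian_char_def)
 show "integrable P G" using square_integrable_imp_integrable[OF 1(1,2)] .
qed

lemma lin_span_mult_integrable:
 assumes "G : lin_span" "H : lin_span" shows "integrable P (%om. G om * H om)"
 using lin_span_facts[OF assms(1)] lin_span_facts[OF assms(2)] by (intro integrable_product_of_squares) auto

lemma indicator_restrict_meas:
 fixes f :: "real => real"
 assumes "f : borel_measurable (restrict_space borel {0..T})"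
 shows "(%t. indicator {0..T} t * f t) : borel_measurable borel"
 using assms borel_measurable_restrict_space_iff[of "{0..T}" borel f] by simp

lemma corr_meas[measurable]: "corr e e' : borel_measurable borel"
proof (cases "e = e'")
 case True
 then have "corr e e' = indicator {0..T}" by (intro ext) (simp add: corr_def)
 then show ?thesis by simp
next
 case False
 then have "corr e e' = (%t. indicator {0..T} t * rh t)" by (intro ext) (simp add: corr_def)
 then show ?thesis using indicator_restrict_meas[OF rho_meas] by (simp only:)
qed

lemma vol_meas[measurable]: "vol e : borel_measurable borel"
proof -
 have "vol e = (%t. indicator {0..T} t * (if e then sg1 else sg2) t)" by (intro ext) (simp add: vol_def)
 then show ?thesis
 using indicator_restrict_meas[OF sigma1_meas] indicator_restrict_meas[OF sigma2_meas] by (cases e) (simp_all only: if_True if_False)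
qed

lemma corr_bound: "\<bar>corr e e' t\<bar> <= 1"
 using rho_bound by (auto simp: corr_def indicator_def abs_le_iff)

lemma B_zero: "AE om in P. B e 0 om = 0"
proof -
 have "(LINT om|P. (B e 0 om)\<^sup>2) = 0" using var1 var2 T by (auto simp: B_def)
 moreover have "integrable P (%om. (B e 0 om)\<^sup>2)" using lin_span_facts[OF lin_span_B] T by simp
 ultimately have "AE om in P. (B e 0 om)\<^sup>2 = 0" by (simp add: integral_nonneg_eq_0_iff_AE)
 then show ?thesis by simp
qed

lemma B_increment_orthogonal:
 assumes "0 <= s" "s <= t" "t <= T"
 shows "(LINT om|P. B e s om * (B e' t om - B e' s om)) = 0"
\<comment> \<open>Independence of increments is assumed only for strictly increasing times, so the
  degenerate cases are settled by \<open>B_zero\<close> and by an increment that is zero.\<close>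
proof (cases "s = 0 \<or> s = t")
 case True
 then show ?thesis
 proof
 assume "s = 0"
 have "(LINT om|P. B e s om * (B e' t om - B e' s om)) = (LINT om|P. 0)"
 by (rule integral_cong_AE) (use B_zero[of e] \<open>s = 0\<close> lin_span_facts(1)[OF lin_span_B] assms in auto)
 then show ?thesis by simp
 qed simp
next
 case False
 then have st: "0 < s" "s < t" using assms by auto
 define p where "p i = (if i = 0 then 0 else if i = 1 then s else t)" for i :: nat
 have "strict_mono_on {..2} p" using st by (auto simp: strict_mono_on_def p_def)
 moreover have "p ` {..2} \<subseteq> {0..T}" using st assms by (auto simp: p_def)
 ultimately have iv: "indep_vars (%_. borel \<Otimes>\<^sub>M borel)
 (%i om. (B1 (p (Suc i)) om - B1 (p i) om, B2 (p (Suc i)) om - B2 (p i) om)) {..<2}"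
 using incr unfolding independent_increments_def by blast
 \<comment> \<open>Projects the two independent vector increments over \<open>0, s, t\<close> to
   component \<open>e\<close> of the first and \<open>e'\<close> of the second.\<close>
 define sel where "sel = (%i z :: real \<times> real. if (if i = (0::nat) then e else e') then fst z else snd z)"
 have sel: "sel i : (borel \<Otimes>\<^sub>M borel) \<rightarrow>\<^sub>M borel" for i unfolding sel_def by measurable
 have "indep_vars (%_. borel) (%i om. sel i (B1 (p (Suc i)) om - B1 (p i) om, B2 (p (Suc i)) om - B2 (p i) om)) {..<2}"
 using indep_vars_compose2[OF iv, of sel "%_. borel"] sel by simp
 also have "(%i om. sel i (B1 (p (Suc i)) om - B1 (p i) om, B2 (p (Suc i)) om - B2 (p i) om))
 = (%i om. B (if i = 0 then e else e') (p (Suc i)) om - B (if i = 0 then e else e') (p i) om)"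
 by (auto simp: sel_def B_def fun_eq_iff)
 finally have iv2: "indep_vars (%_. borel) (%i om. B (if i = 0 then e else e') (p (Suc i)) om - B (if i = 0 then e else e') (p i) om) {..<2}" .
 have sp: "(%om. B c x om - B c y om) : lin_span" if "x : {0..T}" "y : {0..T}" for c x y
 using that by (intro lin_span_diff lin_span_B)
 have rng: "p i : {0..T}" for i using st assms by (auto simp: p_def)
 have "(LINT om|P. (PROD i:{..<2}. B (if i = 0 then e else e') (p (Suc i)) om - B (if i = 0 then e else e') (p i) om))
 = (PROD i:{..<2}. \<integral>om. B (if i = 0 then e else e') (p (Suc i)) om - B (if i = 0 then e else e') (p i) om \<partial>P)"
 by (intro indep_vars_lebesgue_integral iv2) (auto intro!: lin_span_facts sp rng)
 also have "... = 0"
 using lin_span_facts(3)[OF sp[OF rng rng]] by (auto simp: numeral_2_eq_2)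
 finally have "(LINT om|P. (B e s om - B e 0 om) * (B e' t om - B e' s om)) = 0"
 by (simp add: numeral_2_eq_2 p_def)
 moreover have "(LINT om|P. (B e s om - B e 0 om) * (B e' t om - B e' s om)) = (LINT om|P. B e s om * (B e' t om - B e' s om))"
 proof (rule integral_cong_AE)
 show "AE om in P. (B e s om - B e 0 om) * (B e' t om - B e' s om) = B e s om * (B e' t om - B e' s om)"
 using B_zero[of e] by eventually_elim simp
 qed (use lin_span_facts(1)[OF lin_span_B] st assms in auto)
 ultimately show ?thesis by simp
qed

text \<open>The correlation integrated up to the smaller time. Keeping a product of indicators lets
  the formula extend bilinearly to step functions.\<close>

definition covB :: "bool => bool => real => real => real" where
 "covB e e' s t = (LINT x|lborel. corr e e' x * (indicator {0<..s} x * indicator {0<..t} x))"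

lemma corr_integrable: "integrable lborel (corr e e')"
proof (rule integrable_dominated)
 show "integrable lborel (indicator {0..T} :: real => real)" by (rule integrable_indicator_Icc)
 have "\<bar>corr e e' x\<bar> <= indicator {0..T} x" for x
 using corr_bound[of e e' x] by (cases "x : {0..T}") (auto simp: corr_def)
 then show "AE x in lborel. norm (corr e e' x) <= norm (indicator {0..T} x :: real)" by auto
qed simp

lemma B_cov_same:
 assumes "t : {0..T}"
 shows "(LINT om|P. B e t om * B e' t om) = covB e e' t t"
proof -
 have 1: "covB e e' t t = (LINT x|lborel. indicator {0..t} x * (if e = e' then 1 else rh x))"
 unfolding covB_def
 proof (rule integral_cong_AE)
 show "AE x in lborel. corr e e' x * (indicator {0<..t} x * indicator {0<..t} x) = indicator {0..t} x * (if e = e' then 1 else rh x)"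
 using AE_lborel_singleton[of 0] by eventually_elim (use assms in \<open>auto simp: corr_def indicator_def\<close>)
 have "(%x. indicator {0..t} x * (if e = e' then 1 else rh x)) = (%x. indicator {0..t} x * corr e e' x)"
 using assms by (auto simp: corr_def indicator_def)
 then show "(%x. indicator {0..t} x * (if e = e' then 1 else rh x)) : borel_measurable lborel" by simp
 qed auto
 show ?thesis
 proof (cases "e = e'")
 case True
 then show ?thesis unfolding 1 using var1 var2 assms by (auto simp: B_def power2_eq_square)
 next
 case False
 have "(LINT om|P. B e t om * B e' t om) = (LINT om|P. B1 t om * B2 t om)"
 using False by (cases e) (auto simp: B_def mult.commute)
 also have "... = (LINT s:{0..t}|lborel. rh s)" using cov12 assms by simp
 finally show ?thesis unfolding 1 using False by (simp add: set_lebesgue_integral_def)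
 qed
qed

lemma B_cov:
 assumes "s : {0..T}" "t : {0..T}"
 shows "(LINT om|P. B e s om * B e' t om) = covB e e' s t"
proof -
 have le: "(LINT om|P. B e s om * B e' t om) = covB e e' s s" if "s <= t" "s : {0..T}" "t : {0..T}" for e e' s t
 proof -
 have "(LINT om|P. B e s om * B e' t om) = (LINT om|P. B e s om * B e' s om + B e s om * (B e' t om - B e' s om))"
 by (simp add: algebra_simps)
 also have "... = (LINT om|P. B e s om * B e' s om) + (LINT om|P. B e s om * (B e' t om - B e' s om))"
 using that by (intro Bochner_Integration.integral_add lin_span_mult_integrable lin_span_diff lin_span_B)
 finally show ?thesis using B_increment_orthogonal[of s t e e'] B_cov_same[of s e e'] that by simp
 qed
 have min: "covB e e' s t = covB e e' (min s t) (min s t)" for e e'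
 unfolding covB_def by (intro lintegral_cong refl) (auto simp: indicator_def)
 have sym: "corr e' e = corr e e'" by (auto simp: corr_def)
 show ?thesis
 proof (cases "s <= t")
 case True
 then show ?thesis using le[of s t] assms min by (simp add: min_def)
 next
 case False
 then have "(LINT om|P. B e s om * B e' t om) = covB e' e t t"
 using le[of t s e' e] assms by (simp add: mult.commute)
 then show ?thesis using min[of e e'] False by (simp add: covB_def sym min_def)
 qed
qed

lemma step_integral_span:
 assumes "mono_on {..k} p" "p ` {..k} \<subseteq> {0..T}"
 shows "step_integral (B e) k p c : lin_span"
proof -
 have "(%om. \<Sum>i<k. c i * (B e (p (Suc i)) om - B e (p i) om)) : lin_span"
 by (intro lin_span_sum lin_span_scale lin_span_diff lin_span_B image_atMost_mem[OF assms(2)]) auto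
 then show ?thesis unfolding step_integral_def .
qed

text \<open>The Wiener isometry for step functions, polarised and weighted by the correlation.
  Monotone nodes make the indicator of each cell a difference of two indicators starting at
  0.\<close>

lemma step_integral_cov:
 assumes p: "mono_on {..k} p" "p ` {..k} \<subseteq> {0..T}" and p': "mono_on {..k'} p'" "p' ` {..k'} \<subseteq> {0..T}"
 shows "(LINT om|P. step_integral (B e) k p c om * step_integral (B e') k' p' c' om)
 = (LINT x|lborel. corr e e' x * (step_fun k p c x * step_fun k' p' c' x))"
proof -
 let ?I = "%s x. indicator {0<..s} x :: real"
 have int: "integrable lborel (%x. corr e e' x * (?I s x * ?I t x))" for s t
 by (rule integrable_dominated[OF corr_integrable[of e e']]) (auto simp: indicator_def)
 have step: "step_fun k p c x = (\<Sum>i<k. c i * (?I (p (Suc i)) x - ?I (p i) x))"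
 if "mono_on {..k} p" "p ` {..k} \<subseteq> {0..T}" for k p c x
 unfolding step_fun_def
 proof (intro sum.cong refl)
 fix i assume "i : {..<k}"
 then have "p i <= p (Suc i)" "p i : {0..T}"
 using mono_onD[OF that(1), of i "Suc i"] image_atMost_mem[OF that(2), of i] by auto
 then show "c i * indicator {p i<..p (Suc i)} x = c i * (?I (p (Suc i)) x - ?I (p i) x)"
 by (auto simp: indicator_def)
 qed
 have rng: "p i : {0..T}" "p (Suc i) : {0..T}" if "i < k" for i using image_atMost_mem[OF p(2)] that by (meson less_imp_le, meson Suc_leI)
 have rng': "p' i : {0..T}" "p' (Suc i) : {0..T}" if "i < k'" for i using image_atMost_mem[OF p'(2)] that by (meson less_imp_le, meson Suc_leI)
 have cell: "(LINT om|P. (B e b om - B e a om) * (B e' d om - B e' cc om))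
 = (LINT x|lborel. corr e e' x * ((?I b x - ?I a x) * (?I d x - ?I cc x)))"
 if "a : {0..T}" "b : {0..T}" "cc : {0..T}" "d : {0..T}" for a b cc d
 proof -
 have "(LINT om|P. (B e b om - B e a om) * (B e' d om - B e' cc om))
 = (LINT om|P. B e b om * B e' d om - B e b om * B e' cc om - (B e a om * B e' d om - B e a om * B e' cc om))"
 by (simp add: algebra_simps)
 also have "... = covB e e' b d - covB e e' b cc - (covB e e' a d - covB e e' a cc)"
 using that by (simp add: lintegral_diff lin_span_mult_integrable lin_span_B B_cov)
 also have "... = (LINT x|lborel. corr e e' x * (?I b x * ?I d x) - corr e e' x * (?I b x * ?I cc x)
 - (corr e e' x * (?I a x * ?I d x) - corr e e' x * (?I a x * ?I cc x)))"
 unfolding covB_def using int by (simp add: lintegral_diff)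
 also have "... = (LINT x|lborel. corr e e' x * ((?I b x - ?I a x) * (?I d x - ?I cc x)))"
 by (simp add: algebra_simps)
 finally show ?thesis .
 qed
 have intB: "integrable P (%om. (B e b om - B e a om) * (B e' d om - B e' cc om))"
 if "a : {0..T}" "b : {0..T}" "cc : {0..T}" "d : {0..T}" for a b cc d
 using that by (intro lin_span_mult_integrable lin_span_diff lin_span_B)
 have intI: "integrable lborel (%x. corr e e' x * ((?I b x - ?I a x) * (?I d x - ?I cc x)))" for a b cc d
 by (rule integrable_dominated[OF corr_integrable[of e e']]) (auto simp: indicator_def)
 have "(LINT om|P. step_integral (B e) k p c om * step_integral (B e') k' p' c' om)
 = (LINT om|P. (\<Sum>i<k. \<Sum>j<k'. c i * c' j * ((B e (p (Suc i)) om - B e (p i) om) * (B e' (p' (Suc j)) om - B e' (p' j) om))))"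
 unfolding step_integral_def sum_product by (intro lintegral_cong refl sum.cong) (simp add: mult_ac)
 also have "... = (\<Sum>i<k. \<Sum>j<k'. c i * c' j * (LINT om|P. (B e (p (Suc i)) om - B e (p i) om) * (B e' (p' (Suc j)) om - B e' (p' j) om)))"
 using rng rng' by (subst Bochner_Integration.integral_sum; (intro Bochner_Integration.integrable_sum integrable_mult_right intB sum.cong refl)?; simp?)
 (subst Bochner_Integration.integral_sum; (intro integrable_mult_right intB)?; simp)
 also have "... = (\<Sum>i<k. \<Sum>j<k'. c i * c' j * (LINT x|lborel. corr e e' x * ((?I (p (Suc i)) x - ?I (p i) x) * (?I (p' (Suc j)) x - ?I (p' j) x))))"
 using rng rng' by (intro sum.cong refl) (simp add: cell)
 also have "... = (LINT x|lborel. (\<Sum>i<k. \<Sum>j<k'. c i * c' j * (corr e e' x * ((?I (p (Suc i)) x - ?I (p i) x) * (?I (p' (Suc j)) x - ?I (p' j) x)))))"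
 using intI by (simp add: Bochner_Integration.integral_sum)
 also have "... = (LINT x|lborel. corr e e' x * (step_fun k p c x * step_fun k' p' c' x))"
 unfolding step[OF p] step[OF p'] sum_product unfolding sum_distrib_left
 by (intro lintegral_cong refl sum.cong) (simp add: mult_ac)
 finally show ?thesis .
qed

lemma Y_approx:
 assumes t: "t : {0..T}"
 shows "\<exists>k p c. (\<forall>m :: nat. mono_on {..k m} (p m) & p m ` {..k m} \<subseteq> {0..T})
 & (%m. sq_dist lborel (%x. indicator {0..t} x * vol e x) (step_fun (k m) (p m) (c m))) \<longlonglongrightarrow> 0
 & (%m. sq_dist P (Y e t) (step_integral (B e) (k m) (p m) (c m))) \<longlonglongrightarrow> 0
 & Y e t : borel_measurable P"
proof -
 define sg where "sg = (if e then sg1 else sg2)"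
 have "Y True t = (%om. X1 t om - X1 0 om)" "Y False t = (%om. X2 t om - X2 0 om)"
 by (rule ext, simp add: Y_def)+
 then have W: "is_wiener_integral P (B e) t sg (Y e t)"
 using bspec[OF X1_wiener t] bspec[OF X2_wiener t] by (cases e) (simp_all only: B_def sg_def if_True if_False)
 have Ym: "Y e t : borel_measurable P" using W by (simp add: is_wiener_integral_def)
 have "\<exists>k p c. (\<forall>m :: nat. mono_on {..k m} (p m) & p m ` {..k m} \<subseteq> {0..t}) &
 (%m. \<integral>\<^sup>+s\<in>{0..t}. ennreal ((sg s - step_fun (k m) (p m) (c m) s)\<^sup>2) \<partial>lborel) \<longlonglongrightarrow> 0 &
 (%m. sq_dist P (Y e t) (step_integral (B e) (k m) (p m) (c m))) \<longlonglongrightarrow> 0"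
 using W unfolding is_wiener_integral_def sq_dist_def by (rule conjunct2)
 then obtain k p c where H: "(\<forall>m :: nat. mono_on {..k m} (p m) & p m ` {..k m} \<subseteq> {0..t}) &
 (%m. \<integral>\<^sup>+s\<in>{0..t}. ennreal ((sg s - step_fun (k m) (p m) (c m) s)\<^sup>2) \<partial>lborel) \<longlonglongrightarrow> 0 &
 (%m. sq_dist P (Y e t) (step_integral (B e) (k m) (p m) (c m))) \<longlonglongrightarrow> 0" by (elim exE)
 have *: "!!m :: nat. mono_on {..k m} (p m)" "!!m. p m ` {..k m} \<subseteq> {0..t}"
 "(%m. \<integral>\<^sup>+s\<in>{0..t}. ennreal ((sg s - step_fun (k m) (p m) (c m) s)\<^sup>2) \<partial>lborel) \<longlonglongrightarrow> 0"
 "(%m. sq_dist P (Y e t) (step_integral (B e) (k m) (p m) (c m))) \<longlonglongrightarrow> 0"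
 using H by auto
 \<comment> \<open>The nodes lie in \<open>{0..t}\<close>, so the approximating step functions
   vanish elsewhere and the distance over \<open>{0..t}\<close> is a distance over the line.\<close>
 have step0: "step_fun (k m) (p m) (c m) s = 0" if "s \<notin> {0..t}" for m s
 unfolding step_fun_def
 proof (intro sum.neutral ballI)
 fix i assume "i : {..<k m}"
 then have "p m i : {0..t}" "p m (Suc i) : {0..t}"
 using image_atMost_mem[OF *(2), of i m] image_atMost_mem[OF *(2), of "Suc i" m] by auto
 then show "c m i * indicator {p m i<..p m (Suc i)} s = 0" using that by (auto simp: indicator_def)
 qed
 have "(\<integral>\<^sup>+s\<in>{0..t}. ennreal ((sg s - step_fun (k m) (p m) (c m) s)\<^sup>2) \<partial>lborel)
 = sq_dist lborel (%x. indicator {0..t} x * vol e x) (step_fun (k m) (p m) (c m))" for m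
 unfolding sq_dist_def using t
 by (intro nn_integral_cong) (auto simp: indicator_def step0 vol_def sg_def)
 then have "(%m. sq_dist lborel (%x. indicator {0..t} x * vol e x) (step_fun (k m) (p m) (c m))) \<longlonglongrightarrow> 0"
 using *(3) by simp
 moreover have "p m ` {..k m} \<subseteq> {0..T}" for m using *(2)[of m] t by (intro subset_trans[OF *(2)]) auto
 ultimately show ?thesis using * Ym by (intro exI[of _ k] exI[of _ p] exI[of _ c]) simp
qed

lemma step_fun_facts:
 "step_fun k p c : borel_measurable borel" "integrable lborel (%x. (step_fun k p c x)\<^sup>2)"
proof -
 show [measurable]: "step_fun k p c : borel_measurable borel" unfolding step_fun_def by measurable
 have i1: "integrable lborel (step_fun k p c)"
 proof -
 have "integrable lborel (indicator {a<..b} :: real => real)" for a b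
 by (rule integrable_dominated[OF integrable_indicator_Icc[of a b]]) (auto simp: indicator_def)
 then show ?thesis
 unfolding step_fun_def by (intro Bochner_Integration.integrable_sum integrable_mult_right)
 qed
 define C where "C = (\<Sum>i<k. \<bar>c i\<bar>)"
 have "\<bar>step_fun k p c x\<bar> <= C" for x
 proof -
 have "\<bar>step_fun k p c x\<bar> <= (\<Sum>i<k. \<bar>c i * indicator {p i<..p (Suc i)} x\<bar>)" unfolding step_fun_def by (rule sum_abs)
 also have "... <= C" unfolding C_def by (intro sum_mono) (auto simp: indicator_def)
 finally show ?thesis .
 qed
 then have "\<bar>step_fun k p c x\<bar> * \<bar>step_fun k p c x\<bar> <= C * \<bar>step_fun k p c x\<bar>" for x by (intro mult_right_mono) auto
 then show "integrable lborel (%x. (step_fun k p c x)\<^sup>2)"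
 by (intro integrable_dominated[OF integrable_mult_right[OF i1, of C]] AE_I2)
 (auto simp: power2_eq_square abs_mult intro: order_trans[OF _ mult_right_mono[OF abs_ge_self]])
qed

text \<open>Both sides are limits of the isometry for approximating step functions, one under the
  probability and one over time.\<close>

lemma Y_cov:
 assumes s: "s : {0..T}" and t: "t : {0..T}"
 shows "(LINT om|P. Y e s om * Y e' t om)
 = (LINT x|lborel. corr e e' x * (indicator {0..s} x * vol e x * (indicator {0..t} x * vol e' x)))"
 "integrable P (%om. (Y e s om)\<^sup>2)" "Y e s : borel_measurable P"
proof -
 obtain k p c where Hs: "(\<forall>m :: nat. mono_on {..k m} (p m) & p m ` {..k m} \<subseteq> {0..T})
 & (%m. sq_dist lborel (%x. indicator {0..s} x * vol (e) x) (step_fun (k m) (p m) (c m))) \<longlonglongrightarrow> 0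
 & (%m. sq_dist P (Y (e) (s)) (step_integral (B (e)) (k m) (p m) (c m))) \<longlonglongrightarrow> 0
 & Y (e) (s) : borel_measurable P"
 using Y_approx[OF s, of e] by (elim exE)
 have 1: "!!m :: nat. mono_on {..k m} (p m)" "!!m. p m ` {..k m} \<subseteq> {0..T}"
 "(%m. sq_dist lborel (%x. indicator {0..s} x * vol (e) x) (step_fun (k m) (p m) (c m))) \<longlonglongrightarrow> 0"
 "(%m. sq_dist P (Y (e) (s)) (step_integral (B (e)) (k m) (p m) (c m))) \<longlonglongrightarrow> 0"
 "Y (e) (s) : borel_measurable P"
 using Hs by auto
 obtain k' p' c' where Ht: "(\<forall>m :: nat. mono_on {..k' m} (p' m) & p' m ` {..k' m} \<subseteq> {0..T})
 & (%m. sq_dist lborel (%x. indicator {0..t} x * vol (e') x) (step_fun (k' m) (p' m) (c' m))) \<longlonglongrightarrow> 0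
 & (%m. sq_dist P (Y (e') (t)) (step_integral (B (e')) (k' m) (p' m) (c' m))) \<longlonglongrightarrow> 0
 & Y (e') (t) : borel_measurable P"
 using Y_approx[OF t, of e'] by (elim exE)
 have 2: "!!m :: nat. mono_on {..k' m} (p' m)" "!!m. p' m ` {..k' m} \<subseteq> {0..T}"
 "(%m. sq_dist lborel (%x. indicator {0..t} x * vol (e') x) (step_fun (k' m) (p' m) (c' m))) \<longlonglongrightarrow> 0"
 "(%m. sq_dist P (Y (e') (t)) (step_integral (B (e')) (k' m) (p' m) (c' m))) \<longlonglongrightarrow> 0"
 "Y (e') (t) : borel_measurable P"
 using Ht by auto
 note sp = lin_span_facts[OF step_integral_span[OF 1(1,2)]] lin_span_facts[OF step_integral_span[OF 2(1,2)]]
 have "(%m. \<integral>om. 1 * (step_integral (B e) (k m) (p m) (c m) om * step_integral (B e') (k' m) (p' m) (c' m) om) \<partial>P)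
 \<longlonglongrightarrow> (LINT om|P. 1 * (Y e s om * Y e' t om))"
 by (rule inner_product_limit) (use 1 2 sp in auto)
 moreover have "(%m. \<integral>x. corr e e' x * (step_fun (k m) (p m) (c m) x * step_fun (k' m) (p' m) (c' m) x) \<partial>lborel)
 \<longlonglongrightarrow> (LINT x|lborel. corr e e' x * (indicator {0..s} x * vol e x * (indicator {0..t} x * vol e' x)))"
 by (rule inner_product_limit) (use 1 2 step_fun_facts corr_bound in auto)
 ultimately show "(LINT om|P. Y e s om * Y e' t om)
 = (LINT x|lborel. corr e e' x * (indicator {0..s} x * vol e x * (indicator {0..t} x * vol e' x)))"
 using LIMSEQ_unique by (simp add: step_integral_cov[OF 1(1,2) 2(1,2)])
 show "integrable P (%om. (Y e s om)\<^sup>2)"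
 by (rule square_integrable_limit[OF 1(5) sp(1) sp(2) 1(4)])
 show "Y e s : borel_measurable P" by (rule 1(5))
qed

text \<open>Approximants in \<open>lin_span\<close> are built one summand at a time. Elements of
  \<open>lin_span\<close> are Gaussian by assumption, and the property is closed under mean-square
  limits.\<close>

lemma Y_gaussian:
 assumes K: "finite K" and t: "!!i. i : K ==> t i : {0..T}"
 shows "gaussian_char P (%om. SUM i:K. al i * Y (e i) (t i) om)"
proof -
 have "\<exists>G. (\<forall>m::nat. G m : lin_span) & (%m. sq_dist P (%om. SUM i:K. al i * Y (e i) (t i) om) (G m)) \<longlonglongrightarrow> 0
 & (%om. SUM i:K. al i * Y (e i) (t i) om) : borel_measurable P"
 using K t
 proof (induction K)
 case empty
 show ?case by (rule exI[of _ "%m om. 0"]) (simp add: lin_span_zero sq_dist_def)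
 next
 case (insert i K)
 then obtain G where G: "!!m::nat. G m : lin_span" "(%m. sq_dist P (%om. SUM i:K. al i * Y (e i) (t i) om) (G m)) \<longlonglongrightarrow> 0"
 "(%om. SUM i:K. al i * Y (e i) (t i) om) : borel_measurable P" by auto
 have ti: "t i : {0..T}" using insert by auto
 obtain k p c where Hti: "(\<forall>m :: nat. mono_on {..k m} (p m) & p m ` {..k m} \<subseteq> {0..T})
 & (%m. sq_dist lborel (%x. indicator {0..t i} x * vol (e i) x) (step_fun (k m) (p m) (c m))) \<longlonglongrightarrow> 0
 & (%m. sq_dist P (Y (e i) (t i)) (step_integral (B (e i)) (k m) (p m) (c m))) \<longlonglongrightarrow> 0
 & Y (e i) (t i) : borel_measurable P"
 using Y_approx[OF ti, of "e i"] by (elim exE)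
 have 1: "!!m :: nat. mono_on {..k m} (p m)" "!!m. p m ` {..k m} \<subseteq> {0..T}"
 "(%m. sq_dist lborel (%x. indicator {0..t i} x * vol (e i) x) (step_fun (k m) (p m) (c m))) \<longlonglongrightarrow> 0"
 "(%m. sq_dist P (Y (e i) (t i)) (step_integral (B (e i)) (k m) (p m) (c m))) \<longlonglongrightarrow> 0"
 "Y (e i) (t i) : borel_measurable P"
 using Hti by auto
 define H where "H m = step_integral (B (e i)) (k m) (p m) (c m)" for m
 have H: "H m : lin_span" for m unfolding H_def by (rule step_integral_span[OF 1(1,2)])
 note [measurable] = 1(5) G(3) lin_span_facts(1)[OF H] lin_span_facts(1)[OF G(1)]
 define S where "S om = (SUM i:K. al i * Y (e i) (t i) om)" for om
 have [measurable]: "S : borel_measurable P" unfolding S_def by (rule G(3))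
 define G' where "G' m = (%om. al i * H m om + G m om)" for m
 have "G' m : lin_span" for m unfolding G'_def by (intro lin_span_add lin_span_scale H G(1))
 moreover have "(%m. sq_dist P (%om. al i * Y (e i) (t i) om + S om) (G' m)) \<longlonglongrightarrow> 0"
 proof (rule tendsto_sandwich[OF _ _ tendsto_const])
 have "sq_dist P (%om. al i * Y (e i) (t i) om + S om) (G' m)
 <= ennreal (2 * (al i)\<^sup>2) * sq_dist P (Y (e i) (t i)) (H m) + 2 * sq_dist P S (G m)" for m
 proof -
 have le: "(al i * y + z - (al i * h + g))\<^sup>2 <= 2 * (al i)\<^sup>2 * (y - h)\<^sup>2 + 2 * (z - g)\<^sup>2" for y z h g
 using zero_le_power2[of "al i * (y - h) - (z - g)"] by (simp add: power2_eq_square algebra_simps)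
 have "sq_dist P (%om. al i * Y (e i) (t i) om + S om) (G' m)
 <= (\<integral>\<^sup>+om. ennreal (2 * (al i)\<^sup>2) * ennreal ((Y (e i) (t i) om - H m om)\<^sup>2) + 2 * ennreal ((S om - G m om)\<^sup>2) \<partial>P)"
 unfolding sq_dist_def G'_def
 by (intro nn_integral_mono)
 (use le in \<open>simp add: ennreal_mult'[symmetric] ennreal_plus[symmetric] del: ennreal_plus flip: ennreal_numeral\<close>)
 also have "... = ennreal (2 * (al i)\<^sup>2) * sq_dist P (Y (e i) (t i)) (H m) + 2 * sq_dist P S (G m)"
 by (subst nn_integral_add) (auto simp: nn_integral_cmult sq_dist_def)
 finally show ?thesis .
 qed
 then show "eventually (%m. sq_dist P (%om. al i * Y (e i) (t i) om + S om) (G' m)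
 <= ennreal (2 * (al i)\<^sup>2) * sq_dist P (Y (e i) (t i)) (H m) + 2 * sq_dist P S (G m)) sequentially" by simp
 have "(%m. ennreal (2 * (al i)\<^sup>2) * sq_dist P (Y (e i) (t i)) (H m) + 2 * sq_dist P S (G m)) \<longlonglongrightarrow> ennreal (2 * (al i)\<^sup>2) * 0 + 2 * 0"
 using 1(4) G(2) unfolding H_def S_def[symmetric] by (intro tendsto_add tendsto_mult_ennreal tendsto_const) auto
 then show "(%m. ennreal (2 * (al i)\<^sup>2) * sq_dist P (Y (e i) (t i)) (H m) + 2 * sq_dist P S (G m)) \<longlonglongrightarrow> 0" by simp
 qed simp
 moreover have "(%om. al i * Y (e i) (t i) om + S om) : borel_measurable P" by measurable
 ultimately show ?case
 using insert.hyps by (intro exI[of _ G']) (simp add: S_def)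
 qed
 then obtain G where G: "!!m::nat. G m : lin_span" "(%m. sq_dist P (%om. SUM i:K. al i * Y (e i) (t i) om) (G m)) \<longlonglongrightarrow> 0"
 "(%om. SUM i:K. al i * Y (e i) (t i) om) : borel_measurable P" by auto
 show ?thesis by (rule gaussian_char_limit[OF G(3) lin_span_gaussian[OF G(1)] G(2)])
qed

end

section \<open>Traces over bipartite graphs without short cycles\<close>

text \<open>Excludes cycles of length four and six, the only ones that the traces of second and
  third powers can see.\<close>

definition cyclefree :: "'a set => 'b set => ('a => 'b => bool) => bool" where
 "cyclefree A B k \<longleftrightarrow>
 (\<forall>i\<in>A. \<forall>i'\<in>A. \<forall>j\<in>B. \<forall>l\<in>B. k i j --> k i' j --> k i l --> k i' l --> i = i' \<or> j = l) &
 (\<forall>i1\<in>A. \<forall>i2\<in>A. \<forall>i3\<in>A. \<forall>j1\<in>B. \<forall>j2\<in>B. \<forall>j3\<in>B. i1 ~= i2 --> i2 ~= i3 --> i3 ~= i1 -->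
 k i1 j1 --> k i2 j1 --> k i2 j2 --> k i3 j2 --> k i3 j3 --> k i1 j3 --> j1 = j2 & j2 = j3)"

lemma sum_of_bool_eq:
 fixes f :: "'a => real"
 assumes "finite A" "a : A" shows "(SUM x:A. of_bool (x = a) * f x) = f a" "(SUM x:A. of_bool (a = x) * f x) = f a"
proof -
 have "(SUM x:A. of_bool (x = a) * f x) = (SUM x:A. if x = a then f x else 0)"
 by (intro sum.cong refl) simp
 then show "(SUM x:A. of_bool (x = a) * f x) = f a" using assms by simp
 then show "(SUM x:A. of_bool (a = x) * f x) = f a" by (simp add: eq_commute[of a])
qed

lemma sum_product3:
 fixes f g h :: "'a => real"
 shows "(SUM j:B. f j) * (SUM l:B. g l) * (SUM m:B. h m) = (SUM j:B. SUM l:B. SUM m:B. f j * g l * h m)"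
proof -
 have "(SUM j:B. f j) * (SUM l:B. g l) * H = (SUM j:B. SUM l:B. f j * g l * H)" for H
 unfolding sum_product by (simp only: sum_distrib_right)
 from this[of "SUM m:B. h m"] show ?thesis unfolding sum_distrib_left[of _ h] .
qed

context
 fixes A :: "'a set" and B :: "'b set" and k :: "'a => 'b => bool" and c :: "'a => 'b => real"
 assumes fin: "finite A" "finite B" and cf: "cyclefree A B k"
 and supp0: "\<forall>i\<in>A. \<forall>j\<in>B. \<not> k i j --> c i j = 0"
begin

lemma supp: "i : A ==> j : B ==> \<not> k i j ==> c i j = 0"
 using supp0 by blast

text \<open>The adjacency matrix of \<open>k\<close> times the transpose of \<open>c\<close>: twice
  the upper left block of the form times the covariance.\<close>

abbreviation (input) alpha where "alpha i i' \<equiv> (SUM j:B. of_bool (k i j) * c i' j)"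
abbreviation (input) row where "row i \<equiv> (SUM j:B. c i j)"
abbreviation (input) col where "col j \<equiv> (SUM i:A. c i j)"

lemma no_square:
 assumes "i : A" "i' : A" "j : B" "l : B" "k i j" "k i' j" "k i l" "k i' l"
 shows "i = i' \<or> j = l"
 using cf assms unfolding cyclefree_def by blast

lemma no_hexagon:
 assumes "i1 : A" "i2 : A" "i3 : A" "j1 : B" "j2 : B" "j3 : B" "i1 ~= i2" "i2 ~= i3" "i3 ~= i1"
 "k i1 j1" "k i2 j1" "k i2 j2" "k i3 j2" "k i3 j3" "k i1 j3"
 shows "j1 = j2 & j2 = j3"
 using conjunct2[OF cf[unfolded cyclefree_def], rule_format, OF assms] .

lemma alpha_diag: "i : A ==> alpha i i = row i"
 using supp by (intro sum.cong refl) auto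

text \<open>Two different columns \<open>j\<close> and \<open>l\<close>, both adjacent to
  \<open>i\<close> and \<open>i'\<close>, would form a square; hence the double sum collapses to its
  diagonal.\<close>

lemma alpha_pair:
 assumes "i : A" "i' : A" "i ~= i'" and f: "!!l. l : B ==> \<not> k i l ==> f l = 0" "!!l. l : B ==> \<not> k i' l ==> f l = 0"
 shows "alpha i i' * (SUM l:B. f l) = (SUM j:B. c i' j * f j)"
proof -
 have "alpha i i' * (SUM l:B. f l) = (SUM j:B. SUM l:B. of_bool (k i j) * c i' j * f l)"
 by (rule sum_product)
 also have "... = (SUM j:B. SUM l:B. of_bool (l = j) * (c i' j * f l))"
 proof (intro sum.cong refl)
 fix j l assume jl: "j : B" "l : B"
 show "of_bool (k i j) * c i' j * f l = of_bool (l = j) * (c i' j * f l)"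
 proof (cases "l = j")
 case True
 then show ?thesis using f(1)[OF jl(2)] by (cases "k i j") auto
 next
 case False
 then have "\<not> k i j \<or> \<not> k i' j \<or> \<not> k i l \<or> \<not> k i' l"
 using no_square[OF assms(1,2) jl] assms(3) by blast
 then show ?thesis using False supp[OF assms(2) jl(1)] f[OF jl(2)] by auto
 qed
 qed
 also have "... = (SUM j:B. c i' j * f j)"
 by (intro sum.cong refl) (simp add: sum_of_bool_eq fin)
 finally show ?thesis .
qed

text \<open>The same collapse for three rows: a surviving term whose columns are not all equal would
  be a hexagon.\<close>

lemma alpha_triple:
 assumes i: "i1 : A" "i2 : A" "i3 : A" "i1 ~= i2" "i2 ~= i3" "i3 ~= i1"
 shows "alpha i1 i2 * alpha i2 i3 * alpha i3 i1 = (SUM j:B. c i1 j * c i2 j * c i3 j)"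
proof -
 have "alpha i1 i2 * alpha i2 i3 * alpha i3 i1
 = (SUM j:B. SUM l:B. SUM m:B. (of_bool (k i1 j) * c i2 j) * (of_bool (k i2 l) * c i3 l) * (of_bool (k i3 m) * c i1 m))"
 by (rule sum_product3)
 also have "... = (SUM j:B. SUM l:B. SUM m:B. of_bool (l = j) * (of_bool (m = j) * (c i1 m * c i2 j * c i3 l)))"
 proof (intro sum.cong refl)
 fix j l m assume jl: "j : B" "l : B" "m : B"
 show "(of_bool (k i1 j) * c i2 j) * (of_bool (k i2 l) * c i3 l) * (of_bool (k i3 m) * c i1 m)
 = of_bool (l = j) * (of_bool (m = j) * (c i1 m * c i2 j * c i3 l))"
 proof (cases "l = j & m = j")
 case True
 then show ?thesis using supp[OF i(1) jl(1)] supp[OF i(2) jl(1)] supp[OF i(3) jl(1)]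
 by (cases "k i1 j"; cases "k i2 j"; cases "k i3 j") auto
 next
 case False
 then have "\<not> k i1 j \<or> \<not> k i2 j \<or> \<not> k i2 l \<or> \<not> k i3 l \<or> \<not> k i3 m \<or> \<not> k i1 m"
 using no_hexagon[OF i(1-3) jl i(4-6)] by blast
 then have "(of_bool (k i1 j) * c i2 j) * (of_bool (k i2 l) * c i3 l) * (of_bool (k i3 m) * c i1 m) = 0"
 using supp[OF i(2) jl(1)] supp[OF i(3) jl(2)] supp[OF i(1) jl(3)] by auto
 then show ?thesis using False by auto
 qed
 qed
 also have "... = (SUM j:B. c i1 j * c i2 j * c i3 j)"
 proof (intro sum.cong refl)
 fix j assume j: "j : B"
 have "(SUM l:B. SUM m:B. of_bool (l = j) * (of_bool (m = j) * (c i1 m * c i2 j * c i3 l)))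
 = (SUM l:B. of_bool (l = j) * (SUM m:B. of_bool (m = j) * (c i1 m * c i2 j * c i3 l)))"
 by (simp only: sum_distrib_left)
 also have "... = c i1 j * c i2 j * c i3 j"
 unfolding sum_of_bool_eq(1)[OF fin(2) j] ..
 finally show "(SUM l:B. SUM m:B. of_bool (l = j) * (of_bool (m = j) * (c i1 m * c i2 j * c i3 l))) = c i1 j * c i2 j * c i3 j" .
 qed
 finally show ?thesis .
qed

text \<open>Off the diagonal \<open>alpha_pair\<close> applies. On the diagonal the product is the
  full square of the row sum, and the excess over the collapsed value is corrected there.\<close>

lemma trace_square:
 "(SUM i:A. SUM i':A. alpha i i' * alpha i' i)
 = (SUM i:A. (row i)\<^sup>2) + (SUM j:B. (col j)\<^sup>2) - (SUM i:A. SUM j:B. (c i j)\<^sup>2)"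
proof -
 have "alpha i i' * alpha i' i = (SUM j:B. c i' j * c i j) + of_bool (i' = i) * ((row i)\<^sup>2 - (SUM j:B. (c i j)\<^sup>2))"
 if i: "i : A" "i' : A" for i i'
 proof (cases "i' = i")
 case True
 then show ?thesis using alpha_diag[OF i(1)] by (simp add: power2_eq_square)
 next
 case False
 have "alpha i i' * (SUM l:B. of_bool (k i' l) * c i l) = (SUM j:B. c i' j * (of_bool (k i' j) * c i j))"
 using i False supp by (intro alpha_pair) auto
 also have "... = (SUM j:B. c i' j * c i j)" using supp[OF i(2)] by (intro sum.cong refl) auto
 finally show ?thesis using False by simp
 qed
 then have "(SUM i:A. SUM i':A. alpha i i' * alpha i' i)
 = (SUM i:A. SUM i':A. (SUM j:B. c i' j * c i j) + of_bool (i' = i) * ((row i)\<^sup>2 - (SUM j:B. (c i j)\<^sup>2)))"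
 by (intro sum.cong refl) auto
 also have "... = (SUM i:A. SUM i':A. SUM j:B. c i' j * c i j) + (SUM i:A. (row i)\<^sup>2 - (SUM j:B. (c i j)\<^sup>2))"
 unfolding sum.distrib by (intro arg_cong2[where f="(+)"] refl sum.cong sum_of_bool_eq fin)
 also have "(SUM i:A. SUM i':A. SUM j:B. c i' j * c i j) = (SUM j:B. (col j)\<^sup>2)"
 proof -
 have "(SUM i:A. SUM i':A. SUM j:B. c i' j * c i j) = (SUM i:A. SUM j:B. SUM i':A. c i' j * c i j)"
 by (intro sum.cong refl sum.swap)
 also have "... = (SUM j:B. SUM i:A. SUM i':A. c i' j * c i j)" by (rule sum.swap)
 also have "... = (SUM j:B. (col j)\<^sup>2)"
 unfolding power2_eq_square sum_product by (intro sum.cong refl) (simp only: mult.commute)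
 finally show ?thesis .
 qed
 finally show ?thesis by (simp add: sum_subtractf)
qed

text \<open>Inclusion and exclusion over coincidences of the three rows. The collapsed value
  \<open>t\<close> is right for distinct rows; it is corrected by \<open>F\<close> on each of the
  three pair diagonals and by \<open>R\<close> where all rows agree.\<close>

lemma trace_cube:
 "(SUM i1:A. SUM i2:A. SUM i3:A. alpha i1 i2 * alpha i2 i3 * alpha i3 i1)
 = (SUM i:A. (row i) ^ 3) + (SUM j:B. (col j) ^ 3) + 2 * (SUM i:A. SUM j:B. (c i j) ^ 3)
 - 3 * (SUM i:A. SUM j:B. (c i j)\<^sup>2 * (row i + col j) - c i j * row i * col j)"
proof -
 define t where "t i1 i2 i3 = (SUM j:B. c i1 j * c i2 j * c i3 j)" for i1 i2 i3
 define s where "s i i' = (SUM j:B. c i j * c i' j)" for i i'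
 \<comment> \<open>Determined by the full diagonal, where \<open>t\<close>, three copies of
   \<open>F\<close> and \<open>R\<close> must add up to the cube of the row sum.\<close>
 define R where "R i = (row i) ^ 3 - 3 * (row i * s i i) + 2 * t i i i" for i
 define F where "F i i' = row i * s i i' - t i i i'" for i i'
 have pair: "alpha i i' * alpha i' i = s i i'" if i: "i : A" "i' : A" "i ~= i'" for i i'
 proof -
 have "alpha i i' * (SUM l:B. of_bool (k i' l) * c i l) = (SUM j:B. c i' j * (of_bool (k i' j) * c i j))"
 using i supp by (intro alpha_pair) auto
 also have "... = s i i'" unfolding s_def using supp[OF i(2)] by (intro sum.cong refl) auto
 finally show ?thesis .
 qed
 have pt: "alpha i1 i2 * alpha i2 i3 * alpha i3 i1
 = t i1 i2 i3 + of_bool (i2 = i1) * F i1 i3 + of_bool (i3 = i2) * F i2 i1 + of_bool (i3 = i1) * F i3 i2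
 + of_bool (i2 = i1) * (of_bool (i3 = i1) * R i1)"
 if i: "i1 : A" "i2 : A" "i3 : A" for i1 i2 i3
 proof -
 have ts: "t x y z = t y x z" "t x y z = t z x y" for x y z unfolding t_def by (simp_all add: mult_ac)
 consider "i2 = i1" "i3 = i1" | "i2 = i1" "i3 ~= i1" | "i2 ~= i1" "i3 = i1" | "i2 ~= i1" "i3 = i2" | "i2 ~= i1" "i3 ~= i1" "i3 ~= i2" by blast
 then show ?thesis
 proof cases
 case 1
 then show ?thesis using alpha_diag[OF i(1)] by (simp add: F_def R_def power3_eq_cube)
 next
 case 2
 have "alpha i1 i2 * alpha i2 i3 * alpha i3 i1 = alpha i1 i1 * (alpha i1 i3 * alpha i3 i1)" using 2 by (simp only: mult.assoc)
 also have "... = row i1 * s i1 i3" unfolding alpha_diag[OF i(1)] using pair[OF i(1,3)] 2 by simp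
 finally show ?thesis using 2 by (simp add: F_def)
 next
 case 3
 have "alpha i1 i2 * alpha i2 i3 * alpha i3 i1 = alpha i1 i1 * (alpha i1 i2 * alpha i2 i1)" using 3 by (simp only: mult_ac)
 also have "... = row i1 * s i1 i2" unfolding alpha_diag[OF i(1)] using pair[OF i(1,2)] 3 by simp
 finally show ?thesis using 3 ts(1)[of i1 i2 i1] by (simp add: F_def ts)
 next
 case 4
 have "alpha i1 i2 * alpha i2 i3 * alpha i3 i1 = alpha i2 i2 * (alpha i2 i1 * alpha i1 i2)" using 4 by (simp only: mult_ac)
 also have "... = row i2 * s i2 i1" unfolding alpha_diag[OF i(2)] using pair[OF i(2,1)] 4 by simp
 finally show ?thesis using 4 ts(2)[of i2 i2 i1] by (simp add: F_def ts)
 next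
 case 5
 then show ?thesis using alpha_triple[OF i] by (simp add: t_def)
 qed
 qed
 have "(SUM i1:A. SUM i2:A. SUM i3:A. alpha i1 i2 * alpha i2 i3 * alpha i3 i1)
 = (SUM i1:A. SUM i2:A. SUM i3:A. t i1 i2 i3 + of_bool (i2 = i1) * F i1 i3 + of_bool (i3 = i2) * F i2 i1 + of_bool (i3 = i1) * F i3 i2
 + of_bool (i2 = i1) * (of_bool (i3 = i1) * R i1))"
 by (intro sum.cong refl pt)
 also have "... = (SUM i1:A. SUM i2:A. SUM i3:A. t i1 i2 i3)
 + (SUM i1:A. SUM i2:A. SUM i3:A. of_bool (i2 = i1) * F i1 i3)
 + (SUM i1:A. SUM i2:A. SUM i3:A. of_bool (i3 = i2) * F i2 i1)
 + (SUM i1:A. SUM i2:A. SUM i3:A. of_bool (i3 = i1) * F i3 i2)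
 + (SUM i1:A. SUM i2:A. SUM i3:A. of_bool (i2 = i1) * (of_bool (i3 = i1) * R i1))"
 unfolding sum.distrib ..
 also have "(SUM i1:A. SUM i2:A. SUM i3:A. of_bool (i2 = i1) * F i1 i3) = (SUM i:A. SUM i':A. F i i')"
 unfolding sum_distrib_left[symmetric] by (intro sum.cong refl sum_of_bool_eq fin)
 also have "(SUM i1:A. SUM i2:A. SUM i3:A. of_bool (i3 = i2) * F i2 i1) = (SUM i1:A. SUM i2:A. F i2 i1)"
 by (intro sum.cong refl sum_of_bool_eq fin)
 also have "(SUM i1:A. SUM i2:A. F i2 i1) = (SUM i:A. SUM i':A. F i i')" by (rule sum.swap)
 also have "(SUM i1:A. SUM i2:A. SUM i3:A. of_bool (i3 = i1) * F i3 i2) = (SUM i:A. SUM i':A. F i i')"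
 by (intro sum.cong refl sum_of_bool_eq fin)
 also have "(SUM i1:A. SUM i2:A. SUM i3:A. of_bool (i2 = i1) * (of_bool (i3 = i1) * R i1)) = (SUM i:A. R i)"
 proof (intro sum.cong refl)
 fix i assume i: "i : A"
 show "(SUM i2:A. SUM i3:A. of_bool (i2 = i) * (of_bool (i3 = i) * R i)) = R i"
 unfolding sum_distrib_left[symmetric] sum_of_bool_eq(1)[OF fin(1) i] ..
 qed
 also have "(SUM i1:A. SUM i2:A. SUM i3:A. t i1 i2 i3) = (SUM j:B. (col j) ^ 3)"
 proof -
 have "(SUM i1:A. SUM i2:A. SUM i3:A. t i1 i2 i3) = (SUM i1:A. SUM i2:A. SUM j:B. SUM i3:A. c i1 j * c i2 j * c i3 j)"
 unfolding t_def by (intro sum.cong refl sum.swap)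
 also have "... = (SUM i1:A. SUM j:B. SUM i2:A. SUM i3:A. c i1 j * c i2 j * c i3 j)"
 by (intro sum.cong refl sum.swap)
 also have "... = (SUM j:B. SUM i1:A. SUM i2:A. SUM i3:A. c i1 j * c i2 j * c i3 j)"
 by (rule sum.swap)
 also have "... = (SUM j:B. (col j) ^ 3)"
 by (simp add: power3_eq_cube sum_distrib_left[symmetric] sum_distrib_right[symmetric])
 finally show ?thesis .
 qed
 also have FF: "(SUM i:A. SUM i':A. F i i') = (SUM i:A. SUM j:B. c i j * row i * col j - (c i j)\<^sup>2 * col j)"
 proof (intro sum.cong refl)
 fix i assume "i : A"
 have "(SUM i':A. F i i') = row i * (SUM i':A. s i i') - (SUM i':A. t i i i')"
 unfolding F_def sum_subtractf sum_distrib_left ..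
 also have "(SUM i':A. s i i') = (SUM j:B. c i j * col j)"
 unfolding s_def by (subst sum.swap) (simp only: sum_distrib_left)
 also have "(SUM i':A. t i i i') = (SUM j:B. (c i j)\<^sup>2 * col j)"
 unfolding t_def by (subst sum.swap) (simp only: sum_distrib_left power2_eq_square)
 also have "row i * (SUM j:B. c i j * col j) = (SUM j:B. c i j * row i * col j)"
 unfolding sum_distrib_left[of "row i"] by (intro sum.cong refl) (simp only: mult_ac)
 finally show "(SUM i':A. F i i') = (SUM j:B. c i j * row i * col j - (c i j)\<^sup>2 * col j)"
 by (simp only: sum_subtractf)
 qed
 also have "(SUM i:A. R i) = (SUM i:A. (row i) ^ 3) - 3 * (SUM i:A. SUM j:B. (c i j)\<^sup>2 * row i) + 2 * (SUM i:A. SUM j:B. (c i j) ^ 3)"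
 proof -
 have "row i * s i i = (SUM j:B. (c i j)\<^sup>2 * row i)" for i
 unfolding s_def sum_distrib_left[of "row i"] by (intro sum.cong refl) (simp only: power2_eq_square mult_ac)
 moreover have "t i i i = (SUM j:B. (c i j) ^ 3)" for i unfolding t_def by (simp add: power3_eq_cube)
 ultimately show ?thesis unfolding R_def by (simp add: sum.distrib sum_subtractf sum_distrib_left)
 qed
 finally show ?thesis
 by (simp add: sum_subtractf sum.distrib distrib_left)
qed

text \<open>The words with one passage through each off-diagonal block. Here too distinct rows
  collapse, and \<open>G\<close> corrects the diagonal.\<close>

lemma trace_mixed:
 fixes p :: "'a => real" and q :: "'b => real"
 shows "(SUM i:A. SUM i':A. alpha i i' * (SUM l:B. (of_bool (k i' l) * q l) * (of_bool (k i l) * p i)))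
 = (SUM i:A. SUM j:B. of_bool (k i j) * (p i * q j) * (row i + col j - c i j))"
proof -
 define f where "f i i' l = (of_bool (k i' l) * q l) * (of_bool (k i l) * p i)" for i i' l
 define G where "G i = row i * (SUM l:B. of_bool (k i l) * (p i * q l)) - (SUM j:B. of_bool (k i j) * (p i * q j) * c i j)" for i
 have pt: "alpha i i' * (SUM l:B. f i i' l) = (SUM j:B. of_bool (k i j) * (p i * q j) * c i' j) + of_bool (i' = i) * G i"
 if i: "i : A" "i' : A" for i i'
 proof (cases "i' = i")
 case True
 have "f i i l = of_bool (k i l) * (p i * q l)" for l by (simp add: f_def)
 then show ?thesis using True alpha_diag[OF i(1)] by (simp add: G_def)
 next
 case False
 have "alpha i i' * (SUM l:B. f i i' l) = (SUM j:B. c i' j * f i i' j)"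
 using i False by (intro alpha_pair) (auto simp: f_def)
 also have "... = (SUM j:B. of_bool (k i j) * (p i * q j) * c i' j)"
 using supp[OF i(2)] by (intro sum.cong refl) (auto simp: f_def)
 finally show ?thesis using False by simp
 qed
 have "(SUM i:A. SUM i':A. alpha i i' * (SUM l:B. f i i' l))
 = (SUM i:A. SUM i':A. (SUM j:B. of_bool (k i j) * (p i * q j) * c i' j) + of_bool (i' = i) * G i)"
 by (intro sum.cong refl pt)
 also have "... = (SUM i:A. (SUM j:B. of_bool (k i j) * (p i * q j) * col j) + G i)"
 proof (intro sum.cong refl)
 fix i assume i: "i : A"
 have "(SUM i':A. SUM j:B. of_bool (k i j) * (p i * q j) * c i' j) = (SUM j:B. of_bool (k i j) * (p i * q j) * col j)"
 by (subst sum.swap) (simp only: sum_distrib_left)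
 then show "(SUM i':A. (SUM j:B. of_bool (k i j) * (p i * q j) * c i' j) + of_bool (i' = i) * G i)
 = (SUM j:B. of_bool (k i j) * (p i * q j) * col j) + G i"
 unfolding sum.distrib sum_of_bool_eq(1)[OF fin(1) i] by simp
 qed
 also have "... = (SUM i:A. SUM j:B. of_bool (k i j) * (p i * q j) * (row i + col j - c i j))"
 proof (intro sum.cong refl)
 fix i
 have "row i * (SUM l:B. of_bool (k i l) * (p i * q l)) = (SUM l:B. of_bool (k i l) * (p i * q l) * row i)"
 by (simp add: sum_distrib_left sum_distrib_right mult.commute)
 then show "(SUM j:B. of_bool (k i j) * (p i * q j) * col j) + G i = (SUM j:B. of_bool (k i j) * (p i * q j) * (row i + col j - c i j))"
 unfolding G_def by (simp add: sum.distrib sum_subtractf distrib_left right_diff_distrib)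
 qed
 finally show ?thesis unfolding f_def .
qed

end

definition joint_cov :: "('a => real) => ('b => real) => ('a => 'b => real) => 'a + 'b => 'a + 'b => real" where
 "joint_cov p q c x y = (case x of
 Inl i => (case y of Inl i' => of_bool (i = i') * p i | Inr j => c i j)
 | Inr j => (case y of Inl i => c i j | Inr j' => of_bool (j = j') * q j))"

text \<open>Entries are halved because the symmetric form meets every overlapping pair
  twice.\<close>

definition overlap_form :: "('a => 'b => bool) => 'a + 'b => 'a + 'b => real" where
 "overlap_form k x y = (case x of
 Inl i => (case y of Inl i' => 0 | Inr j => of_bool (k i j) / 2)
 | Inr j => (case y of Inl i => of_bool (k i j) / 2 | Inr j' => 0))"

text \<open>In blocks the product has diagonal blocks \<open>al / 2\<close>, \<open>dl / 2\<close>
  and off-diagonal blocks \<open>ka / 2\<close>, \<open>\<mu> / 2\<close>. The closed forms for the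
  powers of \<open>al\<close> and \<open>dl\<close> are symmetric in rows and columns, so both
  blocks contribute equally. In the third power the six mixed words all equal \<open>V\<close>,
  which gives \<open>1 / 8 * (2 * AAA + 6 * V)\<close>.\<close>

lemma overlap_traces:
 fixes A :: "'a set" and B :: "'b set" and p :: "'a => real" and q :: "'b => real"
 assumes fin: "finite A" "finite B" and cf: "cyclefree A B k" and cf': "cyclefree B A (%j i. k i j)"
 and supp: "!!i j. i : A ==> j : B ==> \<not> k i j ==> c i j = 0"
 defines "I \<equiv> A <+> B" and "X \<equiv> mm (A <+> B) (overlap_form k) (joint_cov p q c)"
 shows "tr I (mm I X X) = 1 / 2 * ((SUM i:A. SUM j:B. p i * q j * of_bool (k i j))
 + (SUM i:A. (SUM j:B. c i j)\<^sup>2) + (SUM j:B. (SUM i:A. c i j)\<^sup>2) - (SUM i:A. SUM j:B. (c i j)\<^sup>2))"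
 and "tr I (mm I X (mm I X X)) = 1 / 4 * ((SUM i:A. (SUM j:B. c i j) ^ 3) + (SUM j:B. (SUM i:A. c i j) ^ 3)
 + 2 * (SUM i:A. SUM j:B. (c i j) ^ 3)
 + 3 * (SUM i:A. SUM j:B. of_bool (k i j) * (p i * q j) * ((SUM j:B. c i j) + (SUM i:A. c i j) - c i j))
 - 3 * (SUM i:A. SUM j:B. (c i j)\<^sup>2 * ((SUM j:B. c i j) + (SUM i:A. c i j)) - c i j * (SUM j:B. c i j) * (SUM i:A. c i j)))"
proof -
 define al where "al i i' = (SUM j:B. of_bool (k i j) * c i' j)" for i i'
 define dl where "dl j j' = (SUM i:A. of_bool (k i j) * c i j')" for j j'
 define ka where "ka i j = of_bool (k i j) * q j" for i j
 define \<mu> where "\<mu> j i = of_bool (k i j) * p i" for j i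
 have sumI: "(SUM x:I. f x) = (SUM i:A. f (Inl i)) + (SUM j:B. f (Inr j))" for f :: "'a + 'b => real"
 unfolding I_def by (simp add: sum.Plus fin)
 have X: "X (Inl i) (Inl i') = al i i' / 2" "X (Inr j) (Inr j') = dl j j' / 2"
 "j : B ==> X (Inl i) (Inr j) = ka i j / 2" "i : A ==> X (Inr j) (Inl i) = \<mu> j i / 2" for i i' j j'
 proof -
 show "X (Inl i) (Inl i') = al i i' / 2"
 unfolding X_def mm_def sumI[unfolded I_def] by (simp add: overlap_form_def joint_cov_def al_def sum_divide_distrib)
 show "X (Inr j) (Inr j') = dl j j' / 2"
 unfolding X_def mm_def sumI[unfolded I_def] by (simp add: overlap_form_def joint_cov_def dl_def sum_divide_distrib)
 have "(SUM l:B. of_bool (k i l) / 2 * (of_bool (l = j) * q l)) = of_bool (k i j) / 2 * q j" if "j : B"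
 using sum_of_bool_eq(1)[OF fin(2) that, of "%l. of_bool (k i l) / 2 * q l"] by (simp only: mult_ac)
 then show "X (Inl i) (Inr j) = ka i j / 2" if "j : B"
 using that unfolding X_def mm_def sumI[unfolded I_def] by (simp add: overlap_form_def joint_cov_def ka_def)
 have "(SUM l:A. of_bool (k l j) / 2 * (of_bool (l = i) * p l)) = of_bool (k i j) / 2 * p i" if "i : A"
 using sum_of_bool_eq(1)[OF fin(1) that, of "%l. of_bool (k l j) / 2 * p l"] by (simp only: mult_ac)
 then show "X (Inr j) (Inl i) = \<mu> j i / 2" if "i : A"
 using that unfolding X_def mm_def sumI[unfolded I_def] by (simp add: overlap_form_def joint_cov_def \<mu>_def)
 qed
 have supp1: "\<forall>i\<in>A. \<forall>j\<in>B. \<not> k i j --> c i j = 0" and supp2: "\<forall>j\<in>B. \<forall>i\<in>A. \<not> k i j --> c i j = 0"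
 using supp by blast+
 note T2 = trace_square[OF fin cf supp1, folded al_def]
 have T2': "(SUM j:B. SUM j':B. dl j j' * dl j' j) = (SUM i:A. SUM i':A. al i i' * al i' i)"
 unfolding T2 trace_square[OF fin(2,1) cf' supp2, folded dl_def] sum.swap[of _ A B] by simp
 note T3 = trace_cube[OF fin cf supp1, folded al_def]
 have T3': "(SUM j1:B. SUM j2:B. SUM j3:B. dl j1 j2 * dl j2 j3 * dl j3 j1) = (SUM i1:A. SUM i2:A. SUM i3:A. al i1 i2 * al i2 i3 * al i3 i1)"
 unfolding T3 trace_cube[OF fin(2,1) cf' supp2, folded dl_def] sum.swap[of _ A B]
 by (simp only: add.commute mult.commute mult.left_commute)
 define V where "V = (SUM i:A. SUM j:B. of_bool (k i j) * (p i * q j) * ((SUM j:B. c i j) + (SUM i:A. c i j) - c i j))"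
 have M: "(SUM i:A. SUM i':A. al i i' * (SUM l:B. ka i' l * \<mu> l i)) = V"
 using trace_mixed[OF fin cf supp1, of q p, folded al_def] unfolding ka_def \<mu>_def V_def .
 have M': "(SUM j:B. SUM j':B. dl j j' * (SUM l:A. \<mu> j' l * ka l j)) = V"
 using trace_mixed[OF fin(2,1) cf' supp2, of p q, folded dl_def] unfolding ka_def \<mu>_def V_def sum.swap[of _ A B]
 by (simp only: add.commute mult.commute mult.left_commute)
 have P: "(SUM i:A. SUM j:B. ka i j * \<mu> j i) = (SUM i:A. SUM j:B. p i * q j * of_bool (k i j))"
 by (intro sum.cong refl) (simp add: ka_def \<mu>_def)
 have P': "(SUM j:B. SUM i:A. \<mu> j i * ka i j) = (SUM i:A. SUM j:B. p i * q j * of_bool (k i j))"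
 unfolding P[symmetric] by (subst sum.swap) (simp only: mult.commute)
 have "tr I (mm I X X) = (SUM i:A. (SUM i':A. al i i' / 2 * (al i' i / 2)) + (SUM j:B. ka i j / 2 * (\<mu> j i / 2)))
 + (SUM j:B. (SUM i:A. \<mu> j i / 2 * (ka i j / 2)) + (SUM j':B. dl j j' / 2 * (dl j' j / 2)))"
 unfolding tr_def mm_def sumI by (intro arg_cong2[where f="(+)"] sum.cong refl) (simp_all add: X)
 also have "... = 1 / 4 * ((SUM i:A. SUM i':A. al i i' * al i' i) + (SUM i:A. SUM j:B. ka i j * \<mu> j i)
 + (SUM j:B. SUM i:A. \<mu> j i * ka i j) + (SUM j:B. SUM j':B. dl j j' * dl j' j))"
 by (simp add: sum.distrib sum_divide_distrib[symmetric] field_simps)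
 finally show "tr I (mm I X X) = 1 / 2 * ((SUM i:A. SUM j:B. p i * q j * of_bool (k i j))
 + (SUM i:A. (SUM j:B. c i j)\<^sup>2) + (SUM j:B. (SUM i:A. c i j)\<^sup>2) - (SUM i:A. SUM j:B. (c i j)\<^sup>2))"
 unfolding T2' P P' unfolding T2 by simp
 define AAA where "AAA = (SUM i1:A. SUM i2:A. SUM i3:A. al i1 i2 * al i2 i3 * al i3 i1)"
 have tr3: "tr I (mm I X (mm I X X)) = (SUM x:I. SUM y:I. SUM z:I. X x y * X y z * X z x)"
 unfolding tr_def mm_def sum_distrib_left by (simp only: mult.assoc)
 have AAB: "(SUM i:A. SUM i':A. SUM l:B. al i i' * ka i' l * \<mu> l i) = V"
 unfolding M[symmetric] sum_distrib_left by (simp only: mult.assoc)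
 have ABA: "(SUM i:A. SUM l:B. SUM i':A. ka i l * \<mu> l i' * al i' i) = V"
 proof -
 have "(SUM i:A. SUM l:B. SUM i':A. ka i l * \<mu> l i' * al i' i) = (SUM i:A. SUM i':A. SUM l:B. ka i l * \<mu> l i' * al i' i)"
 by (intro sum.cong refl sum.swap)
 also have "... = (SUM i':A. SUM i:A. SUM l:B. ka i l * \<mu> l i' * al i' i)" by (rule sum.swap)
 also have "... = V" unfolding AAB[symmetric] by (intro sum.cong refl) (simp only: mult_ac)
 finally show ?thesis .
 qed
 have BAA: "(SUM l:B. SUM i:A. SUM i':A. \<mu> l i * al i i' * ka i' l) = V"
 proof -
 have "(SUM l:B. SUM i:A. SUM i':A. \<mu> l i * al i i' * ka i' l) = (SUM i:A. SUM l:B. SUM i':A. \<mu> l i * al i i' * ka i' l)"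
 by (rule sum.swap)
 also have "... = (SUM i:A. SUM i':A. SUM l:B. \<mu> l i * al i i' * ka i' l)" by (intro sum.cong refl sum.swap)
 also have "... = V" unfolding AAB[symmetric] by (intro sum.cong refl) (simp only: mult_ac)
 finally show ?thesis .
 qed
 have BBA: "(SUM j:B. SUM j':B. SUM l:A. dl j j' * \<mu> j' l * ka l j) = V"
 unfolding M'[symmetric] sum_distrib_left by (simp only: mult.assoc)
 have BAB: "(SUM j:B. SUM l:A. SUM j':B. \<mu> j l * ka l j' * dl j' j) = V"
 proof -
 have "(SUM j:B. SUM l:A. SUM j':B. \<mu> j l * ka l j' * dl j' j) = (SUM j:B. SUM j':B. SUM l:A. \<mu> j l * ka l j' * dl j' j)"
 by (intro sum.cong refl sum.swap)
 also have "... = (SUM j':B. SUM j:B. SUM l:A. \<mu> j l * ka l j' * dl j' j)" by (rule sum.swap)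
 also have "... = V" unfolding BBA[symmetric] by (intro sum.cong refl) (simp only: mult_ac)
 finally show ?thesis .
 qed
 have ABB: "(SUM l:A. SUM j:B. SUM j':B. ka l j * dl j j' * \<mu> j' l) = V"
 proof -
 have "(SUM l:A. SUM j:B. SUM j':B. ka l j * dl j j' * \<mu> j' l) = (SUM j:B. SUM l:A. SUM j':B. ka l j * dl j j' * \<mu> j' l)"
 by (rule sum.swap)
 also have "... = (SUM j:B. SUM j':B. SUM l:A. ka l j * dl j j' * \<mu> j' l)" by (intro sum.cong refl sum.swap)
 also have "... = V" unfolding BBA[symmetric] by (intro sum.cong refl) (simp only: mult_ac)
 finally show ?thesis .
 qed
 have "(SUM x:I. SUM y:I. SUM z:I. X x y * X y z * X z x)
 = 1 / 8 * ((SUM i1:A. SUM i2:A. SUM i3:A. al i1 i2 * al i2 i3 * al i3 i1)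
 + (SUM i:A. SUM i':A. SUM l:B. al i i' * ka i' l * \<mu> l i)
 + (SUM i:A. SUM l:B. SUM i':A. ka i l * \<mu> l i' * al i' i)
 + (SUM l:A. SUM j:B. SUM j':B. ka l j * dl j j' * \<mu> j' l)
 + (SUM l:B. SUM i:A. SUM i':A. \<mu> l i * al i i' * ka i' l)
 + (SUM j:B. SUM l:A. SUM j':B. \<mu> j l * ka l j' * dl j' j)
 + (SUM j:B. SUM j':B. SUM l:A. dl j j' * \<mu> j' l * ka l j)
 + (SUM j1:B. SUM j2:B. SUM j3:B. dl j1 j2 * dl j2 j3 * dl j3 j1))"
 proof -
 have 1: "(SUM y:I. SUM z:I. X (Inl i) y * X y z * X z (Inl i)) = 1 / 8 * ((SUM i2:A. SUM i3:A. al i i2 * al i2 i3 * al i3 i)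
 + (SUM i':A. SUM l:B. al i i' * ka i' l * \<mu> l i) + (SUM l:B. SUM i':A. ka i l * \<mu> l i' * al i' i)
 + (SUM j:B. SUM j':B. ka i j * dl j j' * \<mu> j' i))" if "i : A" for i
 proof -
 have "(SUM y:I. SUM z:I. X (Inl i) y * X y z * X z (Inl i))
 = (SUM i2:A. (SUM i3:A. 1 / 8 * (al i i2 * al i2 i3 * al i3 i)) + (SUM l:B. 1 / 8 * (al i i2 * ka i2 l * \<mu> l i)))
 + (SUM j:B. (SUM i':A. 1 / 8 * (ka i j * \<mu> j i' * al i' i)) + (SUM j':B. 1 / 8 * (ka i j * dl j j' * \<mu> j' i)))"
 unfolding sumI using that by (intro arg_cong2[where f="(+)"] sum.cong refl) (simp_all add: X)
 then show ?thesis unfolding sum.distrib sum_distrib_left[symmetric] by (simp only: distrib_left add_ac)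
 qed
 have 2: "(SUM y:I. SUM z:I. X (Inr j) y * X y z * X z (Inr j)) = 1 / 8 * ((SUM i:A. SUM i':A. \<mu> j i * al i i' * ka i' j)
 + (SUM l:A. SUM j':B. \<mu> j l * ka l j' * dl j' j) + (SUM j':B. SUM l:A. dl j j' * \<mu> j' l * ka l j)
 + (SUM j2:B. SUM j3:B. dl j j2 * dl j2 j3 * dl j3 j))" if "j : B" for j
 proof -
 have "(SUM y:I. SUM z:I. X (Inr j) y * X y z * X z (Inr j))
 = (SUM i:A. (SUM i':A. 1 / 8 * (\<mu> j i * al i i' * ka i' j)) + (SUM j':B. 1 / 8 * (\<mu> j i * ka i j' * dl j' j)))
 + (SUM j':B. (SUM l:A. 1 / 8 * (dl j j' * \<mu> j' l * ka l j)) + (SUM j3:B. 1 / 8 * (dl j j' * dl j' j3 * dl j3 j)))"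
 unfolding sumI using that by (intro arg_cong2[where f="(+)"] sum.cong refl) (simp_all add: X)
 then show ?thesis unfolding sum.distrib sum_distrib_left[symmetric] by (simp only: distrib_left add_ac)
 qed
 have "(SUM x:I. SUM y:I. SUM z:I. X x y * X y z * X z x)
 = (SUM i:A. SUM y:I. SUM z:I. X (Inl i) y * X y z * X z (Inl i)) + (SUM j:B. SUM y:I. SUM z:I. X (Inr j) y * X y z * X z (Inr j))"
 by (rule sumI)
 then show ?thesis
 by (simp only: 1 2 sum.distrib sum_distrib_left[symmetric] distrib_left add_ac cong: sum.cong)
 qed
 then have "tr I (mm I X (mm I X X)) = 1 / 8 * (AAA + V + V + V + V + V + V + AAA)"
 unfolding tr3 AAB ABA ABB BAA BAB BBA T3' AAA_def .
 then have "tr I (mm I X (mm I X X)) = 1 / 4 * (AAA + 3 * V)" by simp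
 then show "tr I (mm I X (mm I X X)) = 1 / 4 * ((SUM i:A. (SUM j:B. c i j) ^ 3) + (SUM j:B. (SUM i:A. c i j) ^ 3)
 + 2 * (SUM i:A. SUM j:B. (c i j) ^ 3)
 + 3 * (SUM i:A. SUM j:B. of_bool (k i j) * (p i * q j) * ((SUM j:B. c i j) + (SUM i:A. c i j) - c i j))
 - 3 * (SUM i:A. SUM j:B. (c i j)\<^sup>2 * ((SUM j:B. c i j) + (SUM i:A. c i j)) - c i j * (SUM j:B. c i j) * (SUM i:A. c i j)))"
 unfolding AAA_def T3 V_def by simp
qed

section \<open>Overlap of the cells of two grids\<close>

lemma cell_subset:
 assumes "is_grid T g" "i : {1..fst g}"
 shows "0 <= snd g (i - 1)" "snd g (i - 1) < snd g i" "snd g i <= T" "cell g i \<subseteq> {0..T}"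
proof -
 have m: "strict_mono_on {..fst g} (snd g)" and s: "snd g 0 = 0" "snd g (fst g) = T" using assms(1) by (auto simp: is_grid_def)
 have mono: "snd g x <= snd g y" if "x <= y" "y <= fst g" for x y
 using strict_mono_onD[OF m, of x y] that by (cases "x = y") auto
 show "0 <= snd g (i - 1)" using mono[of 0 "i - 1"] assms(2) s by auto
 show "snd g (i - 1) < snd g i" using assms(2) by (intro strict_mono_onD[OF m]) auto
 show "snd g i <= T" using mono[of i "fst g"] assms(2) s by auto
 with \<open>0 <= snd g (i - 1)\<close> show "cell g i \<subseteq> {0..T}" by (auto simp: cell_def)
qed

lemma grid_le:
 assumes "is_grid T g" "i : {1..fst g}" "i' : {1..fst g}" "i < i'"
 shows "snd g i <= snd g (i' - 1)"
proof -
 have m: "strict_mono_on {..fst g} (snd g)" using assms(1) by (auto simp: is_grid_def)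
 show ?thesis
 proof (cases "i = i' - 1")
 case False
 then show ?thesis using assms by (intro less_imp_le strict_mono_onD[OF m]) auto
 qed simp
qed

lemma cells_disjoint:
 assumes "is_grid T g" "i : {1..fst g}" "i' : {1..fst g}" "i ~= i'"
 shows "cell g i \<inter> cell g i' = {}"
proof (cases "i < i'")
 case True
 then show ?thesis using grid_le[OF assms(1-3)] by (auto simp: cell_def)
next
 case False
 then show ?thesis using grid_le[OF assms(1,3,2)] assms(4) by (auto simp: cell_def)
qed

lemma sum_cells:
 assumes "is_grid T g"
 shows "(SUM I:cells g. f I) = (\<Sum>i=1..fst g. f (cell g i))"
proof -
 have "inj_on (cell g) {1..fst g}"
 proof (rule inj_onI, rule ccontr)
 fix i i' assume i: "i : {1..fst g}" "i' : {1..fst g}" "cell g i = cell g i'" "i ~= i'"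
 have "snd g i : cell g i" using cell_subset(2)[OF assms i(1)] by (simp add: cell_def)
 then show False using cells_disjoint[OF assms i(1,2,4)] i(3) by auto
 qed
 then show ?thesis unfolding cells_def by (simp add: sum.reindex)
qed

lemma sum_cell_indicator:
 assumes "is_grid T g"
 shows "(\<Sum>i=1..fst g. indicator (cell g i) x) = (indicator {0<..T} x :: real)"
proof -
 have m: "strict_mono_on {..fst g} (snd g)" and s: "snd g 0 = 0" "snd g (fst g) = T" using assms by (auto simp: is_grid_def)
 have "(\<Sum>i=1..n. indicator (cell g i) x) = (indicator {snd g 0<..snd g n} x :: real)" if "n <= fst g" for n
 using that
 proof (induction n)
 case (Suc n)
 have "snd g 0 <= snd g n" using strict_mono_onD[OF m, of 0 n] Suc.prems by (cases "n = 0") auto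
 moreover have "snd g n < snd g (Suc n)" using Suc.prems by (intro strict_mono_onD[OF m]) auto
 ultimately show ?case using Suc by (auto simp: cell_def indicator_def)
 qed simp
 then show ?thesis using s by force
qed

lemma overlap_iff:
 assumes "is_grid T g" "is_grid T h" "i : {1..fst g}" "j : {1..fst h}"
 shows "cell g i \<inter> cell h j ~= {} \<longleftrightarrow> snd g (i - 1) < snd h j & snd h (j - 1) < snd g i"
proof
 assume "cell g i \<inter> cell h j ~= {}"
 then show "snd g (i - 1) < snd h j & snd h (j - 1) < snd g i" by (auto simp: cell_def)
next
 assume "snd g (i - 1) < snd h j & snd h (j - 1) < snd g i"
 \<comment> \<open>Cells are closed on the right, so the smaller right endpoint is a common
   point.\<close>
 then have "min (snd g i) (snd h j) : cell g i \<inter> cell h j"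
 using cell_subset(2)[OF assms(1,3)] cell_subset(2)[OF assms(2,4)] by (auto simp: cell_def)
 then show "cell g i \<inter> cell h j ~= {}" by blast
qed

lemma overlap_monotone:
 assumes g: "is_grid T g" "is_grid T h" and i: "i : {1..fst g}" "i' : {1..fst g}" "j : {1..fst h}" "j' : {1..fst h}"
 and k: "cell g i \<inter> cell h j ~= {}" "cell g i' \<inter> cell h j' ~= {}" and less: "i < i'"
 shows "j <= j'"
proof (rule ccontr)
 assume "\<not> j <= j'"
 then have "snd h j' <= snd h (j - 1)" using grid_le[OF g(2) i(4,3)] by simp
 moreover have "snd h (j - 1) < snd g i" "snd g (i' - 1) < snd h j'"
 using k overlap_iff[OF g] i by auto
 moreover have "snd g i <= snd g (i' - 1)" by (rule grid_le[OF g(1) i(1,2) less])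
 ultimately show False by linarith
qed

text \<open>A strict order between two left vertices forces the weak order of their neighbours.
  Around a hexagon each of the three pairs gives a chain of inequalities between the right vertices,
  and any combination of the chains closes up to equalities.\<close>

lemma noncrossing_cyclefree:
 fixes A B :: "nat set"
 assumes nc: "!!i i' j j'. i : A ==> i' : A ==> j : B ==> j' : B ==> k i j ==> k i' j' ==> i < i' ==> j <= j'"
 shows "cyclefree A B k"
 unfolding cyclefree_def
proof (intro conjI ballI impI)
 fix i i' j l assume a: "i : A" "i' : A" "j : B" "l : B" "k i j" "k i' j" "k i l" "k i' l"
 show "i = i' \<or> j = l"
 proof (cases i i' rule: linorder_cases)
 case less
 then show ?thesis using nc[of i i' j l] nc[of i i' l j] a by auto
 next
 case greater
 then show ?thesis using nc[of i' i j l] nc[of i' i l j] a by auto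
 qed simp
next
 fix i1 i2 i3 j1 j2 j3
 assume a: "i1 : A" "i2 : A" "i3 : A" "j1 : B" "j2 : B" "j3 : B" "i1 ~= i2" "i2 ~= i3" "i3 ~= i1"
 "k i1 j1" "k i2 j1" "k i2 j2" "k i3 j2" "k i3 j3" "k i1 j3"
 have 12: "j3 <= j1 & j1 <= j2 & j3 <= j2" if "i1 < i2"
 using nc[of i1 i2 j3 j1] nc[of i1 i2 j1 j2] nc[of i1 i2 j3 j2] a that by auto
 have 21: "j1 <= j3 & j2 <= j1 & j2 <= j3" if "i2 < i1"
 using nc[of i2 i1 j1 j3] nc[of i2 i1 j2 j1] nc[of i2 i1 j2 j3] a that by auto
 have 23: "j1 <= j2 & j2 <= j3 & j1 <= j3" if "i2 < i3"
 using nc[of i2 i3 j1 j2] nc[of i2 i3 j2 j3] nc[of i2 i3 j1 j3] a that by auto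
 have 32: "j2 <= j1 & j3 <= j2 & j3 <= j1" if "i3 < i2"
 using nc[of i3 i2 j2 j1] nc[of i3 i2 j3 j2] nc[of i3 i2 j3 j1] a that by auto
 have 31: "j2 <= j3 & j3 <= j1 & j2 <= j1" if "i3 < i1"
 using nc[of i3 i1 j2 j3] nc[of i3 i1 j3 j1] nc[of i3 i1 j2 j1] a that by auto
 have 13: "j3 <= j2 & j1 <= j3 & j1 <= j2" if "i1 < i3"
 using nc[of i1 i3 j3 j2] nc[of i1 i3 j1 j3] nc[of i1 i3 j1 j2] a that by auto
 consider "i1 < i2" | "i2 < i1" using a by linarith
 then have d1: "j3 <= j1 & j1 <= j2 & j3 <= j2 \<or> j1 <= j3 & j2 <= j1 & j2 <= j3"
 by cases (simp_all add: 12 21)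
 consider "i2 < i3" | "i3 < i2" using a by linarith
 then have d2: "j1 <= j2 & j2 <= j3 & j1 <= j3 \<or> j2 <= j1 & j3 <= j2 & j3 <= j1"
 by cases (simp_all add: 23 32)
 consider "i3 < i1" | "i1 < i3" using a by linarith
 then have d3: "j2 <= j3 & j3 <= j1 & j2 <= j1 \<or> j3 <= j2 & j1 <= j3 & j1 <= j2"
 by cases (simp_all add: 31 13)
 show "j1 = j2" "j2 = j3" using d1 d2 d3 by presburger+
qed

lemma grid_cyclefree:
 assumes "is_grid T g" "is_grid T h"
 shows "cyclefree {1..fst g} {1..fst h} (%i j. cell g i \<inter> cell h j ~= {})"
 "cyclefree {1..fst h} {1..fst g} (%j i. cell g i \<inter> cell h j ~= {})"
proof -
 show "cyclefree {1..fst g} {1..fst h} (%i j. cell g i \<inter> cell h j ~= {})"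
 by (rule noncrossing_cyclefree) (rule overlap_monotone[OF assms])
 have "cyclefree {1..fst h} {1..fst g} (%j i. cell h j \<inter> cell g i ~= {})"
 by (rule noncrossing_cyclefree) (rule overlap_monotone[OF assms(2,1)])
 then show "cyclefree {1..fst h} {1..fst g} (%j i. cell g i \<inter> cell h j ~= {})"
 by (simp only: Int_commute)
qed

section \<open>Covariances of increments as set functions\<close>

context wiener_model begin

abbreviation "cv \<equiv> cov_on rh sg1 sg2"
abbreviation "mp2 \<equiv> mu2 rh sg1 sg2"
abbreviation "mp3 \<equiv> mu3 rh sg1 sg2"

text \<open>The density behind all three set functions: equal indices give the two variances, the
  pair \<open>True False\<close> the covariance, with \<open>vm\<close> as the integral over a
  set.\<close>

definition F :: "bool => bool => real => real" where
 "F e e' t = corr e e' t * (vol e t * vol e' t)"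

definition vm :: "bool => bool => real set => real" where
 "vm e e' A = (LINT t|lborel. F e e' t * indicator A t)"

lemma vol_bound: "\<exists>S>0. \<forall>e t. \<bar>vol e t\<bar> <= S"
proof -
 obtain S1 where S1: "\<forall>t\<in>{0..T}. \<bar>sg1 t\<bar> <= S1" using sigma1_bdd by (auto simp: bounded_iff)
 obtain S2 where S2: "\<forall>t\<in>{0..T}. \<bar>sg2 t\<bar> <= S2" using sigma2_bdd by (auto simp: bounded_iff)
 have "\<bar>vol e t\<bar> <= max 1 (max S1 S2)" for e t
 using bspec[OF S1, of t] bspec[OF S2, of t] by (cases "t : {0..T}"; cases e) (auto simp: vol_def)
 then show ?thesis by (intro exI[of _ "max 1 (max S1 S2)"]) auto
qed

definition S :: real where "S = (SOME S. S > 0 & (\<forall>e t. \<bar>vol e t\<bar> <= S))"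

lemma S: "0 < S" "\<bar>vol e t\<bar> <= S"
 using someI_ex[OF vol_bound] unfolding S_def[symmetric] by auto

lemma F_meas[measurable]: "F e e' : borel_measurable borel"
 unfolding F_def by measurable

lemma F_bound: "\<bar>F e e' t\<bar> <= S^2 * indicator {0..T} t"
proof (cases "t : {0..T}")
 case True
 have "\<bar>corr e e' t\<bar> * (\<bar>vol e t\<bar> * \<bar>vol e' t\<bar>) <= 1 * (S * S)"
 using S by (intro mult_mono corr_bound) auto
 then show ?thesis using True by (simp add: F_def abs_mult power2_eq_square)
qed (simp add: F_def vol_def)

lemma F_integrable: "integrable lborel (F e e')"
proof (rule integrable_dominated)
 show "integrable lborel (%t. S\<^sup>2 * indicator {0..T} t :: real)" by (intro integrable_mult_right integrable_indicator_Icc)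
 show "AE t in lborel. norm (F e e' t) <= norm (S^2 * indicator {0..T} t :: real)"
 using F_bound by (intro AE_I2) (simp add: abs_mult)
qed simp

lemma F_indicator_integrable: "A : sets borel ==> integrable lborel (%t. F e e' t * indicator A t)"
 by (rule integrable_dominated[OF F_integrable[of e e']]) (auto simp: indicator_def)

lemma cov_on_vm: "A \<subseteq> {0..T} ==> cv A = vm True False A"
 unfolding cov_on_def vm_def set_lebesgue_integral_def
 by (intro lintegral_cong refl) (auto simp: F_def corr_def vol_def indicator_def)

lemma var_on_vm: "A \<subseteq> {0..T} ==> var_on sg1 A = vm True True A" "A \<subseteq> {0..T} ==> var_on sg2 A = vm False False A"
 unfolding var_on_def vm_def set_lebesgue_integral_def
 by (intro lintegral_cong refl; auto simp: F_def corr_def vol_def indicator_def power2_eq_square)+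

lemma vm_empty: "vm e e' {} = 0" by (simp add: vm_def)

lemma vm_split:
 assumes "is_grid T h" "A : sets borel" "A \<subseteq> {0<..T}"
 shows "(\<Sum>j=1..fst h. vm e e' (A \<inter> cell h j)) = vm e e' A"
proof -
 have "(\<Sum>j=1..fst h. vm e e' (A \<inter> cell h j)) = (LINT t|lborel. (\<Sum>j=1..fst h. F e e' t * indicator (A \<inter> cell h j) t))"
 unfolding vm_def using assms(2)
 by (intro Bochner_Integration.integral_sum[symmetric] F_indicator_integrable) (auto simp: cell_def)
 also have "... = vm e e' A"
 unfolding vm_def
 proof (intro lintegral_cong refl)
 fix t
 have "(\<Sum>j=1..fst h. F e e' t * indicator (A \<inter> cell h j) t) = F e e' t * indicator A t * (\<Sum>j=1..fst h. indicator (cell h j) t)"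
 unfolding sum_distrib_left by (intro sum.cong refl) (simp add: indicator_inter_arith)
 also have "... = F e e' t * indicator A t"
 unfolding sum_cell_indicator[OF assms(1)] using assms(3) by (auto simp: indicator_def)
 finally show "(\<Sum>j=1..fst h. F e e' t * indicator (A \<inter> cell h j) t) = F e e' t * indicator A t" .
 qed
 finally show ?thesis .
qed

lemma vm_abs_le:
 assumes "a <= b" "A : sets borel" "A \<subseteq> {a..b}"
 shows "\<bar>vm e e' A\<bar> <= S^2 * (b - a)"
proof -
 have "\<bar>vm e e' A\<bar> <= (LINT t|lborel. \<bar>F e e' t * indicator A t\<bar>)" unfolding vm_def by (rule integral_abs_bound)
 also have "... <= (LINT t|lborel. S\<^sup>2 * indicator {a..b} t)"
 proof (rule integral_mono)
 fix t
 have "\<bar>F e e' t\<bar> <= S^2" using F_bound[of e e' t] by (cases "t : {0..T}") auto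
 then show "\<bar>F e e' t * indicator A t\<bar> <= S^2 * indicator {a..b} t"
 using assms(3) by (auto simp: abs_mult indicator_def)
 qed (intro integrable_abs F_indicator_integrable assms integrable_mult_right integrable_indicator_Icc)+
 finally show ?thesis using assms(1) by simp
qed

text \<open>Strictness matters: \<open>overlap_form_bound\<close> divides by the variances of the
  cells.\<close>

lemma vm_pos:
 assumes "0 <= a" "a < b" "b <= T" shows "0 < vm e e {a<..b}"
proof -
 have nn: "0 <= F e e t * indicator {a<..b} t" for t by (auto simp: F_def corr_def indicator_def)
 have "vm e e {a<..b} ~= 0"
 proof
 assume "vm e e {a<..b} = 0"
 then have "AE t in lborel. F e e t * indicator {a<..b} t = 0"
 using integral_nonneg_eq_0_iff_AE[OF F_indicator_integrable[of "{a<..b}" e e]] nn by (simp add: vm_def)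
 then have "AE t in lborel. t \<notin> {a<..b}"
 proof eventually_elim
 case (elim t)
 have "vol e t ~= 0" if "t : {a<..b}" using that assms sigma1_pos sigma2_pos by (cases e) (auto simp: vol_def less_imp_neq[symmetric])
 moreover have "corr e e t = 1" if "t : {a<..b}" using that assms by (auto simp: corr_def)
 ultimately show ?case using elim by (auto simp: F_def)
 qed
 then have "emeasure lborel {a<..b} = 0"
 by (subst (asm) AE_iff_measurable[where N="{a<..b}"]) auto
 then show False using assms by simp
 qed
 moreover have "0 <= vm e e {a<..b}" unfolding vm_def using nn by simp
 ultimately show ?thesis by linarith
qed

lemma increment_cov:
 assumes "0 <= a" "a <= b" "b <= T" "0 <= c" "c <= d" "d <= T"
 shows "(LINT om|P. (Y e b om - Y e a om) * (Y e' d om - Y e' c om)) = vm e e' ({a<..b} \<inter> {c<..d})"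
proof -
 define G where "G s t x = corr e e' x * (indicator {0..s} x * vol e x * (indicator {0..t} x * vol e' x))" for s t x
 have G: "G s t x = F e e' x * indicator ({0..s} \<inter> {0..t}) x" for s t x
 by (auto simp: G_def F_def indicator_def)
 have Gi: "integrable lborel (G s t)" for s t unfolding G by (rule F_indicator_integrable) auto
 have Yi: "integrable P (%om. Y e s om * Y e' t om)" if "s : {0..T}" "t : {0..T}" for s t
 using Y_cov(2,3)[OF that(1) that(1)] Y_cov(2,3)[OF that(2) that(2)] by (intro integrable_product_of_squares) auto
 have "(LINT om|P. (Y e b om - Y e a om) * (Y e' d om - Y e' c om))
 = (LINT om|P. Y e b om * Y e' d om - Y e b om * Y e' c om - (Y e a om * Y e' d om - Y e a om * Y e' c om))"
 by (simp add: algebra_simps)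
 also have "... = (LINT x|lborel. G b d x) - (LINT x|lborel. G b c x) - ((LINT x|lborel. G a d x) - (LINT x|lborel. G a c x))"
 using assms Yi by (simp add: lintegral_diff Y_cov(1) G_def)
 also have "... = (LINT x|lborel. G b d x - G b c x - (G a d x - G a c x))"
 using Gi by (simp add: lintegral_diff)
 also have "... = vm e e' ({a<..b} \<inter> {c<..d})"
 unfolding vm_def G using assms by (intro lintegral_cong refl) (auto simp: indicator_def)
 finally show ?thesis .
qed

end

section \<open>Eigenvalue bound by a weighted row-sum test\<close>

lemma sum_Plus_eq: "finite A ==> finite B ==> (SUM x:A <+> B. f x) = (SUM i:A. f (Inl i)) + (SUM j:B. f (Inr j))"
 by (simp add: sum.Plus)

lemma overlap_quadratic_form:
 assumes "finite A" "finite B"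
 shows "ip (A <+> B) z (mv (A <+> B) (overlap_form k) z) = (SUM i:A. SUM j:B. z (Inl i) * z (Inr j) * of_bool (k i j))"
proof -
 have "ip (A <+> B) z (mv (A <+> B) (overlap_form k) z)
 = (SUM i:A. SUM j:B. z (Inl i) * (of_bool (k i j) / 2 * z (Inr j))) + (SUM j:B. SUM i:A. z (Inr j) * (of_bool (k i j) / 2 * z (Inl i)))"
 unfolding ip_def mv_def by (simp add: sum_Plus_eq[OF assms] overlap_form_def sum_distrib_left)
 also have "(SUM j:B. SUM i:A. z (Inr j) * (of_bool (k i j) / 2 * z (Inl i))) = (SUM i:A. SUM j:B. z (Inr j) * (of_bool (k i j) / 2 * z (Inl i)))"
 by (rule sum.swap)
 also have "(SUM i:A. SUM j:B. z (Inl i) * (of_bool (k i j) / 2 * z (Inr j))) + ... = (SUM i:A. SUM j:B. z (Inl i) * z (Inr j) * of_bool (k i j))"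
 unfolding sum.distrib[symmetric] by (intro sum.cong refl) simp
 finally show ?thesis .
qed

text \<open>A Schur test. For \<open>u = Sg e\<close> with \<open>e\<close> of unit variance,
  Bessel's inequality against functions on one block bounds the sums of \<open>(x i)^2 / p i\<close>
  and of \<open>(y j)^2 / q j\<close> by 1. The products \<open>x i * y j\<close> are then split by
  a weighted arithmetic-geometric mean, and what remains are the row sums bounded by
  \<open>R\<close>.\<close>

lemma overlap_form_bound:
 fixes A :: "'a set" and B :: "'b set"
 assumes fin: "finite A" "finite B" and p: "!!i. i : A ==> 0 < p i" and q: "!!j. j : B ==> 0 < q j"
 and psd: "!!x. 0 <= ip (A <+> B) x (mv (A <+> B) (joint_cov p q c) x)"
 and e: "ip (A <+> B) e (mv (A <+> B) (joint_cov p q c) e) = 1"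
 and R: "!!i. i : A ==> (SUM j:B. of_bool (k i j) * q j) <= R" "!!j. j : B ==> (SUM i:A. of_bool (k i j) * p i) <= R"
 shows "\<bar>ip (A <+> B) (mv (A <+> B) (joint_cov p q c) e) (mv (A <+> B) (overlap_form k) (mv (A <+> B) (joint_cov p q c) e))\<bar> <= R"
proof -
 define u where "u = mv (A <+> B) (joint_cov p q c) e"
 have sym: "ip (A <+> B) e (mv (A <+> B) (joint_cov p q c) f) = ip (A <+> B) f u" for f
 proof -
 have "ip (A <+> B) u f = ip (A <+> B) e (mv (A <+> B) (joint_cov p q c) f)"
 unfolding u_def by (rule ip_mv_sym) (auto simp: joint_cov_def split: sum.splits)
 then show ?thesis by (simp add: ip_commute)
 qed
 \<comment> \<open>Expands the non-negative variance of \<open>e - f\<close>; the hypothesis on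
   \<open>f\<close> says that it is the projection of \<open>e\<close> onto its own
   direction.\<close>
 have bessel: "ip (A <+> B) f u <= 1" if f: "ip (A <+> B) f (mv (A <+> B) (joint_cov p q c) f) = ip (A <+> B) f u" for f
 proof -
 have "mv (A <+> B) (joint_cov p q c) (%x. e x - f x) = (%x. u x - mv (A <+> B) (joint_cov p q c) f x)"
 unfolding u_def mv_def by (rule ext) (simp add: right_diff_distrib sum_subtractf)
 then have "0 <= ip (A <+> B) e u - ip (A <+> B) e (mv (A <+> B) (joint_cov p q c) f) - (ip (A <+> B) f u - ip (A <+> B) f (mv (A <+> B) (joint_cov p q c) f))"
 using psd[of "%x. e x - f x"] by (simp add: ip_diff_left ip_diff_right)
 then show ?thesis unfolding sym f using e unfolding u_def[symmetric] by simp
 qed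
 define x where "x i = u (Inl i)" for i
 define y where "y j = u (Inr j)" for j
 have bx: "(SUM i:A. (x i)\<^sup>2 / p i) <= 1"
 proof -
 \<comment> \<open>Dividing by the variance of each cell makes the covariance applied to
   \<open>f\<close> reproduce \<open>u\<close> on the first block, as that block is
   diagonal.\<close>
 define f :: "'a + 'b => real" where "f z = (case z of Inl i => x i / p i | Inr j => 0)" for z
 have 1: "ip (A <+> B) f v = (SUM i:A. x i / p i * v (Inl i))" for v
 unfolding ip_def sum_Plus_eq[OF fin] by (simp add: f_def)
 have "mv (A <+> B) (joint_cov p q c) f (Inl i) = x i" if "i : A" for i
 proof -
 have "mv (A <+> B) (joint_cov p q c) f (Inl i) = (SUM l:A. of_bool (i = l) * (p i * (x l / p l)))"
 unfolding mv_def sum_Plus_eq[OF fin] by (simp add: f_def joint_cov_def mult.assoc)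
 then show ?thesis unfolding sum_of_bool_eq(2)[OF fin(1) that] using p[OF that] by simp
 qed
 then have "ip (A <+> B) f (mv (A <+> B) (joint_cov p q c) f) = ip (A <+> B) f u"
 unfolding 1 by (intro sum.cong refl) (simp add: x_def)
 then have "ip (A <+> B) f u <= 1" by (rule bessel)
 then show ?thesis unfolding 1 by (simp add: x_def power2_eq_square)
 qed
 have bt: "(SUM j:B. (y j)\<^sup>2 / q j) <= 1"
 proof -
 define f :: "'a + 'b => real" where "f z = (case z of Inl i => 0 | Inr j => y j / q j)" for z
 have 1: "ip (A <+> B) f v = (SUM j:B. y j / q j * v (Inr j))" for v
 unfolding ip_def sum_Plus_eq[OF fin] by (simp add: f_def)
 have "mv (A <+> B) (joint_cov p q c) f (Inr j) = y j" if "j : B" for j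
 proof -
 have "mv (A <+> B) (joint_cov p q c) f (Inr j) = (SUM l:B. of_bool (j = l) * (q j * (y l / q l)))"
 unfolding mv_def sum_Plus_eq[OF fin] by (simp add: f_def joint_cov_def mult.assoc)
 then show ?thesis unfolding sum_of_bool_eq(2)[OF fin(2) that] using q[OF that] by simp
 qed
 then have "ip (A <+> B) f (mv (A <+> B) (joint_cov p q c) f) = ip (A <+> B) f u"
 unfolding 1 by (intro sum.cong refl) (simp add: y_def)
 then have "ip (A <+> B) f u <= 1" by (rule bessel)
 then show ?thesis unfolding 1 by (simp add: y_def power2_eq_square)
 qed
 have xy: "\<bar>x i * y j\<bar> <= ((x i)\<^sup>2 / p i * q j + (y j)\<^sup>2 / q j * p i) / 2" if ij: "i : A" "j : B" for i j
 proof -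
 have pq: "0 < p i" "0 < q j" using p q ij by auto
 have "0 <= (\<bar>x i\<bar> * q j - \<bar>y j\<bar> * p i)\<^sup>2" by simp
 then have "2 * \<bar>x i * y j\<bar> * (p i * q j) <= (x i)\<^sup>2 * (q j)\<^sup>2 + (y j)\<^sup>2 * (p i)\<^sup>2"
 by (simp add: power2_diff power_mult_distrib abs_mult algebra_simps)
 then have "2 * \<bar>x i * y j\<bar> <= ((x i)\<^sup>2 * (q j)\<^sup>2 + (y j)\<^sup>2 * (p i)\<^sup>2) / (p i * q j)"
 using pq by (simp add: pos_le_divide_eq)
 also have "... = (x i)\<^sup>2 / p i * q j + (y j)\<^sup>2 / q j * p i"
 using pq by (simp add: add_divide_distrib power2_eq_square)
 finally show ?thesis by simp
 qed
 have "\<bar>SUM i:A. SUM j:B. x i * y j * of_bool (k i j)\<bar> <= (SUM i:A. \<bar>SUM j:B. x i * y j * of_bool (k i j)\<bar>)"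
 by (rule sum_abs)
 also have "... <= (SUM i:A. SUM j:B. \<bar>x i * y j * of_bool (k i j)\<bar>)" by (intro sum_mono sum_abs)
 also have "... <= (SUM i:A. SUM j:B. (x i)\<^sup>2 / p i / 2 * (of_bool (k i j) * q j) + (y j)\<^sup>2 / q j / 2 * (of_bool (k i j) * p i))"
 proof (intro sum_mono)
 fix i j assume "i : A" "j : B"
 then show "\<bar>x i * y j * of_bool (k i j)\<bar> <= (x i)\<^sup>2 / p i / 2 * (of_bool (k i j) * q j) + (y j)\<^sup>2 / q j / 2 * (of_bool (k i j) * p i)"
 using xy[of i j] by (cases "k i j") (simp_all add: add_divide_distrib)
 qed
 also have "... = (SUM i:A. SUM j:B. (x i)\<^sup>2 / p i / 2 * (of_bool (k i j) * q j)) + (SUM j:B. SUM i:A. (y j)\<^sup>2 / q j / 2 * (of_bool (k i j) * p i))"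
 unfolding sum.distrib by (subst (2) sum.swap) (rule refl)
 also have "... <= (SUM i:A. (x i)\<^sup>2 / p i / 2 * R) + (SUM j:B. (y j)\<^sup>2 / q j / 2 * R)"
 unfolding sum_distrib_left[symmetric] using p q less_imp_le
 by (intro add_mono sum_mono mult_left_mono R divide_nonneg_nonneg) (auto simp: less_imp_le)
 also have "... = ((SUM i:A. (x i)\<^sup>2 / p i) + (SUM j:B. (y j)\<^sup>2 / q j)) / 2 * R"
 by (simp add: sum_distrib_right sum_divide_distrib add_divide_distrib distrib_right)
 also have "... <= 1 * R"
 proof (rule mult_right_mono)
 have "A ~= {} \<or> B ~= {}" using e by (auto simp: ip_def sum_Plus_eq[OF fin])
 then show "0 <= R"
 proof
 assume "A ~= {}"
 then obtain i where i: "i : A" by blast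
 have "0 <= (SUM j:B. of_bool (k i j) * q j)" using q by (intro sum_nonneg mult_nonneg_nonneg) (auto simp: less_imp_le)
 then show ?thesis using R(1)[OF i] by linarith
 next
 assume "B ~= {}"
 then obtain j where j: "j : B" by blast
 have "0 <= (SUM i:A. of_bool (k i j) * p i)" using p by (intro sum_nonneg mult_nonneg_nonneg) (auto simp: less_imp_le)
 then show ?thesis using R(2)[OF j] by linarith
 qed
 qed (use bx bt in simp)
 finally show ?thesis unfolding u_def[symmetric] overlap_quadratic_form[OF fin] by (simp add: x_def y_def)
qed

section \<open>Gaussian quadratic forms as chaos sums\<close>

context prob_space begin

lemma gaussian_char_pair_integrable:
 assumes I: "finite I" and G: "!!al. gaussian_char M (%om. SUM x:I. al x * z x om)" and "x : I" "y : I"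
 shows "z x : borel_measurable M" "integrable M (%om. z x om * z y om)"
proof -
 have "gaussian_char M (z x)" if "x : I" for x
 using G[of "%y. of_bool (y = x)"] unfolding sum_of_bool_eq(1)[OF I that] .
 then show "z x : borel_measurable M" "integrable M (%om. z x om * z y om)"
 using assms(3,4) by (auto simp: gaussian_char_def intro!: integrable_product_of_squares)
qed

lemma ip_covariance:
 assumes I: "finite I" and G: "!!al. gaussian_char M (%om. SUM x:I. al x * z x om)"
 and cov: "!!x y. x : I ==> y : I ==> (LINT om|M. z x om * z y om) = Sg x y"
 shows "(LINT om|M. ip I u (%x. z x om) * ip I v (%x. z x om)) = ip I u (mv I Sg v)"
proof -
 note int = gaussian_char_pair_integrable(2)[OF I G]
 have "(LINT om|M. ip I u (%x. z x om) * ip I v (%x. z x om)) = (LINT om|M. (SUM x:I. SUM y:I. u x * v y * (z x om * z y om)))"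
 unfolding ip_def sum_product by (intro lintegral_cong sum.cong refl) simp
 also have "... = (SUM x:I. SUM y:I. \<integral>om. u x * v y * (z x om * z y om) \<partial>M)"
 by (subst Bochner_Integration.integral_sum, (intro Bochner_Integration.integrable_sum integrable_mult_right int; assumption),
 intro sum.cong refl Bochner_Integration.integral_sum integrable_mult_right int)
 also have "... = (SUM x:I. SUM y:I. u x * v y * Sg x y)"
 by (intro sum.cong refl) (simp add: cov)
 also have "... = ip I u (mv I Sg v)"
 unfolding ip_def mv_def sum_distrib_left by (intro sum.cong refl) simp
 finally show ?thesis .
qed

definition gaussian_diagonalization ::
 "'i set => ('i => 'a => real) => ('i => 'i => real) => ('i => 'i => real) => nat set => (nat => real) => (nat => 'a => real) => bool" where
 "gaussian_diagonalization I z Sg N J a \<eta> \<longleftrightarrow> finite J & indep_vars (%_. borel) \<eta> J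
 & (\<forall>j\<in>J. \<eta> j : borel_measurable M & distr M borel (\<eta> j) = std_normal_distribution
 & integrable M (%om. (\<eta> j om)\<^sup>2) & (LINT om|M. (\<eta> j om)\<^sup>2) = 1)
 & (AE om in M. ip I (%x. z x om) (mv I N (%x. z x om)) = (SUM j:J. a j * (\<eta> j om)\<^sup>2))
 & (\<forall>j\<in>J. \<exists>e. ip I e (mv I Sg e) = 1 & a j = ip I (mv I Sg e) (mv I N (mv I Sg e)))
 & (SUM j:J. (a j)\<^sup>2) = tr I (mm I (mm I N Sg) (mm I N Sg))
 & (SUM j:J. (a j) ^ 3) = tr I (mm I (mm I N Sg) (mm I (mm I N Sg) (mm I N Sg)))"

text \<open>The functionals \<open>e j\<close> give jointly Gaussian variables with identity
  covariance, so their joint characteristic function factorises and they are independent. Directions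
  of zero variance vanish almost surely, which supplies the condition under which the form is
  diagonal.\<close>

lemma gaussian_quadratic_form:
 fixes Sg N :: "'i => 'i => real"
 assumes I: "finite I" and G: "!!al. gaussian_char M (%om. SUM x:I. al x * z x om)"
 and cov: "!!x y. x : I ==> y : I ==> (LINT om|M. z x om * z y om) = Sg x y"
 and symN: "!!i l. i : I ==> l : I ==> N i l = N l i"
 shows "\<exists>J a \<eta>. gaussian_diagonalization I z Sg N J a \<eta>"
proof -
 define L where "L u om = ip I u (%x. z x om)" for u om
 have Lg: "gaussian_char M (L u)" for u using G[of u] unfolding L_def ip_def .
 note Lm = Lg[unfolded gaussian_char_def, THEN conjunct1]
 note Li = Lg[unfolded gaussian_char_def, THEN conjunct2, THEN conjunct1]
 note Lc = Lg[unfolded gaussian_char_def, THEN conjunct2, THEN conjunct2, THEN conjunct2]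
 have LL: "(LINT om|M. L u om * L v om) = ip I u (mv I Sg v)" for u v
 unfolding L_def by (rule ip_covariance[OF I G cov])
 have sq: "(LINT om|M. (L u om)\<^sup>2) = ip I u (mv I Sg u)" for u
 using LL[of u u] unfolding power2_eq_square .
 have Sg: "Sg i l = Sg l i" if "i : I" "l : I" for i l
 using cov[OF that] cov[OF that(2,1)] by (simp add: mult.commute)
 have psd: "0 <= ip I x (mv I Sg x)" for x unfolding sq[symmetric] by simp
 have "\<exists>J K e q a. diagonalizes I Sg N J K e q a"
 by (rule quadratic_form_diagonalization[OF I], rule Sg, assumption, assumption, rule symN, assumption, assumption, rule psd)
 then obtain J K e q a where H0: "diagonalizes I Sg N J K e q a" by (elim exE)
 note H = H0[unfolded diagonalizes_def]
 note H2 = conjunct2[OF H] note H3 = conjunct2[OF H2] note H4 = conjunct2[OF H3]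
 note H5 = conjunct2[OF H4] note H6 = conjunct2[OF H5] note H7 = conjunct2[OF H6]
 note J = conjunct1[OF H] note K = conjunct1[OF H2] note ort = conjunct1[OF H3]
 note null = conjunct1[OF H4] note form = conjunct1[OF H5] note aj = conjunct1[OF H6]
 note tr = conjunct1[OF H7] conjunct2[OF H7]
 define \<eta> where "\<eta> j = L (e j)" for j
 have \<eta>m: "\<eta> j : borel_measurable M" for j unfolding \<eta>_def by (rule Lm)
 have Lsum: "L (%x. SUM j:J. t j * e j x) om = (SUM j:J. t j * \<eta> j om)" for t om
 unfolding L_def \<eta>_def ip_sum_left ip_scale_left ..
 have var: "(LINT om|M. (L (%x. SUM j:J. t j * e j x) om)\<^sup>2) = (SUM j:J. (t j)\<^sup>2)" for t
 proof -
 have "(LINT om|M. (L (%x. SUM j:J. t j * e j x) om)\<^sup>2) = (SUM j:J. SUM l:J. t l * t j * ip I (e l) (mv I Sg (e j)))"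
 unfolding sq mv_sum mv_scale ip_sum_left ip_sum_right ip_scale_left ip_scale_right
 by (subst sum.swap) (simp add: sum_distrib_left mult.assoc mult.left_commute)
 also have "... = (SUM j:J. SUM l:J. of_bool (l = j) * (t l * t j))"
 using ort by (intro sum.cong refl) simp
 also have "... = (SUM j:J. (t j)\<^sup>2)"
 by (intro sum.cong refl) (simp only: sum_of_bool_eq(1)[OF J] power2_eq_square)
 finally show ?thesis .
 qed
 have joint: "(LINT om|M. iexp (SUM j:J. t j * \<eta> j om)) = of_real (exp (- (SUM j:J. (t j)\<^sup>2) / 2))" for t
 using Lc[of "%x. SUM j:J. t j * e j x"] unfolding Lsum var[unfolded Lsum] .
 have single: "(LINT om|M. iexp (r * \<eta> j om)) = of_real (exp (- r\<^sup>2 / 2))" if "j : J" for j r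
 proof -
 have 1: "(SUM l:J. of_bool (l = j) * r * \<eta> l om) = r * \<eta> j om" for om
 using sum_of_bool_eq(1)[OF J that, of "%l. r * \<eta> l om"] by (simp only: mult.assoc)
 have 2: "(SUM l:J. (of_bool (l = j) * r)\<^sup>2) = r^2"
 proof -
 have "(SUM l:J. (of_bool (l = j) * r)\<^sup>2) = (SUM l:J. of_bool (l = j) * r^2)" by (intro sum.cong refl) auto
 then show ?thesis unfolding sum_of_bool_eq(1)[OF J that] .
 qed
 show ?thesis using joint[of "%l. of_bool (l = j) * r"] unfolding 1 2 .
 qed
 have indep: "indep_vars (%_. borel) \<eta> J"
 proof (rule indep_vars_of_joint_char[OF J \<eta>m])
 fix t
 have "(LINT om|M. (PROD j:J. iexp (t j * \<eta> j om))) = (LINT om|M. iexp (SUM j:J. t j * \<eta> j om))"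
 by (intro lintegral_cong refl) (simp add: exp_sum[OF J, symmetric] sum_distrib_left)
 also have "... = (PROD j:J. of_real (exp (- (t j)\<^sup>2 / 2)))"
 unfolding joint by (simp add: exp_sum[OF J] sum_divide_distrib sum_negf[symmetric])
 also have "... = (PROD j:J. \<integral>x. iexp (t j * \<eta> j x) \<partial>M)"
 by (intro prod.cong refl) (simp only: single)
 finally show "(LINT om|M. (PROD j:J. iexp (t j * \<eta> j om))) = (PROD j:J. \<integral>x. iexp (t j * \<eta> j x) \<partial>M)" .
 qed
 have dist: "distr M borel (\<eta> j) = std_normal_distribution" if "j : J" for j
 proof (rule Levy_uniqueness)
 show "real_distribution (distr M borel (\<eta> j))" using \<eta>m by (rule real_distribution_distr)
 show "real_distribution std_normal_distribution" by (rule real_dist_normal_dist)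
 show "char (distr M borel (\<eta> j)) = char std_normal_distribution"
 proof
 fix r
 have "char (distr M borel (\<eta> j)) r = (LINT om|M. iexp (r * \<eta> j om))"
 unfolding char_def using \<eta>m by (subst integral_distr) auto
 then show "char (distr M borel (\<eta> j)) r = char std_normal_distribution r"
 unfolding single[OF that] char_std_normal_distribution .
 qed
 qed
 have sq1: "integrable M (%om. (\<eta> j om)\<^sup>2)" for j
 unfolding \<eta>_def by (rule Li)
 have sq2: "(LINT om|M. (\<eta> j om)\<^sup>2) = 1" if "j : J" for j
 using bspec[OF bspec[OF ort that] that] unfolding \<eta>_def sq by simp
 have "AE om in M. \<forall>k\<in>K. L (q k) om = 0"
 proof (rule AE_finite_allI[OF K])
 fix k assume k: "k : K"
 have "(LINT om|M. (L (q k) om)\<^sup>2) = 0" using null k unfolding sq by simp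
 moreover have "integrable M (%om. (L (q k) om)\<^sup>2)" by (rule Li)
 ultimately show "AE om in M. L (q k) om = 0"
 using integral_nonneg_eq_0_iff_AE[of M "%om. (L (q k) om)\<^sup>2"] by simp
 qed
 then have ae: "AE om in M. ip I (%x. z x om) (mv I N (%x. z x om)) = (SUM j:J. a j * (\<eta> j om)\<^sup>2)"
 proof eventually_elim
 case (elim om)
 then show ?case using form[rule_format, of "%x. z x om"] unfolding L_def \<eta>_def by simp
 qed
 have a: "\<exists>e. ip I e (mv I Sg e) = 1 & a j = ip I (mv I Sg e) (mv I N (mv I Sg e))" if "j : J" for j
 using bspec[OF bspec[OF ort that] that] bspec[OF aj that] by (intro exI[of _ "e j"]) simp
 show ?thesis unfolding gaussian_diagonalization_def
 by (rule exI[of _ J], rule exI[of _ a], rule exI[of _ \<eta>]) (intro conjI ballI; (rule J indep \<eta>m sq1 ae tr | erule dist sq2 a))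
qed

lemma chaos_mgf_integral:
 fixes \<eta> :: "nat => 'a => real"
 assumes J: "finite J" and ind: "indep_vars (%_. borel) \<eta> J"
 and \<eta>: "!!j. j : J ==> \<eta> j : borel_measurable M" "!!j. j : J ==> distr M borel (\<eta> j) = std_normal_distribution"
 and w: "!!j. j : J ==> \<bar>Re w * a j\<bar> < 1 / 2"
 shows "integrable M (%om. exp (w * of_real (SUM j:J. a j * ((\<eta> j om)\<^sup>2 - 1))))"
 "(LINT om|M. exp (w * of_real (SUM j:J. a j * ((\<eta> j om)\<^sup>2 - 1)))) = chaos_mgf J a w"
proof -
 define f where "f j x = exp (- w * a j) * exp (w * a j * of_real (x^2))" for j and x :: real
 have fm: "f j : borel_measurable borel" for j unfolding f_def by measurable
 have ex: "exp (w * of_real (SUM j:J. a j * ((\<eta> j om)\<^sup>2 - 1))) = (PROD j:J. f j (\<eta> j om))" for om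
 unfolding f_def by (simp add: of_real_sum sum_distrib_left exp_sum[OF J] exp_add[symmetric] algebra_simps)
 have re: "Re (w * a j) < 1 / 2" if "j : J" for j using w[OF that] by simp
 have int: "integrable M (%om. f j (\<eta> j om))" and val: "(LINT om|M. f j (\<eta> j om)) = exp (- w * a j) / csqrt (1 - 2 * w * a j)"
 if j: "j : J" for j
 proof -
 have "integrable (distr M borel (\<eta> j)) (f j)"
 unfolding \<eta>(2)[OF j] f_def by (intro integrable_mult_right std_normal_exp_square re j)
 then show "integrable M (%om. f j (\<eta> j om))" using integrable_distr_eq[OF \<eta>(1)[OF j] fm] by blast
 have "(LINT om|M. f j (\<eta> j om)) = (LINT x|std_normal_distribution. f j x)"
 unfolding \<eta>(2)[OF j, symmetric] by (rule integral_distr[OF \<eta>(1)[OF j] fm, symmetric])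
 also have "... = exp (- w * a j) / csqrt (1 - 2 * w * a j)"
 unfolding f_def using std_normal_exp_square(2)[OF re[OF j]] by (simp add: mult.assoc)
 finally show "(LINT om|M. f j (\<eta> j om)) = exp (- w * a j) / csqrt (1 - 2 * w * a j)" .
 qed
 have ind': "indep_vars (%_. borel) (%j om. f j (\<eta> j om)) J"
 by (rule indep_vars_compose2[OF ind]) (rule fm)
 show "integrable M (%om. exp (w * of_real (SUM j:J. a j * ((\<eta> j om)\<^sup>2 - 1))))"
 unfolding ex by (rule indep_vars_integrable[OF J ind' int])
 show "(LINT om|M. exp (w * of_real (SUM j:J. a j * ((\<eta> j om)\<^sup>2 - 1)))) = chaos_mgf J a w"
 proof -
 have "(LINT om|M. (PROD j:J. f j (\<eta> j om))) = (PROD j:J. \<integral>om. f j (\<eta> j om) \<partial>M)"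
 by (rule indep_vars_lebesgue_integral[OF J ind' int])
 also have "... = chaos_mgf J a w" unfolding chaos_mgf_def by (intro prod.cong refl val)
 finally show ?thesis unfolding ex .
 qed
qed

end

section \<open>The estimation error for a fixed pair of grids\<close>

context wiener_model begin

lemma vm_union:
 assumes "A : sets borel" "B' : sets borel"
 shows "vm e e' (A \<union> B') = vm e e' A + vm e e' B' - vm e e' (A \<inter> B')"
proof -
 have "vm e e' (A \<union> B') = (LINT t|lborel. F e e' t * indicator A t + F e e' t * indicator B' t - F e e' t * indicator (A \<inter> B') t)"
 unfolding vm_def by (intro lintegral_cong refl) (auto simp: indicator_def)
 then show ?thesis unfolding vm_def using assms by (simp add: F_indicator_integrable)
qed

lemma cell_borel: "cell g i : sets borel" by (simp add: cell_def)

lemma cell_Ioc: "is_grid T g ==> i : {1..fst g} ==> cell g i \<subseteq> {0<..T}"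
 using cell_subset[of T g i] by (auto simp: cell_def)

lemma vm_cell_pos: "is_grid T g ==> i : {1..fst g} ==> 0 < vm e e (cell g i)"
 unfolding cell_def using cell_subset[of T g i] by (intro vm_pos) auto

lemma theta_vm: "theta T rh sg1 sg2 = vm True False {0<..T}"
proof -
 have "vm True False {0..T} = vm True False {0<..T}"
 unfolding vm_def
 proof (rule integral_cong_AE)
 have "AE t in lborel. t ~= (0::real)" by (rule AE_lborel_singleton)
 then show "AE t in lborel. F True False t * indicator {0..T} t = F True False t * indicator {0<..T} t"
 by eventually_elim (auto simp: indicator_def)
 qed simp_all
 then show ?thesis unfolding theta_def by (simp add: cov_on_vm)
qed

lemma mesh_ge:
 assumes "is_grid T g" "is_grid T h"
 shows "i : {1..fst g} ==> snd g i - snd g (i - 1) <= mesh g h"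
 "j : {1..fst h} ==> snd h j - snd h (j - 1) <= mesh g h"
proof -
 have *: "snd g i - snd g (i - 1) <= Max (measure lborel ` cells g)" if "is_grid T g" "i : {1..fst g}" for g i
 proof -
 have "measure lborel (cell g i) <= Max (measure lborel ` cells g)"
 using that by (intro Max_ge) (auto simp: cells_def)
 then show ?thesis using cell_subset(2)[OF that] by (simp add: cell_def)
 qed
 show "i : {1..fst g} ==> snd g i - snd g (i - 1) <= mesh g h"
 "j : {1..fst h} ==> snd h j - snd h (j - 1) <= mesh g h"
 using *[OF assms(1), of i] *[OF assms(2), of j] by (auto simp: mesh_def)
qed

text \<open>The cells of \<open>h\<close> that meet a cell of \<open>g\<close> lie in its
  enlargement by \<open>m\<close> on both sides, of length at most \<open>3 * m\<close>.
  Intersecting with the time interval allows the use of \<open>vm_split\<close>.\<close>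

lemma overlapping_volume:
 assumes g: "is_grid T g" and h: "is_grid T h" and i: "i : {1..fst g}"
 and m: "snd g i - snd g (i - 1) <= m" "!!j. j : {1..fst h} ==> snd h j - snd h (j - 1) <= m"
 shows "(\<Sum>j=1..fst h. of_bool (cell g i \<inter> cell h j ~= {}) * vm e e (cell h j)) <= 3 * S^2 * m"
proof -
 define U where "U = {max 0 (snd g (i - 1) - m)<..min T (snd g i + m)}"
 have pos: "snd g (i - 1) < snd g i" using cell_subset[OF g i] by simp
 have "(\<Sum>j=1..fst h. of_bool (cell g i \<inter> cell h j ~= {}) * vm e e (cell h j)) <= (\<Sum>j=1..fst h. vm e e (U \<inter> cell h j))"
 proof (rule sum_mono)
 fix j assume j: "j : {1..fst h}"
 show "of_bool (cell g i \<inter> cell h j ~= {}) * vm e e (cell h j) <= vm e e (U \<inter> cell h j)"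
 proof (cases "cell g i \<inter> cell h j = {}")
 case True
 have "0 <= vm e e A" for A unfolding vm_def
 by (intro integral_nonneg_AE AE_I2) (auto simp: F_def corr_def indicator_def)
 then show ?thesis using True by simp
 next
 case False
 then have "snd g (i - 1) < snd h j" "snd h (j - 1) < snd g i" using overlap_iff[OF g h i j] by auto
 then have "U \<inter> cell h j = cell h j" using m(2)[OF j] cell_Ioc[OF h j] by (auto simp: U_def cell_def subset_eq)
 then show ?thesis using False by simp
 qed
 qed
 also have "... = vm e e U" by (rule vm_split[OF h]) (auto simp: U_def)
 also have "... <= S^2 * ((snd g i + m) - (snd g (i - 1) - m))"
 proof -
 have "U \<subseteq> {snd g (i - 1) - m..snd g i + m}" by (auto simp: U_def)
 moreover have "snd g (i - 1) - m <= snd g i + m" using pos m(1) by linarith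
 ultimately have "\<bar>vm e e U\<bar> <= S^2 * ((snd g i + m) - (snd g (i - 1) - m))"
 by (intro vm_abs_le) (auto simp: U_def)
 then show ?thesis by linarith
 qed
 also have "... <= S^2 * (3 * m)" using m(1) by (intro mult_left_mono) auto
 finally show ?thesis by simp
qed

text \<open>Doubling the index set writes each increment as two values of \<open>Y\<close> with
  opposite coefficients.\<close>

lemma increments_gaussian:
 assumes I: "finite I" and ab: "!!x. x : I ==> a x : {0..T} & b x : {0..T}"
 shows "gaussian_char P (%om. SUM x:I. al x * (Y (e x) (b x) om - Y (e x) (a x) om))"
proof -
 have "gaussian_char P (%om. SUM p:I \<times> UNIV. (if snd p then al (fst p) else - al (fst p)) * Y (e (fst p)) (if snd p then b (fst p) else a (fst p)) om)"
 by (rule Y_gaussian) (use I ab in auto)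
 moreover have "(SUM p:I \<times> UNIV. (if snd p then al (fst p) else - al (fst p)) * Y (e (fst p)) (if snd p then b (fst p) else a (fst p)) om)
 = (SUM x:I. al x * (Y (e x) (b x) om - Y (e x) (a x) om))" for om
 proof -
 have "(SUM p:I \<times> UNIV. (if snd p then al (fst p) else - al (fst p)) * Y (e (fst p)) (if snd p then b (fst p) else a (fst p)) om)
 = (SUM x:I. SUM d:UNIV. (if d then al x else - al x) * Y (e x) (if d then b x else a x) om)"
 by (simp add: sum.cartesian_product case_prod_beta del: UNIV_bool)
 then show ?thesis by (simp add: UNIV_bool algebra_simps)
 qed
 ultimately show ?thesis by simp
qed

definition chaos_representation :: "grid => grid => nat set => (nat => real) => (nat => 'a => real) => bool" where
 "chaos_representation g h J a \<eta> \<longleftrightarrow> finite J & indep_vars (%_. borel) \<eta> J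
 & (\<forall>j\<in>J. \<eta> j : borel_measurable P & distr P borel (\<eta> j) = std_normal_distribution)
 & (AE om in P. theta_hat (%t. X1 t om) (%t. X2 t om) g h - theta T rh sg1 sg2 = (SUM j:J. a j * ((\<eta> j om)\<^sup>2 - 1)))
 & (\<forall>j\<in>J. \<bar>a j\<bar> <= 3 * S^2 * mesh g h)
 & (SUM j:J. (a j)\<^sup>2) = mp2 g h & (SUM j:J. (a j) ^ 3) = mp3 g h"

text \<open>Puts the pieces together for deterministic grids: the increments over all cells are
  jointly Gaussian with covariance \<open>joint_cov\<close>, \<open>overlap_form\<close> turns them
  into the estimator, and the absence of cycles identifies the traces with the cumulants.\<close>

lemma grid_chaos:
 assumes g: "is_grid T g" and h: "is_grid T h"
 shows "\<exists>J a \<eta>. chaos_representation g h J a \<eta>"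
proof -
 define A B' where "A = {1..fst g}" and "B' = {1..fst h}"
 have fin: "finite A" "finite B'" by (simp_all add: A_def B'_def)
 define I where "I = A <+> B'"
 have fI: "finite I" by (simp add: I_def fin)
 define k where "k i j \<longleftrightarrow> cell g i \<inter> cell h j ~= {}" for i j
 define p q c where "p i = vm True True (cell g i)" and "q j = vm False False (cell h j)"
 and "c i j = vm True False (cell g i \<inter> cell h j)" for i j
 define N where "N = overlap_form k"
 define Sg where "Sg = joint_cov p q c"
 define z :: "nat + nat => 'a => real" where
 "z x om = (case x of Inl i => Y True (snd g i) om - Y True (snd g (i - 1)) om | Inr j => Y False (snd h j) om - Y False (snd h (j - 1)) om)" for x om
 have gA: "0 <= snd g (i - 1)" "snd g (i - 1) <= snd g i" "snd g i <= T" if "i : A" for i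
 using cell_subset[OF g, of i] that by (auto simp: A_def)
 have hB: "0 <= snd h (j - 1)" "snd h (j - 1) <= snd h j" "snd h j <= T" if "j : B'" for j
 using cell_subset[OF h, of j] that by (auto simp: B'_def)
 have gauss: "gaussian_char P (%om. SUM x:I. al x * z x om)" for al
 proof -
 define a b e where "a x = (case x of Inl i => snd g (i - 1) | Inr j => snd h (j - 1))"
 and "b x = (case x of Inl i => snd g i | Inr j => snd h j)" and "e x = (case x of Inl i => True | Inr j => False)" for x :: "nat + nat"
 have "gaussian_char P (%om. SUM x:I. al x * (Y (e x) (b x) om - Y (e x) (a x) om))"
 proof (rule increments_gaussian[OF fI])
 fix x assume "x : I"
 then show "a x : {0..T} & b x : {0..T}"
 using gA[of "projl x"] hB[of "projr x"] unfolding I_def a_def b_def by (cases x) auto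
 qed
 moreover have "Y (e x) (b x) om - Y (e x) (a x) om = z x om" for x om
 by (simp add: a_def b_def e_def z_def split: sum.split)
 ultimately show ?thesis by simp
 qed
 have cov: "(LINT om|P. z x om * z y om) = Sg x y" if "x : I" "y : I" for x y
 proof -
 have LL: "(LINT om|P. z (Inl i) om * z (Inl i') om) = Sg (Inl i) (Inl i')" if i: "i : A" "i' : A" for i i'
 proof -
 have "(LINT om|P. z (Inl i) om * z (Inl i') om) = vm True True (cell g i \<inter> cell g i')"
 unfolding z_def cell_def sum.case by (rule increment_cov) (use gA i in auto)
 also have "... = Sg (Inl i) (Inl i')"
 using cells_disjoint[OF g, of i i'] i by (cases "i = i'") (auto simp: Sg_def joint_cov_def p_def A_def vm_empty)
 finally show ?thesis .
 qed
 have RR: "(LINT om|P. z (Inr i) om * z (Inr i') om) = Sg (Inr i) (Inr i')" if i: "i : B'" "i' : B'" for i i'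
 proof -
 have "(LINT om|P. z (Inr i) om * z (Inr i') om) = vm False False (cell h i \<inter> cell h i')"
 unfolding z_def cell_def sum.case by (rule increment_cov) (use hB i in auto)
 also have "... = Sg (Inr i) (Inr i')"
 using cells_disjoint[OF h, of i i'] i by (cases "i = i'") (auto simp: Sg_def joint_cov_def q_def B'_def vm_empty)
 finally show ?thesis .
 qed
 have LR: "(LINT om|P. z (Inl i) om * z (Inr j) om) = c i j" if i: "i : A" "j : B'" for i j
 unfolding z_def cell_def sum.case c_def by (rule increment_cov) (use gA hB i in auto)
 show ?thesis
 proof (cases x; cases y)
 fix i i' assume "x = Inl i" "y = Inl i'" then show ?thesis using that LL by (auto simp: I_def)
 next
 fix i i' assume "x = Inr i" "y = Inr i'" then show ?thesis using that RR by (auto simp: I_def)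
 next
 fix i j assume "x = Inl i" "y = Inr j" then show ?thesis using that LR by (auto simp: I_def Sg_def joint_cov_def)
 next
 fix i j assume "x = Inr j" "y = Inl i"
 then show ?thesis using that LR[of i j] by (auto simp: I_def Sg_def joint_cov_def mult.commute[of "z (Inr j) _"])
 qed
 qed
 have symN: "N x y = N y x" for x y by (simp add: N_def overlap_form_def split: sum.split)
 have "\<exists>J a \<eta>. gaussian_diagonalization I z Sg N J a \<eta>"
 by (rule gaussian_quadratic_form[OF fI gauss cov]) (assumption | rule symN)+
 then obtain J a \<eta> where Q: "gaussian_diagonalization I z Sg N J a \<eta>" by (elim exE)
 note H = Q[unfolded gaussian_diagonalization_def]
 note H2 = conjunct2[OF H] note H3 = conjunct2[OF H2] note H4 = conjunct2[OF H3]
 note H5 = conjunct2[OF H4] note H6 = conjunct2[OF H5]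
 note J = conjunct1[OF H] note ind = conjunct1[OF H2] note \<eta> = conjunct1[OF H3]
 note form = conjunct1[OF H4] note aj = conjunct1[OF H5]
 note tr2 = conjunct1[OF H6] note tr3 = conjunct2[OF H6]
 have zX: "z (Inl i) om = X1 (snd g i) om - X1 (snd g (i - 1)) om" "z (Inr i) om = X2 (snd h i) om - X2 (snd h (i - 1)) om" for i om
 by (simp_all add: z_def Y_def)
 have quad: "ip I (%x. z x om) (mv I N (%x. z x om)) = theta_hat (%t. X1 t om) (%t. X2 t om) g h" for om
 unfolding I_def N_def overlap_quadratic_form[OF fin] theta_hat_def overlap_def zX by (simp add: A_def B'_def k_def)
 have row: "(SUM j:B'. c i j) = vm True False (cell g i)" if "i : A" for i
 unfolding c_def B'_def using that by (intro vm_split[OF h] cell_borel cell_Ioc[OF g]) (simp add: A_def)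
 have col: "(SUM i:A. c i j) = vm True False (cell h j)" if "j : B'" for j
 unfolding c_def A_def Int_commute[of _ "cell h j"] using that by (intro vm_split[OF g] cell_borel cell_Ioc[OF h]) (simp add: B'_def)
 have ck: "\<not> k i j ==> c i j = 0" for i j by (simp add: k_def c_def vm_empty)
 \<comment> \<open>The first trace is found by taking expectations. An overlapping pair contributes
   its covariance, any other pair has covariance 0, and together the intersections exhaust the time
   interval.\<close>
 have sum_a: "(SUM j:J. a j) = theta T rh sg1 sg2"
 proof -
 have zint: "integrable P (%om. z (Inl i) om * z (Inr j) om)" if "i : A" "j : B'" for i j
 using that by (intro gaussian_char_pair_integrable(2)[OF fI gauss]) (auto simp: I_def)
 have zm: "z x : borel_measurable P" if "x : I" for x
 by (rule gaussian_char_pair_integrable(1)[OF fI gauss that that])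
 have "(SUM j:J. a j) = (LINT om|P. (SUM j:J. a j * (\<eta> j om)\<^sup>2))"
 using \<eta> by (subst Bochner_Integration.integral_sum) auto
 also have "... = (LINT om|P. ip I (%x. z x om) (mv I N (%x. z x om)))"
 proof (rule integral_cong_AE)
 show "(%om. SUM j:J. a j * (\<eta> j om)\<^sup>2) : borel_measurable P"
 using \<eta> by (intro borel_measurable_sum borel_measurable_times borel_measurable_const borel_measurable_power) auto
 show "(%om. ip I (%x. z x om) (mv I N (%x. z x om))) : borel_measurable P"
 unfolding ip_def mv_def by (intro borel_measurable_sum borel_measurable_times borel_measurable_const zm)
 show "AE om in P. (SUM j:J. a j * (\<eta> j om)\<^sup>2) = ip I (%x. z x om) (mv I N (%x. z x om))"
 using form by eventually_elim simp
 qed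
 also have "... = (LINT om|P. (SUM i:A. SUM j:B'. z (Inl i) om * z (Inr j) om * of_bool (k i j)))"
 unfolding I_def N_def overlap_quadratic_form[OF fin] ..
 also have "... = (SUM i:A. SUM j:B'. \<integral>om. z (Inl i) om * z (Inr j) om * of_bool (k i j) \<partial>P)"
 by (subst Bochner_Integration.integral_sum, (intro Bochner_Integration.integrable_sum integrable_mult_left zint; assumption),
 intro sum.cong refl Bochner_Integration.integral_sum integrable_mult_left zint)
 also have "... = (SUM i:A. SUM j:B'. c i j)"
 proof (intro sum.cong refl)
 fix i j assume ij: "i : A" "j : B'"
 have "(LINT om|P. z (Inl i) om * z (Inr j) om) = Sg (Inl i) (Inr j)"
 by (rule cov) (use ij in \<open>auto simp: I_def\<close>)
 then have "(LINT om|P. z (Inl i) om * z (Inr j) om) = c i j" by (simp add: Sg_def joint_cov_def)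
 then show "(LINT om|P. z (Inl i) om * z (Inr j) om * of_bool (k i j)) = c i j"
 using ck[of i j] by (cases "k i j") simp_all
 qed
 also have "... = (SUM i:A. vm True False ({0<..T} \<inter> cell g i))"
 using cell_Ioc[OF g] by (intro sum.cong refl) (simp add: row A_def Int_absorb1)
 also have "... = theta T rh sg1 sg2"
 unfolding theta_vm A_def by (rule vm_split[OF g]) auto
 finally show ?thesis .
 qed
 have ae: "AE om in P. theta_hat (%t. X1 t om) (%t. X2 t om) g h - theta T rh sg1 sg2 = (SUM j:J. a j * ((\<eta> j om)\<^sup>2 - 1))"
 using form unfolding quad
 proof eventually_elim
 case (elim om)
 then show ?case unfolding sum_a[symmetric] by (simp add: right_diff_distrib sum_subtractf)
 qed
 have bound: "\<bar>a j\<bar> <= 3 * S^2 * mesh g h" if "j : J" for j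
 proof -
 note aj' = bspec[OF aj that]
 obtain e where e0: "ip I e (mv I Sg e) = 1 & a j = ip I (mv I Sg e) (mv I N (mv I Sg e))"
 using aj' by (elim exE)
 note e = conjunct1[OF e0] conjunct2[OF e0]
 show ?thesis unfolding e(2) I_def N_def Sg_def
 proof (rule overlap_form_bound[OF fin])
 show "0 < p i" if "i : A" for i using vm_cell_pos[OF g] that by (simp add: p_def A_def)
 show "0 < q j" if "j : B'" for j using vm_cell_pos[OF h] that by (simp add: q_def B'_def)
 show "0 <= ip (A <+> B') x (mv (A <+> B') (joint_cov p q c) x)" for x
 proof -
 have "0 <= (LINT om|P. ip I x (%y. z y om) * ip I x (%y. z y om))" by simp
 also have "... = ip I x (mv I Sg x)" by (rule ip_covariance[OF fI gauss cov])
 finally show ?thesis by (simp add: I_def Sg_def)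
 qed
 show "ip (A <+> B') e (mv (A <+> B') (joint_cov p q c) e) = 1" using e(1) by (simp add: I_def Sg_def)
 show "(SUM j:B'. of_bool (k i j) * q j) <= 3 * S^2 * mesh g h" if "i : A" for i
 unfolding k_def q_def B'_def using that by (intro overlapping_volume[OF g h] mesh_ge[OF g h]) (simp_all add: A_def)
 show "(SUM i:A. of_bool (k i j) * p i) <= 3 * S^2 * mesh g h" if "j : B'" for j
 unfolding k_def p_def A_def Int_commute[of "cell g _"] using that by (intro overlapping_volume[OF h g] mesh_ge[OF g h]) (simp_all add: B'_def)
 qed
 qed
 have cf: "cyclefree A B' k" "cyclefree B' A (%j i. k i j)"
 using grid_cyclefree[OF g h] by (simp_all add: A_def B'_def k_def[abs_def])
 have sub: "cell g i \<subseteq> {0..T}" if "i : A" for i using cell_subset(4)[OF g] that by (simp add: A_def)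
 have sub': "cell h i \<subseteq> {0..T}" if "i : B'" for i using cell_subset(4)[OF h] that by (simp add: B'_def)
 have cg: "cv (cell g i) = (SUM j:B'. c i j)" "var_on sg1 (cell g i) = p i" if "i : A" for i
 using that sub[OF that] by (simp_all add: cov_on_vm var_on_vm row p_def)
 have ch: "cv (cell h j) = (SUM i:A. c i j)" "var_on sg2 (cell h j) = q j" if "j : B'" for j
 using that sub'[OF that] by (simp_all add: cov_on_vm var_on_vm col q_def)
 have cgh: "cv (cell g i \<inter> cell h j) = c i j"
 "cv (cell g i \<union> cell h j) = (SUM j:B'. c i j) + (SUM i:A. c i j) - c i j" if "i : A" "j : B'" for i j
 proof -
 have "cell g i \<inter> cell h j \<subseteq> {0..T}" "cell g i \<union> cell h j \<subseteq> {0..T}" using sub[OF that(1)] sub'[OF that(2)] by auto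
 then have 1: "cv (cell g i \<inter> cell h j) = vm True False (cell g i \<inter> cell h j)"
 and 2: "cv (cell g i \<union> cell h j) = vm True False (cell g i \<union> cell h j)" by (simp_all only: cov_on_vm)
 show "cv (cell g i \<inter> cell h j) = c i j" unfolding 1 c_def ..
 show "cv (cell g i \<union> cell h j) = (SUM j:B'. c i j) + (SUM i:A. c i j) - c i j"
 unfolding 2 row[OF that(1)] col[OF that(2)] unfolding c_def by (rule vm_union[OF cell_borel cell_borel])
 qed
 have s1: "(SUM i:A. SUM j:B'. var_on sg1 (cell g i) * var_on sg2 (cell h j) * of_bool (k i j)) = (SUM i:A. SUM j:B'. p i * q j * of_bool (k i j))"
 by (intro sum.cong refl) (simp only: cg ch)
 have s2: "(SUM i:A. cv (cell g i) ^ n) = (SUM i:A. (SUM j:B'. c i j) ^ n)" for n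
 by (intro sum.cong refl) (simp only: cg)
 have s3: "(SUM j:B'. cv (cell h j) ^ n) = (SUM j:B'. (SUM i:A. c i j) ^ n)" for n
 by (intro sum.cong refl) (simp only: ch)
 have s4: "(SUM i:A. SUM j:B'. cv (cell g i \<inter> cell h j) ^ n) = (SUM i:A. SUM j:B'. (c i j) ^ n)" for n
 by (intro sum.cong refl) (simp only: cgh)
 have s5: "(SUM i:A. SUM j:B'. var_on sg1 (cell g i) * var_on sg2 (cell h j) * cv (cell g i \<union> cell h j) * of_bool (k i j))
 = (SUM i:A. SUM j:B'. of_bool (k i j) * (p i * q j) * ((SUM j:B'. c i j) + (SUM i:A. c i j) - c i j))"
 proof (intro sum.cong refl)
 fix i j assume ij: "i : A" "j : B'"
 show "var_on sg1 (cell g i) * var_on sg2 (cell h j) * cv (cell g i \<union> cell h j) * of_bool (k i j)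
 = of_bool (k i j) * (p i * q j) * ((SUM j:B'. c i j) + (SUM i:A. c i j) - c i j)"
 unfolding cg(2)[OF ij(1)] ch(2)[OF ij(2)] cgh(2)[OF ij] by (cases "k i j") simp_all
 qed
 have s6: "(SUM i:A. SUM j:B'. (cv (cell g i \<inter> cell h j))\<^sup>2 * (cv (cell g i) + cv (cell h j))
 - cv (cell g i \<inter> cell h j) * cv (cell g i) * cv (cell h j))
 = (SUM i:A. SUM j:B'. (c i j)\<^sup>2 * ((SUM j:B'. c i j) + (SUM i:A. c i j)) - c i j * (SUM j:B'. c i j) * (SUM i:A. c i j))"
 by (intro sum.cong refl) (simp only: cg ch cgh)
 have mu2: "mp2 g h = 1 / 2 * ((SUM i:A. SUM j:B'. p i * q j * of_bool (k i j))
 + (SUM i:A. (SUM j:B'. c i j)\<^sup>2) + (SUM j:B'. (SUM i:A. c i j)\<^sup>2) - (SUM i:A. SUM j:B'. (c i j)\<^sup>2))"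
 unfolding mu2_def Let_def sum_cells[OF g] sum_cells[OF h] A_def[symmetric] B'_def[symmetric] overlap_def k_def[symmetric] s1 s2 s3 s4 s5 s6 ..
 have mu3: "mp3 g h = 1 / 4 * ((SUM i:A. (SUM j:B'. c i j) ^ 3) + (SUM j:B'. (SUM i:A. c i j) ^ 3)
 + 2 * (SUM i:A. SUM j:B'. (c i j) ^ 3)
 + 3 * (SUM i:A. SUM j:B'. of_bool (k i j) * (p i * q j) * ((SUM j:B'. c i j) + (SUM i:A. c i j) - c i j))
 - 3 * (SUM i:A. SUM j:B'. (c i j)\<^sup>2 * ((SUM j:B'. c i j) + (SUM i:A. c i j)) - c i j * (SUM j:B'. c i j) * (SUM i:A. c i j)))"
 unfolding mu3_def Let_def sum_cells[OF g] sum_cells[OF h] A_def[symmetric] B'_def[symmetric] overlap_def k_def[symmetric] s1 s2 s3 s4 s5 s6 ..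
 have T2: "(SUM j:J. (a j)\<^sup>2) = mp2 g h" and T3: "(SUM j:J. (a j) ^ 3) = mp3 g h"
 unfolding tr2 tr3 mu2 mu3 I_def N_def Sg_def by (rule overlap_traces[OF fin cf], rule ck, assumption)+
 have \<eta>1: "\<eta> j : borel_measurable P" and \<eta>2: "distr P borel (\<eta> j) = std_normal_distribution" if "j : J" for j using \<eta> that by blast+
 show ?thesis unfolding chaos_representation_def
 by (rule exI[of _ J], rule exI[of _ a], rule exI[of _ \<eta>]) (intro conjI ballI; (rule J ind ae T2 T3 | erule \<eta>1 \<eta>2 bound))
qed

end

section \<open>Measurability in the random grids\<close>

lemma canonical_cell: "i <= fst g ==> cell (canonical_grid g) i = cell g i"
 by (auto simp: canonical_grid_def cell_def min_def)

lemma fst_canonical_grid: "fst (canonical_grid g) = fst g"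
 by (simp add: canonical_grid_def)

lemma canonical_cells: "cells (canonical_grid g) = cells g"
 unfolding cells_def fst_canonical_grid by (intro image_cong refl canonical_cell) simp

lemma canonical_is_grid: "is_grid T g ==> is_grid T (canonical_grid g)"
 by (auto simp: is_grid_def canonical_grid_def strict_mono_on_def)

lemma canonical_theta_hat: "theta_hat x1 x2 (canonical_grid g) (canonical_grid h) = theta_hat x1 x2 g h"
 unfolding theta_hat_def fst_canonical_grid
 by (intro sum.cong refl arg_cong2[where f="(*)"] arg_cong2[where f=overlap] canonical_cell) (auto simp: canonical_grid_def min_def)

lemma cells_cong:
 assumes "cells g = cells g'" "cells h = cells h'"
 shows "mu2 rh sg1 sg2 g h = mu2 rh sg1 sg2 g' h'" "mu3 rh sg1 sg2 g h = mu3 rh sg1 sg2 g' h'" "mesh g h = mesh g' h'"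
 by (simp_all only: mu2_def mu3_def mesh_def assms)

lemma grid_nonempty: "is_grid T g ==> 0 < T ==> 1 <= fst g"
 by (cases "fst g") (auto simp: is_grid_def)

lemma mesh_le_iff:
 assumes g: "is_grid T g" and h: "is_grid T h" and T: "0 < T"
 shows "mesh g h <= r \<longleftrightarrow> (\<forall>i\<in>{1..fst g}. snd g i - snd g (i - 1) <= r) & (\<forall>j\<in>{1..fst h}. snd h j - snd h (j - 1) <= r)"
proof -
 have *: "Max (measure lborel ` cells g) <= r \<longleftrightarrow> (\<forall>i\<in>{1..fst g}. snd g i - snd g (i - 1) <= r)" if g: "is_grid T g" for g
 proof -
 have ne: "cells g ~= {}" using grid_nonempty[OF g T] by (simp add: cells_def)
 have m: "measure lborel (cell g i) = snd g i - snd g (i - 1)" if "i : {1..fst g}" for i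
 using cell_subset(2)[OF g that] by (simp add: cell_def)
 have "Max (measure lborel ` cells g) <= r \<longleftrightarrow> (\<forall>x\<in>measure lborel ` cells g. x <= r)"
 using ne by (intro Max_le_iff) (auto simp: cells_def)
 also have "... \<longleftrightarrow> (\<forall>i\<in>{1..fst g}. measure lborel (cell g i) <= r)" by (simp add: cells_def)
 finally show ?thesis using m by simp
 qed
 show ?thesis unfolding mesh_def using *[OF g] *[OF h] by simp
qed

lemma fst_grid_measurable: "fst : grid_space \<rightarrow>\<^sub>M count_space UNIV"
 unfolding grid_space_def by (rule measurable_fst)

lemma coord_grid_measurable: "(%g. snd g i) : borel_measurable grid_space"
 unfolding grid_space_def by (rule measurable_compose[OF measurable_snd measurable_component_singleton]) simp

text \<open>The upper limit takes countably many values, and for each of them the sum is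
  measurable.\<close>

lemma sum_random_index:
 fixes f :: "nat => 'a => real"
 assumes n: "n : M \<rightarrow>\<^sub>M count_space UNIV" and f: "!!i. f i : borel_measurable M"
 shows "(%p. \<Sum>i=1..n p. f i p) : borel_measurable M"
 by (rule measurable_compose_countable[where f="%N p. \<Sum>i=1..N. f i p", OF _ n]) (intro borel_measurable_sum f)

abbreviation "grids \<equiv> grid_space \<Otimes>\<^sub>M grid_space"

lemma grids_measurable[measurable]:
 "(%p. fst (fst p)) : grids \<rightarrow>\<^sub>M count_space UNIV" "(%p. fst (snd p)) : grids \<rightarrow>\<^sub>M count_space UNIV"
 "(%p. snd (fst p) i) : borel_measurable grids" "(%p. snd (snd p) i) : borel_measurable grids"
 by (rule measurable_compose[OF measurable_fst] measurable_compose[OF measurable_snd];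
 rule fst_grid_measurable coord_grid_measurable)+

lemma overlap_eq: "overlap (cell g i) (cell h j) = (if max (snd g (i - 1)) (snd h (j - 1)) < min (snd g i) (snd h j) then 1 else 0)"
proof -
 have "cell g i \<inter> cell h j = {max (snd g (i - 1)) (snd h (j - 1))<..min (snd g i) (snd h j)}" by (auto simp: cell_def)
 then show ?thesis by (auto simp: overlap_def)
qed

lemma overlap_measurable[measurable]: "(%p. overlap (cell (fst p) i) (cell (snd p) j)) : borel_measurable grids"
 unfolding overlap_eq by measurable

text \<open>Evaluation is not jointly measurable in path and time for the product sigma-algebra. For
  continuous paths it is the limit of evaluations at rational multiples of mesh
  \<open>1 / Suc m\<close>, clipped to the time interval, and such a limit of countably valued times
  is measurable.\<close>

definition path_eval :: "real => (real => real) => real => real" where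
 "path_eval T x t = lim (%m. x (max 0 (min T (of_int \<lceil>t * real (Suc m)\<rceil> / real (Suc m)))))"

lemma path_eval_eq:
 assumes x: "continuous_on {0..T} x" and t: "t : {0..T}"
 shows "path_eval T x t = x t"
proof -
 define q where "q m = max 0 (min T (of_int \<lceil>t * real (Suc m)\<rceil> / real (Suc m)))" for m
 have "\<bar>q m - t\<bar> <= inverse (real (Suc m))" for m
 proof -
 define r where "r = of_int \<lceil>t * real (Suc m)\<rceil> / real (Suc m)"
 have "t * real (Suc m) <= of_int \<lceil>t * real (Suc m)\<rceil>" "of_int \<lceil>t * real (Suc m)\<rceil> <= t * real (Suc m) + 1" by linarith+
 then have "t <= r" "r <= (t * real (Suc m) + 1) / real (Suc m)" unfolding r_def
 by (simp_all add: pos_le_divide_eq divide_right_mono)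
 moreover have "(t * real (Suc m) + 1) / real (Suc m) = t + inverse (real (Suc m))" by (simp add: add_divide_distrib inverse_eq_divide)
 moreover have "q m = max 0 (min T r)" by (simp add: q_def r_def)
 moreover have "\<bar>max 0 (min T r) - t\<bar> <= e" if "t <= r" "r <= t + e" for e
 using that t by (auto simp: max_def min_def abs_if)
 ultimately show ?thesis by (simp only:)
 qed
 then have "(%m. q m - t) \<longlonglongrightarrow> 0"
 by (intro Lim_null_comparison[OF _ LIMSEQ_inverse_real_of_nat]) auto
 then have "q \<longlonglongrightarrow> t" by (simp add: LIM_zero_iff)
 moreover have "q m : {0..T}" for m using t by (auto simp: q_def)
 ultimately have "(%m. x (q m)) \<longlonglongrightarrow> x t"
 by (intro continuous_on_tendsto_compose[OF x] t) auto
 then show ?thesis unfolding path_eval_def q_def[symmetric] by (rule limI)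
qed

lemma path_eval_measurable:
 assumes T: "0 <= T" and x: "!!s. s : {0..T} ==> (%p. x p s) : borel_measurable M" and t[measurable]: "t : borel_measurable M"
 shows "(%p. path_eval T (x p) (t p)) : borel_measurable M"
 unfolding path_eval_def
proof (rule borel_measurable_lim_metric)
 fix m
 have c: "(%p. \<lceil>t p * real (Suc m)\<rceil>) : M \<rightarrow>\<^sub>M count_space UNIV" by measurable
 show "(%p. x p (max 0 (min T (of_int \<lceil>t p * real (Suc m)\<rceil> / real (Suc m))))) : borel_measurable M"
 by (rule measurable_compose_countable[where f="%k p. x p (max 0 (min T (of_int k / real (Suc m))))", OF _ c])
 (rule x, use T in auto)
qed

abbreviation "paths T \<equiv> \<Pi>\<^sub>M t\<in>{0..T::real}. (borel :: real measure) \<Otimes>\<^sub>M (borel :: real measure)"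

definition path_statistic :: "real => (grid \<times> grid) \<times> (real => real \<times> real) => real" where
 "path_statistic T p = theta_hat (path_eval T (%t. fst (snd p t))) (path_eval T (%t. snd (snd p t))) (fst (fst p)) (snd (fst p))"

lemma path_statistic_measurable[measurable]:
 assumes T: "0 <= T" shows "path_statistic T : borel_measurable (grids \<Otimes>\<^sub>M paths T)"
proof -
 have g: "(%p. fst (fst (fst p))) : grids \<Otimes>\<^sub>M paths T \<rightarrow>\<^sub>M count_space UNIV" "(%p. fst (snd (fst p))) : grids \<Otimes>\<^sub>M paths T \<rightarrow>\<^sub>M count_space UNIV"
 and s: "(%p. snd (fst (fst p)) i) : borel_measurable (grids \<Otimes>\<^sub>M paths T)" "(%p. snd (snd (fst p)) i) : borel_measurable (grids \<Otimes>\<^sub>M paths T)"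
 and o: "(%p. overlap (cell (fst (fst p)) i) (cell (snd (fst p)) j)) : borel_measurable (grids \<Otimes>\<^sub>M paths T)" for i j
 by (rule measurable_compose[OF measurable_fst]; rule grids_measurable overlap_measurable)+
 have c: "(%p. fst (snd p u)) : borel_measurable (grids \<Otimes>\<^sub>M paths T)" "(%p. snd (snd p u)) : borel_measurable (grids \<Otimes>\<^sub>M paths T)" if "u : {0..T}" for u
 proof -
 have "(%p. snd p u) : grids \<Otimes>\<^sub>M paths T \<rightarrow>\<^sub>M borel \<Otimes>\<^sub>M borel"
 by (rule measurable_compose[OF measurable_snd measurable_component_singleton[OF that]])
 note m = this
 show "(%p. fst (snd p u)) : borel_measurable (grids \<Otimes>\<^sub>M paths T)" by (rule measurable_compose[OF m measurable_fst])
 show "(%p. snd (snd p u)) : borel_measurable (grids \<Otimes>\<^sub>M paths T)" by (rule measurable_compose[OF m measurable_snd])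
 qed
 show ?thesis unfolding path_statistic_def[abs_def] theta_hat_def
 by (intro sum_random_index g borel_measurable_times borel_measurable_diff path_eval_measurable T c s o)
qed

context wiener_model begin

lemma vm_interval_measurable:
 assumes [measurable]: "a : borel_measurable M" "b : borel_measurable M"
 shows "(%p. vm e e' {a p<..b p}) : borel_measurable M"
proof -
 have "(%q. F e e' (snd q) * (if a (fst q) < snd q & snd q <= b (fst q) then 1 else 0)) : borel_measurable (M \<Otimes>\<^sub>M lborel)"
 by measurable
 then have "(%p. \<integral>t. F e e' t * (if a p < t & t <= b p then 1 else 0) \<partial>lborel) : borel_measurable M"
 by (intro lborel.borel_measurable_lebesgue_integral) (simp add: split_beta')
 moreover have "vm e e' {a p<..b p} = (LINT t|lborel. F e e' t * (if a p < t & t <= b p then 1 else 0))" for p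
 unfolding vm_def by (intro lintegral_cong refl) (auto simp: indicator_def)
 ultimately show ?thesis by simp
qed

lemma vm_cells_measurable:
 "(%p. vm e e' (cell (fst p) i)) : borel_measurable grids" "(%p. vm e e' (cell (snd p) j)) : borel_measurable grids"
 "(%p. vm e e' (cell (fst p) i \<inter> cell (snd p) j)) : borel_measurable grids"
 "(%p. vm e e' (cell (fst p) i \<union> cell (snd p) j)) : borel_measurable grids"
proof -
 show 1: "(%p. vm e e' (cell (fst p) i)) : borel_measurable grids" and 2: "(%p. vm e e' (cell (snd p) j)) : borel_measurable grids"
 unfolding cell_def by (intro vm_interval_measurable grids_measurable)+
 have "cell g i \<inter> cell h j = {max (snd g (i - 1)) (snd h (j - 1))<..min (snd g i) (snd h j)}" for g h
 by (auto simp: cell_def)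
 then show 3: "(%p. vm e e' (cell (fst p) i \<inter> cell (snd p) j)) : borel_measurable grids"
 by (simp only:) (intro vm_interval_measurable borel_measurable_max borel_measurable_min grids_measurable)
 have "vm e e' (cell g i \<union> cell h j) = vm e e' (cell g i) + vm e e' (cell h j) - vm e e' (cell g i \<inter> cell h j)" for g h
 by (rule vm_union) (simp_all add: cell_def)
 then show "(%p. vm e e' (cell (fst p) i \<union> cell (snd p) j)) : borel_measurable grids"
 by (simp only:) (intro borel_measurable_add borel_measurable_diff 1 2 3)
qed

text \<open>\<open>mu2\<close> as sums over indices with random limits, in place of sums over a
  random set of cells; only this form is visibly measurable.\<close>

definition mu2_index :: "grid \<times> grid => real" where
 "mu2_index p = 1 / 2 * ((\<Sum>i=1..fst (fst p). \<Sum>j=1..fst (snd p). vm True True (cell (fst p) i) * vm False False (cell (snd p) j) * overlap (cell (fst p) i) (cell (snd p) j))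
 + (\<Sum>i=1..fst (fst p). (vm True False (cell (fst p) i))\<^sup>2) + (\<Sum>j=1..fst (snd p). (vm True False (cell (snd p) j))\<^sup>2)
 - (\<Sum>i=1..fst (fst p). \<Sum>j=1..fst (snd p). (vm True False (cell (fst p) i \<inter> cell (snd p) j))\<^sup>2))"

definition mu3_index :: "grid \<times> grid => real" where
 "mu3_index p = 1 / 4 * ((\<Sum>i=1..fst (fst p). vm True False (cell (fst p) i) ^ 3) + (\<Sum>j=1..fst (snd p). vm True False (cell (snd p) j) ^ 3)
 + 2 * (\<Sum>i=1..fst (fst p). \<Sum>j=1..fst (snd p). vm True False (cell (fst p) i \<inter> cell (snd p) j) ^ 3)
 + 3 * (\<Sum>i=1..fst (fst p). \<Sum>j=1..fst (snd p). vm True True (cell (fst p) i) * vm False False (cell (snd p) j)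
 * vm True False (cell (fst p) i \<union> cell (snd p) j) * overlap (cell (fst p) i) (cell (snd p) j))
 - 3 * (\<Sum>i=1..fst (fst p). \<Sum>j=1..fst (snd p). (vm True False (cell (fst p) i \<inter> cell (snd p) j))\<^sup>2 * (vm True False (cell (fst p) i) + vm True False (cell (snd p) j))
 - vm True False (cell (fst p) i \<inter> cell (snd p) j) * vm True False (cell (fst p) i) * vm True False (cell (snd p) j)))"

lemma mu_index_measurable[measurable]: "mu2_index : borel_measurable grids" "mu3_index : borel_measurable grids"
 unfolding mu2_index_def[abs_def] mu3_index_def[abs_def]
 by (intro borel_measurable_add borel_measurable_diff borel_measurable_times borel_measurable_power borel_measurable_const
 sum_random_index grids_measurable vm_cells_measurable overlap_measurable)+

lemma mu_index_eq:
 assumes g: "is_grid T g" and h: "is_grid T h"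
 shows "mu2_index (g, h) = mp2 g h" "mu3_index (g, h) = mp3 g h"
proof -
 have sub: "cell g i \<subseteq> {0..T}" if "i : {1..fst g}" for i using cell_subset(4)[OF g that] .
 have sub': "cell h i \<subseteq> {0..T}" if "i : {1..fst h}" for i using cell_subset(4)[OF h that] .
 have cg: "cv (cell g i) = vm True False (cell g i)" "var_on sg1 (cell g i) = vm True True (cell g i)" if "i : {1..fst g}" for i
 using sub[OF that] by (simp_all add: cov_on_vm var_on_vm)
 have ch: "cv (cell h i) = vm True False (cell h i)" "var_on sg2 (cell h i) = vm False False (cell h i)" if "i : {1..fst h}" for i
 using sub'[OF that] by (simp_all add: cov_on_vm var_on_vm)
 have cgh: "cv (cell g i \<inter> cell h j) = vm True False (cell g i \<inter> cell h j)"
 "cv (cell g i \<union> cell h j) = vm True False (cell g i \<union> cell h j)" if "i : {1..fst g}" "j : {1..fst h}" for i j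
 using sub[OF that(1)] sub'[OF that(2)] by (auto intro!: cov_on_vm)
 show "mu2_index (g, h) = mp2 g h" "mu3_index (g, h) = mp3 g h"
 unfolding mu2_index_def mu3_index_def mu2_def mu3_def Let_def sum_cells[OF g] sum_cells[OF h] fst_conv snd_conv
 by (simp_all only: cg ch cgh cong: sum.cong)
qed

end

section \<open>Averaging over independent sampling times\<close>

locale sampled_model = wiener_model P T rh sg1 sg2 B1 B2 X1 X2
 for P :: "'a measure" and T rh sg1 sg2 B1 B2 X1 X2 +
 fixes G H :: "'a => grid"
 assumes cont1: "\<forall>om\<in>space P. continuous_on {0..T} (%t. X1 t om)"
 and cont2: "\<forall>om\<in>space P. continuous_on {0..T} (%t. X2 t om)"
 and grid: "\<forall>om\<in>space P. is_grid T (G om) & is_grid T (H om)"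
 and sampling: "sampling_independent P T X1 X2 G H"
begin

definition GH :: "'a => grid \<times> grid" where "GH om = (canonical_grid (G om), canonical_grid (H om))"
definition W :: "'a => real => real \<times> real" where "W om = (\<lambda>t\<in>{0..T}. (X1 t om - X1 0 om, X2 t om - X2 0 om))"

lemma indep_GH_W: "indep_set (sets (vimage_algebra (space P) GH grids)) (sets (vimage_algebra (space P) W (paths T)))"
 using sampling unfolding sampling_independent_def GH_def W_def .

lemma GH_measurable: "GH : P \<rightarrow>\<^sub>M grids" and W_measurable: "W : P \<rightarrow>\<^sub>M paths T"
proof -
 have ev: "sets (vimage_algebra (space P) GH grids) \<subseteq> events" "sets (vimage_algebra (space P) W (paths T)) \<subseteq> events"
 using indep_GH_W by (auto simp: indep_set_def indep_sets_def split: bool.splits)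
 have spg: "space grids = UNIV" by (simp add: grid_space_def space_pair_measure space_PiM)
 show "GH : P \<rightarrow>\<^sub>M grids"
 proof (rule measurableI)
 fix A assume "A : sets grids"
 then have "GH -` A \<inter> space P : sets (vimage_algebra (space P) GH grids)" by (rule in_vimage_algebra)
 then show "GH -` A \<inter> space P : events" using ev(1) by blast
 qed (simp add: spg)
 show "W : P \<rightarrow>\<^sub>M paths T"
 proof (rule measurableI)
 fix A assume "A : sets (paths T)"
 then have "W -` A \<inter> space P : sets (vimage_algebra (space P) W (paths T))" by (rule in_vimage_algebra)
 then show "W -` A \<inter> space P : events" using ev(2) by blast
 qed (simp add: W_def space_PiM space_pair_measure PiE_def)
qed

text \<open>Independence of the generated sigma-algebras is the product rule on rectangles, which
  determines the joint law.\<close>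

lemma joint_law: "distr P grids GH \<Otimes>\<^sub>M distr P (paths T) W = distr P (grids \<Otimes>\<^sub>M paths T) (%om. (GH om, W om))"
proof (rule pair_measure_eqI)
 show "sigma_finite_measure (distr P grids GH)" "sigma_finite_measure (distr P (paths T) W)"
 using prob_space_distr[OF GH_measurable] prob_space_distr[OF W_measurable]
 by (auto intro: prob_space_imp_sigma_finite)
 show "sets (distr P grids GH \<Otimes>\<^sub>M distr P (paths T) W) = sets (distr P (grids \<Otimes>\<^sub>M paths T) (%om. (GH om, W om)))"
 by (simp add: sets_pair_measure_cong[OF sets_distr sets_distr])
 fix A B' assume "A : sets (distr P grids GH)" "B' : sets (distr P (paths T) W)"
 then have A: "A : sets grids" and B': "B' : sets (paths T)" by simp_all
 have "prob ((GH -` A \<inter> space P) \<inter> (W -` B' \<inter> space P)) = prob (GH -` A \<inter> space P) * prob (W -` B' \<inter> space P)"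
 by (rule indep_setD[OF indep_GH_W in_vimage_algebra[OF A] in_vimage_algebra[OF B']])
 moreover have "(%om. (GH om, W om)) -` (A \<times> B') \<inter> space P = (GH -` A \<inter> space P) \<inter> (W -` B' \<inter> space P)" by auto
 moreover have "A \<times> B' : sets (grids \<Otimes>\<^sub>M paths T)" using A B' by (rule pair_measureI)
 moreover have "(%om. (GH om, W om)) : P \<rightarrow>\<^sub>M grids \<Otimes>\<^sub>M paths T" by (intro measurable_Pair GH_measurable W_measurable)
 ultimately show "emeasure (distr P grids GH) A * emeasure (distr P (paths T) W) B'
 = emeasure (distr P (grids \<Otimes>\<^sub>M paths T) (%om. (GH om, W om))) (A \<times> B')"
 using A B' GH_measurable W_measurable by (simp add: emeasure_distr emeasure_eq_measure ennreal_mult'')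
qed

text \<open>The second outcome \<open>om'\<close> acts as an independent copy carrying the paths, so
  the inner integral is a version of the conditional expectation given the grids. The uniform bound
  \<open>K\<close> on the inner absolute moments yields joint integrability.\<close>

lemma disintegration:
 fixes f :: "_ => 'b :: {banach, second_countable_topology}"
 assumes f: "f : borel_measurable (grids \<Otimes>\<^sub>M paths T)"
 and int: "!!om. om : space P ==> integrable P (%om'. f (GH om, W om'))"
 and bound: "!!om. om : space P ==> (LINT om'|P. norm (f (GH om, W om'))) <= K"
 shows "integrable P (%om. f (GH om, W om))" "integrable P (%om. \<integral>om'. f (GH om, W om') \<partial>P)"
 "(LINT om|P. f (GH om, W om)) = (LINT om|P. (LINT om'|P. f (GH om, W om')))"
proof -
 define Mg where "Mg = distr P grids GH"
 define Mw where "Mw = distr P (paths T) W"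
 interpret g: prob_space Mg unfolding Mg_def by (rule prob_space_distr[OF GH_measurable])
 interpret w: prob_space Mw unfolding Mw_def by (rule prob_space_distr[OF W_measurable])
 interpret gw: pair_sigma_finite Mg Mw ..
 have sMg: "sets Mg = sets grids" and sMw: "sets Mw = sets (paths T)" by (simp_all add: Mg_def Mw_def)
 have joint: "Mg \<Otimes>\<^sub>M Mw = distr P (grids \<Otimes>\<^sub>M paths T) (%om. (GH om, W om))"
 unfolding Mg_def Mw_def by (rule joint_law)
 have fgw: "f : borel_measurable (Mg \<Otimes>\<^sub>M Mw)"
 using f measurable_cong_sets[OF sets_pair_measure_cong[OF sMg sMw] refl] by blast
 have f2: "f : borel_measurable (grids \<Otimes>\<^sub>M Mw)"
 using f measurable_cong_sets[OF sets_pair_measure_cong[OF refl sMw] refl] by blast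
 have GHW: "(%om. (GH om, W om)) : P \<rightarrow>\<^sub>M grids \<Otimes>\<^sub>M paths T" by (intro measurable_Pair GH_measurable W_measurable)
 have fsec: "(%x. f (GH om, x)) : borel_measurable (paths T)" if "om : space P" for om
 by (rule measurable_compose[OF _ f]) (intro measurable_Pair measurable_const measurable_space[OF GH_measurable that] measurable_ident_sets refl)
 have inner: "(\<integral>\<^sup>+x. ennreal (norm (f (GH om, x))) \<partial>Mw) <= ennreal K" if "om : space P" for om
 proof -
 have "(\<integral>\<^sup>+x. ennreal (norm (f (GH om, x))) \<partial>Mw) = (\<integral>\<^sup>+om'. ennreal (norm (f (GH om, W om'))) \<partial>P)"
 unfolding Mw_def using fsec[OF that] by (intro nn_integral_distr W_measurable) measurable
 also have "... = ennreal (LINT om'|P. norm (f (GH om, W om')))"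
 using int[OF that] by (intro nn_integral_eq_integral integrable_norm AE_I2) auto
 finally show ?thesis using bound[OF that] by (simp add: ennreal_leI)
 qed
 have ifgw: "integrable (Mg \<Otimes>\<^sub>M Mw) f"
 proof (rule integrableI_bounded[OF fgw])
 have m: "(%p. ennreal (norm (f p))) : borel_measurable (Mg \<Otimes>\<^sub>M Mw)" using fgw by measurable
 have m2: "(%p. ennreal (norm (f p))) : borel_measurable (grids \<Otimes>\<^sub>M Mw)" using f2 by measurable
 have "(\<integral>\<^sup>+p. ennreal (norm (f p)) \<partial>(Mg \<Otimes>\<^sub>M Mw)) = (\<integral>\<^sup>+p. (\<integral>\<^sup>+x. ennreal (norm (f (p, x))) \<partial>Mw) \<partial>Mg)"
 by (rule w.nn_integral_fst[OF m, symmetric])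
 also have "... = (\<integral>\<^sup>+om. (\<integral>\<^sup>+x. ennreal (norm (f (GH om, x))) \<partial>Mw) \<partial>P)"
 unfolding Mg_def by (rule nn_integral_distr[OF GH_measurable]) (simp only: measurable_distr_eq1 w.borel_measurable_nn_integral_fst[OF m2])
 also have "... <= (\<integral>\<^sup>+om. ennreal K \<partial>P)" by (rule nn_integral_mono) (rule inner)
 also have "... < \<infinity>" by (simp add: emeasure_space_1)
 finally show "(\<integral>\<^sup>+p. ennreal (norm (f p)) \<partial>(Mg \<Otimes>\<^sub>M Mw)) < \<infinity>" .
 qed
 have sec: "(LINT x|Mw. f (GH om, x)) = (LINT om'|P. f (GH om, W om'))" if "om : space P" for om
 unfolding Mw_def by (rule integral_distr[OF W_measurable fsec[OF that]])
 have mfst: "(%p. \<integral>x. f (p, x) \<partial>Mw) : borel_measurable grids"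
 by (rule w.borel_measurable_lebesgue_integral) (use f2 in \<open>simp add: split_beta'\<close>)
 show "integrable P (%om. f (GH om, W om))"
 using ifgw unfolding joint integrable_distr_eq[OF GHW f] .
 have "integrable Mg (%p. \<integral>x. f (p, x) \<partial>Mw)" by (rule gw.integrable_fst'[OF ifgw])
 then have "integrable P (%om. \<integral>x. f (GH om, x) \<partial>Mw)"
 unfolding Mg_def integrable_distr_eq[OF GH_measurable mfst] .
 then show "integrable P (%om. \<integral>om'. f (GH om, W om') \<partial>P)"
 by (subst Bochner_Integration.integrable_cong[OF refl sec[symmetric]])
 have "(LINT om|P. f (GH om, W om)) = (LINT p|(Mg \<Otimes>\<^sub>M Mw). f p)" unfolding joint by (rule integral_distr[OF GHW f, symmetric])
 also have "... = (LINT p|Mg. (LINT x|Mw. f (p, x)))" by (rule gw.integral_fst'[OF ifgw, symmetric])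
 also have "... = (LINT om|P. (LINT x|Mw. f (GH om, x)))" unfolding Mg_def by (rule integral_distr[OF GH_measurable mfst])
 also have "... = (LINT om|P. (LINT om'|P. f (GH om, W om')))" by (intro lintegral_cong refl sec)
 finally show "(LINT om|P. f (GH om, W om)) = (LINT om|P. (LINT om'|P. f (GH om, W om')))" .
qed

text \<open>Grids from one outcome, paths from another. Canonical encoding does not change the
  estimator, and the initial values cancel in increments.\<close>

lemma path_statistic_GH_W:
 assumes "om : space P" "om' : space P"
 shows "path_statistic T (GH om, W om') = theta_hat (%t. X1 t om') (%t. X2 t om') (G om) (H om)"
proof -
 have g: "is_grid T (G om)" "is_grid T (H om)" using grid assms(1) by auto
 have c: "continuous_on {0..T} (%t. fst (W om' t))" "continuous_on {0..T} (%t. snd (W om' t))"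
 proof -
 have "continuous_on {0..T} (%t. fst (W om' t)) \<longleftrightarrow> continuous_on {0..T} (%t. X1 t om' - X1 0 om')"
 "continuous_on {0..T} (%t. snd (W om' t)) \<longleftrightarrow> continuous_on {0..T} (%t. X2 t om' - X2 0 om')"
 by (rule continuous_on_cong[OF refl]; simp add: W_def)+
 moreover have "continuous_on {0..T} (%t. X1 t om' - X1 0 om')" "continuous_on {0..T} (%t. X2 t om' - X2 0 om')"
 using cont1 cont2 assms(2) by (auto intro!: continuous_on_diff continuous_on_const)
 ultimately show "continuous_on {0..T} (%t. fst (W om' t))" "continuous_on {0..T} (%t. snd (W om' t))" by simp_all
 qed
 have ev: "path_eval T (%t. fst (W om' t)) s = X1 s om' - X1 0 om'" "path_eval T (%t. snd (W om' t)) s = X2 s om' - X2 0 om'" if "s : {0..T}" for s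
 using path_eval_eq[OF c(1) that] path_eval_eq[OF c(2) that] that by (simp_all add: W_def)
 have r: "snd (G om) i : {0..T}" "snd (G om) (i - 1) : {0..T}" if "i : {1..fst (G om)}" for i
 using cell_subset[OF g(1) that] by auto
 have r': "snd (H om) i : {0..T}" "snd (H om) (i - 1) : {0..T}" if "i : {1..fst (H om)}" for i
 using cell_subset[OF g(2) that] by auto
 have "path_statistic T (GH om, W om') = theta_hat (path_eval T (%t. fst (W om' t))) (path_eval T (%t. snd (W om' t))) (G om) (H om)"
 unfolding path_statistic_def GH_def fst_conv snd_conv by (rule canonical_theta_hat)
 also have "... = theta_hat (%t. X1 t om') (%t. X2 t om') (G om) (H om)"
 unfolding theta_hat_def
 proof (intro sum.cong refl)
 fix i j assume i: "i : {1..fst (G om)}" and j: "j : {1..fst (H om)}"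
 show "(path_eval T (%t. fst (W om' t)) (snd (G om) i) - path_eval T (%t. fst (W om' t)) (snd (G om) (i - 1)))
 * (path_eval T (%t. snd (W om' t)) (snd (H om) j) - path_eval T (%t. snd (W om' t)) (snd (H om) (j - 1))) * overlap (cell (G om) i) (cell (H om) j)
 = (X1 (snd (G om) i) om' - X1 (snd (G om) (i - 1)) om') * (X2 (snd (H om) j) om' - X2 (snd (H om) (j - 1)) om') * overlap (cell (G om) i) (cell (H om) j)"
 unfolding ev(1)[OF r(1)[OF i]] ev(1)[OF r(2)[OF i]] ev(2)[OF r'(1)[OF j]] ev(2)[OF r'(2)[OF j]] by simp
 qed
 finally show ?thesis .
qed

text \<open>Counts the cells longer than \<open>r\<close>. A bound on the mesh becomes the vanishing
  of a measurable sum, with no maximum over a random set.\<close>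

definition mesh_violations :: "real => grid \<times> grid => real" where
 "mesh_violations r p = (\<Sum>i=1..fst (fst p). if r < snd (fst p) i - snd (fst p) (i - 1) then 1 else 0)
 + (\<Sum>j=1..fst (snd p). if r < snd (snd p) j - snd (snd p) (j - 1) then 1 else 0)"

lemma mesh_violations_measurable[measurable]: "mesh_violations r : borel_measurable grids"
 unfolding mesh_violations_def[abs_def]
 by (intro borel_measurable_add sum_random_index grids_measurable) measurable

lemma GH_functionals:
 assumes "om : space P"
 shows "mu2_index (GH om) = mu2 rh sg1 sg2 (G om) (H om)" "mu3_index (GH om) = mu3 rh sg1 sg2 (G om) (H om)"
 "mesh_violations r (GH om) = 0 \<longleftrightarrow> mesh (G om) (H om) <= r"
proof -
 have g: "is_grid T (canonical_grid (G om))" "is_grid T (canonical_grid (H om))" using grid assms canonical_is_grid by auto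
 show "mu2_index (GH om) = mu2 rh sg1 sg2 (G om) (H om)" "mu3_index (GH om) = mu3 rh sg1 sg2 (G om) (H om)"
 unfolding GH_def mu_index_eq[OF g] by (rule cells_cong; rule canonical_cells)+
 have "mesh_violations r (GH om) = 0 \<longleftrightarrow> mesh (canonical_grid (G om)) (canonical_grid (H om)) <= r"
 unfolding mesh_le_iff[OF g T] GH_def mesh_violations_def fst_conv snd_conv
 by (subst add_nonneg_eq_0_iff) (auto intro!: sum_nonneg simp: sum_nonneg_eq_0_iff not_less split: if_splits)
 then show "mesh_violations r (GH om) = 0 \<longleftrightarrow> mesh (G om) (H om) <= r"
 using cells_cong(3)[OF canonical_cells canonical_cells] by simp
qed

end

section \<open>Weighted bounds for the Edgeworth density and its positive part\<close>

text \<open>Degree eight is what \<open>weighted_gauss_bound\<close> asks for: six from the square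
  of the cubic polynomial and two from the weight \<open>1 + x^2\<close>.\<close>

lemma poly_exp_bound:
 fixes x :: real
 assumes "0 < p" "0 <= q" "k <= 8"
 shows "(1 + abs x) ^ k * exp (q * abs x - p * x^2) <= 8 ^ 8 * exp (1 + (q + 1)\<^sup>2 / (4 * p))"
proof -
 define y where "y = 1 + abs x"
 have y: "1 <= y" by (simp add: y_def)
 have "y ^ k <= y ^ 8" using y assms(3) by (intro power_increasing)
 also have "... = 8 ^ 8 * (y / 8) ^ 8" by (simp add: power_divide)
 also have "... <= 8 ^ 8 * exp (y / 8) ^ 8"
 proof (intro mult_left_mono power_mono)
 show "y / 8 <= exp (y / 8)" using exp_ge_add_one_self[of "y / 8"] by linarith
 qed (use y in auto)
 also have "exp (y / 8) ^ 8 = exp y" by (simp add: exp_of_nat_mult[symmetric])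
 finally have 1: "y ^ k <= 8 ^ 8 * exp y" .
 \<comment> \<open>Completing the square, with the linear rate raised by one to absorb the factor
   \<open>exp y\<close>.\<close>
 have "0 <= (2 * p * abs x - (q + 1))\<^sup>2" by simp
 then have "4 * p * ((q + 1) * abs x - p * x^2) <= (q + 1)\<^sup>2"
 by (simp add: power2_eq_square algebra_simps)
 then have "(q + 1) * abs x - p * x^2 <= (q + 1)\<^sup>2 / (4 * p)"
 using assms(1) by (simp add: pos_le_divide_eq mult.commute)
 then have 2: "y + (q * abs x - p * x^2) <= 1 + (q + 1)\<^sup>2 / (4 * p)"
 by (simp add: y_def algebra_simps)
 have "y ^ k * exp (q * abs x - p * x^2) <= 8 ^ 8 * exp y * exp (q * abs x - p * x^2)"
 by (rule mult_right_mono[OF 1]) simp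
 also have "... = 8 ^ 8 * exp (y + (q * abs x - p * x^2))" by (simp add: exp_add)
 also have "... <= 8 ^ 8 * exp (1 + (q + 1)\<^sup>2 / (4 * p))" using 2 by simp
 finally show ?thesis by (simp add: y_def)
qed

lemma powr_le_exp:
 fixes x :: real
 assumes "0 < gm" "0 < s" "0 <= x"
 shows "x powr gm <= (gm / s) powr gm * exp (s * x)"
proof -
 have "s * x / gm <= exp (s * x / gm)" using exp_ge_add_one_self[of "s * x / gm"] by linarith
 then have "(s * x / gm) powr gm <= exp (s * x / gm) powr gm" using assms by (intro powr_mono2) auto
 also have "... = exp (s * x)" using assms by (simp add: exp_powr_real)
 finally have 1: "(s * x / gm) powr gm <= exp (s * x)" .
 have "x powr gm = ((gm / s) * (s * x / gm)) powr gm" using assms by simp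
 also have "... = (gm / s) powr gm * (s * x / gm) powr gm" using assms by (intro powr_mult)
 also have "... <= (gm / s) powr gm * exp (s * x)" by (rule mult_left_mono[OF 1]) simp
 finally show ?thesis .
qed

lemma exp_neg_half_le: "exp (- abs x / 2) <= 8 / (1 + x^2)" for x :: real
proof -
 have "1 + abs x / 2 + (abs x / 2)\<^sup>2 / 2 <= exp (abs x / 2)" by (rule exp_lower_Taylor_quadratic) simp
 then have "(1 + x^2) / 8 <= exp (abs x / 2)" by (simp add: power2_eq_square field_simps)
 then have "1 + x^2 <= 8 * exp (abs x / 2)" by simp
 moreover have "exp (- abs x / 2) = 1 / exp (abs x / 2)" by (simp add: exp_minus field_simps)
 moreover have "0 < 1 + x^2" by (simp add: add_pos_nonneg)
 ultimately show ?thesis by (simp add: divide_le_eq le_divide_eq mult.commute)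
qed

lemma integrable_of_cauchy_bound:
 fixes f :: "real => real"
 assumes [measurable]: "f : borel_measurable borel" and b: "!!x. \<bar>f x\<bar> <= K / (1 + x^2)"
 shows "integrable lborel f" "(LINT x|lborel. \<bar>f x\<bar>) <= K * (LINT x|lborel. 1 / (1 + x^2))"
proof -
 have i: "integrable lborel (%x. K * (1 / (1 + x^2)) :: real)"
 using integrable_inverse_1_plus_square by (intro integrable_mult_right)
 show 1: "integrable lborel f"
 by (rule integrable_dominated[OF i]) (use b order_trans[OF b abs_ge_self] in auto)
 have "(LINT x|lborel. \<bar>f x\<bar>) <= (LINT x|lborel. K * (1 / (1 + x^2)))"
 by (rule integral_mono[OF integrable_abs[OF 1] i]) (use b in simp)
 then show "(LINT x|lborel. \<bar>f x\<bar>) <= K * (LINT x|lborel. 1 / (1 + x^2))" by (simp only: integral_mult_right_zero)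
qed

lemma gauss_density_eq: "0 < c ==> gauss_density x c = 1 / sqrt (2 * pi * c) * exp (- x\<^sup>2 / (2 * c))"
 by (simp add: gauss_density_def normal_density_def)

lemma gauss_density_pos: "0 < c ==> 0 < gauss_density x c"
 by (simp add: gauss_density_eq)

lemma gauss_density_meas[measurable]: "(%x. gauss_density x c) : borel_measurable borel"
 unfolding gauss_density_def by measurable

lemma h3_meas[measurable]: "(%x. h3 x c) : borel_measurable borel"
 unfolding h3_def by measurable

lemma ew_density_meas[measurable]: "ew_density c ka : borel_measurable borel"
 unfolding ew_density_def[abs_def] by measurable

text \<open>The powers 0, 1 and 2 serve the Gaussian part, the cubic correction and the negative
  part, which is quadratic in the correction.\<close>

lemma weighted_gauss_bound:
 assumes c: "0 < c"
 shows "\<exists>K. 0 <= K & (\<forall>x k. k <= 2 --> exp (abs x / 2) * (gauss_density x c * \<bar>h3 x c\<bar> ^ k) <= K / (1 + x^2))"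
proof -
 \<comment> \<open>The summand 1 makes \<open>L * y ^ 3\<close> at least 1, so that each power up to
   the second is bounded by the square.\<close>
 define L where "L = 1 + (1 + 3 * c) / c ^ 3"
 have L: "1 <= L" using c by (simp add: L_def)
 define K where "K = 1 / sqrt (2 * pi * c) * (L^2 * (8 ^ 8 * exp (1 + (1 / 2 + 1)\<^sup>2 / (4 * (1 / (2 * c))))))"
 have "exp (abs x / 2) * (gauss_density x c * \<bar>h3 x c\<bar> ^ k) <= K / (1 + x^2)" if k: "k <= 2" for x k
 proof -
 define y where "y = 1 + abs x"
 have y: "1 <= y" by (simp add: y_def)
 have "\<bar>x ^ 3 - 3 * c * x\<bar> <= abs x ^ 3 + 3 * c * abs x"
 using c abs_triangle_ineq4[of "x ^ 3" "3 * c * x"] by (simp add: abs_mult power_abs)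
 also have "... <= y ^ 3 + 3 * c * y ^ 3"
 proof (intro add_mono mult_left_mono power_mono)
 have "abs x <= y ^ 1" by (simp add: y_def)
 also have "... <= y ^ 3" using y by (intro power_increasing) auto
 finally show "abs x <= y ^ 3" .
 qed (use c in \<open>auto simp: y_def\<close>)
 finally have "\<bar>x ^ 3 - 3 * c * x\<bar> <= (1 + 3 * c) * y ^ 3" by (simp add: algebra_simps)
 then have "\<bar>h3 x c\<bar> <= (1 + 3 * c) / c ^ 3 * y ^ 3"
 using c by (simp add: h3_def abs_divide divide_right_mono)
 also have "... <= L * y ^ 3" using y by (intro mult_right_mono) (auto simp: L_def)
 finally have h: "\<bar>h3 x c\<bar> <= L * y ^ 3" .
 have "\<bar>h3 x c\<bar> ^ k <= (L * y ^ 3) ^ k" by (rule power_mono[OF h]) simp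
 also have "... <= (L * y ^ 3)\<^sup>2"
 proof (rule power_increasing[OF k])
 have "1 * 1 <= L * y ^ 3" using L y by (intro mult_mono) auto
 then show "1 <= L * y ^ 3" by simp
 qed
 also have "... = L^2 * y ^ 6" by (simp add: power_mult_distrib power_mult[symmetric])
 finally have hk: "\<bar>h3 x c\<bar> ^ k <= L^2 * y ^ 6" .
 have x2: "1 + x^2 <= y^2" by (simp add: y_def power2_sum)
 have "exp (abs x / 2) * (gauss_density x c * \<bar>h3 x c\<bar> ^ k) * (1 + x^2)
 <= exp (abs x / 2) * (gauss_density x c * (L^2 * y ^ 6)) * y^2"
 using gauss_density_pos[OF c, of x] hk x2 by (intro mult_mono mult_left_mono) auto
 also have "... = 1 / sqrt (2 * pi * c) * (L^2 * (y ^ 8 * exp (1 / 2 * abs x - 1 / (2 * c) * x^2)))"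
 unfolding gauss_density_eq[OF c] exp_diff by (simp add: exp_minus field_simps power_add[symmetric])
 also have "... <= K"
 unfolding K_def y_def using c by (intro mult_left_mono poly_exp_bound) auto
 finally show ?thesis by (simp add: pos_le_divide_eq add_pos_nonneg)
 qed
 moreover have "0 <= K" using c by (simp add: K_def)
 ultimately show ?thesis by (intro exI[of _ K] conjI allI impI)
qed

lemma ew_density_integral:
 assumes c: "0 < c" shows "integrable lborel (ew_density c ka)" "(LINT x|lborel. ew_density c ka x) = 1"
proof -
 obtain K where W: "0 <= K & (\<forall>x k. k <= 2 --> exp (abs x / 2) * (gauss_density x c * \<bar>h3 x c\<bar> ^ k) <= K / (1 + x^2))"
 using weighted_gauss_bound[OF c] by (elim exE)
 note K = conjunct1[OF W] conjunct2[OF W, rule_format]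
 have le: "gauss_density x c * \<bar>h3 x c\<bar> ^ k <= K / (1 + x^2)" if "k <= 2" for x k
 proof -
 have "1 * (gauss_density x c * \<bar>h3 x c\<bar> ^ k) <= exp (abs x / 2) * (gauss_density x c * \<bar>h3 x c\<bar> ^ k)"
 using gauss_density_pos[OF c, of x] by (intro mult_right_mono) auto
 then show ?thesis using K(2)[OF that, of x] by simp
 qed
 have i0: "integrable lborel (%x. gauss_density x c)"
 by (rule integrable_of_cauchy_bound(1)) (use le[of 0] gauss_density_pos[OF c] in \<open>auto simp: less_imp_le\<close>)
 have i1: "integrable lborel (%x. gauss_density x c * h3 x c)"
 by (rule integrable_of_cauchy_bound(1)) (use le[of 1] gauss_density_pos[OF c] in \<open>auto simp: abs_mult less_imp_le\<close>)
 have e: "ew_density c ka = (%x. gauss_density x c + ka / 6 * (gauss_density x c * h3 x c))"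
 by (rule ext) (simp add: ew_density_def algebra_simps)
 show "integrable lborel (ew_density c ka)" unfolding e using i0 i1 by (intro Bochner_Integration.integrable_add integrable_mult_right)
 have "(LINT x|lborel. gauss_density x c) = 1"
 unfolding gauss_density_def using c by (intro integral_normal_density) simp
 \<comment> \<open>The correction carries no mass since \<open>h3\<close> is odd.\<close>
 moreover have "(LINT x|lborel. gauss_density x c * h3 x c) = 0"
 proof -
 have "(LINT x|lborel. gauss_density x c * h3 x c) = (LINT x|lborel. gauss_density (0 + - 1 * x) c * h3 (0 + - 1 * x) c)"
 using lborel_integral_real_affine[of "-1" "%x. gauss_density x c * h3 x c" 0] by simp
 also have "... = (LINT x|lborel. - (gauss_density x c * h3 x c))"
 proof (intro lintegral_cong refl)
 fix x
 have "h3 (- x) c = - h3 x c"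
 unfolding h3_def minus_divide_left by (rule arg_cong2[where f="(/)"]) simp_all
 then show "gauss_density (0 + - 1 * x) c * h3 (0 + - 1 * x) c = - (gauss_density x c * h3 x c)"
 by (simp add: gauss_density_eq[OF c])
 qed
 finally show ?thesis by simp
 qed
 ultimately show "(LINT x|lborel. ew_density c ka x) = 1"
 unfolding e using i0 i1 by (simp add: Bochner_Integration.integral_add)
qed

text \<open>The rate \<open>1 / 2\<close> lies between two needs: it dominates polynomial growth,
  and against \<open>exp (- abs x)\<close> it leaves an integrable half.\<close>

definition weighted_bound_const :: "real => real => bool" where
 "weighted_bound_const c K \<longleftrightarrow> 0 <= K & (\<forall>f A ka. f : borel_measurable borel --> (\<forall>x. \<bar>f x\<bar> <= A * exp (abs x / 2)) -->
 integrable lborel (%x. f x * ew_density c ka x)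
 & (LINT x|lborel. \<bar>f x * ew_density c ka x\<bar>) <= A * K * (1 + abs ka)
 & (LINT x|lborel. \<bar>f x * max 0 (- ew_density c ka x)\<bar>) <= A * K * ka^2
 & integrable lborel (%x. \<bar>f x\<bar> * exp (- abs x)) & (LINT x|lborel. \<bar>f x\<bar> * exp (- abs x)) <= A * K)"

lemma edgeworth_weighted_bound:
 assumes c: "0 < c"
 shows "\<exists>K. weighted_bound_const c K"
proof -
 obtain K0 where W: "0 <= K0 & (\<forall>x k. k <= 2 --> exp (abs x / 2) * (gauss_density x c * \<bar>h3 x c\<bar> ^ k) <= K0 / (1 + x^2))"
 using weighted_gauss_bound[OF c] by (elim exE)
 note K0 = conjunct1[OF W] conjunct2[OF W, rule_format] 
 define I where "I = (\<integral>x. 1 / (1 + x^2) \<partial>lborel :: real)"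
 have I: "0 <= I" unfolding I_def by (intro integral_nonneg_AE AE_I2) simp
 define K where "K = max K0 8 * I"
 have K: "K0 * I <= K" "8 * I <= K" "0 <= K" using I K0 by (auto simp: K_def intro: mult_right_mono)
 have A: "0 <= A" if "!!x. \<bar>f x\<bar> <= A * exp (abs x / 2)" for f :: "real => real" and A
 using that[of 0] by simp
 have w: "\<bar>f x * (gauss_density x c * \<bar>h3 x c\<bar> ^ k)\<bar> <= A * K0 / (1 + x^2)"
 if f: "!!x. \<bar>f x\<bar> <= A * exp (abs x / 2)" and k: "k <= 2" for f A x k
 proof -
 have "\<bar>f x * (gauss_density x c * \<bar>h3 x c\<bar> ^ k)\<bar> = \<bar>f x\<bar> * (gauss_density x c * \<bar>h3 x c\<bar> ^ k)"
 using gauss_density_pos[OF c, of x] by (simp add: abs_mult)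
 also have "... <= A * exp (abs x / 2) * (gauss_density x c * \<bar>h3 x c\<bar> ^ k)"
 using gauss_density_pos[OF c, of x] by (intro mult_right_mono f) auto
 also have "... <= A * (K0 / (1 + x^2))"
 unfolding mult.assoc by (intro mult_left_mono K0(2)[OF k] A[OF f])
 finally show ?thesis by simp
 qed
 have e: "\<bar>f x * ew_density c ka x\<bar> <= A * K0 * (1 + abs ka) / (1 + x^2)"
 if f: "!!x. \<bar>f x\<bar> <= A * exp (abs x / 2)" for f A x ka
 proof -
 have "f x * ew_density c ka x = f x * gauss_density x c + ka / 6 * (f x * (gauss_density x c * h3 x c))"
 by (simp add: ew_density_def algebra_simps)
 then have "\<bar>f x * ew_density c ka x\<bar> <= \<bar>f x * gauss_density x c\<bar> + \<bar>ka / 6 * (f x * (gauss_density x c * h3 x c))\<bar>"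
 using abs_triangle_ineq by metis
 also have "\<bar>ka / 6 * (f x * (gauss_density x c * h3 x c))\<bar> = abs ka / 6 * \<bar>f x * (gauss_density x c * \<bar>h3 x c\<bar> ^ 1)\<bar>"
 by (simp add: abs_mult)
 also have "abs ka / 6 * \<bar>f x * (gauss_density x c * \<bar>h3 x c\<bar> ^ 1)\<bar> <= abs ka * (A * K0 / (1 + x^2))"
 by (rule mult_mono) (use w[OF f, of 1 x] in auto)
 also have "\<bar>f x * gauss_density x c\<bar> <= A * K0 / (1 + x^2)" using w[OF f, of 0 x] by simp
 finally show ?thesis by (simp add: algebra_simps add_divide_distrib)
 qed
 have n: "\<bar>f x * max 0 (- ew_density c ka x)\<bar> <= A * K0 * ka^2 / (1 + x^2)"
 if f: "!!x. \<bar>f x\<bar> <= A * exp (abs x / 2)" for f A x ka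
 proof -
 define y where "y = ka / 6 * h3 x c"
 \<comment> \<open>The negative part lives where \<open>y < -1\<close>, and there
   \<open>- y <= y^2\<close>. This makes it quadratic in \<open>ka\<close>.\<close>
 have "max 0 (- (1 + y)) <= y^2"
 proof (cases "y < -1")
 case True
 have "- y * 1 <= - y * - y" using True by (intro mult_left_mono) auto
 then show ?thesis using True by (simp add: power2_eq_square)
 next
 case False
 then have "max 0 (- (1 + y)) = 0" by (intro max_absorb1) simp
 then show ?thesis by simp
 qed
 also have "y^2 = ka^2 / 36 * \<bar>h3 x c\<bar>\<^sup>2" by (simp add: y_def power_mult_distrib power_divide)
 also have "... <= ka^2 * \<bar>h3 x c\<bar>\<^sup>2" by (rule mult_right_mono) auto
 finally have "gauss_density x c * max 0 (- (1 + y)) <= gauss_density x c * (ka^2 * \<bar>h3 x c\<bar>\<^sup>2)"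
 using gauss_density_pos[OF c, of x] by (intro mult_left_mono) auto
 moreover have "max 0 (- ew_density c ka x) = gauss_density x c * max 0 (- (1 + y))"
 proof -
 have g: "max 0 (- (v * z)) = v * max 0 (- z)" if v: "0 < v" for v z :: real
 proof (cases "0 <= z")
 case True
 then have "0 <= v * z" using v by simp
 then show ?thesis using True by (simp add: max_def)
 next
 case False
 then have "v * z < 0" using v by (intro mult_pos_neg) auto
 then show ?thesis using False by (simp add: max_def)
 qed
 show ?thesis unfolding ew_density_def y_def by (rule g[OF gauss_density_pos[OF c]])
 qed
 ultimately have m: "max 0 (- ew_density c ka x) <= ka^2 * (gauss_density x c * \<bar>h3 x c\<bar>\<^sup>2)" by (simp add: mult.left_commute)
 have "\<bar>f x * max 0 (- ew_density c ka x)\<bar> = \<bar>f x\<bar> * max 0 (- ew_density c ka x)" by (simp add: abs_mult)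
 also have "... <= \<bar>f x\<bar> * (ka^2 * (gauss_density x c * \<bar>h3 x c\<bar>\<^sup>2))" by (rule mult_left_mono[OF m]) simp
 also have "... = ka^2 * \<bar>f x * (gauss_density x c * \<bar>h3 x c\<bar>\<^sup>2)\<bar>"
 using gauss_density_pos[OF c, of x] by (simp add: abs_mult)
 also have "... <= ka^2 * (A * K0 / (1 + x^2))" by (rule mult_left_mono[OF w[OF f order_refl]]) simp
 finally show ?thesis by (simp add: mult_ac)
 qed
 have q: "\<bar>\<bar>f x\<bar> * exp (- abs x)\<bar> <= A * 8 / (1 + x^2)"
 if f: "!!x. \<bar>f x\<bar> <= A * exp (abs x / 2)" for f :: "real => real" and A x
 proof -
 have "\<bar>\<bar>f x\<bar> * exp (- abs x)\<bar> <= A * exp (abs x / 2) * exp (- abs x)" by (simp add: abs_mult f mult_right_mono)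
 also have "... = A * exp (- abs x / 2)" by (simp add: mult.assoc exp_add[symmetric])
 also have "... <= A * (8 / (1 + x^2))" by (intro mult_left_mono exp_neg_half_le A[OF f])
 finally show ?thesis by simp
 qed
 have main: "integrable lborel (%x. f x * ew_density c ka x)
 & (LINT x|lborel. \<bar>f x * ew_density c ka x\<bar>) <= A * K * (1 + abs ka)
 & (LINT x|lborel. \<bar>f x * max 0 (- ew_density c ka x)\<bar>) <= A * K * ka^2
 & integrable lborel (%x. \<bar>f x\<bar> * exp (- abs x)) & (LINT x|lborel. \<bar>f x\<bar> * exp (- abs x)) <= A * K"
 if fm[measurable]: "f : borel_measurable borel" and f': "\<forall>x. \<bar>f x\<bar> <= A * exp (abs x / 2)" for f :: "real => real" and A ka :: real
 proof (intro conjI)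
 have f: "\<bar>f x\<bar> <= A * exp (abs x / 2)" for x using f' by blast
 show "integrable lborel (%x. f x * ew_density c ka x)"
 by (rule integrable_of_cauchy_bound(1)[OF _ e[OF f]]) measurable
 have "(LINT x|lborel. \<bar>f x * ew_density c ka x\<bar>) <= A * K0 * (1 + abs ka) * I"
 unfolding I_def by (rule integrable_of_cauchy_bound(2)[OF _ e[OF f]]) measurable
 also have "... = A * (1 + abs ka) * (K0 * I)" by simp
 also have "... <= A * (1 + abs ka) * K" using A[OF f] by (intro mult_left_mono K) auto
 finally show "(LINT x|lborel. \<bar>f x * ew_density c ka x\<bar>) <= A * K * (1 + abs ka)" by (simp add: mult_ac)
 have "(LINT x|lborel. \<bar>f x * max 0 (- ew_density c ka x)\<bar>) <= A * K0 * ka^2 * I"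
 unfolding I_def by (rule integrable_of_cauchy_bound(2)[OF _ n[OF f]]) measurable
 also have "... = A * ka^2 * (K0 * I)" by simp
 also have "... <= A * ka^2 * K" using A[OF f] by (intro mult_left_mono K) auto
 finally show "(LINT x|lborel. \<bar>f x * max 0 (- ew_density c ka x)\<bar>) <= A * K * ka^2" by (simp add: mult_ac)
 have m: "(%x. \<bar>f x\<bar> * exp (- abs x)) : borel_measurable borel" by measurable
 have "(LINT x|lborel. \<bar>f x\<bar> * exp (- abs x)) <= A * 8 * I"
 using integrable_of_cauchy_bound(2)[OF m q[OF f]] unfolding I_def by (simp add: abs_mult)
 also have "... <= A * K" unfolding mult.assoc using A[OF f] by (intro mult_left_mono K)
 finally show "(LINT x|lborel. \<bar>f x\<bar> * exp (- abs x)) <= A * K" .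
 show "integrable lborel (%x. \<bar>f x\<bar> * exp (- abs x))" by (rule integrable_of_cauchy_bound(1)[OF m q[OF f]])
 qed
 show ?thesis unfolding weighted_bound_const_def by (rule exI[of _ K]) (intro conjI[OF K(3)] allI impI, rule main, assumption+)
qed

lemma positive_part_mass:
 assumes c: "0 < c"
 shows "integrable lborel (%x. max 0 (ew_density c ka x))" "1 <= (LINT x|lborel. max 0 (ew_density c ka x))"
 "(LINT x|lborel. max 0 (ew_density c ka x)) = 1 + (LINT x|lborel. max 0 (- ew_density c ka x))"
proof -
 note i = ew_density_integral[OF c, of ka]
 show i1: "integrable lborel (%x. max 0 (ew_density c ka x))" using i(1) by (intro integrable_max) auto
 have i2: "integrable lborel (%x. max 0 (- ew_density c ka x))" using i(1) by (intro integrable_max) auto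
 have "(LINT x|lborel. ew_density c ka x) <= (LINT x|lborel. max 0 (ew_density c ka x))"
 by (rule integral_mono[OF i(1) i1]) simp
 then show "1 <= (LINT x|lborel. max 0 (ew_density c ka x))" using i(2) by simp
 have "(LINT x|lborel. ew_density c ka x) = (LINT x|lborel. max 0 (ew_density c ka x) - max 0 (- ew_density c ka x))"
 by (intro lintegral_cong refl) (auto simp: max_def)
 then show "(LINT x|lborel. max 0 (ew_density c ka x)) = 1 + (LINT x|lborel. max 0 (- ew_density c ka x))"
 using i(2) i1 i2 by (simp add: lintegral_diff)
qed

definition positive_part_const :: "real => real => bool" where
 "positive_part_const c K \<longleftrightarrow> 0 <= K & (\<forall>f A ka. f : borel_measurable borel --> (\<forall>x. \<bar>f x\<bar> <= A * exp (abs x / 2)) --> abs ka <= 1 -->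
 \<bar>(LINT x|lborel. f x * ew_density c ka x)
 - (LINT x|lborel. f x * (max 0 (ew_density c ka x) / (LINT u|lborel. max 0 (ew_density c ka u))))\<bar> <= A * K * ka^2)"

text \<open>The positive part has mass \<open>1 + N\<close>, where \<open>N\<close> is the mass of
  the negative part. Cutting off and renormalising are therefore both errors of order
  \<open>ka^2\<close>.\<close>

lemma positive_part_comparison:
 assumes c: "0 < c"
 shows "\<exists>K. positive_part_const c K"
proof -
 obtain K where WK0: "weighted_bound_const c K" using edgeworth_weighted_bound[OF c] by (elim exE)
 note WK = WK0[unfolded weighted_bound_const_def]
 note wk = conjunct2[OF WK, rule_format]
 note K = conjunct1[OF WK] conjunct1[OF wk] conjunct1[OF conjunct2[OF wk]] conjunct1[OF conjunct2[OF conjunct2[OF wk]]]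
 have main: "\<bar>(LINT x|lborel. f x * ew_density c ka x)
 - (LINT x|lborel. f x * (max 0 (ew_density c ka x) / (LINT u|lborel. max 0 (ew_density c ka u))))\<bar> <= A * (K + K * (2 * K)) * ka^2"
 if fm[measurable]: "f : borel_measurable borel" and f': "\<forall>x. \<bar>f x\<bar> <= A * exp (abs x / 2)" and ka: "abs ka <= 1" for f :: "real => real" and A ka :: real
 proof -
 have f: "\<bar>f x\<bar> <= A * exp (abs x / 2)" for x using f' by blast
 define e where "e = ew_density c ka"
 have em[measurable]: "e : borel_measurable borel" unfolding e_def by measurable
 define D where "D = (LINT u|lborel. max 0 (e u))"
 define N where "N = (LINT u|lborel. max 0 (- e u))"
 have A: "0 <= A" using f[of 0] by simp
 have D: "1 <= D" "D = 1 + N" using positive_part_mass[OF c, of ka] by (simp_all add: D_def N_def e_def)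
 have N: "N <= K * ka^2" using K(4)[of "%_. 1" 1 ka] by (simp add: N_def e_def)
 have fe: "integrable lborel (%x. f x * e x)" unfolding e_def by (rule K(2)[OF fm f])
 have fp: "integrable lborel (%x. f x * (max 0 (e x) / D))"
 proof (rule integrable_dominated[OF fe])
 show "AE x in lborel. norm (f x * (max 0 (e x) / D)) <= norm (f x * e x)"
 proof (rule AE_I2)
 fix x
 have "max 0 (e x) / D <= max 0 (e x) / 1" by (rule divide_left_mono) (use D(1) in auto)
 also have "... <= \<bar>e x\<bar>" by simp
 finally have "\<bar>f x\<bar> * (max 0 (e x) / D) <= \<bar>f x\<bar> * \<bar>e x\<bar>" by (rule mult_left_mono) simp
 then show "norm (f x * (max 0 (e x) / D)) <= norm (f x * e x)"
 using D(1) by (simp add: abs_mult)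
 qed
 qed measurable
 have fn: "integrable lborel (%x. f x * max 0 (- e x))"
 proof (rule integrable_dominated[OF fe])
 show "AE x in lborel. norm (f x * max 0 (- e x)) <= norm (f x * e x)"
 by (rule AE_I2) (simp add: abs_mult mult_left_mono max_def)
 qed measurable
 have pt: "\<bar>f x * e x - f x * (max 0 (e x) / D)\<bar> <= \<bar>f x * max 0 (- e x)\<bar> + N * \<bar>f x * e x\<bar>" for x
 proof (cases "0 <= e x")
 case True
 have "0 <= N" using D by simp
 \<comment> \<open>Where the density is non-negative only the division by \<open>D = 1 + N\<close>
   is felt, and it removes the fraction \<open>N / D\<close>.\<close>
 have "e x - e x / D = e x * (N / D)" using D by (simp add: field_simps)
 then have "f x * e x - f x * (max 0 (e x) / D) = f x * e x * (N / D)"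
 using True by (simp only: max_absorb2 right_diff_distrib[symmetric] mult.assoc)
 then have "\<bar>f x * e x - f x * (max 0 (e x) / D)\<bar> = \<bar>f x * e x\<bar> * (N / D)"
 using D(1) \<open>0 <= N\<close> by (simp only: abs_mult[of "f x * e x"]) simp
 also have "... <= \<bar>f x * e x\<bar> * N"
 using D \<open>0 <= N\<close> mult_left_mono[of 1 D N] by (intro mult_left_mono) (auto simp: divide_le_eq)
 finally show ?thesis using True by (simp add: mult.commute)
 next
 case False
 have "0 <= N * \<bar>f x * e x\<bar>" using D by simp
 then show ?thesis using False by (simp add: abs_mult)
 qed
 have "\<bar>(LINT x|lborel. f x * e x) - (LINT x|lborel. f x * (max 0 (e x) / D))\<bar> = \<bar>\<integral>x. f x * e x - f x * (max 0 (e x) / D) \<partial>lborel\<bar>"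
 by (simp only: lintegral_diff[OF fe fp])
 also have "... <= (LINT x|lborel. \<bar>f x * e x - f x * (max 0 (e x) / D)\<bar>)" by (rule integral_abs_bound)
 also have "... <= (LINT x|lborel. \<bar>f x * max 0 (- e x)\<bar> + N * \<bar>f x * e x\<bar>)"
 by (intro integral_mono Bochner_Integration.integrable_add integrable_mult_right integrable_abs Bochner_Integration.integrable_diff fe fp fn pt)
 also have "... = (LINT x|lborel. \<bar>f x * max 0 (- e x)\<bar>) + N * (LINT x|lborel. \<bar>f x * e x\<bar>)"
 using fn fe by (subst Bochner_Integration.integral_add) auto
 also have "... <= A * K * ka^2 + K * ka^2 * (A * K * 2)"
 proof (intro add_mono mult_mono N)
 show "(LINT x|lborel. \<bar>f x * max 0 (- e x)\<bar>) <= A * K * ka^2" unfolding e_def by (rule K(4)[OF fm f])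
 have "(LINT x|lborel. \<bar>f x * e x\<bar>) <= A * K * (1 + abs ka)" unfolding e_def by (rule K(3)[OF fm f])
 also have "... <= A * K * 2" using ka A K(1) by (intro mult_left_mono) auto
 finally show "(LINT x|lborel. \<bar>f x * e x\<bar>) <= A * K * 2" .
 qed (use K(1) in auto)
 also have "... = A * (K + K * (2 * K)) * ka^2" by (simp add: algebra_simps)
 finally show "\<bar>(LINT x|lborel. f x * ew_density c ka x)
 - (LINT x|lborel. f x * (max 0 (ew_density c ka x) / (LINT u|lborel. max 0 (ew_density c ka u))))\<bar> <= A * (K + K * (2 * K)) * ka^2"
 unfolding D_def e_def .
 qed
 have "0 <= K + K * (2 * K)" using K(1) by simp
 then show ?thesis unfolding positive_part_const_def by (rule exI[of _ "K + K * (2 * K)", OF conjI]) (intro allI impI, rule main, assumption+)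
qed

lemma p_star_edgeworth: "p_star c bt l = ew_density c (bt powr (1 / 2) * l)"
 by (rule ext) (simp add: p_star_def ew_density_def)

lemma p_plus_density:
 assumes "0 < c" shows "is_probability_density (p_plus c bt l)"
proof -
 define e where "e = p_star c bt l"
 define D where "D = (LINT u|lborel. max 0 (e u))"
 note m = positive_part_mass[OF assms, of "bt powr (1 / 2) * l", folded p_star_edgeworth, folded e_def]
 have D: "1 <= D" using m(2) unfolding D_def .
 have em[measurable]: "e : borel_measurable borel" unfolding e_def p_star_edgeworth by measurable
 have p: "p_plus c bt l z = max 0 (e z) / D" for z by (simp add: p_plus_def e_def D_def)
 have "(\<integral>\<^sup>+z. ennreal (max 0 (e z) / D) \<partial>lborel) = ennreal (LINT z|lborel. max 0 (e z) / D)"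
 using m(1) D by (intro nn_integral_eq_integral AE_I2) auto
 also have "... = 1" using D unfolding D_def[symmetric] by (simp add: D_def[symmetric])
 finally show ?thesis unfolding is_probability_density_def p[abs_def] using D by auto
qed

text \<open>Averaging leaves errors in the coefficients of 1, \<open>w^2\<close> and
  \<open>w ^ 3\<close>; the Gaussian factor turns these powers into the integrable bound required
  for inversion.\<close>

lemma gaussian_cubic_bound:
 assumes c: "0 < c"
 shows "\<exists>K. 0 <= K & (\<forall>s u. \<bar>s\<bar> <= 1 --> norm (exp (of_real (c / 2) * (Complex s u)\<^sup>2)) * (1 + norm (Complex s u) ^ 2 + norm (Complex s u) ^ 3) <= K / (1 + u^2))"
proof -
 define L where "L = 8 ^ 8 * exp (1 + (0 + 1)\<^sup>2 / (4 * (c / 2)))"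
 show ?thesis
 proof (intro exI[of _ "exp (c / 2) * (3 * L)"] conjI allI impI)
 show "0 <= exp (c / 2) * (3 * L)" by (simp add: L_def)
 fix s u :: real assume s: "abs s <= 1"
 define y where "y = 1 + abs u"
 have y: "1 <= y" by (simp add: y_def)
 have n: "norm (Complex s u) <= y" using cmod_le[of "Complex s u"] s by (simp add: y_def)
 have p: "y ^ k <= y ^ 3" if "k <= 3" for k by (rule power_increasing[OF that y])
 have "1 + norm (Complex s u) ^ 2 + norm (Complex s u) ^ 3 <= y ^ 0 + y ^ 2 + y ^ 3"
 using n by (intro add_mono power_mono) auto
 also have "... <= 3 * y ^ 3" using p[of 0] p[of 2] by simp
 finally have 1: "1 + norm (Complex s u) ^ 2 + norm (Complex s u) ^ 3 <= 3 * y ^ 3" .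
 have u2: "1 + u^2 <= y^2" by (simp add: y_def power2_sum)
 have "s^2 <= 1" using s by (simp add: abs_square_le_1)
 then have "c * s^2 / 2 <= c / 2" using c by simp
 then have 2: "norm (exp (of_real (c / 2) * (Complex s u)\<^sup>2)) <= exp (c / 2) * exp (- (c / 2) * u^2)"
 unfolding norm_exp_half_square by (intro mult_mono) auto
 have "norm (exp (of_real (c / 2) * (Complex s u)\<^sup>2)) * (1 + norm (Complex s u) ^ 2 + norm (Complex s u) ^ 3) * (1 + u^2)
 <= (exp (c / 2) * exp (- (c / 2) * u^2)) * (3 * y ^ 3) * y^2"
 using 1 2 u2 y by (intro mult_mono) auto
 also have "... = exp (c / 2) * (3 * (y ^ 5 * exp (0 * abs u - c / 2 * u^2)))"
 by (simp add: power_add[symmetric])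
 also have "... <= exp (c / 2) * (3 * L)"
 unfolding L_def y_def using c by (intro mult_left_mono poly_exp_bound) auto
 finally show "norm (exp (of_real (c / 2) * (Complex s u)\<^sup>2)) * (1 + norm (Complex s u) ^ 2 + norm (Complex s u) ^ 3)
 <= exp (c / 2) * (3 * L) / (1 + u^2)"
 by (simp add: pos_le_divide_eq add_pos_nonneg)
 qed
qed

section \<open>Exponential moments of the estimation error\<close>

context wiener_model begin

text \<open>Grids and outcome are separate arguments, so that the grids of one outcome can be
  combined with the paths of another.\<close>

definition dev :: "grid => grid => 'a => real" where
 "dev g h om = theta_hat (%t. X1 t om) (%t. X2 t om) g h - theta T rh sg1 sg2"

text \<open>Bounds \<open>mu2\<close> for every pair of grids: three of its sums are at most
  \<open>(S^2 * T)^2\<close> each, and the fourth enters with a minus sign.\<close>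

definition Kmu :: real where "Kmu = 3 / 2 * (S^2 * T)\<^sup>2"

text \<open>With this scale every coefficient is at most \<open>1 / 4\<close> even for mesh
  \<open>T\<close>; hence the exponential moment is controlled for all grids, by
  \<open>Kexp\<close>.\<close>

definition s0 :: real where "s0 = 1 / (12 * S^2 * T)"
definition Kexp :: real where "Kexp = 2 * exp (4 * (s0^2 * Kmu))"

lemma dev_measurable:
 assumes g: "is_grid T g" and h: "is_grid T h"
 shows "dev g h : borel_measurable P"
proof -
 have r: "snd g (i - 1) : {0..T}" "snd g i : {0..T}" if "i : {1..fst g}" for i using cell_subset[OF g that] by auto
 have r': "snd h (i - 1) : {0..T}" "snd h i : {0..T}" if "i : {1..fst h}" for i using cell_subset[OF h that] by auto
 show ?thesis unfolding dev_def[abs_def] theta_hat_def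
 by (intro borel_measurable_diff borel_measurable_const borel_measurable_sum borel_measurable_times bspec[OF X1_meas] bspec[OF X2_meas] r r')
qed

lemma mesh_bounds:
 assumes g: "is_grid T g" and h: "is_grid T h"
 shows "0 < mesh g h" "mesh g h <= T"
proof -
 have 1: "1 : {1..fst g}" using grid_nonempty[OF g T] by simp
 show "0 < mesh g h" using mesh_ge(1)[OF g h 1] cell_subset(2)[OF g 1] by linarith
 have "snd g i - snd g (i - 1) <= T" if "i : {1..fst g}" for i using cell_subset[OF g that] by linarith
 moreover have "snd h i - snd h (i - 1) <= T" if "i : {1..fst h}" for i using cell_subset[OF h that] by linarith
 ultimately show "mesh g h <= T" unfolding mesh_le_iff[OF g h T] by blast
qed

lemma sum_vm_cells:
 assumes g: "is_grid T g" shows "(\<Sum>i=1..fst g. vm e e' (cell g i)) = vm e e' {0<..T}"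
proof -
 have "(\<Sum>i=1..fst g. vm e e' (cell g i)) = (\<Sum>i=1..fst g. vm e e' ({0<..T} \<inter> cell g i))"
 using cell_Ioc[OF g] by (intro sum.cong refl) (simp add: Int_absorb1)
 also have "... = vm e e' {0<..T}" by (rule vm_split[OF g]) auto
 finally show ?thesis .
qed

lemma sum_vm_squares:
 assumes g: "is_grid T g" shows "(\<Sum>i=1..fst g. (vm e e' (cell g i))\<^sup>2) <= (S^2 * T)\<^sup>2"
proof -
 have len: "(\<Sum>i=1..fst g. snd g i - snd g (i - 1)) = T"
 using sum_telescope''[of 0 "fst g" "snd g"] g by (simp add: is_grid_def)
 have "(\<Sum>i=1..fst g. (vm e e' (cell g i))\<^sup>2) <= (\<Sum>i=1..fst g. S\<^sup>2 * T * (S^2 * (snd g i - snd g (i - 1))))"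
 proof (rule sum_mono)
 fix i assume i: "i : {1..fst g}"
 note c = cell_subset[OF g i]
 have b: "\<bar>vm e e' (cell g i)\<bar> <= S^2 * (snd g i - snd g (i - 1))"
 unfolding cell_def using c by (intro vm_abs_le) auto
 also have le: "S^2 * (snd g i - snd g (i - 1)) <= S^2 * T" using c by (intro mult_left_mono) auto
 finally have b': "\<bar>vm e e' (cell g i)\<bar> <= S^2 * T" .
 have "\<bar>vm e e' (cell g i)\<bar> * \<bar>vm e e' (cell g i)\<bar> <= S^2 * T * (S^2 * (snd g i - snd g (i - 1)))"
 by (rule mult_mono[OF b' b]) (use T in auto)
 then show "(vm e e' (cell g i))\<^sup>2 <= S^2 * T * (S^2 * (snd g i - snd g (i - 1)))"
 unfolding power2_eq_square[of "vm _ _ _"] abs_mult_self_eq .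
 qed
 also have "... = S^2 * T * (S^2 * T)" unfolding sum_distrib_left[symmetric] len ..
 finally show ?thesis unfolding power2_eq_square[of "S^2 * T"] .
qed

text \<open>Non-negativity and the bound on the third cumulant are read off the coefficients of the
  chaos representation; the upper bound comes from the defining sums.\<close>

lemma mu_bounds:
 assumes g: "is_grid T g" and h: "is_grid T h"
 shows "0 <= mp2 g h" "mp2 g h <= Kmu" "\<bar>mp3 g h\<bar> <= 3 * S^2 * mesh g h * mp2 g h"
proof -
 obtain J a \<eta> where H0: "chaos_representation g h J a \<eta>" using grid_chaos[OF g h] by (elim exE)
 note H = H0[unfolded chaos_representation_def]
 note H5 = conjunct2[OF conjunct2[OF conjunct2[OF conjunct2[OF H]]]]
 note bd = conjunct1[OF H5] and m2 = conjunct1[OF conjunct2[OF H5]] and m3 = conjunct2[OF conjunct2[OF H5]]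
 show "0 <= mp2 g h" unfolding m2[symmetric] by (rule sum_nonneg) simp
 have "\<bar>SUM j:J. (a j) ^ 3\<bar> <= (SUM j:J. \<bar>(a j) ^ 3\<bar>)" by (rule sum_abs)
 also have "... <= (SUM j:J. 3 * S^2 * mesh g h * (a j)\<^sup>2)"
 proof (rule sum_mono)
 fix j assume j: "j : J"
 have "\<bar>(a j) ^ 3\<bar> = \<bar>a j\<bar> * (a j)\<^sup>2" by (simp add: power3_eq_cube power2_eq_square abs_mult)
 also have "... <= 3 * S^2 * mesh g h * (a j)\<^sup>2" by (rule mult_right_mono[OF bspec[OF bd j]]) simp
 finally show "\<bar>(a j) ^ 3\<bar> <= 3 * S^2 * mesh g h * (a j)\<^sup>2" .
 qed
 finally show "\<bar>mp3 g h\<bar> <= 3 * S^2 * mesh g h * mp2 g h"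
 unfolding sum_distrib_left[symmetric] m2 m3 .
 have h1: "(\<Sum>i=1..fst g. \<Sum>j=1..fst h. vm True True (cell g i) * vm False False (cell h j) * overlap (cell g i) (cell h j)) <= (S^2 * T)\<^sup>2"
 proof -
 have "(\<Sum>i=1..fst g. \<Sum>j=1..fst h. vm True True (cell g i) * vm False False (cell h j) * overlap (cell g i) (cell h j))
 <= (\<Sum>i=1..fst g. \<Sum>j=1..fst h. vm True True (cell g i) * vm False False (cell h j))"
 proof (intro sum_mono)
 fix i j assume "i : {1..fst g}" "j : {1..fst h}"
 then have "0 < vm True True (cell g i) * vm False False (cell h j)"
 using vm_cell_pos[OF g] vm_cell_pos[OF h] by (intro mult_pos_pos)
 then show "vm True True (cell g i) * vm False False (cell h j) * overlap (cell g i) (cell h j) <= vm True True (cell g i) * vm False False (cell h j)"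
 by (simp add: overlap_def)
 qed
 also have "... = vm True True {0<..T} * vm False False {0<..T}"
 unfolding sum_product[symmetric] sum_vm_cells[OF g] sum_vm_cells[OF h] ..
 also have "... <= \<bar>vm True True {0<..T}\<bar> * \<bar>vm False False {0<..T}\<bar>" unfolding abs_mult[symmetric] by (rule abs_ge_self)
 also have "... <= (S^2 * T) * (S^2 * T)"
 proof (rule mult_mono)
 have "\<bar>vm e e {0<..T}\<bar> <= S^2 * (T - 0)" for e using T by (intro vm_abs_le) auto
 then show "\<bar>vm True True {0<..T}\<bar> <= S^2 * T" "\<bar>vm False False {0<..T}\<bar> <= S^2 * T" by simp_all
 qed (use T in auto)
 finally show ?thesis unfolding power2_eq_square[of "S^2 * T"] .
 qed
 have h4: "0 <= (\<Sum>i=1..fst g. \<Sum>j=1..fst h. (vm True False (cell g i \<inter> cell h j))\<^sup>2)" by (intro sum_nonneg) simp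
 have "mu2_index (g, h) <= Kmu"
 proof -
 have "1 / 2 * (x + y + z - u) <= 3 / 2 * K" if "x <= K" "y <= K" "z <= K" "0 <= u" for x y z u K :: real
 using that by simp
 from this[OF h1 sum_vm_squares[OF g] sum_vm_squares[OF h] h4] show ?thesis
 unfolding mu2_index_def fst_conv snd_conv Kmu_def .
 qed
 then show "mp2 g h <= Kmu" unfolding mu_index_eq(1)[OF g h] .
qed

definition mgf_representation :: "real => grid => grid => nat set => (nat => real) => bool" where
 "mgf_representation r g h J a \<longleftrightarrow> finite J & (\<forall>j\<in>J. \<bar>a j\<bar> <= 3 * S^2 * r * mesh g h)
 & (SUM j:J. (a j)\<^sup>2) = r^2 * mp2 g h & (SUM j:J. (a j) ^ 3) = r ^ 3 * mp3 g h
 & (\<forall>w. \<bar>Re w\<bar> <= 1 --> integrable P (%om. exp (w * of_real (r * dev g h om)))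
 & (LINT om|P. exp (w * of_real (r * dev g h om))) = chaos_mgf J a w)"

lemma deviation_mgf:
 assumes g: "is_grid T g" and h: "is_grid T h" and r: "0 < r" and small: "3 * S^2 * r * mesh g h <= 1 / 4"
 shows "\<exists>J a. mgf_representation r g h J a"
proof -
 obtain J a \<eta> where H0: "chaos_representation g h J a \<eta>" using grid_chaos[OF g h] by (elim exE)
 note H = H0[unfolded chaos_representation_def]
 note H2 = conjunct2[OF H] note H3 = conjunct2[OF H2] note H4 = conjunct2[OF H3] note H5 = conjunct2[OF H4]
 note J = conjunct1[OF H] note ind = conjunct1[OF H2] note \<eta> = conjunct1[OF H3] note ae = conjunct1[OF H4]
 note bd = conjunct1[OF H5] and m2 = conjunct1[OF conjunct2[OF H5]] and m3 = conjunct2[OF conjunct2[OF H5]]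
 define a' where "a' j = r * a j" for j
 have b: "\<bar>a' j\<bar> <= 3 * S^2 * r * mesh g h" if j: "j : J" for j
 proof -
 have "r * \<bar>a j\<bar> <= r * (3 * S^2 * mesh g h)" using bspec[OF bd j] r by (intro mult_left_mono) auto
 then show ?thesis using r by (simp add: a'_def abs_mult mult_ac)
 qed
 have s2: "(SUM j:J. (a' j)\<^sup>2) = r^2 * mp2 g h" and s3: "(SUM j:J. (a' j) ^ 3) = r ^ 3 * mp3 g h"
 unfolding m2[symmetric] m3[symmetric] by (simp_all add: a'_def power_mult_distrib sum_distrib_left)
 have mg: "integrable P (%om. exp (w * of_real (r * dev g h om)))
 & (LINT om|P. exp (w * of_real (r * dev g h om))) = chaos_mgf J a' w" if w: "\<bar>Re w\<bar> <= 1" for w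
 proof -
 have small': "\<bar>Re w * a' j\<bar> < 1 / 2" if j: "j : J" for j
 proof -
 have "\<bar>Re w * a' j\<bar> <= 1 * (1 / 4)" unfolding abs_mult
 using b[OF j] small by (intro mult_mono w) auto
 then show ?thesis by simp
 qed
 have \<eta>1: "\<eta> j : borel_measurable P" and \<eta>2: "distr P borel (\<eta> j) = std_normal_distribution" if "j : J" for j
 using bspec[OF \<eta> that] by blast+
 note q = chaos_mgf_integral[OF J ind \<eta>1 \<eta>2 small']
 have eq: "AE om in P. exp (w * of_real (r * dev g h om)) = exp (w * of_real (SUM j:J. a' j * ((\<eta> j om)\<^sup>2 - 1)))"
 using ae
 proof eventually_elim
 case (elim om)
 then have "r * dev g h om = (SUM j:J. a' j * ((\<eta> j om)\<^sup>2 - 1))"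
 unfolding dev_def by (simp add: sum_distrib_left a'_def mult.assoc)
 then show ?case by (simp only:)
 qed
 have m: "(%om. exp (w * of_real (r * dev g h om))) : borel_measurable P"
 using dev_measurable[OF g h] by measurable
 have m': "(%om. exp (w * of_real (SUM j:J. a' j * ((\<eta> j om)\<^sup>2 - 1)))) : borel_measurable P"
 by (rule borel_measurable_integrable[OF q(1)])
 show ?thesis using integrable_cong_AE[OF m m' eq] integral_cong_AE[OF m m' eq] q by simp
 qed
 show ?thesis unfolding mgf_representation_def
 by (rule exI[of _ J], rule exI[of _ a']) (intro conjI ballI allI impI; (rule J s2 s3 | erule b | drule mg; blast))
qed

text \<open>The two real arguments 1 and -1 dominate the absolute value. At real arguments the
  logarithmic terms of \<open>norm_chaos_mgf_le\<close> vanish and only the variance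
  remains.\<close>

lemma deviation_exp_moment:
 assumes g: "is_grid T g" and h: "is_grid T h" and r: "0 < r" and small: "3 * S^2 * r * mesh g h <= 1 / 4"
 shows "integrable P (%om. exp (r * \<bar>dev g h om\<bar>))" "(LINT om|P. exp (r * \<bar>dev g h om\<bar>)) <= 2 * exp (4 * (r^2 * mp2 g h))"
proof -
 obtain J a where H0: "mgf_representation r g h J a" using deviation_mgf[OF assms] by (elim exE)
 note H = H0[unfolded mgf_representation_def]
 note H2 = conjunct2[OF H] note H3 = conjunct2[OF H2] note H4 = conjunct2[OF H3]
 note J = conjunct1[OF H] note bd = conjunct1[OF H2] note s2 = conjunct1[OF H3] note mg = conjunct2[OF H4]
 have e: "integrable P (%om. exp (s * (r * dev g h om)))" "(LINT om|P. exp (s * (r * dev g h om))) <= exp (4 * (r^2 * mp2 g h))"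
 if s: "abs s <= 1" for s :: real
 proof -
 have w: "\<bar>Re (complex_of_real s)\<bar> <= 1" using s by simp
 have eq: "exp (complex_of_real s * of_real (r * dev g h om)) = complex_of_real (exp (s * (r * dev g h om)))" for om
 by (simp only: of_real_mult[symmetric] exp_of_real)
 note i = mg[rule_format, OF w, unfolded eq]
 show "integrable P (%om. exp (s * (r * dev g h om)))" using conjunct1[OF i] unfolding complex_of_real_integrable_eq .
 have "(LINT om|P. exp (s * (r * dev g h om))) = norm (complex_of_real (LINT om|P. exp (s * (r * dev g h om))))" by simp
 also have "... = norm (chaos_mgf J a (of_real s))" using conjunct2[OF i] by (simp only: integral_complex_of_real)
 also have "... <= exp (4 * (SUM k:J. (a k)\<^sup>2) - (SUM k:J. ln (1 + (Im (complex_of_real s))\<^sup>2 * (a k)\<^sup>2)) / 4)"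
 by (rule norm_chaos_mgf_le[OF J w]) (rule order_trans[OF bspec[OF bd] small])
 also have "... = exp (4 * (r^2 * mp2 g h))" unfolding s2 by simp
 finally show "(LINT om|P. exp (s * (r * dev g h om))) <= exp (4 * (r^2 * mp2 g h))" .
 qed
 note e1 = e[of 1] and e2 = e[of "-1"]
 have i: "integrable P (%om. exp (1 * (r * dev g h om)) + exp (- 1 * (r * dev g h om)))"
 by (intro Bochner_Integration.integrable_add e1(1) e2(1)) simp_all
 have le: "exp (r * \<bar>dev g h om\<bar>) <= exp (1 * (r * dev g h om)) + exp (- 1 * (r * dev g h om))" for om
 by (cases "0 <= dev g h om") simp_all
 show i': "integrable P (%om. exp (r * \<bar>dev g h om\<bar>))"
 proof (rule integrable_dominated[OF i])
 show "(%om. exp (r * \<bar>dev g h om\<bar>)) : borel_measurable P" using dev_measurable[OF g h] by measurable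
 show "AE om in P. norm (exp (r * \<bar>dev g h om\<bar>)) <= norm (exp (1 * (r * dev g h om)) + exp (- 1 * (r * dev g h om)))"
 by (rule AE_I2) (use le in \<open>simp add: add_pos_pos[THEN abs_of_pos]\<close>)
 qed
 have "(LINT om|P. exp (r * \<bar>dev g h om\<bar>)) <= (LINT om|P. exp (1 * (r * dev g h om)) + exp (- 1 * (r * dev g h om)))"
 by (rule integral_mono[OF i' i le])
 also have "... = (LINT om|P. exp (1 * (r * dev g h om))) + (LINT om|P. exp (- 1 * (r * dev g h om)))"
 by (rule Bochner_Integration.integral_add; rule e1(1) e2(1); simp)
 also have "... <= 2 * exp (4 * (r^2 * mp2 g h))" using e1(2) e2(2) by simp
 finally show "(LINT om|P. exp (r * \<bar>dev g h om\<bar>)) <= 2 * exp (4 * (r^2 * mp2 g h))" .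
qed

end

section \<open>The event of regular sampling and the averaged transform\<close>

context sampled_model begin

abbreviation "sdev om \<equiv> dev (G om) (H om)"

abbreviation "lam2 bt om \<equiv> lambda2 rh sg1 sg2 bt (G om) (H om)"
abbreviation "lam3 bt om \<equiv> lambda3 rh sg1 sg2 bt (G om) (H om)"

lemma grid_G: "om : space P ==> is_grid T (G om)" and grid_H: "om : space P ==> is_grid T (H om)"
 using grid by auto

lemma lam_bounds:
 assumes "om : space P" "0 < bt"
 shows "\<bar>lam2 bt om\<bar> <= 2 * Kmu / bt" "\<bar>lam3 bt om\<bar> <= 24 * S^2 * mesh (G om) (H om) * mp2 (G om) (H om) / bt^2"
 "\<bar>lam3 bt om\<bar> <= 24 * S^2 * T * Kmu / bt^2"
proof -
 note g = grid_G[OF assms(1)] grid_H[OF assms(1)]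
 note m = mu_bounds[OF g]
 show "\<bar>lam2 bt om\<bar> <= 2 * Kmu / bt" using m assms(2) by (simp add: lambda2_def abs_mult field_simps)
 have "8 * \<bar>mp3 (G om) (H om)\<bar> / bt^2 <= 8 * (3 * S^2 * mesh (G om) (H om) * mp2 (G om) (H om)) / bt^2"
 using m(3) by (intro divide_right_mono mult_left_mono) auto
 moreover have "\<bar>lam3 bt om\<bar> = 8 * \<bar>mp3 (G om) (H om)\<bar> / bt^2"
 using assms(2) by (simp add: lambda3_def abs_mult divide_inverse)
 ultimately show 1: "\<bar>lam3 bt om\<bar> <= 24 * S^2 * mesh (G om) (H om) * mp2 (G om) (H om) / bt^2" by simp
 have "24 * S^2 * (mesh (G om) (H om) * mp2 (G om) (H om)) / bt^2 <= 24 * S^2 * (T * Kmu) / bt^2"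
 using m mesh_bounds[OF g] T by (intro divide_right_mono mult_left_mono mult_mono) auto
 then show "\<bar>lam3 bt om\<bar> <= 24 * S^2 * T * Kmu / bt^2" using 1 by (simp add: mult.assoc)
qed

lemma lam_measurable: "lam2 bt : borel_measurable P" "lam3 bt : borel_measurable P"
proof -
 have "(%om. mu2_index (GH om)) : borel_measurable P" "(%om. mu3_index (GH om)) : borel_measurable P"
 by (rule measurable_compose[OF GH_measurable mu_index_measurable(1)] measurable_compose[OF GH_measurable mu_index_measurable(2)])+
 then have "(%om. mp2 (G om) (H om)) : borel_measurable P" "(%om. mp3 (G om) (H om)) : borel_measurable P"
 using GH_functionals by (simp_all cong: measurable_cong)
 then show "lam2 bt : borel_measurable P" "lam3 bt : borel_measurable P"
 unfolding lambda2_def lambda3_def by measurable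
qed

lemma lam_integrable: "0 < bt ==> integrable P (lam2 bt)" "0 < bt ==> integrable P (lam3 bt)"
 by (rule integrable_const_bound[OF AE_I2 lam_measurable(1)] integrable_const_bound[OF AE_I2 lam_measurable(2)],
 (simp only: real_norm_def, rule lam_bounds(1,3); assumption))+

definition good :: "real => real => real => 'a set" where
 "good c bt a = {om : space P. (lam2 bt om - c)\<^sup>2 <= bt powr (2 * a - 1) & mesh (G om) (H om) <= bt powr a}"

text \<open>The event expressed on the space of canonical grids, since disintegration needs a factor
  that depends on the grids alone.\<close>

definition good_ind :: "real => real => real => grid \<times> grid => real" where
 "good_ind c bt a p = (if (2 * inverse bt * mu2_index p - c)\<^sup>2 <= bt powr (2 * a - 1) & mesh_violations (bt powr a) p = 0 then 1 else 0)"

lemma good_ind_measurable: "good_ind c bt a : borel_measurable grids"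
 unfolding good_ind_def[abs_def] by measurable

lemma good_ind_eq: "om : space P ==> good_ind c bt a (GH om) = indicator (good c bt a) om"
 by (simp add: good_ind_def good_def GH_functionals lambda2_def)

lemma good_events: "good c bt a : events"
proof -
 have [measurable]: "(%om. good_ind c bt a (GH om)) : borel_measurable P"
 by (rule measurable_compose[OF GH_measurable good_ind_measurable])
 have "{om : space P. good_ind c bt a (GH om) = 1} : events" by measurable
 moreover have "{om : space P. good_ind c bt a (GH om) = 1} = good c bt a"
 proof (rule set_eqI)
 fix om show "om : {om : space P. good_ind c bt a (GH om) = 1} \<longleftrightarrow> om : good c bt a"
 using good_ind_eq[of om c bt a] by (cases "om : space P") (simp_all add: indicator_def, simp add: good_def)
 qed
 ultimately show ?thesis by simp
qed

text \<open>Integrability of the sections is asked only where \<open>k\<close> is non-zero: at the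
  scale \<open>bt powr (- 1 / 2)\<close> exponential moments are available only for grids in
  \<open>good\<close>.\<close>

lemma disintegration_dev:
 fixes ph :: "real => 'b :: {banach, second_countable_topology}"
 assumes k: "k : borel_measurable grids" and ph: "ph : borel_measurable borel"
 and int: "!!om. om : space P ==> k (GH om) ~= 0 ==> integrable P (%om'. ph (sdev om om'))"
 and bound: "!!om. om : space P ==> \<bar>k (GH om)\<bar> * (LINT om'|P. norm (ph (sdev om om'))) <= K"
 shows "integrable P (%om. k (GH om) *\<^sub>R ph (sdev om om))"
 "integrable P (%om. k (GH om) *\<^sub>R (LINT om'|P. ph (sdev om om')))"
 "(LINT om|P. k (GH om) *\<^sub>R ph (sdev om om)) = (LINT om|P. k (GH om) *\<^sub>R (LINT om'|P. ph (sdev om om')))"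
proof -
 define f where "f p = k (fst p) *\<^sub>R ph (path_statistic T p - theta T rh sg1 sg2)" for p
 have [measurable]: "path_statistic T : borel_measurable (grids \<Otimes>\<^sub>M paths T)" using T by (intro path_statistic_measurable) simp
 have m1: "(%p. k (fst p)) : borel_measurable (grids \<Otimes>\<^sub>M paths T)" by (rule measurable_compose[OF measurable_fst k])
 have "(%p. path_statistic T p - theta T rh sg1 sg2) : borel_measurable (grids \<Otimes>\<^sub>M paths T)" by measurable
 then have m2: "(%p. ph (path_statistic T p - theta T rh sg1 sg2)) : borel_measurable (grids \<Otimes>\<^sub>M paths T)" by (rule measurable_compose[OF _ ph])
 have f: "f : borel_measurable (grids \<Otimes>\<^sub>M paths T)" unfolding f_def[abs_def] by (rule borel_measurable_scaleR[OF m1 m2])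
 have eq: "f (GH om, W om') = k (GH om) *\<^sub>R ph (sdev om om')" if "om : space P" "om' : space P" for om om'
 unfolding f_def path_statistic_GH_W[OF that] dev_def fst_conv ..
 have in_eq: "(LINT om'|P. f (GH om, W om')) = k (GH om) *\<^sub>R (LINT om'|P. ph (sdev om om'))" if "om : space P" for om
 proof -
 have "(LINT om'|P. f (GH om, W om')) = (LINT om'|P. k (GH om) *\<^sub>R ph (sdev om om'))"
 by (rule lintegral_cong[OF refl]) (rule eq[OF that])
 then show ?thesis by simp
 qed
 have i: "integrable P (%om'. f (GH om, W om'))" if om: "om : space P" for om
 proof -
 have "integrable P (%om'. k (GH om) *\<^sub>R ph (sdev om om'))"
 using int[OF om] by (cases "k (GH om) = 0") auto
 then show ?thesis using Bochner_Integration.integrable_cong[OF refl eq[OF om], of P] by simp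
 qed
 have b: "(LINT om'|P. norm (f (GH om, W om'))) <= K" if om: "om : space P" for om
 proof -
 have "(LINT om'|P. norm (f (GH om, W om'))) = (LINT om'|P. \<bar>k (GH om)\<bar> * norm (ph (sdev om om')))"
 by (rule lintegral_cong[OF refl]) (simp add: eq[OF om])
 then show ?thesis using bound[OF om] by simp
 qed
 note d = disintegration[OF f i b]
 show "integrable P (%om. k (GH om) *\<^sub>R ph (sdev om om))"
 using d(1) Bochner_Integration.integrable_cong[OF refl eq, of P "%om. om"] by simp
 show "integrable P (%om. k (GH om) *\<^sub>R (LINT om'|P. ph (sdev om om')))"
 using d(2) Bochner_Integration.integrable_cong[OF refl in_eq, of P] by simp
 have "(LINT om|P. k (GH om) *\<^sub>R ph (sdev om om)) = (LINT om|P. f (GH om, W om))"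
 by (rule lintegral_cong[OF refl]) (rule eq[symmetric])
 also have "... = (LINT om|P. (LINT om'|P. f (GH om, W om')))" by (rule d(3))
 also have "... = (LINT om|P. k (GH om) *\<^sub>R (LINT om'|P. ph (sdev om om')))"
 by (rule lintegral_cong[OF refl in_eq])
 finally show "(LINT om|P. k (GH om) *\<^sub>R ph (sdev om om)) = (LINT om|P. k (GH om) *\<^sub>R (LINT om'|P. ph (sdev om om')))" .
qed

lemma s0_pos: "0 < s0" using S(1) T by (simp add: s0_def)

text \<open>Given the grids, the exponential moment at scale \<open>s0\<close> is at most
  \<open>Kexp\<close> whatever the grids are. A weight depending on the grids thus contributes its
  full mean, with none of the loss that Hoelder's inequality would bring.\<close>

lemma event_exp_moment:
 assumes k: "k : borel_measurable grids" and k01: "!!p. 0 <= k p & k p <= 1"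
 shows "integrable P (%om. k (GH om) * exp (s0 * \<bar>sdev om om\<bar>))"
 "(LINT om|P. k (GH om) * exp (s0 * \<bar>sdev om om\<bar>)) <= Kexp * (LINT om|P. k (GH om))"
proof -
 have e: "integrable P (%om'. exp (s0 * \<bar>sdev om om'\<bar>))" "(LINT om'|P. exp (s0 * \<bar>sdev om om'\<bar>)) <= Kexp"
 if om: "om : space P" for om
 proof -
 note g = grid_G[OF om] grid_H[OF om]
 have "3 * S^2 * s0 * mesh (G om) (H om) <= 3 * S^2 * s0 * T"
 using mesh_bounds[OF g] s0_pos by (intro mult_left_mono) auto
 also have "... = 1 / 4" using S(1) T by (simp add: s0_def)
 finally have sm: "3 * S^2 * s0 * mesh (G om) (H om) <= 1 / 4" .
 show "integrable P (%om'. exp (s0 * \<bar>sdev om om'\<bar>))" by (rule deviation_exp_moment(1)[OF g s0_pos sm])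
 have "2 * exp (4 * (s0^2 * mp2 (G om) (H om))) <= Kexp"
 unfolding Kexp_def using mu_bounds(2)[OF g] by (simp add: mult_left_mono)
 then show "(LINT om'|P. exp (s0 * \<bar>sdev om om'\<bar>)) <= Kexp"
 using deviation_exp_moment(2)[OF g s0_pos sm] by linarith
 qed
 have Kexp: "0 <= Kexp" by (simp add: Kexp_def)
 have km: "(%om. k (GH om)) : borel_measurable P" by (rule measurable_compose[OF GH_measurable k])
 have ki: "integrable P (%om. k (GH om))" by (rule integrable_const_bound[of _ 1]) (use k01 km in auto)
 have bd: "\<bar>k (GH om)\<bar> * (LINT om'|P. norm (exp (s0 * \<bar>sdev om om'\<bar>))) <= 1 * Kexp" if "om : space P" for om
 using e(2)[OF that] k01[of "GH om"] by (intro mult_mono) auto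
 have pm: "(%x. exp (s0 * abs x)) : borel_measurable borel" by measurable
 note d = disintegration_dev[OF k pm e(1) bd]
 show "integrable P (%om. k (GH om) * exp (s0 * \<bar>sdev om om\<bar>))" using d(1) by simp
 have "(LINT om|P. k (GH om) * exp (s0 * \<bar>sdev om om\<bar>)) = (LINT om|P. k (GH om) * (LINT om'|P. exp (s0 * \<bar>sdev om om'\<bar>)))"
 using d(3) by simp
 also have "... <= (LINT om|P. k (GH om) * Kexp)"
 proof (rule integral_mono)
 show "integrable P (%om. k (GH om) * (LINT om'|P. exp (s0 * \<bar>sdev om om'\<bar>)))" using d(2) by simp
 show "integrable P (%om. k (GH om) * Kexp)" using ki by simp
 fix om assume "om : space P"
 then show "k (GH om) * (LINT om'|P. exp (s0 * \<bar>sdev om om'\<bar>)) <= k (GH om) * Kexp"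
 using k01 e(2) by (intro mult_left_mono) auto
 qed
 finally show "(LINT om|P. k (GH om) * exp (s0 * \<bar>sdev om om\<bar>)) <= Kexp * (LINT om|P. k (GH om))" by (simp add: mult.commute)
qed

end

text \<open>Names the constant of \<open>chaos_mgf_expansion\<close>, so that one value can be fixed
  before the sample size varies.\<close>

definition chaos_expansion_const :: "real => real => bool" where
 "chaos_expansion_const c K \<longleftrightarrow> 0 <= K & (\<forall>(J :: nat set) a ep (w :: complex). finite J --> \<bar>Re w\<bar> <= 1 -->
 (\<forall>k\<in>J. \<bar>a k\<bar> <= ep) --> 0 <= ep --> ep <= 1 / 4 --> 64 * ep^2 <= c --> \<bar>2 * (SUM k:J. (a k)\<^sup>2) - c\<bar> <= c / 2 -->
 norm (chaos_mgf J a w - exp (of_real (c / 2) * w^2) *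
 (1 + of_real ((2 * (SUM k:J. (a k)\<^sup>2) - c) / 2) * w^2 + of_real (4 / 3 * (SUM k:J. (a k) ^ 3)) * w ^ 3))
 <= K * (ep^2 + (2 * (SUM k:J. (a k)\<^sup>2) - c)\<^sup>2) / (1 + (Im w)\<^sup>2))"

lemma chaos_expansion_const_exists: "0 < c ==> \<exists>K. chaos_expansion_const c K"
 unfolding chaos_expansion_const_def by (erule chaos_mgf_expansion[where 'i=nat]) (rule exI, intro conjI allI impI, assumption, blast)

context sampled_model begin

text \<open>The expansion in the normalisation of the theorem. Scaling the error by
  \<open>r = bt powr (- 1 / 2)\<close> turns twice the sum of squares into \<open>lam2\<close>, and
  \<open>4 / 3\<close> of the sum of cubes into \<open>bt powr (1 / 2) * lam3 / 6\<close>.\<close>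

lemma good_conditional_mgf:
 assumes c: "0 < c" and bt: "0 < bt" and K: "chaos_expansion_const c K"
 and ep: "ep = 3 * S^2 * bt powr (a - 1 / 2)" "ep <= 1 / 4" "64 * ep^2 <= c" and d: "bt powr (2 * a - 1) <= (c / 2)\<^sup>2"
 and om: "om : good c bt a"
 shows "3 * S^2 * bt powr (- 1 / 2) * mesh (G om) (H om) <= 1 / 4"
 "(bt powr (- 1 / 2))\<^sup>2 * mp2 (G om) (H om) <= c"
 "\<bar>Re w\<bar> <= 1 ==> integrable P (%om'. exp (w * of_real (bt powr (- 1 / 2) * sdev om om')))"
 "\<bar>Re w\<bar> <= 1 ==> norm ((LINT om'|P. exp (w * of_real (bt powr (- 1 / 2) * sdev om om')))
 - exp (of_real (c / 2) * w^2) * (1 + of_real ((lam2 bt om - c) / 2) * w^2 + of_real (bt powr (1 / 2) * lam3 bt om / 6) * w ^ 3))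
 <= K * (ep^2 + bt powr (2 * a - 1)) / (1 + (Im w)\<^sup>2)"
proof -
 define r where "r = bt powr (- 1 / 2)"
 have r: "0 < r" using bt by (simp add: r_def)
 have sp: "om : space P" and l2: "(lam2 bt om - c)\<^sup>2 <= bt powr (2 * a - 1)" and me: "mesh (G om) (H om) <= bt powr a"
 using om by (auto simp: good_def)
 note g = grid_G[OF sp] grid_H[OF sp]
 have r2: "r^2 = inverse bt"
 proof -
 have "r^2 = bt powr (- 1 / 2 + - 1 / 2)" unfolding r_def powr_add power2_eq_square ..
 then show ?thesis using bt by (simp add: powr_minus)
 qed
 have r3: "r ^ 3 = bt powr (1 / 2) * inverse (bt^2)"
 proof -
 have "bt powr (1 / 2) * r = 1" unfolding r_def powr_add[symmetric] using bt by simp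
 then have "bt powr (1 / 2) * (r^2 * r^2) = r ^ 3" by (simp add: power2_eq_square power3_eq_cube)
 then show ?thesis unfolding r2 by (simp add: power2_eq_square)
 qed
 have rm: "3 * S^2 * r * mesh (G om) (H om) <= ep"
 proof -
 have "3 * S^2 * r * mesh (G om) (H om) <= 3 * S^2 * r * bt powr a" using me r by (intro mult_left_mono) auto
 also have "r * bt powr a = bt powr (a - 1 / 2)" unfolding r_def powr_add[symmetric] by simp
 then have "3 * S^2 * r * bt powr a = ep" unfolding ep(1) by (simp add: mult.assoc)
 finally show ?thesis .
 qed
 then have sm: "3 * S^2 * r * mesh (G om) (H om) <= 1 / 4" using ep(2) by linarith
 then show "3 * S^2 * bt powr (- 1 / 2) * mesh (G om) (H om) <= 1 / 4" unfolding r_def .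
 have l2': "lam2 bt om = 2 * (r^2 * mp2 (G om) (H om))" unfolding r2 lambda2_def by simp
 have l3': "4 / 3 * (r ^ 3 * mp3 (G om) (H om)) = bt powr (1 / 2) * lam3 bt om / 6" unfolding r3 lambda3_def by simp
 have "\<bar>lam2 bt om - c\<bar> <= \<bar>c / 2\<bar>" using order_trans[OF l2 d] unfolding abs_le_square_iff .
 then have lc: "\<bar>lam2 bt om - c\<bar> <= c / 2" using c by simp
 then have "r^2 * mp2 (G om) (H om) <= c" using c unfolding l2' by linarith
 then show "(bt powr (- 1 / 2))\<^sup>2 * mp2 (G om) (H om) <= c" unfolding r_def .
 obtain J x where H0: "mgf_representation r (G om) (H om) J x" using deviation_mgf[OF g r sm] by (elim exE)
 note H = H0[unfolded mgf_representation_def]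
 note H2 = conjunct2[OF H] note H3 = conjunct2[OF H2] note H4 = conjunct2[OF H3]
 note J = conjunct1[OF H] note bd = conjunct1[OF H2] note s2 = conjunct1[OF H3] note s3 = conjunct1[OF H4] note mg = conjunct2[OF H4]
 have bd': "\<forall>k\<in>J. \<bar>x k\<bar> <= ep" using bd rm by (meson order_trans)
 have ep0: "0 <= ep" unfolding ep(1) by simp
 assume w: "\<bar>Re w\<bar> <= 1"
 show "integrable P (%om'. exp (w * of_real (bt powr (- 1 / 2) * sdev om om')))"
 using mg[rule_format, OF w] unfolding r_def by (rule conjunct1)
 have "\<bar>2 * (SUM k:J. (x k)\<^sup>2) - c\<bar> <= c / 2" unfolding s2 l2'[symmetric] by (rule lc)
 from conjunct2[OF K[unfolded chaos_expansion_const_def], rule_format, OF J w bspec[OF bd'] ep0 ep(2,3) this]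
 have "norm (chaos_mgf J x w - exp (of_real (c / 2) * w^2) *
 (1 + of_real ((2 * (SUM k:J. (x k)\<^sup>2) - c) / 2) * w^2 + of_real (4 / 3 * (SUM k:J. (x k) ^ 3)) * w ^ 3))
 <= K * (ep^2 + (2 * (SUM k:J. (x k)\<^sup>2) - c)\<^sup>2) / (1 + (Im w)\<^sup>2)" .
 also have "... <= K * (ep^2 + bt powr (2 * a - 1)) / (1 + (Im w)\<^sup>2)"
 unfolding s2 l2'[symmetric] using l2 K unfolding chaos_expansion_const_def
 by (intro divide_right_mono mult_left_mono add_left_mono) auto
 finally show "norm ((LINT om'|P. exp (w * of_real (bt powr (- 1 / 2) * sdev om om')))
 - exp (of_real (c / 2) * w^2) * (1 + of_real ((lam2 bt om - c) / 2) * w^2 + of_real (bt powr (1 / 2) * lam3 bt om / 6) * w ^ 3))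
 <= K * (ep^2 + bt powr (2 * a - 1)) / (1 + (Im w)\<^sup>2)"
 unfolding s2 s3 l2'[symmetric] l3' conjunct2[OF mg[rule_format, OF w], symmetric] unfolding r_def .
qed

text \<open>The expansion is affine in \<open>lam2\<close> and \<open>lam3\<close>, so averaging
  over the grids only replaces these by their means over the event. The remainder bound is the same
  for all grids in the event and survives the average.\<close>

lemma good_mgf:
 assumes c: "0 < c" and bt: "0 < bt" and K: "chaos_expansion_const c K"
 and ep: "ep = 3 * S^2 * bt powr (a - 1 / 2)" "ep <= 1 / 4" "64 * ep^2 <= c" and d: "bt powr (2 * a - 1) <= (c / 2)\<^sup>2"
 and w: "\<bar>Re w\<bar> <= 1"
 defines "k \<equiv> indicator (good c bt a)"
 shows "integrable P (%om. k om *\<^sub>R exp (w * of_real (bt powr (- 1 / 2) * sdev om om)))"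
 "norm ((LINT om|P. k om *\<^sub>R exp (w * of_real (bt powr (- 1 / 2) * sdev om om)))
 - exp (of_real (c / 2) * w^2) * (of_real (LINT om|P. k om) + of_real ((LINT om|P. k om * (lam2 bt om - c)) / 2) * w^2
 + of_real (bt powr (1 / 2) * (LINT om|P. k om * lam3 bt om) / 6) * w ^ 3))
 <= K * (ep^2 + bt powr (2 * a - 1)) / (1 + (Im w)\<^sup>2)"
proof -
 define r where "r = bt powr (- 1 / 2)"
 have r: "0 < r" using bt by (simp add: r_def)
 define ph :: "real => complex" where "ph x = exp (w * of_real (r * x))" for x
 have ph: "ph : borel_measurable borel" unfolding ph_def by measurable
 have kk: "good_ind c bt a (GH om) = k om" if "om : space P" for om unfolding k_def by (rule good_ind_eq[OF that])
 have mem: "om : good c bt a" if "om : space P" "good_ind c bt a (GH om) ~= 0" for om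
 using that kk[OF that(1)] by (auto simp: k_def indicator_def split: if_splits)
 note cm = good_conditional_mgf[OF c bt K ep d, folded r_def]
 have int: "integrable P (%om'. ph (sdev om om'))" if "om : space P" "good_ind c bt a (GH om) ~= 0" for om
 unfolding ph_def by (rule cm(3)[OF mem[OF that] w])
 have bd: "\<bar>good_ind c bt a (GH om)\<bar> * (LINT om'|P. norm (ph (sdev om om'))) <= 2 * exp (4 * c)" if om: "om : space P" for om
 proof (cases "good_ind c bt a (GH om) = 0")
 case False
 note mm = mem[OF om False]
 note e = deviation_exp_moment[OF grid_G[OF om] grid_H[OF om] r cm(1)[OF mm]]
 have "norm (ph x) <= exp (r * abs x)" for x
 proof -
 have "Re w * (r * x) <= \<bar>Re w\<bar> * (r * abs x)" using r abs_ge_self[of "Re w * (r * x)"] by (simp add: abs_mult)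
 also have "... <= 1 * (r * abs x)" using w r by (intro mult_right_mono) auto
 finally show ?thesis by (simp add: ph_def norm_exp_eq_Re)
 qed
 then have "(LINT om'|P. norm (ph (sdev om om'))) <= (LINT om'|P. exp (r * \<bar>sdev om om'\<bar>))"
 by (intro integral_mono integrable_norm int om False e(1))
 also have "... <= 2 * exp (4 * (r^2 * mp2 (G om) (H om)))" by (rule e(2))
 also have "... <= 2 * exp (4 * c)" using cm(2)[OF mm] by simp
 finally show ?thesis using kk[OF om] False by (simp add: k_def indicator_def)
 qed simp
 note dd = disintegration_dev[OF good_ind_measurable ph int bd]
 show "integrable P (%om. k om *\<^sub>R exp (w * of_real (bt powr (- 1 / 2) * sdev om om)))"
 using dd(1) unfolding ph_def r_def by (simp add: kk cong: Bochner_Integration.integrable_cong)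
 define Q where "Q om = (LINT om'|P. ph (sdev om om'))" for om
 define E where "E = exp (of_real (c / 2) * w^2)"
 define R where "R om = E * (of_real (k om) + of_real (k om * (lam2 bt om - c)) * (w^2 / 2) + of_real (k om * lam3 bt om) * (of_real (bt powr (1 / 2) / 6) * w ^ 3))" for om
 have ki: "integrable P k" unfolding k_def using good_events by (intro integrable_real_indicator) (auto simp: emeasure_eq_measure)
 have kmult: "integrable P (%om. k om * f om)" if "integrable P f" for f :: "'a => real"
 proof (rule integrable_dominated[OF that])
 show "(%om. k om * f om) : borel_measurable P"
 unfolding k_def by (intro borel_measurable_times borel_measurable_indicator good_events borel_measurable_integrable that)
 show "AE om in P. norm (k om * f om) <= norm (f om)"
 by (rule AE_I2) (simp add: k_def indicator_def)
 qed
 have k2: "integrable P (%om. k om * (lam2 bt om - c))" and k3: "integrable P (%om. k om * lam3 bt om)"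
 using lam_integrable[OF bt] by (auto intro!: kmult)
 have Ri: "integrable P R" unfolding R_def
 by (intro integrable_mult_right Bochner_Integration.integrable_add integrable_mult_left integrable_of_real ki k2 k3)
 have RI: "(LINT om|P. R om) = E * (of_real (LINT om|P. k om) + of_real ((LINT om|P. k om * (lam2 bt om - c)) / 2) * w^2
 + of_real (bt powr (1 / 2) * (LINT om|P. k om * lam3 bt om) / 6) * w ^ 3)"
 proof -
 have i: "integrable P (%om. complex_of_real (k om))" "integrable P (%om. of_real (k om * (lam2 bt om - c)) * (w^2 / 2))"
 "integrable P (%om. of_real (k om * lam3 bt om) * (of_real (bt powr (1 / 2) / 6) * w ^ 3))"
 by (intro integrable_mult_left integrable_of_real ki k2 k3)+
 have "(LINT om|P. R om) = E * ((LINT om|P. complex_of_real (k om)) + (LINT om|P. of_real (k om * (lam2 bt om - c))) * (w^2 / 2)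
 + (LINT om|P. of_real (k om * lam3 bt om)) * (of_real (bt powr (1 / 2) / 6) * w ^ 3))"
 unfolding R_def integral_mult_right_zero
 by (simp only: Bochner_Integration.integral_add[OF Bochner_Integration.integrable_add[OF i(1,2)] i(3)] Bochner_Integration.integral_add[OF i(1,2)] integral_mult_left_zero)
 then show ?thesis unfolding integral_complex_of_real by (simp add: algebra_simps)
 qed
 have Qi: "integrable P (%om. k om *\<^sub>R Q om)"
 using dd(2) unfolding Q_def by (simp add: kk cong: Bochner_Integration.integrable_cong)
 have "(LINT om|P. k om *\<^sub>R ph (sdev om om)) = (LINT om|P. good_ind c bt a (GH om) *\<^sub>R ph (sdev om om))"
 by (rule lintegral_cong[OF refl]) (simp add: kk)
 also have "... = (LINT om|P. good_ind c bt a (GH om) *\<^sub>R (LINT om'|P. ph (sdev om om')))" by (rule dd(3))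
 also have "... = (LINT om|P. k om *\<^sub>R Q om)"
 unfolding Q_def by (rule lintegral_cong[OF refl]) (simp only: kk)
 finally have e1: "(LINT om|P. k om *\<^sub>R ph (sdev om om)) = (LINT om|P. k om *\<^sub>R Q om)" .
 define L where "L = K * (ep^2 + bt powr (2 * a - 1)) / (1 + (Im w)\<^sup>2)"
 have L: "0 <= L" using K by (simp add: L_def chaos_expansion_const_def)
 have pt: "norm (k om *\<^sub>R Q om - R om) <= L" for om
 proof (cases "om : good c bt a")
 case True
 have "k om *\<^sub>R Q om - R om = Q om - E * (1 + of_real ((lam2 bt om - c) / 2) * w^2 + of_real (bt powr (1 / 2) * lam3 bt om / 6) * w ^ 3)"
 using True by (simp add: k_def R_def field_simps)
 then show ?thesis using cm(4)[OF True w] unfolding Q_def E_def ph_def L_def by simp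
 next
 case False
 then show ?thesis using L by (simp add: k_def R_def)
 qed
 have "norm ((LINT om|P. k om *\<^sub>R Q om) - (LINT om|P. R om)) = norm (LINT om|P. k om *\<^sub>R Q om - R om)"
 by (simp only: lintegral_diff[OF Qi Ri])
 also have "... <= (LINT om|P. norm (k om *\<^sub>R Q om - R om))" by (rule integral_norm_bound)
 also have "... <= (LINT om|P. L)" using Qi Ri pt by (intro integral_mono integrable_norm Bochner_Integration.integrable_diff) auto
 also have "... = L" by (simp add: prob_space)
 finally have "norm ((LINT om|P. k om *\<^sub>R ph (sdev om om)) - (LINT om|P. R om)) <= L" unfolding e1 .
 then show "norm ((LINT om|P. k om *\<^sub>R exp (w * of_real (bt powr (- 1 / 2) * sdev om om)))
 - exp (of_real (c / 2) * w^2) * (of_real (LINT om|P. k om) + of_real ((LINT om|P. k om * (lam2 bt om - c)) / 2) * w^2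
 + of_real (bt powr (1 / 2) * (LINT om|P. k om * lam3 bt om) / 6) * w ^ 3))
 <= K * (ep^2 + bt powr (2 * a - 1)) / (1 + (Im w)\<^sup>2)"
 unfolding RI E_def ph_def r_def L_def .
qed

lemma off_good_bound:
 assumes "0 < bt" and X: "X : borel_measurable P" and b: "!!om. om : space P ==> \<bar>X om\<bar> <= L"
 shows "\<bar>(LINT om|P. indicator (good c bt a) om * X om) - (LINT om|P. X om)\<bar> <= L * prob (space P - good c bt a)" "0 <= L"
proof -
 have Xi: "integrable P X" by (rule integrable_const_bound[of _ L]) (use b X in auto)
 obtain om0 where "om0 : space P" using not_empty by blast
 then show L: "0 <= L" using b[of om0] by linarith
 have gi: "integrable P (%om. indicator (good c bt a) om * X om)"
 by (rule integrable_dominated[OF Xi]) (use X good_events[of c bt a] in \<open>auto simp: indicator_def\<close>)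
 have "\<bar>(LINT om|P. indicator (good c bt a) om * X om) - (LINT om|P. X om)\<bar> = \<bar>\<integral>om. indicator (good c bt a) om * X om - X om \<partial>P\<bar>"
 by (simp only: lintegral_diff[OF gi Xi])
 also have "... <= (LINT om|P. \<bar>indicator (good c bt a) om * X om - X om\<bar>)" by (rule integral_abs_bound)
 also have "... <= (LINT om|P. L * indicator (space P - good c bt a) om)"
 proof (rule integral_mono)
 show "integrable P (%om. \<bar>indicator (good c bt a) om * X om - X om\<bar>)" using gi Xi by (intro integrable_abs Bochner_Integration.integrable_diff)
 show "integrable P (%om. L * indicator (space P - good c bt a) om)"
 using good_events by (intro integrable_mult_right integrable_real_indicator) (auto simp: emeasure_eq_measure)
 fix om assume "om : space P"
 then show "\<bar>indicator (good c bt a) om * X om - X om\<bar> <= L * indicator (space P - good c bt a) om"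
 using b by (auto simp: indicator_def)
 qed
 also have "... = L * prob (space P - good c bt a)" using good_events[of c bt a] by simp
 finally show "\<bar>(LINT om|P. indicator (good c bt a) om * X om) - (LINT om|P. X om)\<bar> <= L * prob (space P - good c bt a)" .
qed

end

section \<open>From the averaged transform to expectations of test functions\<close>

context sampled_model begin

lemma dev_random_measurable: "(%om. sdev om om) : borel_measurable P"
proof -
 have m: "path_statistic T : borel_measurable (grids \<Otimes>\<^sub>M paths T)" using T by (intro path_statistic_measurable) simp
 have "(%om. path_statistic T (GH om, W om)) : borel_measurable P"
 by (rule measurable_compose[OF _ m]) (intro measurable_Pair GH_measurable W_measurable)
 then have "(%om. path_statistic T (GH om, W om) - theta T rh sg1 sg2) : borel_measurable P" by measurable
 moreover have "path_statistic T (GH om, W om) - theta T rh sg1 sg2 = sdev om om" if "om : space P" for om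
 unfolding path_statistic_GH_W[OF that that] dev_def ..
 ultimately show ?thesis by (subst measurable_cong) (auto simp: dev_def path_statistic_GH_W)
qed

text \<open>The law of the rescaled error restricted to the event, without normalisation: its
  integrals add to those over the complement, and its missing mass is one more small error.\<close>

definition good_law :: "real => real => real => real measure" where
 "good_law c bt a = distr (density P (%om. ennreal (indicator (good c bt a) om))) borel (%om. bt powr (- 1 / 2) * sdev om om)"

lemma good_law_integral:
 fixes g :: "real => 'b :: {banach, second_countable_topology}"
 assumes g: "g : borel_measurable borel"
 shows "integrable (good_law c bt a) g \<longleftrightarrow> integrable P (%om. indicator (good c bt a) om *\<^sub>R g (bt powr (- 1 / 2) * sdev om om))"
 "(LINT x|good_law c bt a. g x) = (LINT om|P. indicator (good c bt a) om *\<^sub>R g (bt powr (- 1 / 2) * sdev om om))"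
proof -
 have Z: "(%om. bt powr (- 1 / 2) * sdev om om) : borel_measurable P"
 using dev_random_measurable by measurable
 then have Z': "(%om. bt powr (- 1 / 2) * sdev om om) : density P (%om. ennreal (indicator (good c bt a) om)) \<rightarrow>\<^sub>M borel"
 unfolding measurable_density_eq1 .
 have k: "(%om. indicator (good c bt a) om :: real) : borel_measurable P" using good_events by simp
 have gz: "(%om. g (bt powr (- 1 / 2) * sdev om om)) : borel_measurable P" by (rule measurable_compose[OF Z g])
 have nn: "AE om in P. (0 :: real) <= indicator (good c bt a) om" by simp
 show "integrable (good_law c bt a) g \<longleftrightarrow> integrable P (%om. indicator (good c bt a) om *\<^sub>R g (bt powr (- 1 / 2) * sdev om om))"
 unfolding good_law_def integrable_distr_eq[OF Z' g] integrable_density[OF gz k nn] ..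
 show "(LINT x|good_law c bt a. g x) = (LINT om|P. indicator (good c bt a) om *\<^sub>R g (bt powr (- 1 / 2) * sdev om om))"
 unfolding good_law_def integral_distr[OF Z' g] integral_density[OF gz k nn] ..
qed

lemma good_law_finite: "finite_measure (good_law c bt a)"
proof -
 have k: "(%om. ennreal (indicator (good c bt a) om)) : borel_measurable P" using good_events by simp
 have "emeasure (density P (%om. ennreal (indicator (good c bt a) om))) (space P) = (\<integral>\<^sup>+om. ennreal (indicator (good c bt a) om) * indicator (space P) om \<partial>P)"
 by (rule emeasure_density[OF k]) simp
 also have "... <= (\<integral>\<^sup>+om. 1 \<partial>P)" by (rule nn_integral_mono) (simp add: indicator_def)
 also have "... = 1" by (simp add: emeasure_space_1)
 finally have "emeasure (density P (%om. ennreal (indicator (good c bt a) om))) (space P) ~= \<infinity>"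
 by (metis ennreal_one_neq_top infinity_ennreal_def neq_top_trans)
 then have "finite_measure (density P (%om. ennreal (indicator (good c bt a) om)))" by (intro finite_measureI) simp
 then show ?thesis unfolding good_law_def
 by (rule finite_measure.finite_measure_distr) (unfold measurable_density_eq1, intro borel_measurable_times borel_measurable_const dev_random_measurable)
qed

lemma powr_small:
 fixes bt :: real
 assumes "0 < bt" "bt < 1" "p <= 1" shows "bt <= bt powr p"
 using powr_mono'[of p 1 bt] assms by simp

lemma kappa_bound:
 assumes c: "0 < c" and a: "3 / 4 < a" "a < 1" and bt: "0 < bt" "bt < 1" and d: "bt powr (2 * a - 1) <= (c / 2)\<^sup>2"
 and q: "prob (space P - good c bt a) <= bt ^ 3"
 shows "\<bar>bt powr (1 / 2) * (LINT om|P. lam3 bt om)\<bar> <= (24 * S^2 * c + 24 * S^2 * T * Kmu) * bt powr (a - 1 / 2)"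
proof -
 define k :: "'a => real" where "k = indicator (good c bt a)"
 have m: "lam3 bt : borel_measurable P" by (rule lam_measurable(2))
 have off: "\<bar>(LINT om|P. k om * lam3 bt om) - (LINT om|P. lam3 bt om)\<bar> <= 24 * S^2 * T * Kmu / bt^2 * prob (space P - good c bt a)"
 and K9: "0 <= 24 * S^2 * T * Kmu / bt^2"
 unfolding k_def by (rule off_good_bound[OF bt(1) m lam_bounds(3)[OF _ bt(1)]]; assumption)+
 have Kmu: "0 <= 24 * S^2 * T * Kmu" using T by (simp add: Kmu_def)
 have "24 * S^2 * T * Kmu / bt^2 * prob (space P - good c bt a) <= 24 * S^2 * T * Kmu / bt^2 * bt ^ 3"
 by (rule mult_left_mono[OF q K9])
 also have "... = 24 * S^2 * T * Kmu * bt" using bt by (simp add: power2_eq_square power3_eq_cube)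
 finally have off': "\<bar>(LINT om|P. k om * lam3 bt om) - (LINT om|P. lam3 bt om)\<bar> <= 24 * S^2 * T * Kmu * bt" using off by linarith
 have pt: "\<bar>k om * lam3 bt om\<bar> <= 24 * S^2 * c * bt powr (a - 1)" for om
 proof (cases "om : good c bt a")
 case True
 then have sp: "om : space P" and l2: "(lam2 bt om - c)\<^sup>2 <= bt powr (2 * a - 1)" and me: "mesh (G om) (H om) <= bt powr a"
 by (auto simp: good_def)
 note g = grid_G[OF sp] grid_H[OF sp]
 have "\<bar>lam2 bt om - c\<bar> <= \<bar>c / 2\<bar>" using order_trans[OF l2 d] unfolding abs_le_square_iff .
 then have "\<bar>lam2 bt om - c\<bar> <= c / 2" using c by simp
 then have "lam2 bt om <= 2 * c" using c abs_ge_self[of "lam2 bt om - c"] by linarith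
 then have mu: "mp2 (G om) (H om) <= bt * c" using bt(1) by (simp add: lambda2_def field_simps)
 have "\<bar>lam3 bt om\<bar> <= 24 * S^2 * mesh (G om) (H om) * mp2 (G om) (H om) / bt^2" by (rule lam_bounds(2)[OF sp bt(1)])
 also have "... <= 24 * S^2 * bt powr a * (bt * c) / bt^2"
 using me mu mu_bounds(1)[OF g] mesh_bounds(1)[OF g] by (intro divide_right_mono mult_mono mult_left_mono) auto
 also have "... = 24 * S^2 * c * (bt powr a / bt)" using bt by (simp add: power2_eq_square)
 also have "bt powr a / bt = bt powr (a - 1)" using bt by (simp add: powr_diff)
 finally show ?thesis using True by (simp add: k_def)
 next
 case False
 then show ?thesis using c by (simp add: k_def)
 qed
 have ki: "integrable P (%om. k om * lam3 bt om)"
 by (rule integrable_const_bound[of _ "24 * S^2 * c * bt powr (a - 1)"]) (use pt m good_events in \<open>auto simp: k_def\<close>)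
 have "\<bar>\<integral>om. k om * lam3 bt om \<partial>P\<bar> <= (LINT om|P. \<bar>k om * lam3 bt om\<bar>)" by (rule integral_abs_bound)
 also have "... <= (LINT om|P. 24 * S^2 * c * bt powr (a - 1))" by (intro integral_mono integrable_abs ki pt) simp
 also have "... = 24 * S^2 * c * bt powr (a - 1)" by (simp add: prob_space)
 finally have in': "\<bar>\<integral>om. k om * lam3 bt om \<partial>P\<bar> <= 24 * S^2 * c * bt powr (a - 1)" .
 have h1: "bt powr (1 / 2) * bt powr (a - 1) = bt powr (a - 1 / 2)" unfolding powr_add[symmetric] by simp
 have h2: "bt powr (1 / 2) * bt <= 1 * bt powr (a - 1 / 2)"
 using bt a by (intro mult_mono powr_small powr_le_one_le) (auto intro: powr_le1)
 have "\<bar>\<integral>om. lam3 bt om \<partial>P\<bar> <= 24 * S^2 * c * bt powr (a - 1) + 24 * S^2 * T * Kmu * bt" using off' in' by linarith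
 then have "bt powr (1 / 2) * \<bar>\<integral>om. lam3 bt om \<partial>P\<bar> <= bt powr (1 / 2) * (24 * S^2 * c * bt powr (a - 1) + 24 * S^2 * T * Kmu * bt)"
 by (rule mult_left_mono) simp
 also have "... = 24 * S^2 * c * (bt powr (1 / 2) * bt powr (a - 1)) + 24 * S^2 * T * Kmu * (bt powr (1 / 2) * bt)" by (simp add: algebra_simps)
 also have "... <= 24 * S^2 * c * bt powr (a - 1 / 2) + 24 * S^2 * T * Kmu * (1 * bt powr (a - 1 / 2))"
 unfolding h1 using h2 Kmu c by (intro add_mono mult_left_mono) auto
 also have "... = (24 * S^2 * c + 24 * S^2 * T * Kmu) * bt powr (a - 1 / 2)" by (simp add: algebra_simps)
 finally show ?thesis by (simp add: abs_mult)
qed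

text \<open>Replaces means over the event by full expectations. The three errors are the missing
  mass, the bias of \<open>lam2\<close> with its part off the event, and the part of
  \<open>lam3\<close> off the event. As \<open>lam2\<close> and \<open>lam3\<close> are at most of
  order \<open>1 / bt\<close> and \<open>1 / bt^2\<close>, the bound \<open>bt ^ 3\<close> on the
  complement leaves at least a factor \<open>bt\<close>, which is below the rate.\<close>

lemma good_edgeworth_mgf:
 assumes c: "0 < c" and a: "3 / 4 < a" "a < 1" and bt: "0 < bt" "bt < 1" and K: "chaos_expansion_const c K1"
 and ep: "3 * S^2 * bt powr (a - 1 / 2) <= 1 / 4" "64 * (3 * S^2 * bt powr (a - 1 / 2))\<^sup>2 <= c" and d: "bt powr (2 * a - 1) <= (c / 2)\<^sup>2"
 and q: "prob (space P - good c bt a) <= bt ^ 3"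
 and bias: "\<bar>\<integral>om. lam2 bt om - c \<partial>P\<bar> <= Kb * bt powr (2 * a - 1)"
 and K3: "0 <= K3" "norm (exp (of_real (c / 2) * (Complex s u)\<^sup>2)) * (1 + norm (Complex s u) ^ 2 + norm (Complex s u) ^ 3) <= K3 / (1 + u^2)"
 and s: "abs s <= 1"
 shows "norm ((LINT z|good_law c bt a. exp (Complex s u * of_real z)) - edgeworth_mgf c (bt powr (1 / 2) * (LINT om|P. lam3 bt om)) (Complex s u))
 <= (K1 * ((3 * S^2)\<^sup>2 + 1) + (1 + (Kb + 2 * Kmu + c) + 24 * S^2 * T * Kmu) * K3) * bt powr (2 * a - 1) / (1 + u^2)"
proof -
 define w where "w = Complex s u"
 define D where "D = bt powr (2 * a - 1)"
 define k :: "'a => real" where "k = indicator (good c bt a)"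
 define E where "E = exp (of_real (c / 2) * w^2)"
 define I1 where "I1 = (LINT om|P. k om)"
 define I2 where "I2 = (LINT om|P. k om * (lam2 bt om - c))"
 define I3 where "I3 = (LINT om|P. k om * lam3 bt om)"
 define l where "l = (LINT om|P. lam3 bt om)"
 define r where "r = bt powr (1 / 2)"
 have D0: "0 <= D" by (simp add: D_def)
 have btD: "bt <= D" unfolding D_def using bt a by (intro powr_small) auto
 have btn: "bt ^ 2 <= bt" "bt ^ 3 <= bt" using bt power_decreasing[of 1 2 bt] power_decreasing[of 1 3 bt] by auto
 have Kmu: "0 <= Kmu" by (simp add: Kmu_def)
 have K9: "0 <= 24 * S^2 * T * Kmu" using T Kmu by simp
 have r: "0 <= r" "r <= 1" unfolding r_def using bt by (auto intro: powr_le1)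
 have b1: "\<bar>I1 - 1\<bar> <= D"
 proof -
 have "I1 = prob (good c bt a)" unfolding I1_def k_def using good_events by simp
 then have "1 - I1 = prob (space P - good c bt a)" using prob_compl[OF good_events] by simp
 then show ?thesis using q btn btD measure_nonneg[of P "space P - good c bt a"] by linarith
 qed
 have b2: "abs I2 <= (Kb + 2 * Kmu + c) * D"
 proof -
 have m: "(%om. lam2 bt om - c) : borel_measurable P" using lam_measurable(1) by measurable
 have b: "\<bar>lam2 bt om - c\<bar> <= 2 * Kmu / bt + c" if "om : space P" for om
 using lam_bounds(1)[OF that bt(1)] c by linarith
 have "\<bar>I2 - (LINT om|P. lam2 bt om - c)\<bar> <= (2 * Kmu / bt + c) * prob (space P - good c bt a)"
 unfolding I2_def k_def by (rule off_good_bound(1)[OF bt(1) m b])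
 also have "... <= (2 * Kmu / bt + c) * bt ^ 3"
 by (rule mult_left_mono[OF q]) (use Kmu bt c in auto)
 also have "... = 2 * Kmu * bt ^ 2 + c * bt ^ 3" using bt by (simp add: distrib_right power2_eq_square power3_eq_cube)
 also have "... <= 2 * Kmu * D + c * D" using Kmu c btn btD by (intro add_mono mult_left_mono) auto
 finally have "\<bar>I2 - (LINT om|P. lam2 bt om - c)\<bar> <= 2 * Kmu * D + c * D" .
 then have "abs I2 <= Kb * D + (2 * Kmu * D + c * D)" using bias unfolding D_def by linarith
 then show ?thesis by (simp add: algebra_simps)
 qed
 have b3: "\<bar>r * (I3 - l)\<bar> <= 24 * S^2 * T * Kmu * D"
 proof -
 have "\<bar>I3 - l\<bar> <= 24 * S^2 * T * Kmu / bt^2 * prob (space P - good c bt a)"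
 unfolding I3_def l_def k_def by (rule off_good_bound(1)[OF bt(1) lam_measurable(2) lam_bounds(3)[OF _ bt(1)]])
 also have "... <= 24 * S^2 * T * Kmu / bt^2 * bt ^ 3" by (rule mult_left_mono[OF q]) (use K9 in simp)
 also have "... = 24 * S^2 * T * Kmu * bt" using bt by (simp add: power2_eq_square power3_eq_cube)
 also have "... <= 24 * S^2 * T * Kmu * D" by (rule mult_left_mono[OF btD K9])
 finally have 1: "\<bar>I3 - l\<bar> <= 24 * S^2 * T * Kmu * D" .
 have "r * \<bar>I3 - l\<bar> <= 1 * (24 * S^2 * T * Kmu * D)" by (rule mult_mono[OF r(2) 1]) (use r in auto)
 then show ?thesis using r by (simp add: abs_mult)
 qed
 define m where "m = (1 + (Kb + 2 * Kmu + c) + 24 * S^2 * T * Kmu) * D"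
 have p2: "0 <= (Kb + 2 * Kmu + c) * D" using b2 by linarith
 have p3: "0 <= 24 * S^2 * T * Kmu * D" using K9 D0 by simp
 have m: "m = D + (Kb + 2 * Kmu + c) * D + 24 * S^2 * T * Kmu * D" by (simp add: m_def algebra_simps)
 have w: "\<bar>Re w\<bar> <= 1" using s by (simp add: w_def)
 have Imw: "Im w = u" by (simp add: w_def)
 have "(LINT z|good_law c bt a. exp (w * of_real z)) = (LINT om|P. k om *\<^sub>R exp (w * of_real (bt powr (- 1 / 2) * sdev om om)))"
 unfolding k_def by (rule good_law_integral(2)) measurable
 then have A: "norm ((LINT z|good_law c bt a. exp (w * of_real z)) - E * (of_real I1 + of_real (I2 / 2) * w^2 + of_real (r * I3 / 6) * w ^ 3))
 <= K1 * ((3 * S^2 * bt powr (a - 1 / 2))\<^sup>2 + D) / (1 + u^2)"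
 using good_mgf(2)[OF c bt(1) K refl ep d w] unfolding E_def I1_def I2_def I3_def k_def D_def r_def Imw by simp
 have "(3 * S^2 * bt powr (a - 1 / 2))\<^sup>2 = (3 * S^2)\<^sup>2 * D"
 unfolding D_def power_mult_distrib[of "3 * S^2"] power2_eq_square[of "bt powr _"] powr_add[symmetric] by simp
 then have "K1 * ((3 * S^2 * bt powr (a - 1 / 2))\<^sup>2 + D) = K1 * ((3 * S^2)\<^sup>2 + 1) * D" by (simp only:) (simp add: algebra_simps)
 then have A': "norm ((LINT z|good_law c bt a. exp (w * of_real z)) - E * (of_real I1 + of_real (I2 / 2) * w^2 + of_real (r * I3 / 6) * w ^ 3))
 <= K1 * ((3 * S^2)\<^sup>2 + 1) * D / (1 + u^2)" using A by (simp only:)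
 have "E * (of_real I1 + of_real (I2 / 2) * w^2 + of_real (r * I3 / 6) * w ^ 3) - edgeworth_mgf c (r * l) w
 = E * (of_real (I1 - 1) + of_real (I2 / 2) * w^2 + of_real (r * (I3 - l) / 6) * w ^ 3)"
 unfolding edgeworth_mgf_def E_def[symmetric] right_diff_distrib[symmetric] by (simp add: algebra_simps diff_divide_distrib)
 then have "norm (E * (of_real I1 + of_real (I2 / 2) * w^2 + of_real (r * I3 / 6) * w ^ 3) - edgeworth_mgf c (r * l) w)
 = norm E * norm (of_real (I1 - 1) + of_real (I2 / 2) * w^2 + of_real (r * (I3 - l) / 6) * w ^ 3)" by (simp only: norm_mult)
 also have "... <= norm E * (m * (1 + norm w ^ 2 + norm w ^ 3))"
 proof (rule mult_left_mono)
 have "norm (of_real (I1 - 1) + of_real (I2 / 2) * w^2 + of_real (r * (I3 - l) / 6) * w ^ 3)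
 <= norm (complex_of_real (I1 - 1)) + norm (of_real (I2 / 2) * w^2) + norm (of_real (r * (I3 - l) / 6) * w ^ 3)"
 by (intro order_trans[OF norm_triangle_ineq] add_right_mono norm_triangle_ineq)
 also have "... = \<bar>I1 - 1\<bar> + \<bar>I2 / 2\<bar> * norm w ^ 2 + \<bar>r * (I3 - l) / 6\<bar> * norm w ^ 3"
 by (simp only: norm_mult norm_power norm_of_real)
 also have "... <= m + m * norm w ^ 2 + m * norm w ^ 3"
 proof (intro add_mono mult_right_mono)
 show "\<bar>I1 - 1\<bar> <= m" "\<bar>I2 / 2\<bar> <= m" "\<bar>r * (I3 - l) / 6\<bar> <= m"
 unfolding m using b1 b2 b3 p2 p3 D0 by (simp_all only: abs_divide)
 qed auto
 also have "... = m * (1 + norm w ^ 2 + norm w ^ 3)" by (simp add: algebra_simps)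
 finally show "norm (of_real (I1 - 1) + of_real (I2 / 2) * w^2 + of_real (r * (I3 - l) / 6) * w ^ 3) <= m * (1 + norm w ^ 2 + norm w ^ 3)" .
 qed simp
 also have "... = m * (norm E * (1 + norm w ^ 2 + norm w ^ 3))" by simp
 also have "... <= m * (K3 / (1 + u^2))"
 unfolding E_def w_def by (rule mult_left_mono[OF K3(2)]) (use m p2 p3 D0 in linarith)
 finally have Bd: "norm (E * (of_real I1 + of_real (I2 / 2) * w^2 + of_real (r * I3 / 6) * w ^ 3) - edgeworth_mgf c (r * l) w) <= m * (K3 / (1 + u^2))" .
 have "norm ((LINT z|good_law c bt a. exp (w * of_real z)) - edgeworth_mgf c (r * l) w)
 <= K1 * ((3 * S^2)\<^sup>2 + 1) * D / (1 + u^2) + m * (K3 / (1 + u^2))"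
 by (rule norm_diff_triangle_le[OF A' Bd])
 also have "... = (K1 * ((3 * S^2)\<^sup>2 + 1) + (1 + (Kb + 2 * Kmu + c) + 24 * S^2 * T * Kmu) * K3) * D / (1 + u^2)"
 proof -
 have "x * D / v + y * D * (K3 / v) = (x + y * K3) * D / v" for x y v :: real
 by (simp add: add_divide_distrib distrib_right distrib_left mult_ac)
 then show ?thesis unfolding m_def .
 qed
 finally show ?thesis unfolding w_def r_def l_def D_def .
qed

text \<open>On the event the comparison of densities applies to \<open>good_law\<close>. On the
  complement \<open>f\<close> is bounded by an exponential of the unscaled error, whose moment is
  proportional to the probability of the complement.\<close>

lemma edgeworth_expansion_step:
 assumes c: "0 < c" and a: "3 / 4 < a" "a < 1" and bt: "0 < bt" "bt < 1" and K: "chaos_expansion_const c K1"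
 and ep: "3 * S^2 * bt powr (a - 1 / 2) <= 1 / 4" "64 * (3 * S^2 * bt powr (a - 1 / 2))\<^sup>2 <= c" and d: "bt powr (2 * a - 1) <= (c / 2)\<^sup>2"
 and q: "prob (space P - good c bt a) <= bt powr (gm / 2 + 3)" and gm: "0 < gm"
 and bias: "\<bar>\<integral>om. lam2 bt om - c \<partial>P\<bar> <= Kb * bt powr (2 * a - 1)"
 and K3: "0 <= K3" "!!s u. \<bar>s\<bar> <= 1 ==> norm (exp (of_real (c / 2) * (Complex s u)\<^sup>2)) * (1 + norm (Complex s u) ^ 2 + norm (Complex s u) ^ 3) <= K3 / (1 + u^2)"
 and f: "f : borel_measurable borel" "!!x. \<bar>f x\<bar> <= M * (1 + abs x powr gm)" and M: "0 < M"
 and fe: "integrable lborel (%x. f x * ew_density c (bt powr (1 / 2) * (LINT om|P. lam3 bt om)) x)"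
 and fi: "integrable lborel (%x. \<bar>f x\<bar> * exp (- abs x))" "(LINT x|lborel. \<bar>f x\<bar> * exp (- abs x)) <= K4"
 and Kd: "0 <= Kd" "K1 * ((3 * S^2)\<^sup>2 + 1) + (1 + (Kb + 2 * Kmu + c) + 24 * S^2 * T * Kmu) * K3 <= Kd"
 shows "\<bar>(LINT om|P. f (bt powr (- 1 / 2) * sdev om om)) - (LINT x|lborel. f x * ew_density c (bt powr (1 / 2) * (LINT om|P. lam3 bt om)) x)\<bar>
 <= (Kd * (LINT u|lborel. 1 / (1 + u^2)) / (2 * pi) * K4 + M * (1 + (gm / s0) powr gm) * Kexp) * bt powr (2 * a - 1)"
proof -
 define D where "D = bt powr (2 * a - 1)"
 define ka where "ka = bt powr (1 / 2) * (LINT om|P. lam3 bt om)"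
 define k :: "'a => real" where "k = indicator (good c bt a)"
 define Z where "Z om = bt powr (- 1 / 2) * sdev om om" for om
 have D0: "0 <= D" by (simp add: D_def)
 have btD: "bt <= D" unfolding D_def using bt a by (intro powr_small) auto
 have bt3: "bt ^ 3 <= bt" using bt power_decreasing[of 1 3 bt] by auto
 have p3: "bt powr 3 = bt ^ 3" using bt by (simp add: powr_numeral)
 have "bt powr (gm / 2 + 3) <= bt powr 3" using bt gm by (intro powr_mono') auto
 then have q3: "prob (space P - good c bt a) <= bt ^ 3" using q p3 by linarith
 have Zm: "Z : borel_measurable P" unfolding Z_def[abs_def] using dev_random_measurable by measurable
 have fZm: "(%om. f (Z om)) : borel_measurable P" by (rule measurable_compose[OF Zm f(1)])
 have main: "\<bar>(LINT om|P. k om * f (Z om)) - (LINT x|lborel. f x * ew_density c ka x)\<bar>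
 <= Kd * D * (LINT u|lborel. 1 / (1 + u^2)) / (2 * pi) * (LINT x|lborel. \<bar>f x\<bar> * exp (- abs x))"
 proof -
 have e: "(LINT x|good_law c bt a. f x) = (LINT om|P. k om * f (Z om))"
 using good_law_integral(2)[OF f(1)] unfolding k_def Z_def by simp
 show ?thesis unfolding e[symmetric]
 proof (rule edgeworth_comparison[OF good_law_finite _ c])
 show "sets (good_law c bt a) = sets borel" by (simp add: good_law_def)
 fix s u :: real assume s: "abs s <= 1"
 have em: "(%z. exp (s * z)) : borel_measurable borel" by measurable
 have eq: "norm (indicator (good c bt a) om *\<^sub>R exp (of_real s * of_real (bt powr (- 1 / 2) * sdev om om)) :: complex)
 = indicator (good c bt a) om *\<^sub>R exp (s * (bt powr (- 1 / 2) * sdev om om))" for om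
 unfolding of_real_mult[symmetric] norm_scaleR norm_exp_eq_Re by simp
 have "integrable P (%om. norm (indicator (good c bt a) om *\<^sub>R exp (of_real s * of_real (bt powr (- 1 / 2) * sdev om om)) :: complex))"
 by (rule integrable_norm, rule good_mgf(1)[OF c bt(1) K refl ep d]) (use s in simp)
 then show "integrable (good_law c bt a) (%z. exp (s * z))"
 unfolding good_law_integral(1)[OF em] eq .
 have "norm ((LINT z|good_law c bt a. exp (Complex s u * of_real z)) - edgeworth_mgf c ka (Complex s u))
 <= (K1 * ((3 * S^2)\<^sup>2 + 1) + (1 + (Kb + 2 * Kmu + c) + 24 * S^2 * T * Kmu) * K3) * D / (1 + u^2)"
 unfolding ka_def D_def by (rule good_edgeworth_mgf[OF c a bt K ep d q3 bias K3(1) K3(2)[OF s] s])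
 also have "... <= Kd * D / (1 + u^2)" using Kd(2) D0 by (intro divide_right_mono mult_right_mono) auto
 finally show "norm ((LINT z|good_law c bt a. exp (Complex s u * of_real z)) - edgeworth_mgf c ka (Complex s u)) <= Kd * D / (1 + u^2)" .
 next
 show "f : borel_measurable borel" by (rule f(1))
 show "integrable lborel (%x. \<bar>f x\<bar> * exp (- abs x))" by (rule fi(1))
 show "integrable lborel (%x. f x * ew_density c ka x)" unfolding ka_def by (rule fe)
 qed
 qed
 have C0: "0 <= (\<integral>u. 1 / (1 + u^2) \<partial>lborel :: real)" by (intro integral_nonneg_AE AE_I2) simp
 have main': "\<bar>(LINT om|P. k om * f (Z om)) - (LINT x|lborel. f x * ew_density c ka x)\<bar> <= Kd * (LINT u|lborel. 1 / (1 + u^2)) / (2 * pi) * K4 * D"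
 proof -
 have "Kd * D * (LINT u|lborel. 1 / (1 + u^2)) / (2 * pi) * (LINT x|lborel. \<bar>f x\<bar> * exp (- abs x))
 <= Kd * D * (LINT u|lborel. 1 / (1 + u^2)) / (2 * pi) * K4"
 using Kd(1) D0 C0 by (intro mult_left_mono[OF fi(2)]) auto
 then show ?thesis using main by (simp add: mult_ac)
 qed
 \<comment> \<open>The power of \<open>bt\<close> comes from the scaling inside the power
   \<open>gm\<close>, the last factor from trading that power for an exponential at scale
   \<open>s0\<close>.\<close>
 define A5 where "A5 = M * bt powr (- gm / 2) * (1 + (gm / s0) powr gm)"
 have A5: "0 <= A5" using M by (simp add: A5_def add_nonneg_nonneg)
 have fb: "\<bar>f (Z om)\<bar> <= A5 * exp (s0 * \<bar>sdev om om\<bar>)" for om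
 proof -
 define y where "y = \<bar>sdev om om\<bar>"
 define B where "B = bt powr (- gm / 2)"
 have y: "0 <= y" by (simp add: y_def)
 have B: "1 <= B"
 proof -
 have "bt powr 0 <= B" unfolding B_def using bt gm by (intro powr_mono') auto
 then show ?thesis using bt by simp
 qed
 have e1: "1 <= exp (s0 * y)" using s0_pos y by simp
 have "\<bar>Z om\<bar> powr gm = (bt powr (- 1 / 2) * y) powr gm" by (simp add: Z_def y_def abs_mult)
 also have "... = B * y powr gm" unfolding B_def using y by (simp add: powr_mult powr_powr)
 also have "... <= B * ((gm / s0) powr gm * exp (s0 * y))" using B by (intro mult_left_mono powr_le_exp gm s0_pos y) auto
 finally have 1: "\<bar>Z om\<bar> powr gm <= B * ((gm / s0) powr gm * exp (s0 * y))" .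
 have "1 * 1 <= B * exp (s0 * y)" using B e1 by (intro mult_mono) auto
 then have "1 + \<bar>Z om\<bar> powr gm <= B * exp (s0 * y) + B * ((gm / s0) powr gm * exp (s0 * y))" using 1 by simp
 then have "M * (1 + \<bar>Z om\<bar> powr gm) <= M * (B * exp (s0 * y) + B * ((gm / s0) powr gm * exp (s0 * y)))"
 using M by (intro mult_left_mono) auto
 also have "... = A5 * exp (s0 * y)" by (simp add: A5_def B_def algebra_simps)
 finally show ?thesis using f(2)[of "Z om"] unfolding y_def by linarith
 qed
 have ei: "integrable P (%om. exp (s0 * \<bar>sdev om om\<bar>))"
 using event_exp_moment(1)[of "%_. 1"] by simp
 have fi': "integrable P (%om. f (Z om))"
 by (rule integrable_dominated[OF integrable_mult_right[OF ei, of A5] fZm], rule AE_I2)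
 (use fb A5 in \<open>simp add: abs_mult\<close>)
 have km: "k : borel_measurable P" unfolding k_def using good_events by simp
 have kfi: "integrable P (%om. k om * f (Z om))"
 proof (rule integrable_dominated[OF fi'])
 show "(%om. k om * f (Z om)) : borel_measurable P"
 by (intro borel_measurable_times km fZm)
 show "AE om in P. norm (k om * f (Z om)) <= norm (f (Z om))"
 by (rule AE_I2) (simp add: k_def indicator_def)
 qed
 have gm: "(%p. 1 - good_ind c bt a p) : borel_measurable grids" using good_ind_measurable by measurable
 have g01: "0 <= 1 - good_ind c bt a p & 1 - good_ind c bt a p <= 1" for p by (simp add: good_ind_def)
 note ev = event_exp_moment[OF gm g01]
 have kk: "good_ind c bt a (GH om) = k om" if "om : space P" for om unfolding k_def by (rule good_ind_eq[OF that])
 have qi: "(LINT om|P. 1 - good_ind c bt a (GH om)) = prob (space P - good c bt a)"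
 proof -
 have "(LINT om|P. 1 - good_ind c bt a (GH om)) = (LINT om|P. indicator (space P - good c bt a) om)"
 by (rule lintegral_cong[OF refl]) (auto simp: kk k_def indicator_def)
 then show ?thesis using good_events[of c bt a] by simp
 qed
 have "\<bar>(LINT om|P. f (Z om)) - (LINT om|P. k om * f (Z om))\<bar> = \<bar>\<integral>om. f (Z om) - k om * f (Z om) \<partial>P\<bar>"
 by (simp only: lintegral_diff[OF fi' kfi])
 also have "... <= (LINT om|P. \<bar>f (Z om) - k om * f (Z om)\<bar>)" by (rule integral_abs_bound)
 also have "... <= (LINT om|P. A5 * ((1 - good_ind c bt a (GH om)) * exp (s0 * \<bar>sdev om om\<bar>)))"
 proof (rule integral_mono)
 show "integrable P (%om. \<bar>f (Z om) - k om * f (Z om)\<bar>)" by (intro integrable_abs Bochner_Integration.integrable_diff fi' kfi)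
 show "integrable P (%om. A5 * ((1 - good_ind c bt a (GH om)) * exp (s0 * \<bar>sdev om om\<bar>)))" by (rule integrable_mult_right[OF ev(1)])
 fix om assume om: "om : space P"
 show "\<bar>f (Z om) - k om * f (Z om)\<bar> <= A5 * ((1 - good_ind c bt a (GH om)) * exp (s0 * \<bar>sdev om om\<bar>))"
 unfolding kk[OF om] using fb[of om] by (simp add: k_def indicator_def)
 qed
 also have "... = A5 * (LINT om|P. (1 - good_ind c bt a (GH om)) * exp (s0 * \<bar>sdev om om\<bar>))" by (rule integral_mult_right_zero)
 also have "... <= A5 * (Kexp * prob (space P - good c bt a))" using ev(2) unfolding qi by (rule mult_left_mono[OF _ A5])
 also have "... <= A5 * (Kexp * bt powr (gm / 2 + 3))" using q A5 by (intro mult_left_mono) (auto simp: Kexp_def)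
 also have "... = M * (1 + (gm / s0) powr gm) * Kexp * (bt powr (- gm / 2) * bt powr (gm / 2 + 3))" by (simp add: A5_def mult_ac)
 also have "bt powr (- gm / 2) * bt powr (gm / 2 + 3) = bt ^ 3" unfolding powr_add[symmetric] using p3 by simp
 also have "M * (1 + (gm / s0) powr gm) * Kexp * bt ^ 3 <= M * (1 + (gm / s0) powr gm) * Kexp * D"
 using M bt3 btD by (intro mult_left_mono) (auto simp: Kexp_def add_nonneg_nonneg)
 finally have "\<bar>(LINT om|P. f (Z om)) - (LINT om|P. k om * f (Z om))\<bar> <= M * (1 + (gm / s0) powr gm) * Kexp * D" .
 then have "\<bar>(LINT om|P. f (Z om)) - (LINT x|lborel. f x * ew_density c ka x)\<bar>
 <= Kd * (LINT u|lborel. 1 / (1 + u^2)) / (2 * pi) * K4 * D + M * (1 + (gm / s0) powr gm) * Kexp * D" using main' by linarith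
 then show ?thesis unfolding Z_def ka_def D_def by (simp add: distrib_right)
qed

end

section \<open>Uniform constants and the choice of large indices\<close>

theorem theorem2:
  fixes P :: "'a measure"
    and T M \<gamma> \<eta> C r0 cs c a :: real
    and \<rho> \<sigma>1 \<sigma>2 :: "real \<Rightarrow> real"
    and B1 B2 X1 X2 :: "real \<Rightarrow> 'a \<Rightarrow> real"
    and G H :: "nat \<Rightarrow> 'a \<Rightarrow> grid"
    and b :: "nat \<Rightarrow> real"
    and A :: "nat \<Rightarrow> 'a set"
    and Z :: "nat \<Rightarrow> 'a \<Rightarrow> real"
    and l3 :: "nat \<Rightarrow> real"
  assumes "prob_space P" and "0 < T"
    and "\<rho> \<in> borel_measurable (restrict_space borel {0..T})"
    and "\<sigma>1 \<in> borel_measurable (restrict_space borel {0..T})"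
    and "\<sigma>2 \<in> borel_measurable (restrict_space borel {0..T})"
    and "\<forall>t\<in>{0..T}. \<rho> t \<in> {-1..1}"
    and "\<forall>t\<in>{0..T}. 0 < \<sigma>1 t" and "\<forall>t\<in>{0..T}. 0 < \<sigma>2 t"
    and "bounded (\<sigma>1 ` {0..T})" and "bounded (\<sigma>2 ` {0..T})"
    and "centered_gaussian_process P T B1 B2"
    and "independent_increments P T B1 B2"
    and "\<forall>t\<in>{0..T}. (LINT \<omega>|P. (B1 t \<omega>)\<^sup>2) = t"
    and "\<forall>t\<in>{0..T}. (LINT \<omega>|P. (B2 t \<omega>)\<^sup>2) = t"
    and "\<forall>t\<in>{0..T}. (LINT \<omega>|P. B1 t \<omega> * B2 t \<omega>) = (LINT s:{0..t}|lborel. \<rho> s)"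
    and "\<forall>t\<in>{0..T}. X1 t \<in> borel_measurable P"
    and "\<forall>t\<in>{0..T}. X2 t \<in> borel_measurable P"
    and "\<forall>t\<in>{0..T}. is_wiener_integral P B1 t \<sigma>1 (\<lambda>\<omega>. X1 t \<omega> - X1 0 \<omega>)"
    and "\<forall>t\<in>{0..T}. is_wiener_integral P B2 t \<sigma>2 (\<lambda>\<omega>. X2 t \<omega> - X2 0 \<omega>)"
    and "\<forall>\<omega>\<in>space P. continuous_on {0..T} (\<lambda>t. X1 t \<omega>)"
    and "\<forall>\<omega>\<in>space P. continuous_on {0..T} (\<lambda>t. X2 t \<omega>)"
    and "\<forall>n. \<forall>\<omega>\<in>space P. is_grid T (G n \<omega>) \<and> is_grid T (H n \<omega>)"
    and "\<forall>n. sampling_independent P T X1 X2 (G n) (H n)"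
    and "\<forall>n. 0 < b n" and "b \<longlonglongrightarrow> 0"
    and "0 < M" "0 < \<gamma>" "0 < \<eta>" "0 < C" "0 < r0" "0 < cs"
    and "3 / 4 < a" "a < 1" and "0 < c" "c < cs"
  defines "A \<equiv> \<lambda>n. {\<omega> \<in> space P.
        (lambda2 \<rho> \<sigma>1 \<sigma>2 (b n) (G n \<omega>) (H n \<omega>) - c)\<^sup>2 \<le> b n powr (2 * a - 1)
        \<and> mesh (G n \<omega>) (H n \<omega>) \<le> b n powr a}"
    and "Z \<equiv> \<lambda>n \<omega>. b n powr (-1 / 2) *
        (theta_hat (\<lambda>t. X1 t \<omega>) (\<lambda>t. X2 t \<omega>) (G n \<omega>) (H n \<omega>) - theta T \<rho> \<sigma>1 \<sigma>2)"
    and "l3 \<equiv> \<lambda>n. LINT \<omega>|P. lambda3 \<rho> \<sigma>1 \<sigma>2 (b n) (G n \<omega>) (H n \<omega>)"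
  assumes "\<forall>p>1. (\<lambda>n. measure P (space P - A n)) \<in> o(\<lambda>n. b n powr p)"
    and "(\<lambda>n. LINT \<omega>|P. lambda2 \<rho> \<sigma>1 \<sigma>2 (b n) (G n \<omega>) (H n \<omega>) - c) \<in> O(\<lambda>n. b n powr (2 * a - 1))"
  shows "uniform_expansion P (growth_class M \<gamma> \<inter> smoothness_class C \<eta> r0 cs)
           Z (\<lambda>n. p_star c (b n) (l3 n)) (\<lambda>n. b n powr (2 * a - 1))
    \<and> (bdd_above (range l3) \<longrightarrow>
         uniform_expansion P (growth_class M \<gamma> \<inter> smoothness_class C \<eta> r0 cs)
           Z (\<lambda>n. p_plus c (b n) (l3 n)) (\<lambda>n. b n powr (2 * a - 1)))
    \<and> (\<forall>n. is_probability_density (p_plus c (b n) (l3 n)))"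
proof -
 interpret prob_space P by fact
 interpret wiener_model P T \<rho> \<sigma>1 \<sigma>2 B1 B2 X1 X2 by unfold_locales fact+
 have sm: "sampled_model P T \<rho> \<sigma>1 \<sigma>2 B1 B2 X1 X2 (G n) (H n)" for n
 proof unfold_locales
 show "\<forall>om\<in>space P. continuous_on {0..T} (%t. X1 t om)" by fact
 show "\<forall>om\<in>space P. continuous_on {0..T} (%t. X2 t om)" by fact
 show "\<forall>om\<in>space P. is_grid T (G n om) & is_grid T (H n om)"
 using \<open>\<forall>n. \<forall>om\<in>space P. is_grid T (G n om) & is_grid T (H n om)\<close> by (rule spec)
 show "sampling_independent P T X1 X2 (G n) (H n)"
 using \<open>\<forall>n. sampling_independent P T X1 X2 (G n) (H n)\<close> by (rule spec)
 qed
 have c: "0 < c" and \<gamma>: "0 < \<gamma>" and M: "0 < M" and a: "3 / 4 < a" "a < 1" by fact+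
 have bn: "0 < b n" for n using \<open>\<forall>n. 0 < b n\<close> by (rule spec)
 have small: "\<forall>\<^sub>F n in sequentially. b n powr p < e" if "0 < p" "0 < e" for p e
 proof -
 have "((%n. b n powr p) \<longlongrightarrow> 0) sequentially"
 by (rule tendsto_zero_powrI[OF \<open>b \<longlonglongrightarrow> 0\<close> tendsto_const _ that(1)]) (use bn in \<open>simp add: less_imp_le\<close>)
 then show ?thesis using that(2) by (rule order_tendstoD(2))
 qed
 obtain K1 where K1: "chaos_expansion_const c K1" using chaos_expansion_const_exists[OF c] by (elim exE)
 obtain K3 where K3': "0 <= K3 & (\<forall>s u. \<bar>s\<bar> <= 1 -->
 norm (exp (of_real (c / 2) * (Complex s u)\<^sup>2)) * (1 + norm (Complex s u) ^ 2 + norm (Complex s u) ^ 3) <= K3 / (1 + u^2))"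
 using gaussian_cubic_bound[OF c] by (elim exE)
 note K3 = conjunct1[OF K3'] conjunct2[OF K3', rule_format]
 obtain KW where KW0: "weighted_bound_const c KW" using edgeworth_weighted_bound[OF c] by (elim exE)
 note KW = KW0[unfolded weighted_bound_const_def]
 note W = conjunct2[OF KW, rule_format]
 obtain KP where KP0: "positive_part_const c KP" using positive_part_comparison[OF c] by (elim exE)
 note KP = KP0[unfolded positive_part_const_def]
 note PP = conjunct2[OF KP, rule_format]
 obtain Kb where Kb: "0 < Kb"
 "\<forall>\<^sub>F n in sequentially. norm (LINT om|P. lambda2 \<rho> \<sigma>1 \<sigma>2 (b n) (G n om) (H n om) - c) <= Kb * norm (b n powr (2 * a - 1))"
 by (rule landau_o.bigE[OF \<open>(%n. LINT om|P. lambda2 \<rho> \<sigma>1 \<sigma>2 (b n) (G n om) (H n om) - c) : O(%n. b n powr (2 * a - 1))\<close>])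
 have off: "\<forall>\<^sub>F n in sequentially. norm (measure P (space P - A n)) <= 1 * norm (b n powr (\<gamma> / 2 + 3))"
 proof (rule landau_o.smallD)
 have "1 < \<gamma> / 2 + 3" using \<gamma> by simp
 with \<open>\<forall>p>1. (%n. measure P (space P - A n)) : o(%n. b n powr p)\<close>
 show "(%n. measure P (space P - A n)) : o(%n. b n powr (\<gamma> / 2 + 3))" by blast
 qed simp
 \<comment> \<open>Trades polynomial growth for an exponential at rate \<open>1 / 2\<close>, the
   weight used in \<open>weighted_bound_const\<close>.\<close>
 define A0 where "A0 = M * (1 + (\<gamma> / (1 / 2)) powr \<gamma>)"
 have growth: "f : borel_measurable borel" "\<bar>f x\<bar> <= M * (1 + abs x powr \<gamma>)" "\<bar>f x\<bar> <= A0 * exp (abs x / 2)"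
 if "f : growth_class M \<gamma>" for f x
 proof -
 show "f : borel_measurable borel" and g: "\<bar>f x\<bar> <= M * (1 + abs x powr \<gamma>)" using that by (auto simp: growth_class_def)
 have e1: "1 <= exp (abs x / 2)" by simp
 have e2: "abs x powr \<gamma> <= (\<gamma> / (1 / 2)) powr \<gamma> * exp (abs x / 2)"
 using powr_le_exp[OF \<gamma>, of "1 / 2" "abs x"] by simp
 have "1 + abs x powr \<gamma> <= (1 + (\<gamma> / (1 / 2)) powr \<gamma>) * exp (abs x / 2)"
 unfolding distrib_right mult_1 by (rule add_mono[OF e1 e2])
 then have "M * (1 + abs x powr \<gamma>) <= A0 * exp (abs x / 2)" unfolding A0_def mult.assoc using M by (intro mult_left_mono) auto
 then show "\<bar>f x\<bar> <= A0 * exp (abs x / 2)" using g by linarith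
 qed
 have A0: "0 <= A0" unfolding A0_def using M by (intro mult_nonneg_nonneg add_nonneg_nonneg) auto
 \<comment> \<open>The maximum secures a non-negative constant without tracking the sign of the
   sum.\<close>
 define Kd where "Kd = max 0 (K1 * ((3 * S^2)\<^sup>2 + 1) + (1 + (Kb + 2 * Kmu + c) + 24 * S^2 * T * Kmu) * K3)"
 define Kst where "Kst = Kd * (LINT u|lborel. 1 / (1 + u^2)) / (2 * pi) * (A0 * KW) + M * (1 + (\<gamma> / s0) powr \<gamma>) * Kexp"
 define Kka where "Kka = 24 * S^2 * c + 24 * S^2 * T * Kmu"
 have Kka: "0 <= Kka" unfolding Kka_def Kmu_def using c T by (intro add_nonneg_nonneg mult_nonneg_nonneg) auto
 \<comment> \<open>Everything asked of a large index, free of the test function; this is where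
   uniformity over the class originates.\<close>
 define reg where "reg n \<longleftrightarrow> b n < 1 & 3 * S^2 * b n powr (a - 1 / 2) <= 1 / 4 & 64 * (3 * S^2 * b n powr (a - 1 / 2))\<^sup>2 <= c
 & b n powr (2 * a - 1) <= (c / 2)\<^sup>2 & measure P (space P - A n) <= b n powr (\<gamma> / 2 + 3)
 & \<bar>LINT om|P. lambda2 \<rho> \<sigma>1 \<sigma>2 (b n) (G n om) (H n om) - c\<bar> <= Kb * b n powr (2 * a - 1) & Kka * b n powr (a - 1 / 2) <= 1" for n
 have S3: "0 < 3 * S^2" using S(1) by simp
 have reg: "\<forall>\<^sub>F n in sequentially. reg n"
 proof -
 have 1: "\<forall>\<^sub>F n in sequentially. b n powr 1 < 1" by (rule small) auto
 \<comment> \<open>The first bound in the minimum keeps the coefficients below \<open>1 / 4\<close>,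
   the second is \<open>64 * ep^2 <= c\<close> solved for the scale.\<close>
 have 2: "\<forall>\<^sub>F n in sequentially. b n powr (a - 1 / 2) < min (1 / 4) (sqrt c / 8) / (3 * S^2)"
 using a c S3 by (intro small divide_pos_pos) auto
 have 3: "\<forall>\<^sub>F n in sequentially. b n powr (2 * a - 1) < (c / 2)\<^sup>2" using a c by (intro small) auto
 \<comment> \<open>Keeps the Edgeworth correction at most 1, as \<open>positive_part_const\<close>
   demands; adding 1 avoids a zero denominator.\<close>
 have 4: "\<forall>\<^sub>F n in sequentially. b n powr (a - 1 / 2) < 1 / (Kka + 1)" using a Kka by (intro small) auto
 from 1 2 3 4 off Kb(2) show ?thesis
 proof eventually_elim
 case (elim n)
 define x where "x = b n powr (a - 1 / 2)"
 have x: "0 <= x" by (simp add: x_def)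
 have "3 * S^2 * x < min (1 / 4) (sqrt c / 8)" using elim(2) S3 unfolding x_def by (simp add: pos_less_divide_eq mult.commute)
 then have y: "3 * S^2 * x <= 1 / 4" "3 * S^2 * x <= sqrt c / 8" by simp_all
 have "(3 * S^2 * x)\<^sup>2 <= (sqrt c / 8)\<^sup>2" by (rule power_mono[OF y(2)]) (use x in simp)
 also have "... = c / 64" using c by (simp add: power_divide)
 finally have y2: "64 * (3 * S^2 * x)\<^sup>2 <= c" by simp
 have "Kka * x <= Kka * (1 / (Kka + 1))" using elim(4) Kka unfolding x_def by (intro mult_left_mono) auto
 also have "... <= 1" using Kka by simp
 finally have y3: "Kka * x <= 1" .
 show ?case unfolding reg_def x_def[symmetric] using elim(1,3,5,6) bn[of n] y(1) y2 y3 by simp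
 qed
 qed
 have step: "\<bar>(LINT om|P. f (Z n om)) - (LINT z|lborel. f z * p_star c (b n) (l3 n) z)\<bar> <= Kst * b n powr (2 * a - 1)
 & \<bar>b n powr (1 / 2) * l3 n\<bar> <= Kka * b n powr (a - 1 / 2)"
 if n: "reg n" and f: "f : growth_class M \<gamma>" for n f
 proof -
 interpret sn: sampled_model P T \<rho> \<sigma>1 \<sigma>2 B1 B2 X1 X2 "G n" "H n" by (rule sm)
 have An: "A n = sn.good c (b n) a" unfolding A_def sn.good_def ..
 have Zn: "Z n = (%om. b n powr (- 1 / 2) * dev (G n om) (H n om) om)" unfolding Z_def dev_def ..
 have r: "b n < 1" "3 * S^2 * b n powr (a - 1 / 2) <= 1 / 4" "64 * (3 * S^2 * b n powr (a - 1 / 2))\<^sup>2 <= c"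
 "b n powr (2 * a - 1) <= (c / 2)\<^sup>2" "prob (space P - sn.good c (b n) a) <= b n powr (\<gamma> / 2 + 3)"
 "\<bar>LINT om|P. lambda2 \<rho> \<sigma>1 \<sigma>2 (b n) (G n om) (H n om) - c\<bar> <= Kb * b n powr (2 * a - 1)"
 using n unfolding reg_def An by simp_all
 note w = W[OF growth(1,3)[OF f]]
 have Kd: "0 <= Kd" "K1 * ((3 * S^2)\<^sup>2 + 1) + (1 + (Kb + 2 * Kmu + c) + 24 * S^2 * T * Kmu) * K3 <= Kd" by (simp_all add: Kd_def)
 have w1: "integrable lborel (%x. f x * ew_density c ka x)" for ka by (rule conjunct1[OF w])
 have w2: "integrable lborel (%x. \<bar>f x\<bar> * exp (- abs x))" by (rule conjunct1[OF conjunct2[OF conjunct2[OF conjunct2[OF w]]]])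
 have w3: "(LINT x|lborel. \<bar>f x\<bar> * exp (- abs x)) <= A0 * KW" by (rule conjunct2[OF conjunct2[OF conjunct2[OF conjunct2[OF w]]]])
 have "\<bar>(LINT om|P. f (Z n om)) - (LINT z|lborel. f z * p_star c (b n) (l3 n) z)\<bar> <= Kst * b n powr (2 * a - 1)"
 unfolding Zn p_star_edgeworth l3_def Kst_def
 by (rule sn.edgeworth_expansion_step[OF c a bn r(1) K1 r(2,3,4,5) \<gamma> r(6) K3 growth(1,2)[OF f] M w1 w2 w3 Kd])
 moreover have "\<bar>b n powr (1 / 2) * l3 n\<bar> <= Kka * b n powr (a - 1 / 2)"
 unfolding l3_def Kka_def
 proof (rule sn.kappa_bound[OF c a bn r(1) r(4)])
 have "b n powr (\<gamma> / 2 + 3) <= b n powr 3" using bn[of n] r(1) \<gamma> by (intro powr_mono') auto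
 then show "prob (space P - sn.good c (b n) a) <= b n ^ 3" using r(5) bn[of n] by (simp add: powr_numeral)
 qed
 ultimately show ?thesis ..
 qed
 have step': "\<bar>(LINT om|P. f (Z n om)) - (LINT z|lborel. f z * p_plus c (b n) (l3 n) z)\<bar> <= (Kst + A0 * KP * Kka^2) * b n powr (2 * a - 1)"
 if n: "reg n" and f: "f : growth_class M \<gamma>" for n f
 proof -
 define ka where "ka = b n powr (1 / 2) * l3 n"
 note s = step[OF n f, folded ka_def]
 have "Kka * b n powr (a - 1 / 2) <= 1" using n unfolding reg_def by simp
 then have ka1: "abs ka <= 1" using s by linarith
 \<comment> \<open>Twice the exponent \<open>a - 1 / 2\<close> is that of the rate, so passing to
   the positive part costs nothing in order.\<close>
 have "ka^2 <= (Kka * b n powr (a - 1 / 2))\<^sup>2" using s power_mono[of "abs ka" "Kka * b n powr (a - 1 / 2)" 2] by simp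
 also have "... = Kka^2 * b n powr (2 * a - 1)"
 unfolding power_mult_distrib power2_eq_square[of "b n powr _"] powr_add[symmetric] by simp
 finally have ka2: "A0 * KP * ka^2 <= A0 * KP * (Kka^2 * b n powr (2 * a - 1))"
 using A0 KP by (intro mult_left_mono) auto
 have "\<bar>(LINT z|lborel. f z * p_star c (b n) (l3 n) z) - (LINT z|lborel. f z * p_plus c (b n) (l3 n) z)\<bar> <= A0 * KP * ka^2"
 unfolding p_plus_def p_star_edgeworth ka_def[symmetric] by (rule PP[OF growth(1,3)[OF f] ka1])
 then have "\<bar>(LINT om|P. f (Z n om)) - (LINT z|lborel. f z * p_plus c (b n) (l3 n) z)\<bar> <= Kst * b n powr (2 * a - 1) + A0 * KP * (Kka^2 * b n powr (2 * a - 1))"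
 using s ka2 by linarith
 then show ?thesis by (simp add: distrib_right mult.assoc)
 qed
 \<comment> \<open>The bound for a single test function involves it only through \<open>M\<close>
   and \<open>\<gamma>\<close>, so it passes to the supremum.\<close>
 have uniform: "uniform_expansion P (growth_class M \<gamma> \<inter> smoothness_class C \<eta> r0 cs) Z p (%n. b n powr (2 * a - 1))"
 if p: "\<forall>n f. reg n --> f : growth_class M \<gamma> --> \<bar>(LINT om|P. f (Z n om)) - (LINT z|lborel. f z * p n z)\<bar> <= K * b n powr (2 * a - 1)" for p K
 unfolding uniform_expansion_def
 proof (rule exI[of _ K], rule eventually_mono[OF reg], rule SUP_least)
 fix n f assume n: "reg n" and "f : growth_class M \<gamma> \<inter> smoothness_class C \<eta> r0 cs"
 then have "f : growth_class M \<gamma>" by simp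
 with p n show "ereal \<bar>(LINT om|P. f (Z n om)) - (LINT z|lborel. f z * p n z)\<bar> <= ereal (K * b n powr (2 * a - 1))"
 unfolding ereal_less_eq by blast
 qed
 show ?thesis
 proof (intro conjI impI allI)
 show "uniform_expansion P (growth_class M \<gamma> \<inter> smoothness_class C \<eta> r0 cs) Z (%n. p_star c (b n) (l3 n)) (%n. b n powr (2 * a - 1))"
 by (rule uniform[of _ Kst]) (use step in blast)
 show "uniform_expansion P (growth_class M \<gamma> \<inter> smoothness_class C \<eta> r0 cs) Z (%n. p_plus c (b n) (l3 n)) (%n. b n powr (2 * a - 1))"
 by (rule uniform[of _ "Kst + A0 * KP * Kka^2"]) (use step' in blast)
 show "is_probability_density (p_plus c (b n) (l3 n))" for n by (rule p_plus_density[OF c])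
 qed
qed

end
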